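(* Let $R$ be an infinite computable set. Then $\Omega_R$ is dumb for $\mathbf c_{\Omega,R}$; in particular, a $K$-trivial set $A$ is computable from $\Omega_R$ if and only if $A\models\mathbf c_{\Omega,R}$.
   Context: $\Omega$: fixed left-c.e. ML-random real (viewed also as a binary sequence), approximations $\Omega_s\nearrow\Omega$. $\Omega_R$: the bits of $\Omega$ at positions in $R$, in order. $k_s(n)=\lfloor-\log_2(\Omega_s-\Omega_n)\rfloor$; $\mathbf c_{\Omega,R}(n,s)=2^{-|R\cap k_s(n)|}$ with $R\cap m=R\cap\{0,\dots,m-1\}$. A $\mathbf c$-test is a nested sequence of uniformly c.e. open sets $V_n$ with $\mu(V_n)\le C\lim_s\mathbf c(n,s)$; $Y$ fails it if $Y\in\bigcap_nV_n$. $A\models \mathbf c$: some computable approximation of $A$ has finite total $\mathbf c$-cost. An ML-random sequence $Y$ is dumb for a cost function $\mathbf c$ if $Y$ fails some $\mathbf c$-test and for every $K$-trivial $A$: $A\models\mathbf c$ iff $A\le_{\mathrm T}Y$. *)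

theory Defs
  imports "HOL-Probability.Probability" "HOL-Library.Infinite_Set"
begin

datatype recf =
    Zr
  | Sc
  | Pj nat
  | Orc
  | Cn recf "recf list"
  | Pr recf recf
  | Mn recf

lemma list_all2_mono_ind [mono]:
  "(\<And>x y. P x y \<longrightarrow> Q x y) \<Longrightarrow> list_all2 P xs ys \<longrightarrow> list_all2 Q xs ys"
  by (auto elim: list_all2_mono)

inductive evalr :: "(nat \<Rightarrow> nat) \<Rightarrow> recf \<Rightarrow> nat list \<Rightarrow> nat \<Rightarrow> bool"
  for orc :: "nat \<Rightarrow> nat" where
  ev_Zr: "evalr orc Zr xs 0"
| ev_Sc: "evalr orc Sc (x # xs) (Suc x)"
| ev_Pj: "i < length xs \<Longrightarrow> evalr orc (Pj i) xs (xs ! i)"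
| ev_Orc: "evalr orc Orc (x # xs) (orc x)"
| ev_Cn: "list_all2 (\<lambda>g y. evalr orc g xs y) gs ys \<Longrightarrow> evalr orc f ys z \<Longrightarrow> evalr orc (Cn f gs) xs z"
| ev_Pr0: "evalr orc f xs z \<Longrightarrow> evalr orc (Pr f g) (0 # xs) z"
| ev_PrS: "evalr orc (Pr f g) (n # xs) y \<Longrightarrow> evalr orc g (y # n # xs) z
            \<Longrightarrow> evalr orc (Pr f g) (Suc n # xs) z"
| ev_Mn: "evalr orc f (y # xs) 0 \<Longrightarrow> (\<forall>z<y. \<exists>v. v \<noteq> 0 \<and> evalr orc f (z # xs) v)
            \<Longrightarrow> evalr orc (Mn f) xs y"

definition no_oracle :: "nat \<Rightarrow> nat" where "no_oracle = (\<lambda>_. 0)"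

definition chi :: "nat set \<Rightarrow> nat \<Rightarrow> nat" where
  "chi A x = (if x \<in> A then 1 else 0)"

definition seq_oracle :: "(nat \<Rightarrow> bool) \<Rightarrow> nat \<Rightarrow> nat" where
  "seq_oracle Y x = (if Y x then 1 else 0)"

definition computable1 :: "(nat \<Rightarrow> nat) \<Rightarrow> bool" where
  "computable1 f \<longleftrightarrow> (\<exists>p. \<forall>x. evalr no_oracle p [x] (f x))"

definition computable2 :: "(nat \<Rightarrow> nat \<Rightarrow> nat) \<Rightarrow> bool" where
  "computable2 g \<longleftrightarrow> (\<exists>p. \<forall>x y. evalr no_oracle p [x, y] (g x y))"

definition computable_set :: "nat set \<Rightarrow> bool" where
  "computable_set R \<longleftrightarrow> computable1 (chi R)"

definition turing_le :: "nat set \<Rightarrow> (nat \<Rightarrow> bool) \<Rightarrow> bool" where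
  "turing_le A Y \<longleftrightarrow> (\<exists>p. \<forall>x. evalr (seq_oracle Y) p [x] (chi A x))"

text \<open>Bijective coding: the string s corresponds to n where n+1 has binary expansion 1s.\<close>
definition code :: "bool list \<Rightarrow> nat" where
  "code s = foldl (\<lambda>n b. 2 * n + 1 + (if b then 1 else 0)) 0 s"

fun str_of :: "nat \<Rightarrow> bool list" where
  "str_of n = (if n = 0 then [] else str_of ((n - 1) div 2) @ [even n])"

definition cyl :: "bool list \<Rightarrow> (nat \<Rightarrow> bool) set" where
  "cyl s = {X. \<forall>i<length s. X i = s ! i}"

definition cantor :: "(nat \<Rightarrow> bool) measure" where
  "cantor = PiM UNIV (\<lambda>_::nat. measure_pmf (bernoulli_pmf (1/2)))"

definition mu :: "(nat \<Rightarrow> bool) set \<Rightarrow> real" where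
  "mu S = measure cantor S"

definition unif_ce_open :: "(nat \<Rightarrow> (nat \<Rightarrow> bool) set) \<Rightarrow> bool" where
  "unif_ce_open V \<longleftrightarrow> (\<exists>p. \<forall>n. V n = (\<Union>k\<in>{k. \<exists>v. evalr no_oracle p [n, k] v}. cyl (str_of k)))"

definition MLrandom :: "(nat \<Rightarrow> bool) \<Rightarrow> bool" where
  "MLrandom Y \<longleftrightarrow> (\<forall>V. unif_ce_open V \<and> (\<forall>n. mu (V n) \<le> (1/2) ^ n) \<longrightarrow> Y \<notin> (\<Inter>n. V n))"

definition mach_out :: "recf \<Rightarrow> bool list \<Rightarrow> bool list \<Rightarrow> bool" where
  "mach_out p s t \<longleftrightarrow> evalr no_oracle p [code s] (code t)"

definition prefix_free_machine :: "recf \<Rightarrow> bool" where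
  "prefix_free_machine p \<longleftrightarrow>
     (\<forall>s s'. (\<exists>v. evalr no_oracle p [code s] v) \<and> (\<exists>v. evalr no_oracle p [code s'] v)
        \<and> take (length s) s' = s \<longrightarrow> s = s')"

definition optimal_pf_machine :: "recf \<Rightarrow> bool" where
  "optimal_pf_machine U \<longleftrightarrow> prefix_free_machine U \<and>
     (\<forall>M. prefix_free_machine M \<longrightarrow>
        (\<exists>c. \<forall>s t. mach_out M s t \<longrightarrow> (\<exists>s'. mach_out U s' t \<and> length s' \<le> length s + c)))"

definition Kc :: "recf \<Rightarrow> bool list \<Rightarrow> nat" where
  "Kc U t = (LEAST l. \<exists>s. length s = l \<and> mach_out U s t)"

definition init_seg :: "nat set \<Rightarrow> nat \<Rightarrow> bool list" where
  "init_seg A n = map (\<lambda>i. i \<in> A) [0..<n]"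

definition K_trivial :: "nat set \<Rightarrow> bool" where
  "K_trivial A \<longleftrightarrow> (\<forall>U. optimal_pf_machine U \<longrightarrow>
     (\<exists>b. \<forall>n. Kc U (init_seg A n) \<le> Kc U (str_of n) + b))"

definition c_test :: "(nat \<Rightarrow> nat \<Rightarrow> real) \<Rightarrow> (nat \<Rightarrow> (nat \<Rightarrow> bool) set) \<Rightarrow> bool" where
  "c_test c V \<longleftrightarrow> unif_ce_open V \<and> (\<forall>n. V (Suc n) \<subseteq> V n) \<and>
     (\<exists>C. \<forall>n. mu (V n) \<le> C * lim (\<lambda>s. c n s))"

definition fails_test :: "(nat \<Rightarrow> bool) \<Rightarrow> (nat \<Rightarrow> (nat \<Rightarrow> bool) set) \<Rightarrow> bool" where
  "fails_test Y V \<longleftrightarrow> Y \<in> (\<Inter>n. V n)"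

definition comp_approx :: "(nat \<Rightarrow> nat \<Rightarrow> nat) \<Rightarrow> nat set \<Rightarrow> bool" where
  "comp_approx g A \<longleftrightarrow> computable2 g \<and>
     (\<forall>x. \<exists>s0. \<forall>s\<ge>s0. (g x s \<noteq> 0) = (x \<in> A))"

definition stage_cost :: "(nat \<Rightarrow> nat \<Rightarrow> real) \<Rightarrow> (nat \<Rightarrow> nat \<Rightarrow> nat) \<Rightarrow> nat \<Rightarrow> real" where
  "stage_cost c g t =
     (if \<exists>x. (g x t \<noteq> 0) \<noteq> (g x (Suc t) \<noteq> 0)
      then c (LEAST x. (g x t \<noteq> 0) \<noteq> (g x (Suc t) \<noteq> 0)) (Suc t) else 0)"

definition obeys :: "nat set \<Rightarrow> (nat \<Rightarrow> nat \<Rightarrow> real) \<Rightarrow> bool" where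
  "obeys A c \<longleftrightarrow> (\<exists>g. comp_approx g A \<and> summable (stage_cost c g))"

definition dumb :: "(nat \<Rightarrow> bool) \<Rightarrow> (nat \<Rightarrow> nat \<Rightarrow> real) \<Rightarrow> bool" where
  "dumb Y c \<longleftrightarrow> MLrandom Y \<and> (\<exists>V. c_test c V \<and> fails_test Y V) \<and>
     (\<forall>A. K_trivial A \<longrightarrow> (obeys A c \<longleftrightarrow> turing_le A Y))"

definition real_bit :: "real \<Rightarrow> nat \<Rightarrow> bool" where
  "real_bit x i = odd (nat \<lfloor>x * 2 ^ (Suc i)\<rfloor>)"

definition bits_on :: "real \<Rightarrow> nat set \<Rightarrow> nat \<Rightarrow> bool" where
  "bits_on x R i = real_bit x (enumerate R i)"

text \<open>c(n,s) = 2^(-|R \<inter> k_s(n)|), k_s(n) = floor(-log2(Om s - Om n));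
  when Om s \<le> Om n (no positive difference, k_s(n) = infinity) the cost is 0.\<close>
definition cOR :: "(nat \<Rightarrow> real) \<Rightarrow> nat set \<Rightarrow> nat \<Rightarrow> nat \<Rightarrow> real" where
  "cOR Om R n s =
     (if Om n < Om s
      then 1 / 2 ^ card (R \<inter> {..<nat \<lfloor>- log 2 (Om s - Om n)\<rfloor>})
      else 0)"

definition comp_rat_seq :: "(nat \<Rightarrow> real) \<Rightarrow> bool" where
  "comp_rat_seq q \<longleftrightarrow> (\<exists>a b. computable1 a \<and> computable1 b \<and>
     (\<forall>s. q s = real (a s) / real (b s + 1)))"

end

theory Submission
  imports Defs "HOL-Library.Nat_Bijection"
begin

text \<open>Write \<open>Y\<close> for the bits of \<open>Omega\<close> on \<open>R\<close>. A test against \<open>Y\<close> pulls back along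
  \<open>Z \<mapsto> Z \<circ> enumerate R\<close> to a test of the same measure against \<open>Omega\<close>, so \<open>Y\<close> is random. The first
  \<open>|R \<inter> k\<^sub>s(n)|\<close> bits of \<open>Y\<close> are among at most two strings read off from \<open>Om s\<close>, which gives a test
  capturing \<open>Y\<close>; applied to the changes of an approximation of finite cost it becomes a Solovay test,
  and \<open>Y\<close> passing that test computes the approximated set.

  Conversely let \<open>A\<close> be \<open>K\<close>-trivial and computed from \<open>Y\<close> by a fixed program. First, the oracles from
  which the program computes \<open>A\<close> up to \<open>x\<close> have measure at least \<open>\<epsilon> 2\<close> to the minus \<open>|R \<inter> k(x)|\<close>:
  otherwise \<open>Omega\<close> would fail a test whose measure is paid for by the short descriptions of the
  initial segments of \<open>A\<close>. Second, a golden run argument yields stages at which, for every \<open>w\<close>, the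
  measure of the oracles whose first error is at position \<open>w - 1\<close> is backed by descriptions that are
  lost if the approximation changes below \<open>w\<close>; as \<open>A\<close> is \<open>K\<close>-trivial, only a finite total measure
  can be lost. Third, if the approximation changes twice at positions that an oracle had computed
  according to the current guess, the oracle was lost in this sense in between; so the measures of the oracles
  refuted by the changes, and with them the costs, have a finite sum.\<close>

section \<open>Oracle-uniform recursive functions\<close>

text \<open>The obstacle is self-reference: the game behind the second step issues requests that
  depend on the answers of \<open>U\<close>, and a request of weight \<open>2 ^ (-q)\<close> is
  honoured only up to the coding constant of the machine that issues it. Instead of a fixed point,
  one machine plays a game for every \<open>c\<close> in a slot of its own; its constant
  \<open>k\<close> is known afterwards, and slot \<open>c = k + b\<close> is analysed. There
  \<open>U\<close> describes the initial segments of \<open>A\<close> within \<open>2 * c\<close> of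
  every request, so a round answered by \<open>j\<close> different strings costs \<open>U\<close> at
  least \<open>j\<close> times its weight over \<open>4 ^ c\<close>. Runs are nested
  \<open>2 * 4 ^ c\<close> deep, and each level adds one to the number of answers of its rounds. If
  the outermost run ended, \<open>U\<close> would have spent more than it has; so some level begins
  pieces forever without reaching its goal. In this golden run demands get met, and what a change
  destroys counts towards the goal that is never reached. The exponent in the first step comes from
  the bits outside \<open>R\<close>: near \<open>Omega\<close> the first \<open>k\<close> bits have
  two possible values, and fixing the \<open>k - |R \<inter> k|\<close> bits off \<open>R\<close> is
  independent of the bits on \<open>R\<close> that do the computing.\<close>

definition rc :: "nat \<Rightarrow> (nat list \<Rightarrow> nat) \<Rightarrow> bool" where
  "rc n f \<longleftrightarrow> (\<exists>p. \<forall>orc xs. length xs = n \<longrightarrow> evalr orc p xs (f xs))"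

lemma rc_proj: "i < n \<Longrightarrow> rc n (\<lambda>xs. xs ! i)"
  unfolding rc_def by (intro exI[of _ "Pj i"]) (auto intro: ev_Pj)

lemma rc_zero: "rc n (\<lambda>xs. 0)"
  unfolding rc_def by (intro exI[of _ Zr]) (auto intro: ev_Zr)

lemma rc_Suc:
  assumes "rc n f" shows "rc n (\<lambda>xs. Suc (f xs))"
proof -
  obtain p where p: "\<And>orc xs. length xs = n \<Longrightarrow> evalr orc p xs (f xs)"
    using assms unfolding rc_def by blast
  show ?thesis unfolding rc_def
    by (intro exI[of _ "Cn Sc [p]"] allI impI ev_Cn[where ys="[_]"]) (auto intro: p ev_Sc)
qed

lemma rc_const: "rc n (\<lambda>xs. c)"
  by (induction c) (auto intro: rc_zero rc_Suc)

lemma rc_comp1: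
  assumes "rc 1 (\<lambda>xs. F (xs ! 0))" "rc n f" shows "rc n (\<lambda>xs. F (f xs))"
proof -
  obtain p where p: "\<And>orc xs. length xs = n \<Longrightarrow> evalr orc p xs (f xs)"
    using assms unfolding rc_def by blast
  obtain q where q: "\<And>orc xs. length xs = 1 \<Longrightarrow> evalr orc q xs (F (xs ! 0))"
    using assms unfolding rc_def by blast
  have "evalr orc q [f xs] (F (f xs))" for orc xs using q[of "[f xs]"] by simp
  then show ?thesis unfolding rc_def
    by (intro exI[of _ "Cn q [p]"] allI impI ev_Cn[where ys="[_]"]) (auto intro: p)
qed

lemma rc_comp2:
  assumes "rc 2 (\<lambda>xs. F (xs ! 0) (xs ! 1))" "rc n f" "rc n g" shows "rc n (\<lambda>xs. F (f xs) (g xs))"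
proof -
  obtain p where p: "\<And>orc xs. length xs = n \<Longrightarrow> evalr orc p xs (f xs)"
    using assms unfolding rc_def by blast
  obtain p' where p': "\<And>orc xs. length xs = n \<Longrightarrow> evalr orc p' xs (g xs)"
    using assms unfolding rc_def by blast
  obtain q where q: "\<And>orc xs. length xs = 2 \<Longrightarrow> evalr orc q xs (F (xs ! 0) (xs ! 1))"
    using assms unfolding rc_def by blast
  have "evalr orc q [f xs, g xs] (F (f xs) (g xs))" for orc xs using q[of "[f xs, g xs]"] by simp
  then show ?thesis unfolding rc_def
    by (intro exI[of _ "Cn q [p,p']"] allI impI ev_Cn[where ys="[_,_]"]) (auto intro: p p')
qed

lemma rc_prec:
  assumes "rc 1 (\<lambda>xs. f (xs ! 0))" "rc 3 (\<lambda>xs. g (xs ! 0) (xs ! 1) (xs ! 2))"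
    and "rc n h" "rc n k"
  shows "rc n (\<lambda>xs. rec_nat (f (k xs)) (\<lambda>m y. g y m (k xs)) (h xs))"
proof -
  obtain p where p: "\<And>orc xs. length xs = 1 \<Longrightarrow> evalr orc p xs (f (xs ! 0))"
    using assms unfolding rc_def by blast
  obtain q where q: "\<And>orc xs. length xs = 3 \<Longrightarrow> evalr orc q xs (g (xs ! 0) (xs ! 1) (xs ! 2))"
    using assms unfolding rc_def by blast
  have *: "evalr orc (Pr p q) [m, x] (rec_nat (f x) (\<lambda>m y. g y m x) m)" for orc m x
  proof (induction m)
    case 0 then show ?case using p[of "[x]"] by (auto intro: ev_Pr0)
  next
    case (Suc m)
    show ?case using ev_PrS[OF Suc q[of "[rec_nat (f x) (\<lambda>m y. g y m x) m, m, x]"]] by simp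
  qed
  have "rc 2 (\<lambda>xs. rec_nat (f (xs ! 1)) (\<lambda>m y. g y m (xs ! 1)) (xs ! 0))"
    unfolding rc_def
  proof (intro exI[of _ "Pr p q"] allI impI)
    fix orc and xs :: "nat list" assume "length xs = 2"
    then obtain a b where "xs = [a, b]" by (metis One_nat_def Suc_1 length_0_conv length_Suc_conv)
    then show "evalr orc (Pr p q) xs (rec_nat (f (xs ! 1)) (\<lambda>m y. g y m (xs ! 1)) (xs ! 0))"
      using * by simp
  qed
  from rc_comp2[OF this assms(3,4)] show ?thesis by simp
qed

lemma rc_least:
  assumes "rc 2 (\<lambda>xs. f (xs ! 0) (xs ! 1))" "rc n k" "\<And>x. \<exists>y. f y x = 0"
  shows "rc n (\<lambda>xs. LEAST y. f y (k xs) = 0)"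
proof -
  obtain q where q: "\<And>orc xs. length xs = 2 \<Longrightarrow> evalr orc q xs (f (xs ! 0) (xs ! 1))"
    using assms unfolding rc_def by blast
  have q': "evalr orc q [a, b] (f a b)" for orc a b using q[of "[a, b]"] by simp
  have "evalr orc (Mn q) [x] (LEAST y. f y x = 0)" for orc x
  proof (rule ev_Mn)
    have "f (LEAST y. f y x = 0) x = 0" using assms(3)[of x] by (rule LeastI_ex)
    then show "evalr orc q [LEAST y. f y x = 0, x] 0" using q' by metis
    show "\<forall>z<LEAST y. f y x = 0. \<exists>v. v \<noteq> 0 \<and> evalr orc q [z, x] v"
      using q' not_less_Least by blast
  qed
  then have "rc 1 (\<lambda>xs. LEAST y. f y (xs ! 0) = 0)"
    unfolding rc_def by (intro exI[of _ "Mn q"]) (auto simp: length_Suc_conv)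
  from rc_comp1[OF this assms(2)] show ?thesis by simp
qed

lemma rc_add: assumes "rc n f" "rc n g" shows "rc n (\<lambda>xs. f xs + g xs)"
proof -
  have *: "rec_nat x (\<lambda>m y. Suc y) m = m + x" for m x :: nat by (induction m) auto
  show ?thesis
    using rc_prec[where f="\<lambda>x. x" and g="\<lambda>y m x. Suc y", OF rc_proj rc_Suc[OF rc_proj] assms] by (simp add: *)
qed

lemma rc_mult: assumes "rc n f" "rc n g" shows "rc n (\<lambda>xs. f xs * g xs)"
proof -
  have *: "rec_nat 0 (\<lambda>m y. y + x) m = m * x" for m x :: nat by (induction m) auto
  show ?thesis
    using rc_prec[where f="\<lambda>x. 0" and g="\<lambda>y m x. y + x", OF rc_zero rc_add[OF rc_proj rc_proj] assms] by (simp add: *)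
qed

lemma rc_pred: assumes "rc n f" shows "rc n (\<lambda>xs. f xs - 1)"
proof -
  have *: "rec_nat 0 (\<lambda>m y. m) m = m - 1" for m :: nat by (cases m) auto
  show ?thesis
    using rc_prec[where f="\<lambda>x. 0" and g="\<lambda>y m x. m", OF rc_zero rc_proj assms rc_zero] by (simp add: *)
qed

lemma rc_diff: assumes "rc n f" "rc n g" shows "rc n (\<lambda>xs. f xs - g xs)"
proof -
  have *: "rec_nat x (\<lambda>m y. y - 1) m = x - m" for m x :: nat by (induction m) auto
  show ?thesis
    using rc_prec[where f="\<lambda>x. x" and g="\<lambda>y m x. y - 1", OF rc_proj rc_pred[OF rc_proj] assms(2,1)] by (simp add: * del: One_nat_def)
qed

lemma rc_triangle: assumes "rc n f" shows "rc n (\<lambda>xs. triangle (f xs))"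
proof -
  have *: "rec_nat 0 (\<lambda>m y. Suc (y + m)) m = triangle m" for m :: nat by (induction m) auto
  show ?thesis
    using rc_prec[where f="\<lambda>x. 0" and g="\<lambda>y m x. Suc (y + m)", OF rc_zero rc_Suc[OF rc_add[OF rc_proj rc_proj]] assms rc_zero]
    by (simp add: *)
qed

lemma rc_pair: assumes "rc n f" "rc n g" shows "rc n (\<lambda>xs. prod_encode (f xs, g xs))"
  unfolding prod_encode_def by (simp add: rc_add rc_triangle assms)

text \<open>The diagonal of the pairing function on which \<open>z\<close> lies, found by search
  among the triangular numbers; unpairing then needs only subtraction.\<close>

definition rown :: "nat \<Rightarrow> nat" where "rown z = (LEAST k. Suc z - triangle (Suc k) = 0)"

lemma le_triangle: "k \<le> triangle k"
  by (induction k) auto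

lemma prod_decode_rown: "prod_decode z = (z - triangle (rown z), rown z - (z - triangle (rown z)))"
proof -
  obtain m n where z: "z = prod_encode (m, n)" by (metis prod_decode_inverse surj_pair)
  have mono: "i \<le> j \<Longrightarrow> triangle i \<le> triangle j" for i j
    by (induction j) (auto simp: le_Suc_eq)
  have "rown z = m + n" unfolding rown_def
  proof (rule Least_equality)
    show "Suc z - triangle (Suc (m + n)) = 0" by (simp add: z prod_encode_def)
    fix y assume "Suc z - triangle (Suc y) = 0"
    then have "triangle (m + n) < triangle (Suc y)" by (simp add: z prod_encode_def)
    then show "m + n \<le> y" using mono[of "Suc y" "m + n"] by (meson not_less not_less_eq_eq)
  qed
  moreover have "z = triangle (m + n) + m" by (simp add: z prod_encode_def)
  ultimately show ?thesis using prod_encode_inverse[of "(m, n)"] z by simp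
qed

lemma rc_rown: assumes "rc n f" shows "rc n (\<lambda>xs. rown (f xs))"
  unfolding rown_def
proof (rule rc_least[OF _ assms])
  show "rc 2 (\<lambda>xs. Suc (xs ! 1) - triangle (Suc (xs ! 0)))"
    by (intro rc_diff rc_Suc rc_triangle rc_proj) auto
  show "\<exists>y. Suc x - triangle (Suc y) = 0" for x
    using le_triangle[of "Suc x"] by (intro exI[of _ x]) simp
qed

lemma rc_unpair:
  assumes "rc n f"
  shows "rc n (\<lambda>xs. fst (prod_decode (f xs)))" "rc n (\<lambda>xs. snd (prod_decode (f xs)))"
  by (simp_all add: prod_decode_rown rc_diff rc_triangle rc_rown assms)

section \<open>Computability on coded types\<close>

text \<open>Only \<open>dec\<close> after \<open>enc\<close> has to be the identity, so that finite
  types such as \<open>bool\<close> qualify. The converse law is added in \<open>codb\<close>, for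
  unbounded search.\<close>

class cod =
  fixes enc :: "'a \<Rightarrow> nat" and dec :: "nat \<Rightarrow> 'a"
  assumes dec_enc [simp]: "dec (enc x) = x"

lemma enc_inj [simp]: "enc x = enc y \<longleftrightarrow> x = y"
  by (metis dec_enc)

instantiation nat :: cod
begin
definition enc_nat :: "nat \<Rightarrow> nat" where "enc_nat x = x"
definition dec_nat :: "nat \<Rightarrow> nat" where "dec_nat x = x"
instance by standard (simp add: enc_nat_def dec_nat_def)
end

instantiation bool :: cod
begin
definition enc_bool :: "bool \<Rightarrow> nat" where "enc_bool b = (if b then 1 else 0)"
definition dec_bool :: "nat \<Rightarrow> bool" where "dec_bool x = (x = 1)"
instance by standard (simp add: enc_bool_def dec_bool_def)
end

instantiation prod :: (cod, cod) cod
begin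
definition enc_prod :: "'a \<times> 'b \<Rightarrow> nat" where "enc_prod p = prod_encode (enc (fst p), enc (snd p))"
definition dec_prod :: "nat \<Rightarrow> 'a \<times> 'b" where
  "dec_prod n = (dec (fst (prod_decode n)), dec (snd (prod_decode n)))"
instance by standard (simp add: enc_prod_def dec_prod_def)
end

instantiation list :: (cod) cod
begin
definition enc_list :: "'a list \<Rightarrow> nat" where "enc_list xs = list_encode (map enc xs)"
definition dec_list :: "nat \<Rightarrow> 'a list" where "dec_list n = map dec (list_decode n)"
instance by standard (simp add: enc_list_def dec_list_def comp_def)
end

text \<open>One program has to be right for all oracles. The same programs then serve without an
  oracle and as subroutines of an oracle computation.\<close>

definition cpt :: "('a::cod \<Rightarrow> 'b::cod) \<Rightarrow> bool" where
  "cpt f \<longleftrightarrow> (\<exists>p. \<forall>orc x. evalr orc p [enc x] (enc (f x)))"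

lemma cptI:
  assumes "rc 1 (\<lambda>xs. F (xs ! 0))" "\<And>x. F (enc x) = enc (f x)" shows "cpt f"
proof -
  obtain p where p: "\<And>orc xs. length xs = 1 \<Longrightarrow> evalr orc p xs (F (xs ! 0))"
    using assms(1) unfolding rc_def by blast
  have "evalr orc p [enc x] (enc (f x))" for orc x using p[of "[enc x]" orc] assms(2)[of x] by simp
  then show ?thesis unfolding cpt_def by blast
qed

lemma cpt_id: "cpt (\<lambda>x. x)"
  by (rule cptI[of "\<lambda>x. x"]) (auto intro: rc_proj)

lemma cpt_const: "cpt (\<lambda>x. c)"
  by (rule cptI[of "\<lambda>x. enc c"]) (auto intro: rc_const)

lemma cpt_comp: assumes "cpt g" "cpt f" shows "cpt (\<lambda>x. g (f x))"
proof -
  obtain p q where "\<And>orc x. evalr orc p [enc x] (enc (f x))" "\<And>orc x. evalr orc q [enc x] (enc (g x))"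
    using assms unfolding cpt_def by metis
  then show ?thesis unfolding cpt_def
    by (intro exI[of _ "Cn q [p]"] allI ev_Cn[where ys="[_]"]) auto
qed

lemma rc_enc_pair:
  obtains p where "\<And>orc a b. evalr orc p [a, b] (prod_encode (a, b))"
proof -
  have "rc 2 (\<lambda>xs. prod_encode (xs ! 0, xs ! 1))" by (intro rc_pair rc_proj) auto
  then obtain p where p: "\<And>orc xs. length xs = 2 \<Longrightarrow> evalr orc p xs (prod_encode (xs ! 0, xs ! 1))"
    unfolding rc_def by blast
  have "evalr orc p [a, b] (prod_encode (a, b))" for orc a b using p[of "[a, b]" orc] by simp
  then show ?thesis using that by blast
qed

lemma cpt_Pair: assumes "cpt f" "cpt g" shows "cpt (\<lambda>x. (f x, g x))"
proof -
  obtain p q where p: "\<And>orc x. evalr orc p [enc x] (enc (f x))" and q: "\<And>orc x. evalr orc q [enc x] (enc (g x))"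
    using assms unfolding cpt_def by metis
  obtain c where c: "\<And>orc a b. evalr orc c [a, b] (prod_encode (a, b))" using rc_enc_pair by blast
  have "evalr orc (Cn c [p, q]) [enc x] (enc (f x, g x))" for orc x
    unfolding enc_prod_def using p q c by (intro ev_Cn[where ys="[enc (f x), enc (g x)]"]) auto
  then show ?thesis unfolding cpt_def by blast
qed

lemma cpt_comp2: assumes "cpt (\<lambda>p. g (fst p) (snd p))" "cpt f" "cpt h" shows "cpt (\<lambda>x. g (f x) (h x))"
  using cpt_comp[OF assms(1) cpt_Pair[OF assms(2,3)]] by simp

lemma cpt_fst0: "cpt fst"
  by (rule cptI[of "\<lambda>x. fst (prod_decode x)"]) (auto intro!: rc_unpair rc_proj simp: enc_prod_def)
lemma cpt_snd0: "cpt snd"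
  by (rule cptI[of "\<lambda>x. snd (prod_decode x)"]) (auto intro!: rc_unpair rc_proj simp: enc_prod_def)
lemma cpt_fst: "cpt f \<Longrightarrow> cpt (\<lambda>x. fst (f x))" using cpt_comp[OF cpt_fst0] .
lemma cpt_snd: "cpt f \<Longrightarrow> cpt (\<lambda>x. snd (f x))" using cpt_comp[OF cpt_snd0] .

lemma cpt_nat1:
  assumes "rc 1 (\<lambda>xs. F (xs ! 0))" "cpt f" shows "cpt (\<lambda>x. F (f x :: nat) :: nat)"
  by (rule cpt_comp[OF cptI[of F] assms(2)]) (use assms in \<open>auto simp: enc_nat_def\<close>)

lemma cpt_nat2:
  assumes "rc 2 (\<lambda>xs. F (xs ! 0) (xs ! 1))" "cpt f" "cpt g"
  shows "cpt (\<lambda>x. F (f x :: nat) (g x :: nat) :: nat)"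
proof (rule cpt_comp2[OF cptI[of "\<lambda>x. F (fst (prod_decode x)) (snd (prod_decode x))"] assms(2,3)])
  show "rc 1 (\<lambda>xs. F (fst (prod_decode (xs ! 0))) (snd (prod_decode (xs ! 0))))"
    using rc_comp2[OF assms(1) rc_unpair(1)[OF rc_proj] rc_unpair(2)[OF rc_proj], of 0 1 0] by simp
qed (auto simp: enc_nat_def enc_prod_def)

lemma cpt_Suc: "cpt f \<Longrightarrow> cpt (\<lambda>x. Suc (f x))"
  by (rule cpt_nat1) (auto intro!: rc_Suc rc_proj)
lemma cpt_add: "cpt f \<Longrightarrow> cpt g \<Longrightarrow> cpt (\<lambda>x. f x + g x :: nat)"
  by (rule cpt_nat2) (auto intro!: rc_add rc_proj)
lemma cpt_mult: "cpt f \<Longrightarrow> cpt g \<Longrightarrow> cpt (\<lambda>x. f x * g x :: nat)"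
  by (rule cpt_nat2) (auto intro!: rc_mult rc_proj)
lemma cpt_diff: "cpt f \<Longrightarrow> cpt g \<Longrightarrow> cpt (\<lambda>x. f x - g x :: nat)"
  by (rule cpt_nat2) (auto intro!: rc_diff rc_proj)

lemma cpt_enc: "cpt f \<Longrightarrow> cpt (\<lambda>x. enc (f x))"
  unfolding cpt_def by (simp add: enc_nat_def)

lemma cpt_rec_nat:
  assumes f: "cpt f" and g: "cpt (\<lambda>p. g (fst p) (fst (snd p)) (snd (snd p)))" and h: "cpt h"
  shows "cpt (\<lambda>x. rec_nat (f x) (\<lambda>n y. g x n y) (h x))"
proof -
  obtain F where F: "\<And>orc x. evalr orc F [enc x] (enc (f x))"
    using f unfolding cpt_def by blast
  obtain G where G: "\<And>orc x n y. evalr orc G [prod_encode (enc x, prod_encode (n, enc y))] (enc (g x n y))"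
    using g unfolding cpt_def enc_prod_def enc_nat_def by (metis fst_conv snd_conv)
  obtain H where H: "\<And>orc x. evalr orc H [enc x] (h x)"
    using h unfolding cpt_def by (auto simp: enc_nat_def)
  obtain c where c: "\<And>orc a b. evalr orc c [a, b] (prod_encode (a, b))" using rc_enc_pair by blast
  define S where "S = Cn G [Cn c [Pj 2, Cn c [Pj 1, Pj 0]]]"
  have 1: "evalr orc (Cn c [Pj 1, Pj 0]) [a, b, d] (prod_encode (b, a))" for orc a b d
    using c ev_Pj[of 1 "[a,b,d]"] ev_Pj[of 0 "[a,b,d]"] by (intro ev_Cn[where ys="[b, a]"]) auto
  have 2: "evalr orc (Cn c [Pj 2, Cn c [Pj 1, Pj 0]]) [a, b, d] (prod_encode (d, prod_encode (b, a)))" for orc a b d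
    using c 1 ev_Pj[of 2 "[a,b,d]"] by (intro ev_Cn[where ys="[d, prod_encode (b, a)]"]) auto
  have S: "evalr orc S [enc y, n, enc x] (enc (g x n y))" for orc x n y
    unfolding S_def using 2 G by (intro ev_Cn[where ys="[prod_encode (enc x, prod_encode (n, enc y))]"]) auto
  have P: "evalr orc (Pr F S) [n, enc x] (enc (rec_nat (f x) (\<lambda>n y. g x n y) n))" for orc n x
  proof (induction n)
    case 0 then show ?case using F by (auto intro: ev_Pr0)
  next
    case (Suc n) then show ?case using ev_PrS[OF Suc S] by simp
  qed
  have "evalr orc (Cn (Pr F S) [H, Pj 0]) [enc x] (enc (rec_nat (f x) (\<lambda>n y. g x n y) (h x)))" for orc x
    using P H ev_Pj[of 0 "[enc x]"] by (intro ev_Cn[where ys="[h x, enc x]"]) auto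
  then show ?thesis unfolding cpt_def by blast
qed

lemma cpt_isone: "cpt f \<Longrightarrow> cpt (\<lambda>x. f x = (0::nat))"
proof -
  assume f: "cpt f"
  have "cpt (\<lambda>x::nat. x = 0)"
    by (rule cptI[of "\<lambda>x. 1 - x"]) (auto intro!: rc_diff rc_const rc_proj simp: enc_nat_def enc_bool_def)
  from cpt_comp[OF this f] show ?thesis .
qed

lemma cpt_If: assumes "cpt P" "cpt f" "cpt g" shows "cpt (\<lambda>x. if P x then f x else g x)"
proof -
  have "cpt (\<lambda>x. rec_nat (g x) (\<lambda>_ _. f x) (enc (P x)))"
    by (rule cpt_rec_nat[OF assms(3) cpt_comp[OF assms(2) cpt_fst0] cpt_enc[OF assms(1)]])
  moreover have "rec_nat (g x) (\<lambda>_ _. f x) (enc (P x)) = (if P x then f x else g x)" for x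
    by (simp add: enc_bool_def)
  ultimately show ?thesis by simp
qed

lemma cpt_not: assumes "cpt P" shows "cpt (\<lambda>x. \<not> P x)"
proof -
  have "cpt (\<lambda>x. if P x then False else True)" by (intro cpt_If cpt_const assms)
  moreover have "(\<lambda>x. if P x then False else True) = (\<lambda>x. \<not> P x)" by auto
  ultimately show ?thesis by simp
qed
lemma cpt_conj: assumes "cpt P" "cpt Q" shows "cpt (\<lambda>x. P x \<and> Q x)"
proof -
  have "cpt (\<lambda>x. if P x then Q x else False)" by (intro cpt_If cpt_const assms)
  moreover have "(\<lambda>x. if P x then Q x else False) = (\<lambda>x. P x \<and> Q x)" by auto
  ultimately show ?thesis by simp
qed
lemma cpt_disj: "cpt P \<Longrightarrow> cpt Q \<Longrightarrow> cpt (\<lambda>x. P x \<or> Q x)"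
  using cpt_not[OF cpt_conj[OF cpt_not cpt_not], of P Q] by (simp only: de_Morgan_conj not_not)
lemma cpt_imp: "cpt P \<Longrightarrow> cpt Q \<Longrightarrow> cpt (\<lambda>x. P x \<longrightarrow> Q x)"
  unfolding imp_conv_disj by (rule cpt_disj[OF cpt_not])
lemma cpt_le: "cpt f \<Longrightarrow> cpt g \<Longrightarrow> cpt (\<lambda>x. f x \<le> (g x :: nat))"
  using cpt_isone[OF cpt_diff, of f g] by (simp only: diff_is_0_eq)
lemma cpt_less: "cpt f \<Longrightarrow> cpt g \<Longrightarrow> cpt (\<lambda>x. f x < (g x :: nat))"
  using cpt_not[OF cpt_le, of g f] by (simp only: not_le)
lemma cpt_eq: assumes "cpt f" "cpt g" shows "cpt (\<lambda>x. f x = g x)"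
proof -
  have "cpt (\<lambda>x. enc (f x) \<le> enc (g x) \<and> enc (g x) \<le> enc (f x))"
    by (intro cpt_conj cpt_le cpt_enc assms)
  then show ?thesis by (simp add: eq_iff[symmetric])
qed
lemma cpt_iff: "cpt P \<Longrightarrow> cpt Q \<Longrightarrow> cpt (\<lambda>x. P x \<longleftrightarrow> Q x)" by (rule cpt_eq)

lemma cpt_Least0:
  assumes "cpt (\<lambda>p. P (fst p) (snd p))" "\<And>x. \<exists>n::nat. P x n"
  shows "cpt (\<lambda>x. LEAST n. P x n)"
proof -
  have "cpt (\<lambda>p. (if P (fst p) (snd p) then 0 else 1) :: nat)"
    by (intro cpt_If cpt_const assms(1))
  then obtain F where F: "\<And>orc x n. evalr orc F [prod_encode (enc x, n)] (if P x n then 0 else 1)"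
    unfolding cpt_def enc_nat_def enc_prod_def by (metis fst_conv snd_conv)
  obtain c where c: "\<And>orc a b. evalr orc c [a, b] (prod_encode (a, b))" using rc_enc_pair by blast
  have 1: "evalr orc (Cn c [Pj 1, Pj 0]) [a, b] (prod_encode (b, a))" for orc a b
    using c ev_Pj[of 1 "[a,b]"] ev_Pj[of 0 "[a,b]"] by (intro ev_Cn[where ys="[b, a]"]) auto
  have 2: "evalr orc (Cn F [Cn c [Pj 1, Pj 0]]) [n, enc x] (if P x n then 0 else 1)" for orc n x
    using F 1 by (intro ev_Cn[where ys="[prod_encode (enc x, n)]"]) auto
  have "evalr orc (Mn (Cn F [Cn c [Pj 1, Pj 0]])) [enc x] (enc (LEAST n. P x n))" for orc x
    unfolding enc_nat_def
  proof (rule ev_Mn)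
    show "evalr orc (Cn F [Cn c [Pj 1, Pj 0]]) [LEAST n. P x n, enc x] 0"
      using 2[of orc "LEAST n. P x n" x] LeastI_ex[OF assms(2)[of x]] by simp
    show "\<forall>z<LEAST n. P x n. \<exists>v. v \<noteq> 0 \<and> evalr orc (Cn F [Cn c [Pj 1, Pj 0]]) [z, enc x] v"
    proof (intro allI impI)
      fix z assume "z < (LEAST n. P x n)"
      then have "\<not> P x z" by (rule not_less_Least)
      then have "evalr orc (Cn F [Cn c [Pj 1, Pj 0]]) [z, enc x] 1" using 2[of orc z x] by simp
      then show "\<exists>v. v \<noteq> 0 \<and> evalr orc (Cn F [Cn c [Pj 1, Pj 0]]) [z, enc x] v" by (intro exI[of _ 1]) simp
    qed
  qed
  then show ?thesis unfolding cpt_def by blast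
qed

lemma cpt_all_less:
  assumes "cpt (\<lambda>p. P (fst p) (snd p :: nat))" "cpt f"
  shows "cpt (\<lambda>x. \<forall>i<f x. P x i)"
proof -
  have "cpt (\<lambda>x. rec_nat True (\<lambda>n y. y \<and> P x n) (f x))"
    using cpt_comp2[OF assms(1) cpt_fst[OF cpt_id] cpt_fst[OF cpt_snd[OF cpt_id]]]
    by (intro cpt_rec_nat cpt_const assms cpt_conj cpt_snd cpt_id)
  moreover have "rec_nat True (\<lambda>n y. y \<and> P x n) k = (\<forall>i<k. P x i)" for x k
    by (induction k) (auto simp: less_Suc_eq)
  ultimately show ?thesis by simp
qed

lemma cpt_ex_less:
  assumes "cpt (\<lambda>p. P (fst p) (snd p :: nat))" "cpt f"
  shows "cpt (\<lambda>x. \<exists>i<f x. P x i)"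
  using cpt_not[OF cpt_all_less[OF cpt_not[OF assms(1)] assms(2)]] by (simp only: not_all not_not de_Morgan_conj not_imp simp_thms)

lemma cpt_sum_less:
  assumes "cpt (\<lambda>p. g (fst p) (snd p :: nat))" "cpt f"
  shows "cpt (\<lambda>x. \<Sum>i<f x. g x i :: nat)"
proof -
  have "cpt (\<lambda>x. rec_nat 0 (\<lambda>n y. y + g x n) (f x))"
    using cpt_comp2[OF assms(1) cpt_fst[OF cpt_id] cpt_fst[OF cpt_snd[OF cpt_id]]]
    by (intro cpt_rec_nat cpt_const assms cpt_add cpt_snd cpt_id)
  moreover have "rec_nat 0 (\<lambda>n y. y + g x n) k = (\<Sum>i<k. g x i)" for x k
    by (induction k) auto
  ultimately show ?thesis by simp
qed

lemma cpt_funpow: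
  fixes g :: "'a::cod \<Rightarrow> 'b::cod \<Rightarrow> 'b"
  assumes "cpt (\<lambda>p. g (fst p) (snd p))" "cpt a" "cpt f"
  shows "cpt (\<lambda>x. (g x ^^ f x) (a x))"
proof -
  have "cpt (\<lambda>x. rec_nat (a x) (\<lambda>n y. g x y) (f x))"
    using cpt_comp2[OF assms(1) cpt_fst[OF cpt_id] cpt_snd[OF cpt_snd[OF cpt_id]]]
    by (intro cpt_rec_nat cpt_const assms)
  moreover have "rec_nat (a x) (\<lambda>n y. g x y) k = (g x ^^ k) (a x)" for x k
    by (induction k) auto
  ultimately show ?thesis by simp
qed

lemma cpt_power: assumes "cpt f" "cpt g" shows "cpt (\<lambda>x. f x ^ g x :: nat)"
proof -
  have "cpt (\<lambda>x. rec_nat 1 (\<lambda>n y. f x * y) (g x))"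
    by (intro cpt_rec_nat cpt_const cpt_mult cpt_comp[OF assms(1)] cpt_fst cpt_snd cpt_id assms)
  moreover have "rec_nat 1 (\<lambda>n y. f x * y) k = f x ^ k" for x k by (induction k) auto
  ultimately show ?thesis by simp
qed

lemma cpt_Least_cong:
  assumes "cpt (\<lambda>p. P (fst p) (snd p))" "\<And>x. \<exists>n::nat. P x n" "\<And>x. f x = (LEAST n. P x n)"
  shows "cpt f"
proof -
  have "f = (\<lambda>x. LEAST n. P x n)" using assms(3) by (rule ext)
  then show ?thesis using cpt_Least0[OF assms(1,2)] by simp
qed

lemma cpt_div: assumes "cpt f" "cpt g" shows "cpt (\<lambda>x. f x div g x :: nat)"
proof (rule cpt_comp2[OF _ assms], rule cpt_Least_cong)
  show "cpt (\<lambda>p. (snd (fst p) = 0 \<and> snd p = 0) \<or> (snd (fst p) \<noteq> 0 \<and> fst (fst p) < Suc (snd p) * (snd (fst p)::nat)))"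
    by (intro cpt_disj cpt_conj cpt_eq cpt_not cpt_less cpt_mult cpt_Suc cpt_fst cpt_snd cpt_id cpt_const)
  show "\<exists>n. (snd x = 0 \<and> n = 0) \<or> (snd x \<noteq> 0 \<and> fst x < Suc n * snd x)" for x :: "nat \<times> nat"
  proof (cases "snd x = 0")
    case False
    then have "Suc (fst x) * 1 \<le> Suc (fst x) * snd x" by (intro mult_le_mono) auto
    then have "Suc (fst x) \<le> Suc (fst x) * snd x" by (simp only: mult_1_right)
    then have "fst x < Suc (fst x) * snd x" by (rule Suc_le_lessD)
    then show ?thesis using False by blast
  qed auto
  show "fst x div snd x = (LEAST n. (snd x = 0 \<and> n = 0) \<or> (snd x \<noteq> 0 \<and> fst x < Suc n * snd x))" for x :: "nat \<times> nat"
  proof (rule Least_equality[symmetric])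
    show "(snd x = 0 \<and> fst x div snd x = 0) \<or> (snd x \<noteq> 0 \<and> fst x < Suc (fst x div snd x) * snd x)"
      using dividend_less_div_times[of "snd x" "fst x"] by (cases "snd x = 0") auto
    fix n assume "(snd x = 0 \<and> n = 0) \<or> (snd x \<noteq> 0 \<and> fst x < Suc n * snd x)"
    then show "fst x div snd x \<le> n" using less_mult_imp_div_less[of "fst x" "Suc n" "snd x"] by auto
  qed
qed

lemma cpt_mod: "cpt f \<Longrightarrow> cpt g \<Longrightarrow> cpt (\<lambda>x. f x mod g x :: nat)"
  unfolding modulo_nat_def by (intro cpt_diff cpt_mult cpt_div)

lemma cpt_even: assumes "cpt f" shows "cpt (\<lambda>x. even (f x :: nat))"
  unfolding even_iff_mod_2_eq_zero by (intro cpt_eq cpt_mod cpt_const assms)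

lemmas cpt_basic = cpt_const cpt_id cpt_Pair cpt_fst cpt_snd cpt_Suc cpt_add cpt_mult cpt_diff
  cpt_If cpt_not cpt_conj cpt_disj cpt_imp cpt_le cpt_less cpt_eq cpt_all_less cpt_ex_less
  cpt_sum_less cpt_power cpt_div cpt_mod cpt_even

section \<open>Lists\<close>

lemma cpt_Cons: assumes "cpt f" "cpt g" shows "cpt (\<lambda>x. f x # g x)"
proof -
  have "cpt (\<lambda>p. fst p # snd p)"
    by (rule cptI[of Suc]) (auto intro!: rc_Suc rc_proj simp: enc_list_def enc_prod_def)
  from cpt_comp2[OF this assms] show ?thesis .
qed

lemma cpt_Nil_eq: "cpt f \<Longrightarrow> cpt (\<lambda>x. f x = [])" by (rule cpt_eq[OF _ cpt_const])

lemma cpt_tl: assumes "cpt f" shows "cpt (\<lambda>x. tl (f x :: 'a::cod list))"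
proof -
  have "cpt (tl :: 'a list \<Rightarrow> _)"
  proof (rule cptI[of "\<lambda>n. snd (prod_decode (n - 1))"])
    show "rc 1 (\<lambda>xs. snd (prod_decode (xs ! 0 - 1)))" by (intro rc_unpair rc_diff rc_proj rc_const) auto
    show "snd (prod_decode (enc xs - 1)) = enc (tl xs)" for xs :: "'a list"
    proof (cases xs)
      case Nil
      have "prod_decode 0 = (0,0)" by (simp add: prod_decode_def prod_decode_aux.simps)
      then show ?thesis using Nil by (simp add: enc_list_def)
    qed (simp add: enc_list_def)
  qed
  from cpt_comp[OF this assms] show ?thesis .
qed

lemma cpt_hd: assumes "cpt f" shows "cpt (\<lambda>x. hd (f x))"
proof -
  let ?c = "enc (hd [] :: 'b)"
  have "cpt (hd :: 'b list \<Rightarrow> 'b)"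
  proof (rule cptI[of "\<lambda>n. (1 - n) * ?c + (1 - (1 - n)) * fst (prod_decode (n - 1))"])
    show "rc 1 (\<lambda>xs. (1 - xs ! 0) * ?c + (1 - (1 - xs ! 0)) * fst (prod_decode (xs ! 0 - 1)))"
      by (intro rc_add rc_mult rc_diff rc_unpair rc_proj rc_const) auto
    show "(1 - enc xs) * ?c + (1 - (1 - enc xs)) * fst (prod_decode (enc xs - 1)) = enc (hd xs)" for xs :: "'b list"
      by (cases xs) (auto simp: enc_list_def)
  qed
  from cpt_comp[OF this assms] show ?thesis .
qed

text \<open>The code of a list bounds its length and so serves as a computable number of iterations
  in \<open>cpt_foldl\<close>.\<close>

lemma length_le_enc: "length xs \<le> enc xs"
proof (induction xs)
  case (Cons a xs)
  have "enc xs \<le> prod_encode (enc a, enc xs)" by (rule le_prod_encode_2)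
  then show ?case using Cons by (simp add: enc_list_def)
qed (simp add: enc_list_def)

text \<open>The step stands still once the list is empty, so every number of iterations from the
  length on gives the fold.\<close>

lemma foldl_funpow:
  fixes G :: "'b \<Rightarrow> 'c \<Rightarrow> 'b"
  defines "st \<equiv> \<lambda>s. if snd s = [] then s else (G (fst s) (hd (snd s)), tl (snd s))"
  shows "length xs \<le> n \<Longrightarrow> (st ^^ n) (b, xs) = (foldl G b xs, [])"
proof (induction n arbitrary: b xs)
  case 0 then show ?case by simp
next
  case (Suc n)
  have eq: "(st ^^ Suc n) (b, xs) = (st ^^ n) (st (b, xs))"
    by (simp only: funpow_Suc_right o_apply)
  show ?case
  proof (cases xs)
    case Nil then show ?thesis using Suc.IH[of xs b] eq by (simp add: st_def)
  next
    case (Cons y ys)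
    then show ?thesis using Suc.IH[of ys "G b y"] Suc.prems eq unfolding st_def by simp
  qed
qed

lemma cpt_foldl:
  assumes F: "cpt (\<lambda>p. F (fst p) (fst (snd p)) (snd (snd p)))" and a: "cpt a" and l: "cpt l"
  shows "cpt (\<lambda>x. foldl (\<lambda>acc y. F x acc y) (a x) (l x))"
proof -
  let ?st = "\<lambda>x s. if snd s = [] then s else (F x (fst s) (hd (snd s)), tl (snd s))"
  have "cpt (\<lambda>q. F (fst q) (fst (snd q)) (hd (snd (snd q))))"
    using cpt_comp[OF F cpt_Pair[OF cpt_fst[OF cpt_id] cpt_Pair[OF cpt_fst[OF cpt_snd[OF cpt_id]] cpt_hd[OF cpt_snd[OF cpt_snd[OF cpt_id]]]]]]
    by simp
  then have 1: "cpt (\<lambda>x. fst ((?st x ^^ enc (l x)) (a x, l x)))"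
    by (intro cpt_fst cpt_funpow cpt_Pair cpt_enc a l cpt_If cpt_Nil_eq cpt_tl cpt_snd cpt_id)
  show ?thesis using 1 by (simp only: foldl_funpow[OF length_le_enc] fst_conv)
qed

lemma cpt_rev: assumes "cpt f" shows "cpt (\<lambda>x. rev (f x))"
proof -
  have "foldl (\<lambda>acc y. y # acc) b xs = rev xs @ b" for b and xs :: "'b list" by (induction xs arbitrary: b) auto
  moreover have "cpt (\<lambda>x. foldl (\<lambda>acc y. y # acc) [] (f x))"
    by (intro cpt_foldl cpt_Cons assms cpt_basic)
  ultimately show ?thesis by simp
qed

lemma cpt_foldr:
  assumes "cpt (\<lambda>p. F (fst p) (fst (snd p)) (snd (snd p)))" "cpt a" "cpt l"
  shows "cpt (\<lambda>x. foldr (\<lambda>y acc. F x y acc) (l x) (a x))"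
  unfolding foldr_conv_foldl
  using cpt_comp[OF assms(1) cpt_Pair[OF cpt_fst[OF cpt_id] cpt_Pair[OF cpt_snd[OF cpt_snd[OF cpt_id]] cpt_fst[OF cpt_snd[OF cpt_id]]]]]
  by (intro cpt_foldl cpt_rev assms) simp

lemma cpt_append: assumes "cpt f" "cpt g" shows "cpt (\<lambda>x. f x @ g x)"
proof -
  have "cpt (\<lambda>x. foldr (\<lambda>y acc. y # acc) (f x) (g x))"
    by (intro cpt_foldr cpt_Cons cpt_basic assms)
  moreover have "foldr (\<lambda>y acc. y # acc) xs ys = xs @ ys" for xs ys :: "'b list" by (induction xs) auto
  ultimately show ?thesis by simp
qed

lemma foldr_map_eq: "foldr (\<lambda>y acc. G y # acc) xs [] = map G xs"
  by (induction xs) auto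

lemma cpt_map:
  assumes "cpt (\<lambda>p. F (fst p) (snd p))" "cpt l" shows "cpt (\<lambda>x. map (\<lambda>y. F x y) (l x))"
proof -
  have "cpt (\<lambda>x. foldr (\<lambda>y acc. F x y # acc) (l x) [])"
    using cpt_comp[OF assms(1) cpt_Pair[OF cpt_fst[OF cpt_id] cpt_fst[OF cpt_snd[OF cpt_id]]]]
    by (intro cpt_foldr cpt_Cons cpt_basic assms) simp
  then show ?thesis by (simp only: foldr_map_eq)
qed

lemma cpt_filter:
  assumes "cpt (\<lambda>p. P (fst p) (snd p))" "cpt l" shows "cpt (\<lambda>x. filter (\<lambda>y. P x y) (l x))"
proof -
  have "cpt (\<lambda>x. foldr (\<lambda>y acc. if P x y then y # acc else acc) (l x) [])"
    using cpt_comp[OF assms(1) cpt_Pair[OF cpt_fst[OF cpt_id] cpt_fst[OF cpt_snd[OF cpt_id]]]]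
    by (intro cpt_foldr cpt_If cpt_Cons cpt_basic assms) simp
  moreover have "foldr (\<lambda>y acc. if Q y then y # acc else acc) xs [] = filter Q xs" for Q and xs :: "'b list" by (induction xs) auto
  ultimately show ?thesis by simp
qed

lemma cpt_length: assumes "cpt l" shows "cpt (\<lambda>x. length (l x))"
proof -
  have "cpt (\<lambda>x. foldr (\<lambda>y acc. Suc acc) (l x) 0)"
    by (intro cpt_foldr cpt_basic assms)
  moreover have "foldr (\<lambda>y acc. Suc acc) xs 0 = length xs" for xs :: "'b list" by (induction xs) auto
  ultimately show ?thesis by simp
qed

lemma cpt_drop: assumes "cpt n" "cpt l" shows "cpt (\<lambda>x. drop (n x) (l x))"
proof -
  have "cpt (\<lambda>x. (tl ^^ n x) (l x))" by (intro cpt_funpow cpt_tl cpt_basic assms)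
  moreover have "(tl ^^ n) xs = drop n xs" for n and xs :: "'b list" by (induction n) (auto simp: drop_Suc tl_drop)
  ultimately show ?thesis by simp
qed

lemma cpt_take: assumes "cpt n" "cpt l" shows "cpt (\<lambda>x. take (n x) (l x))"
proof -
  have "cpt (\<lambda>x. rev (drop (length (l x) - n x) (rev (l x))))"
    by (intro cpt_rev cpt_drop cpt_diff cpt_length assms)
  moreover have "rev (drop (length xs - n) (rev xs)) = take n xs" for n and xs :: "'b list"
    by (cases "n \<le> length xs") (simp_all add: rev_drop)
  ultimately show ?thesis by simp
qed

lemma cpt_upt: assumes "cpt n" shows "cpt (\<lambda>x. [0..<n x])"
proof -
  have "cpt (\<lambda>x. rec_nat [] (\<lambda>i acc. acc @ [i]) (n x))"
    by (intro cpt_rec_nat cpt_append cpt_Cons cpt_basic assms)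
  moreover have "rec_nat [] (\<lambda>i acc. acc @ [i]) k = [0..<k]" for k by (induction k) auto
  ultimately show ?thesis by simp
qed

text \<open>The default replaces the unspecified result of \<open>!\<close> beyond the end, which
  makes indexing a total function that a program can compute.\<close>

definition nthd :: "'a \<Rightarrow> 'a list \<Rightarrow> nat \<Rightarrow> 'a" where
  "nthd d xs i = hd (drop i xs @ [d])"

lemma nthd_simp: "nthd d xs i = (if i < length xs then xs ! i else d)"
  unfolding nthd_def by (simp add: hd_append hd_drop_conv_nth not_le[symmetric])

lemma cpt_nthd: "cpt d \<Longrightarrow> cpt xs \<Longrightarrow> cpt i \<Longrightarrow> cpt (\<lambda>x. nthd (d x) (xs x) (i x))"
  unfolding nthd_def by (intro cpt_hd cpt_append cpt_drop cpt_Cons cpt_const)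

lemma cpt_list_all:
  assumes "cpt (\<lambda>p. P (fst p) (snd p))" "cpt l" shows "cpt (\<lambda>x. list_all (\<lambda>y. P x y) (l x))"
proof -
  have "cpt (\<lambda>x. filter (\<lambda>y. \<not> P x y) (l x) = [])"
    by (intro cpt_eq cpt_filter cpt_not assms cpt_const)
  then show ?thesis by (simp add: list_all_iff filter_empty_conv)
qed

lemma cpt_list_ex:
  assumes "cpt (\<lambda>p. P (fst p) (snd p))" "cpt l" shows "cpt (\<lambda>x. list_ex (\<lambda>y. P x y) (l x))"
proof -
  have "cpt (\<lambda>x. \<not> list_all (\<lambda>y. \<not> P x y) (l x))" by (intro cpt_not cpt_list_all assms)
  then show ?thesis by (simp add: list_all_iff list_ex_iff)
qed

lemma cpt_member: assumes "cpt a" "cpt l" shows "cpt (\<lambda>x. a x \<in> set (l x))"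
proof -
  have "cpt (\<lambda>x. list_ex (\<lambda>y. y = a x) (l x))"
    by (intro cpt_list_ex cpt_eq cpt_snd cpt_comp[OF assms(1)] cpt_fst cpt_id assms)
  then show ?thesis by (simp add: list_ex_iff)
qed

lemmas cpt_list = cpt_Cons cpt_tl cpt_hd cpt_rev cpt_append cpt_map cpt_filter cpt_length cpt_drop
  cpt_take cpt_upt cpt_nthd cpt_list_all cpt_list_ex cpt_member

section \<open>Rational-valued functions and c.e. predicates\<close>

text \<open>A difference of naturals over a positive natural: signs need no coding, and comparing
  two values reduces to comparing naturals.\<close>

definition crat :: "('a::cod \<Rightarrow> real) \<Rightarrow> bool" where
  "crat f \<longleftrightarrow> (\<exists>a b c. cpt a \<and> cpt b \<and> cpt c \<and> (\<forall>x. f x = (real (a x) - real (b x)) / real (Suc (c x))))"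

lemma cratI: "cpt a \<Longrightarrow> cpt b \<Longrightarrow> cpt c \<Longrightarrow> (\<And>x. f x = (real (a x) - real (b x)) / real (Suc (c x))) \<Longrightarrow> crat f"
  unfolding crat_def by blast

lemma cratE:
  assumes "crat f"
  obtains a b c where "cpt a" "cpt b" "cpt c" "f = (\<lambda>x. (real (a x) - real (b x)) / real (Suc (c x)))"
  using assms unfolding crat_def by (metis ext)

lemma crat_comp: assumes "crat f" "cpt g" shows "crat (\<lambda>x. f (g x))"
  using assms(1)
proof (rule cratE)
  fix a b c assume *: "cpt a" "cpt b" "cpt c" "f = (\<lambda>x. (real (a x) - real (b x)) / real (Suc (c x)))"
  then show ?thesis
    by (intro cratI[of "\<lambda>x. a (g x)" "\<lambda>x. b (g x)" "\<lambda>x. c (g x)"])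
      (auto intro: cpt_comp[OF *(1) assms(2)] cpt_comp[OF *(2) assms(2)] cpt_comp[OF *(3) assms(2)])
qed

lemma crat_nat: "cpt n \<Longrightarrow> crat (\<lambda>x. real (n x))"
  by (rule cratI[of n "\<lambda>_. 0" "\<lambda>_. 0"]) (auto intro: cpt_const)
lemma crat_0: "crat (\<lambda>x. 0)" using crat_nat[OF cpt_const[of 0]] by simp
lemma crat_1: "crat (\<lambda>x. 1)" using crat_nat[OF cpt_const[of 1]] by simp
lemma crat_numeral: "crat (\<lambda>x. numeral k)" using crat_nat[OF cpt_const[of "numeral k"]] by simp
lemma crat_add: assumes "crat f" "crat g" shows "crat (\<lambda>x. f x + g x)"
proof -
  obtain a b c where 1: "cpt a" "cpt b" "cpt c" "f = (\<lambda>x. (real (a x) - real (b x)) / real (Suc (c x)))" using assms(1) cratE by blast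
  obtain a' b' c' where 2: "cpt a'" "cpt b'" "cpt c'" "g = (\<lambda>x. (real (a' x) - real (b' x)) / real (Suc (c' x)))" using assms(2) cratE by blast
  show ?thesis
  proof (rule cratI)
    show "cpt (\<lambda>x. a x * Suc (c' x) + a' x * Suc (c x))" "cpt (\<lambda>x. b x * Suc (c' x) + b' x * Suc (c x))"
      "cpt (\<lambda>x. c x * c' x + c x + c' x)" by (intro cpt_basic 1 2)+
    fix x
    have "real (Suc (c x * c' x + c x + c' x)) = real (Suc (c x)) * real (Suc (c' x))" by (simp add: algebra_simps)
    moreover have "real (Suc (c x)) \<noteq> 0" "real (Suc (c' x)) \<noteq> 0" by auto
    ultimately show "f x + g x = (real (a x * Suc (c' x) + a' x * Suc (c x)) - real (b x * Suc (c' x) + b' x * Suc (c x))) / real (Suc (c x * c' x + c x + c' x))"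
      unfolding 1(4) 2(4) by (simp add: divide_simps del: of_nat_Suc) (simp add: algebra_simps)
  qed
qed

lemma crat_mult: assumes "crat f" "crat g" shows "crat (\<lambda>x. f x * g x)"
proof -
  obtain a b c where 1: "cpt a" "cpt b" "cpt c" "f = (\<lambda>x. (real (a x) - real (b x)) / real (Suc (c x)))" using assms(1) cratE by blast
  obtain a' b' c' where 2: "cpt a'" "cpt b'" "cpt c'" "g = (\<lambda>x. (real (a' x) - real (b' x)) / real (Suc (c' x)))" using assms(2) cratE by blast
  show ?thesis
  proof (rule cratI)
    show "cpt (\<lambda>x. a x * a' x + b x * b' x)" "cpt (\<lambda>x. a x * b' x + b x * a' x)"
      "cpt (\<lambda>x. c x * c' x + c x + c' x)" by (intro cpt_basic 1 2)+
    fix x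
    have "real (Suc (c x * c' x + c x + c' x)) = real (Suc (c x)) * real (Suc (c' x))" by (simp add: algebra_simps)
    moreover have "real (Suc (c x)) \<noteq> 0" "real (Suc (c' x)) \<noteq> 0" by auto
    ultimately show "f x * g x = (real (a x * a' x + b x * b' x) - real (a x * b' x + b x * a' x)) / real (Suc (c x * c' x + c x + c' x))"
      unfolding 1(4) 2(4) by (simp add: divide_simps del: of_nat_Suc) (simp add: algebra_simps)
  qed
qed

lemma crat_minus: assumes "crat f" shows "crat (\<lambda>x. - f x)"
proof -
  obtain a b c where 1: "cpt a" "cpt b" "cpt c" "f = (\<lambda>x. (real (a x) - real (b x)) / real (Suc (c x)))" using assms(1) cratE by blast
  show ?thesis by (rule cratI[OF 1(2,1,3)]) (simp add: 1(4) minus_divide_left)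
qed

lemma crat_diff: "crat f \<Longrightarrow> crat g \<Longrightarrow> crat (\<lambda>x. f x - g x)"
  using crat_add[OF _ crat_minus] by simp

lemma crat_inv_pow: assumes "cpt n" shows "crat (\<lambda>x. 1 / 2 ^ n x)"
proof (rule cratI[OF cpt_const[of 1] cpt_const[of 0]])
  show "cpt (\<lambda>x. 2 ^ n x - 1 :: nat)" by (intro cpt_basic assms)
  show "1 / 2 ^ n x = (real 1 - real 0) / real (Suc (2 ^ n x - 1))" for x
  proof -
    have "Suc (2 ^ n x - 1) = 2 ^ n x" by simp
    then show ?thesis by simp
  qed
qed

lemma crat_div_pow: "crat f \<Longrightarrow> cpt n \<Longrightarrow> crat (\<lambda>x. f x / 2 ^ n x)"
  using crat_mult[OF _ crat_inv_pow, of f n] by simp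

lemma crat_pow: "cpt n \<Longrightarrow> crat (\<lambda>x. 2 ^ n x)"
  using crat_nat[OF cpt_power[OF cpt_const[of 2]]] by simp

lemma crat_div_Suc: assumes "crat f" "cpt n" shows "crat (\<lambda>x. f x / real (Suc (n x)))"
proof -
  have "crat (\<lambda>x. 1 / real (Suc (n x)))"
    by (rule cratI[of "\<lambda>_. 1" "\<lambda>_. 0" n]) (auto intro: cpt_const assms)
  from crat_mult[OF assms(1) this] show ?thesis by simp
qed

lemma crat_If: assumes "cpt P" "crat f" "crat g" shows "crat (\<lambda>x. if P x then f x else g x)"
proof -
  have "crat (\<lambda>x. real (if P x then 1 else 0) * f x + real (if P x then 0 else 1) * g x)"
    by (intro crat_add crat_mult crat_nat cpt_If cpt_const assms)
  moreover have "(\<lambda>x. real (if P x then 1 else 0) * f x + real (if P x then 0 else 1) * g x) = (\<lambda>x. if P x then f x else g x)" by auto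
  ultimately show ?thesis by simp
qed

lemma cpt_crat_le: assumes "crat f" "crat g" shows "cpt (\<lambda>x. f x \<le> g x)"
proof -
  obtain a b c where 1: "cpt a" "cpt b" "cpt c" "(\<lambda>x. g x - f x) = (\<lambda>x. (real (a x) - real (b x)) / real (Suc (c x)))"
    using cratE[OF crat_diff[OF assms(2,1)]] by blast
  have "f x \<le> g x \<longleftrightarrow> b x \<le> a x" for x
  proof -
    have e: "g x - f x = (real (a x) - real (b x)) / real (Suc (c x))" using fun_cong[OF 1(4), of x] .
    have "f x \<le> g x \<longleftrightarrow> 0 \<le> g x - f x" by simp
    also have "\<dots> \<longleftrightarrow> b x \<le> a x" unfolding e zero_le_divide_iff by auto
    finally show ?thesis .
  qed
  then show ?thesis using cpt_le[OF 1(2,1)] by simp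
qed

lemma cpt_crat_less: assumes "crat f" "crat g" shows "cpt (\<lambda>x. f x < g x)"
  using cpt_not[OF cpt_crat_le[OF assms(2,1)]] by (simp only: not_le)

lemma cpt_crat_eq: assumes "crat f" "crat g" shows "cpt (\<lambda>x. f x = g x)"
  using cpt_conj[OF cpt_crat_le[OF assms] cpt_crat_le[OF assms(2,1)]] by (simp only: order_eq_iff)

lemma crat_sum_list:
  assumes "crat (\<lambda>p. F (fst p) (snd p))" "cpt l" shows "crat (\<lambda>x. \<Sum>y\<leftarrow>l x. F x y)"
proof -
  obtain a b c where 1: "cpt a" "cpt b" "cpt c" "(\<lambda>p. F (fst p) (snd p)) = (\<lambda>x. (real (a x) - real (b x)) / real (Suc (c x)))"
    using cratE[OF assms(1)] by blast
  have F: "F x y = (real (a (x,y)) - real (b (x,y))) / real (Suc (c (x,y)))" for x y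
    using fun_cong[OF 1(4), of "(x,y)"] by simp
  \<comment> \<open>The accumulator holds positive part, negative part and denominator minus one of
    the partial sum; fractions are never reduced.\<close>
  define st where "st x y s = (fst s * Suc (c (x, y)) + a (x,y) * Suc (snd (snd s)),
      fst (snd s) * Suc (c (x,y)) + b (x,y) * Suc (snd (snd s)), snd (snd s) * c (x,y) + snd (snd s) + c (x,y))" for x y s
  define val where "val s = (real (fst s) - real (fst (snd s))) / real (Suc (snd (snd s)))" for s :: "nat \<times> nat \<times> nat"
  have val: "val (st x y s) = F x y + val s" for x y s
  proof -
    let ?d = "snd (snd s)" and ?c = "c (x,y)"
    have e: "real (Suc (?d * ?c + ?d + ?c)) = real (Suc ?c) * real (Suc ?d)" by (simp add: algebra_simps)
    have "real (Suc ?c) \<noteq> 0" "real (Suc ?d) \<noteq> 0" by auto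
    then show ?thesis unfolding val_def st_def F fst_conv snd_conv e
      by (simp add: divide_simps del: of_nat_Suc) (simp add: algebra_simps)
  qed
  have *: "val (foldr (st x) xs (0,0,0)) = (\<Sum>y\<leftarrow>xs. F x y)" for x xs
    by (induction xs) (auto simp: val, simp add: val_def)
  have cst: "cpt (\<lambda>x. foldr (\<lambda>y acc. st x y acc) (l x) (0,0,0))"
    unfolding st_def
    by (intro cpt_foldr cpt_basic assms cpt_comp[OF 1(1)] cpt_comp[OF 1(2)] cpt_comp[OF 1(3)])
  show ?thesis
    by (rule cratI[OF cpt_fst[OF cst] cpt_fst[OF cpt_snd[OF cst]] cpt_snd[OF cpt_snd[OF cst]]])
      (simp add: *[symmetric] val_def)
qed

lemma crat_sum_less:
  assumes "crat (\<lambda>p. F (fst p) (snd p :: nat))" "cpt n" shows "crat (\<lambda>x. \<Sum>i<n x. F x i)"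
proof -
  have "(\<Sum>i\<leftarrow>[0..<k]. F x i) = (\<Sum>i<k. F x i)" for x k by (induction k) auto
  with crat_sum_list[OF assms(1) cpt_upt[OF assms(2)]] show ?thesis by (simp only:)
qed

lemmas crat_intros = crat_nat crat_0 crat_1 crat_numeral crat_add crat_mult crat_minus crat_diff
  crat_inv_pow crat_div_pow crat_pow crat_div_Suc crat_If crat_sum_list crat_sum_less
lemmas cpt_crat = cpt_crat_le cpt_crat_less cpt_crat_eq

section \<open>Bijective codings and c.e. predicates\<close>

class codb = cod +
  assumes enc_dec [simp]: "enc (dec n :: 'a) = n"

instance nat :: codb by standard (simp add: enc_nat_def dec_nat_def)
instance prod :: (codb, codb) codb
proof
  show "enc (dec n :: 'a \<times> 'b) = n" for n
    unfolding enc_prod_def dec_prod_def fst_conv snd_conv enc_dec prod.collapse by (rule prod_decode_inverse)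
qed
instance list :: (codb) codb by standard (simp add: enc_list_def dec_list_def comp_def)

text \<open>In \<open>codb\<close> decoding is free: \<open>enc (dec n) = n\<close>, so the program
  for \<open>f\<close> already computes its decoded value.\<close>

lemma cpt_dec: "cpt f \<Longrightarrow> cpt (\<lambda>x. dec (f x) :: 'a::codb)"
  unfolding cpt_def by (simp add: enc_nat_def)

definition ce :: "('a::cod \<Rightarrow> bool) \<Rightarrow> bool" where
  "ce P \<longleftrightarrow> (\<exists>Q. cpt Q \<and> (\<forall>x. P x \<longleftrightarrow> (\<exists>n::nat. Q (x, n))))"

lemma ceI: "cpt (\<lambda>p. Q (fst p) (snd p)) \<Longrightarrow> (\<And>x. P x \<longleftrightarrow> (\<exists>n::nat. Q x n)) \<Longrightarrow> ce P"
  unfolding ce_def by (intro exI[of _ "\<lambda>p. Q (fst p) (snd p)"]) simp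

lemma ce_cpt: "cpt P \<Longrightarrow> ce P"
  by (rule ceI[of "\<lambda>x n. P x"]) (auto intro: cpt_comp[OF _ cpt_fst0])

lemma ce_ex:
  assumes "ce (\<lambda>p. P (fst p) (snd p))" shows "ce (\<lambda>x. \<exists>y::'b::codb. P x y)"
proof -
  obtain Q where Q: "cpt Q" "\<And>x y. P x y \<longleftrightarrow> (\<exists>n::nat. Q ((x, y), n))"
    using assms unfolding ce_def by (metis fst_conv snd_conv)
  show ?thesis
  proof (rule ceI[of "\<lambda>x m. Q ((x, fst (dec m :: 'b \<times> nat)), snd (dec m :: 'b \<times> nat))"])
    show "cpt (\<lambda>p. Q ((fst p, fst (dec (snd p) :: 'b \<times> nat)), snd (dec (snd p) :: 'b \<times> nat)))"
      by (intro cpt_comp[OF Q(1)] cpt_Pair cpt_fst cpt_snd cpt_dec cpt_id)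
    show "(\<exists>y. P x y) = (\<exists>n. Q ((x, fst (dec n :: 'b \<times> nat)), snd (dec n :: 'b \<times> nat)))" for x
      unfolding Q(2) by (metis dec_enc fst_conv snd_conv)
  qed
qed

lemma ce_comp: assumes "ce P" "cpt f" shows "ce (\<lambda>x. P (f x))"
proof -
  obtain Q where Q: "cpt Q" "\<And>x. P x \<longleftrightarrow> (\<exists>n::nat. Q (x, n))" using assms unfolding ce_def by blast
  show ?thesis
    by (rule ceI[of "\<lambda>x n. Q (f x, n)"])
      (intro cpt_comp[OF Q(1)] cpt_Pair cpt_comp[OF assms(2)] cpt_fst cpt_snd cpt_id, rule Q(2))
qed

lemma ce_conj: assumes "ce P" "ce Q" shows "ce (\<lambda>x. P x \<and> Q x)"
proof -
  obtain P' Q' where "cpt P'" "\<And>x. P x \<longleftrightarrow> (\<exists>n::nat. P' (x, n))" "cpt Q'" "\<And>x. Q x \<longleftrightarrow> (\<exists>n::nat. Q' (x, n))"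
    using assms unfolding ce_def by blast
  note * = this
  have "ce (\<lambda>x. \<exists>n m::nat. P' (x, n) \<and> Q' (x, m))"
    by (intro ce_ex ce_cpt cpt_conj cpt_comp[OF *(1)] cpt_comp[OF *(3)] cpt_Pair cpt_fst cpt_snd cpt_id)
  then show ?thesis by (simp add: *)
qed

text \<open>The search for a value together with a witness succeeds because \<open>f\<close> is
  total, and any pair it finds carries the right value.\<close>

lemma cpt_ce_graph:
  assumes "ce (\<lambda>p. f (fst p) = snd p)" shows "cpt (f :: 'a::cod \<Rightarrow> 'b::codb)"
proof -
  obtain Q where Q: "cpt Q" "\<And>x y. f x = y \<longleftrightarrow> (\<exists>n::nat. Q ((x, y), n))"
    using assms unfolding ce_def by (metis fst_conv snd_conv)
  let ?R = "\<lambda>x m. Q ((x, fst (dec m :: 'b \<times> nat)), snd (dec m :: 'b \<times> nat))"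
  have ex: "\<exists>m. ?R x m" for x
  proof -
    obtain n where n: "Q ((x, f x), n)" using Q(2)[of x "f x"] by blast
    show ?thesis by (rule exI[of _ "enc (f x, n)"]) (simp only: dec_enc fst_conv snd_conv n)
  qed
  have 1: "cpt (\<lambda>x. fst (dec (LEAST m. ?R x m) :: 'b \<times> nat))"
    by (intro cpt_fst cpt_dec cpt_Least0 ex cpt_comp[OF Q(1)] cpt_Pair cpt_snd cpt_id)
  have "?R x (LEAST m. ?R x m)" for x using ex by (rule LeastI_ex)
  then have "f x = fst (dec (LEAST m. ?R x m) :: 'b \<times> nat)" for x by (intro Q(2)[THEN iffD2] exI)
  then have "f = (\<lambda>x. fst (dec (LEAST m. ?R x m) :: 'b \<times> nat))" by (rule ext)
  with 1 show ?thesis by (simp only:)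
qed

section \<open>Strings\<close>

declare str_of.simps [simp del]

lemma code_snoc: "code (s @ [b]) = 2 * code s + 1 + (if b then 1 else 0)"
  by (simp add: code_def)

lemma str_of_code [simp]: "str_of (code s) = s"
proof (induction s rule: rev_induct)
  case Nil then show ?case by (simp add: code_def str_of.simps)
next
  case (snoc b s)
  have "str_of (code (s @ [b])) = str_of ((code (s @ [b]) - 1) div 2) @ [even (code (s @ [b]))]"
    by (subst str_of.simps) (simp add: code_snoc)
  also have "(code (s @ [b]) - 1) div 2 = code s" by (simp add: code_snoc)
  also have "even (code (s @ [b])) = b" by (simp add: code_snoc)
  finally show ?case using snoc by simp
qed

lemma code_str_of [simp]: "code (str_of n) = n"
proof (induction n rule: less_induct)
  case (less n)
  show ?case
  proof (cases "n = 0")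
    case False
    then have "code (str_of n) = 2 * ((n - 1) div 2) + 1 + (if even n then 1 else 0)"
      by (subst str_of.simps) (simp add: code_snoc less)
    then show ?thesis using False by (auto elim!: evenE oddE)
  qed (simp add: str_of.simps code_def)
qed

lemma code_inj [simp]: "code s = code t \<longleftrightarrow> s = t"
  by (metis str_of_code)

lemma cpt_code: "cpt f \<Longrightarrow> cpt (\<lambda>x. code (f x))"
  unfolding code_def by (intro cpt_foldl cpt_basic) auto

text \<open>The recursion of \<open>str_of\<close> is unrolled into steps that peel off one bit and
  stand still at 0; \<open>f x\<close> steps are more than enough.\<close>

lemma cpt_str_of: assumes "cpt f" shows "cpt (\<lambda>x. str_of (f x))"
proof -
  let ?st = "\<lambda>s. if fst s = 0 then s else ((fst s - 1) div 2, even (fst s) # snd s)"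
  have *: "n \<le> k \<Longrightarrow> snd ((?st ^^ k) (n, acc)) = str_of n @ acc" for n k and acc :: "bool list"
  proof (induction k arbitrary: n acc)
    case 0 then show ?case by (simp add: str_of.simps)
  next
    case (Suc k)
    have e: "(?st ^^ Suc k) (n, acc) = (?st ^^ k) (?st (n, acc))" by (simp only: funpow_Suc_right o_apply)
    show ?case
    proof (cases "n = 0")
      case True then show ?thesis unfolding e using Suc.IH[of 0 acc] by simp
    next
      case False
      then have "(n - 1) div 2 \<le> k" using Suc.prems by linarith
      from Suc.IH[OF this, of "even n # acc"] False show ?thesis unfolding e
        by (subst str_of.simps) simp
    qed
  qed
  have "cpt (\<lambda>x. snd ((?st ^^ f x) (f x, [])))"
    by (intro cpt_snd cpt_funpow cpt_basic assms cpt_Cons)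
  then show ?thesis by (simp only: * order_refl append_Nil2)
qed

text \<open>\<open>bool list\<close> is not of class \<open>codb\<close>; the bijection
  \<open>str_of\<close> provides the search through all strings.\<close>

lemma ce_ex_str:
  assumes "ce (\<lambda>p. P (fst p) (snd p))" shows "ce (\<lambda>x. \<exists>s::bool list. P x s)"
proof -
  have "ce (\<lambda>x. \<exists>n. P x (str_of n))"
    using ce_comp[OF assms, of "\<lambda>p. (fst p, str_of (snd p))"]
    by (intro ce_ex) (simp add: cpt_Pair cpt_fst cpt_str_of cpt_snd cpt_id)
  moreover have "(\<exists>n. P x (str_of n)) = (\<exists>s. P x s)" for x by (metis str_of_code)
  ultimately show ?thesis by simp
qed

section \<open>Coded derivations: a universal evaluator\<close>

fun rcode :: "recf \<Rightarrow> nat" where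
  "rcode Zr = enc (0::nat, 0::nat)"
| "rcode Sc = enc (1::nat, 0::nat)"
| "rcode (Pj i) = enc (2::nat, i)"
| "rcode Orc = enc (3::nat, 0::nat)"
| "rcode (Cn f gs) = enc (4::nat, enc (rcode f, map rcode gs))"
| "rcode (Pr f g) = enc (5::nat, enc (rcode f, rcode g))"
| "rcode (Mn f) = enc (6::nat, rcode f)"

type_synonym judg = "nat \<times> nat list \<times> nat"

text \<open>With \<open>(c, xs, v)\<close> read as the claim that the program coded by
  \<open>c\<close> returns \<open>v\<close> on \<open>xs\<close>, each disjunct mirrors one rule of
  \<open>evalr\<close> and looks up its premises in \<open>D\<close>. Queries beyond the end of
  \<open>W\<close> are refused, which makes the use of the oracle finite.\<close>

definition just :: "bool list \<Rightarrow> judg list \<Rightarrow> judg \<Rightarrow> bool" where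
  "just W D j = (let c = fst j; xs = fst (snd j); v = snd (snd j);
      t = fst (dec c :: nat \<times> nat); r = snd (dec c :: nat \<times> nat) in
    (t = 0 \<and> v = 0) \<or>
    (t = 1 \<and> xs \<noteq> [] \<and> v = Suc (hd xs)) \<or>
    (t = 2 \<and> r < length xs \<and> v = nthd 0 xs r) \<or>
    (t = 3 \<and> xs \<noteq> [] \<and> hd xs < length W \<and> v = (if nthd False W (hd xs) then 1 else 0)) \<or>
    (t = 4 \<and> (let f = fst (dec r :: nat \<times> nat list); gs = snd (dec r :: nat \<times> nat list) in
       list_ex (\<lambda>i. fst i = f \<and> snd (snd i) = v \<and> length (fst (snd i)) = length gs \<and>
          (\<forall>k<length gs. (nthd 0 gs k, xs, nthd 0 (fst (snd i)) k) \<in> set D)) D)) \<or>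
    (t = 5 \<and> xs \<noteq> [] \<and> (let f = fst (dec r :: nat \<times> nat); g = snd (dec r :: nat \<times> nat) in
       (hd xs = 0 \<and> (f, tl xs, v) \<in> set D) \<or>
       (hd xs \<noteq> 0 \<and> list_ex (\<lambda>i. fst i = c \<and> fst (snd i) = (hd xs - 1) # tl xs \<and>
          (g, snd (snd i) # (hd xs - 1) # tl xs, v) \<in> set D) D))) \<or>
    (t = 6 \<and> (r, v # xs, 0) \<in> set D \<and>
       (\<forall>z<v. list_ex (\<lambda>i. fst i = r \<and> fst (snd i) = z # xs \<and> snd (snd i) \<noteq> 0) D)))"

text \<open>The premises of a line stand behind it, so derivations can be put in front of one
  another freely.\<close>

fun valid :: "bool list \<Rightarrow> judg list \<Rightarrow> bool" where
  "valid W [] = True"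
| "valid W (j # D) = (just W D j \<and> valid W D)"

lemma cpt_just: "cpt W \<Longrightarrow> cpt D \<Longrightarrow> cpt j \<Longrightarrow> cpt (\<lambda>x. just (W x) (D x) (j x))"
proof -
  have "cpt (\<lambda>p. just (fst p) (fst (snd p)) (snd (snd p)))"
    unfolding just_def Let_def by (intro cpt_basic cpt_list cpt_dec)
  from cpt_comp[OF this cpt_Pair[OF _ cpt_Pair]] show "cpt W \<Longrightarrow> cpt D \<Longrightarrow> cpt j \<Longrightarrow> cpt (\<lambda>x. just (W x) (D x) (j x))" by simp
qed

text \<open>A bounded quantifier over suffixes replaces the recursion, to make validity visibly
  computable.\<close>

lemma valid_alt: "valid W D \<longleftrightarrow> (\<forall>i<length D. just W (drop (Suc i) D) (nthd (0,[],0) D i))"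
  by (induction D) (auto simp: nthd_simp less_Suc_eq_0_disj all_conj_distrib nth_Cons split: nat.splits)

lemma cpt_valid: "cpt W \<Longrightarrow> cpt D \<Longrightarrow> cpt (\<lambda>x. valid (W x) (D x))"
proof -
  have "cpt (\<lambda>p. valid (fst p) (snd p))"
    unfolding valid_alt by (intro cpt_basic cpt_list cpt_just)
  from cpt_comp2[OF this] show "cpt W \<Longrightarrow> cpt D \<Longrightarrow> cpt (\<lambda>x. valid (W x) (D x))" .
qed

text \<open>Premises occur only positively, and \<open>W\<close> is read only below its length; more
  lines and a longer prefix do no harm.\<close>

lemma just_mono:
  assumes "just W D j" "set D \<subseteq> set D'" "length W \<le> length W'" "\<forall>i<length W. W' ! i = W ! i"
  shows "just W' D' j"
proof -
  have ex: "list_ex P D \<Longrightarrow> (\<And>i. P i \<Longrightarrow> Q i) \<Longrightarrow> list_ex Q D'" for P Q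
  proof -
    assume "list_ex P D" "\<And>i. P i \<Longrightarrow> Q i"
    then obtain i where "i \<in> set D" "Q i" unfolding list_ex_iff by blast
    then show "list_ex Q D'" unfolding list_ex_iff using assms(2) by blast
  qed
  have W: "nthd False W' k = nthd False W k" if "k < length W" for k
    using that assms(3,4) by (auto simp: nthd_simp)
  show ?thesis
    using assms(1) unfolding just_def Let_def
    apply (elim disjE conjE)
            apply (simp_all add: W)
    subgoal using assms(3) by simp
    subgoal by (erule ex) (use assms(2) in blast)
    subgoal using assms(2) by blast
    subgoal by (erule ex) (use assms(2) in blast)
    subgoal
      apply (intro conjI)
      using assms(2) apply blast
      apply (intro allI impI)
      apply (drule spec, drule (1) mp, erule ex)
      apply simp
      done
    done
qed

lemma valid_append: "valid W D1 \<Longrightarrow> valid W D2 \<Longrightarrow> valid W (D1 @ D2)"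
  by (induction D1) (auto intro: just_mono)

lemma valid_mono: "valid W D \<Longrightarrow> length W \<le> length W' \<Longrightarrow> \<forall>i<length W. W' ! i = W ! i \<Longrightarrow> valid W' D"
  by (induction D) (auto intro: just_mono)

definition agr :: "(nat \<Rightarrow> nat) \<Rightarrow> bool list \<Rightarrow> bool" where
  "agr orc W \<longleftrightarrow> (\<forall>i<length W. orc i = (if W ! i then 1 else 0))"

lemma valid_sound:
  assumes "agr orc W" "valid W D" "(rcode p, xs, v) \<in> set D"
  shows "evalr orc p xs v"
  using assms(2,3)
proof (induction D arbitrary: p xs v)
  case (Cons j D)
  then have IH: "\<And>p xs v. (rcode p, xs, v) \<in> set D \<Longrightarrow> evalr orc p xs v" and j: "just W D j" by auto
  show ?case
  proof (cases "(rcode p, xs, v) \<in> set D")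
    case True then show ?thesis by (rule IH)
  next
    case False
    then have "j = (rcode p, xs, v)" using Cons.prems by auto
    with j have J: "just W D (rcode p, xs, v)" by simp
    show ?thesis
    proof (cases p)
      case Zr then show ?thesis using J by (auto simp: just_def intro: ev_Zr)
    next
      case Sc then show ?thesis using J by (cases xs) (auto simp: just_def intro: ev_Sc)
    next
      case (Pj i) then show ?thesis using J by (auto simp: just_def nthd_simp intro: ev_Pj)
    next
      case Orc then show ?thesis using J assms(1) ev_Orc[of orc "hd xs" "tl xs"]
        by (cases xs) (auto simp: just_def nthd_simp agr_def)
    next
      case (Cn f gs)
      have "\<exists>i\<in>set D. fst i = rcode f \<and> snd (snd i) = v \<and> length (fst (snd i)) = length gs \<and>
          (\<forall>k<length gs. (nthd 0 (map rcode gs) k, xs, nthd 0 (fst (snd i)) k) \<in> set D)"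
        using J unfolding Cn by (simp add: just_def list_ex_iff)
      then obtain i where i: "i \<in> set D" "fst i = rcode f" "snd (snd i) = v" "length (fst (snd i)) = length gs"
          "\<And>k. k < length gs \<Longrightarrow> (nthd 0 (map rcode gs) k, xs, nthd 0 (fst (snd i)) k) \<in> set D" by blast
      define ys where "ys = fst (snd i)"
      have ys: "(rcode f, ys, v) \<in> set D" "length ys = length gs"
        using i unfolding ys_def by (metis prod.collapse, simp)
      have ys3: "(rcode (gs ! k), xs, ys ! k) \<in> set D" if "k < length gs" for k
        using i(5)[OF that] i(4) that by (simp add: nthd_simp ys_def)
      note ys = ys ys3
      have "list_all2 (\<lambda>g y. evalr orc g xs y) gs ys"
        unfolding list_all2_conv_all_nth using ys IH by auto
      then show ?thesis unfolding Cn using IH[OF ys(1)] by (rule ev_Cn)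
    next
      case (Pr f g)
      have xs: "xs = hd xs # tl xs" using J Pr by (auto simp: just_def)
      show ?thesis
      proof (cases "hd xs")
        case 0
        then have "(rcode f, tl xs, v) \<in> set D" using J Pr by (auto simp: just_def)
        from ev_Pr0[OF IH[OF this]] show ?thesis using 0 xs Pr by metis
      next
        case (Suc n)
        then have "\<exists>i\<in>set D. fst i = rcode (Pr f g) \<and> fst (snd i) = n # tl xs \<and> (rcode g, snd (snd i) # n # tl xs, v) \<in> set D"
          using J unfolding Pr by (simp add: just_def list_ex_iff)
        then obtain i where i: "i \<in> set D" "fst i = rcode (Pr f g)" "fst (snd i) = n # tl xs" "(rcode g, snd (snd i) # n # tl xs, v) \<in> set D" by blast
        then have "(rcode (Pr f g), n # tl xs, snd (snd i)) \<in> set D" by (metis prod.collapse)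
        from ev_PrS[OF IH[OF this] IH[OF i(4)]] show ?thesis using Suc xs Pr by metis
      qed
    next
      case (Mn f)
      have m0: "(rcode f, v # xs, 0) \<in> set D"
        and m1: "\<forall>z<v. \<exists>i\<in>set D. fst i = rcode f \<and> fst (snd i) = z # xs \<and> snd (snd i) \<noteq> 0"
        using J unfolding Mn by (simp_all add: just_def list_ex_iff Let_def)
      have m2: "\<exists>u. (rcode f, z # xs, u) \<in> set D \<and> u \<noteq> 0" if "z < v" for z
      proof -
        obtain i where "i \<in> set D" "fst i = rcode f" "fst (snd i) = z # xs" "snd (snd i) \<noteq> 0" using m1 \<open>z < v\<close> by blast
        then show ?thesis by (intro exI[of _ "snd (snd i)"]) (metis prod.collapse)
      qed
      note m = m0 m2
      show ?thesis unfolding Mn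
      proof (rule ev_Mn)
        show "evalr orc f (v # xs) 0" using m(1) by (rule IH)
        show "\<forall>z<v. \<exists>v. v \<noteq> 0 \<and> evalr orc f (z # xs) v" using m(2) IH by blast
      qed
    qed
  qed
qed simp

definition der :: "bool list \<Rightarrow> nat \<Rightarrow> nat list \<Rightarrow> nat \<Rightarrow> bool" where
  "der W e xs v \<longleftrightarrow> (\<exists>D. valid W D \<and> (e, xs, v) \<in> set D)"

definition opre :: "(nat \<Rightarrow> nat) \<Rightarrow> nat \<Rightarrow> bool list" where
  "opre orc l = map (\<lambda>i. orc i = 1) [0..<l]"

definition derj :: "(nat \<Rightarrow> nat) \<Rightarrow> judg \<Rightarrow> bool" where
  "derj orc j \<longleftrightarrow> (\<exists>l. der (opre orc l) (fst j) (fst (snd j)) (snd (snd j)))"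

lemma derj_finite:
  assumes "finite J" "\<forall>j\<in>J. derj orc j"
  shows "\<exists>l D. valid (opre orc l) D \<and> J \<subseteq> set D"
  using assms
proof (induction J)
  case empty show ?case by (rule exI[of _ 0], rule exI[of _ "[]"]) simp
next
  case (insert j J)
  then obtain l D where 1: "valid (opre orc l) D" "J \<subseteq> set D" by auto
  obtain l' D' where 2: "valid (opre orc l') D'" "j \<in> set D'"
    using insert.prems unfolding der_def derj_def by auto
  have "valid (opre orc (max l l')) (D @ D')"
    by (intro valid_append valid_mono[OF 1(1)] valid_mono[OF 2(1)]) (auto simp: opre_def)
  moreover have "insert j J \<subseteq> set (D @ D')" using 1 2 by auto
  ultimately show ?case by blast
qed

text \<open>Derivations of finitely many premises, over oracle prefixes of different lengths, are
  concatenated over the longest prefix; the new line goes on top.\<close>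

lemma derj_just:
  assumes "finite J" "\<forall>j\<in>J. derj orc j" "\<And>D. J \<subseteq> set D \<Longrightarrow> just (opre orc l') D j"
  shows "derj orc j"
proof -
  obtain l D where 1: "valid (opre orc l) D" "J \<subseteq> set D" using derj_finite[OF assms(1,2)] by blast
  have 2: "just (opre orc l') D j" using assms(3)[OF 1(2)] .
  have "valid (opre orc (max l l')) (j # D)"
    using just_mono[OF 2, of D "opre orc (max l l')"] valid_mono[OF 1(1), of "opre orc (max l l')"]
    by (auto simp: opre_def)
  then have "der (opre orc (max l l')) (fst j) (fst (snd j)) (snd (snd j))"
    unfolding der_def prod.collapse by (meson list.set_intros(1))
  then show ?thesis unfolding derj_def ..
qed

lemma derj_complete:
  assumes "\<And>x. orc x = 0 \<or> orc x = 1" "evalr orc p xs v"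
  shows "derj orc (rcode p, xs, v)"
  using assms(2)
proof (induction rule: evalr.induct)
  case (ev_Zr xs) show ?case by (rule derj_just[of "{}"]) (simp_all add: just_def)
next
  case (ev_Sc x xs) show ?case by (rule derj_just[of "{}"]) (simp_all add: just_def)
next
  case (ev_Pj i xs) show ?case by (rule derj_just[of "{}"]) (simp_all add: just_def nthd_simp ev_Pj.hyps)
next
  case (ev_Orc x xs)
  have n: "nthd False (opre orc (Suc x)) x = (orc x = 1)" "length (opre orc (Suc x)) = Suc x"
    by (simp_all add: nthd_simp opre_def nth_append)
  have o: "orc x = (if orc x = 1 then 1 else 0)" using assms(1)[of x] by auto
  show ?case
  proof (rule derj_just[of "{}" _ "Suc x"])
    show "just (opre orc (Suc x)) D (rcode Orc, x # xs, orc x)" for D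
      unfolding just_def Let_def using o n by simp
  qed simp_all
next
  case (ev_Cn xs gs ys f z)
  let ?J = "insert (rcode f, ys, z) {(rcode (gs ! k), xs, ys ! k) |k. k < length gs}"
  have len: "length gs = length ys" using ev_Cn.IH(1) by (rule list_all2_lengthD)
  show ?case
  proof (rule derj_just[of ?J _ 0])
    show "finite ?J" by simp
    have "derj orc (rcode (gs ! k), xs, ys ! k)" if "k < length gs" for k
      using list_all2_nthD[OF ev_Cn.IH(1) that] by (rule conjunct2)
    then show "\<forall>j\<in>?J. derj orc j" using ev_Cn.IH(2) by auto
    show "just (opre orc 0) D (rcode (Cn f gs), xs, z)" if "?J \<subseteq> set D" for D
    proof -
      have "list_ex (\<lambda>i. fst i = rcode f \<and> snd (snd i) = z \<and> length (fst (snd i)) = length (map rcode gs) \<and>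
          (\<forall>k<length (map rcode gs). (nthd 0 (map rcode gs) k, xs, nthd 0 (fst (snd i)) k) \<in> set D)) D"
        unfolding list_ex_iff using that len by (intro bexI[of _ "(rcode f, ys, z)"]) (auto simp: nthd_simp)
      then show ?thesis by (simp add: just_def)
    qed
  qed
next
  case (ev_Pr0 f xs z g)
  show ?case
    by (rule derj_just[of "{(rcode f, xs, z)}"]) (simp_all add: just_def ev_Pr0.IH)
next
  case (ev_PrS f g n xs y z)
  show ?case
  proof (rule derj_just[of "{(rcode (Pr f g), n # xs, y), (rcode g, y # n # xs, z)}" _ 0])
    show "\<forall>j\<in>{(rcode (Pr f g), n # xs, y), (rcode g, y # n # xs, z)}. derj orc j"
      using ev_PrS.IH by simp
    fix D assume D: "{(rcode (Pr f g), n # xs, y), (rcode g, y # n # xs, z)} \<subseteq> set D"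
    have "list_ex (\<lambda>i. fst i = rcode (Pr f g) \<and> fst (snd i) = n # xs \<and> (rcode g, snd (snd i) # n # xs, z) \<in> set D) D"
      unfolding list_ex_iff by (rule bexI[of _ "(rcode (Pr f g), n # xs, y)"]) (use D in auto)
    then show "just (opre orc 0) D (rcode (Pr f g), Suc n # xs, z)" by (simp add: just_def)
  qed simp
next
  case (ev_Mn f y xs)
  have "\<forall>z. \<exists>v. z < y \<longrightarrow> v \<noteq> 0 \<and> derj orc (rcode f, z # xs, v)" using ev_Mn.IH(2) by blast
  then obtain u where u: "\<forall>z. z < y \<longrightarrow> u z \<noteq> 0 \<and> derj orc (rcode f, z # xs, u z)"
    by (rule choice[THEN exE])
  let ?J = "insert (rcode f, y # xs, 0) ((\<lambda>z. (rcode f, z # xs, u z)) ` {..<y})"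
  show ?case
  proof (rule derj_just[of ?J _ 0])
    show "\<forall>j\<in>?J. derj orc j" using u ev_Mn.IH(1) by simp
    fix D assume D: "?J \<subseteq> set D"
    have "list_ex (\<lambda>i. fst i = rcode f \<and> fst (snd i) = z # xs \<and> snd (snd i) \<noteq> 0) D" if "z < y" for z
      unfolding list_ex_iff by (rule bexI[of _ "(rcode f, z # xs, u z)"]) (use D that u in auto)
    moreover have "(rcode f, y # xs, 0) \<in> set D" using D by simp
    ultimately show "just (opre orc 0) D (rcode (Mn f), xs, y)" by (simp add: just_def)
  qed simp
qed

lemma der_complete:
  assumes "\<And>x. orc x = 0 \<or> orc x = 1" "evalr orc p xs v"
  shows "\<exists>l. der (opre orc l) (rcode p) xs v"
  using derj_complete[OF assms] unfolding derj_def by simp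

lemma evalr_iff_der:
  assumes "\<And>x. orc x = 0 \<or> orc x = 1"
  shows "evalr orc p xs v \<longleftrightarrow> (\<exists>l. der (opre orc l) (rcode p) xs v)"
proof
  assume "\<exists>l. der (opre orc l) (rcode p) xs v"
  then obtain l D where D: "valid (opre orc l) D" "(rcode p, xs, v) \<in> set D" unfolding der_def by blast
  have "agr orc (opre orc l)" unfolding agr_def opre_def using assms by auto
  from valid_sound[OF this D] show "evalr orc p xs v" .
qed (rule der_complete[OF assms])

inductive_cases evZr: "evalr orc Zr xs v"
inductive_cases evSc: "evalr orc Sc xs v"
inductive_cases evPj: "evalr orc (Pj i) xs v"
inductive_cases evOrc: "evalr orc Orc xs v"
inductive_cases evCn: "evalr orc (Cn f gs) xs v"
inductive_cases evPr0: "evalr orc (Pr f g) (0 # xs) v"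
inductive_cases evPrS: "evalr orc (Pr f g) (Suc n # xs) v"
inductive_cases evMn: "evalr orc (Mn f) xs v"

lemma evalr_det: "evalr orc p xs v \<Longrightarrow> evalr orc p xs v' \<Longrightarrow> v = v'"
proof (induction arbitrary: v' rule: evalr.induct)
  case ev_Zr then show ?case by (rule evZr) simp
next
  case ev_Sc from ev_Sc.prems show ?case by (rule evSc) simp
next
  case ev_Pj from ev_Pj.prems show ?case by (rule evPj) simp
next
  case ev_Orc from ev_Orc.prems show ?case by (rule evOrc) simp
next
  case (ev_Pr0 f xs z g) from ev_Pr0.prems show ?case by (rule evPr0) (rule ev_Pr0.IH)
next
  case (ev_PrS f g n xs y z)
  from ev_PrS.prems obtain y' where "evalr orc (Pr f g) (n # xs) y'" "evalr orc g (y' # n # xs) v'"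
    by (rule evPrS)
  then show ?case using ev_PrS.IH(1)[of y'] ev_PrS.IH(2)[of v'] by simp
next
  case (ev_Cn xs gs ys f z)
  from ev_Cn.prems obtain ys' where *: "list_all2 (\<lambda>g y. evalr orc g xs y) gs ys'" "evalr orc f ys' v'"
    by (rule evCn)
  have "ys = ys'"
  proof (rule nth_equalityI)
    have l: "length gs = length ys" "length gs = length ys'"
      using list_all2_lengthD[OF ev_Cn.IH(1)] list_all2_lengthD[OF *(1)] by auto
    then show "length ys = length ys'" by simp
    fix i assume "i < length ys"
    then have i: "i < length gs" using l by simp
    show "ys ! i = ys' ! i" using list_all2_nthD[OF ev_Cn.IH(1) i] list_all2_nthD[OF *(1) i] by blast
  qed
  then show ?case using ev_Cn.IH(2)[of v'] *(2) by simp
next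
  case (ev_Mn f y xs)
  from ev_Mn.prems have *: "evalr orc f (v' # xs) 0" "\<forall>z<v'. \<exists>v. v \<noteq> 0 \<and> evalr orc f (z # xs) v"
    by (rule evMn, simp)+
  show ?case
  proof (rule linorder_cases[of y v'])
    assume "y < v'"
    then obtain u where "u \<noteq> 0" "evalr orc f (y # xs) u" using *(2) by blast
    then show ?thesis using ev_Mn.IH(1)[of u] by simp
  next
    assume "v' < y"
    then obtain u where "u \<noteq> 0" "\<And>w. evalr orc f (v' # xs) w \<Longrightarrow> u = w" using ev_Mn.IH(2) by blast
    then show ?thesis using *(1) by blast
  qed
qed

section \<open>Computability with and without an oracle, through the evaluator\<close>

lemma no_oracle_01: "no_oracle x = 0 \<or> no_oracle x = 1" by (simp add: no_oracle_def)
lemma seq_oracle_01: "seq_oracle Y x = 0 \<or> seq_oracle Y x = 1" by (simp add: seq_oracle_def)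
lemma opre_no_oracle: "opre no_oracle l = map (\<lambda>i. False) [0..<l]" by (simp add: opre_def no_oracle_def)
lemma opre_seq_oracle: "opre (seq_oracle Y) l = map Y [0..<l]" by (simp add: opre_def seq_oracle_def)

lemma ce_der:
  assumes "cpt W" "cpt e" "cpt xs" "cpt v" shows "ce (\<lambda>x. der (W x) (e x) (xs x) (v x))"
  unfolding der_def
  by (intro ce_ex ce_cpt cpt_conj cpt_valid cpt_member cpt_Pair cpt_snd cpt_id
    cpt_comp[OF assms(1)] cpt_comp[OF assms(2)] cpt_comp[OF assms(3)] cpt_comp[OF assms(4)] cpt_fst)

definition univ :: "nat \<Rightarrow> nat list \<Rightarrow> nat \<Rightarrow> bool" where
  "univ e xs v \<longleftrightarrow> (\<exists>l. der (map (\<lambda>i. False) [0..<l]) e xs v)"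

lemma univ_rcode: "univ (rcode p) xs v \<longleftrightarrow> evalr no_oracle p xs v"
  unfolding univ_def evalr_iff_der[OF no_oracle_01] opre_no_oracle ..

lemma ce_univ: assumes "cpt e" "cpt xs" "cpt v" shows "ce (\<lambda>x. univ (e x) (xs x) (v x))"
  unfolding univ_def
  by (intro ce_ex ce_der cpt_basic cpt_list cpt_comp[OF assms(1)] cpt_comp[OF assms(2)] cpt_comp[OF assms(3)])

lemma ce_evalr: "cpt xs \<Longrightarrow> cpt v \<Longrightarrow> ce (\<lambda>x. evalr no_oracle p (xs x) (v x))"
  unfolding univ_rcode[symmetric] by (intro ce_univ cpt_const)

lemma computable1_cpt: assumes "computable1 f" shows "cpt f"
proof (rule cpt_ce_graph)
  obtain p where p: "\<And>x. evalr no_oracle p [x] (f x)" using assms unfolding computable1_def by blast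
  have "f x = y \<longleftrightarrow> evalr no_oracle p [x] y" for x y using p evalr_det by blast
  moreover have "ce (\<lambda>q. evalr no_oracle p [fst q] (snd q))"
    by (intro ce_evalr cpt_Cons cpt_fst cpt_snd cpt_id cpt_const)
  ultimately show "ce (\<lambda>p. f (fst p) = snd p)" by simp
qed

lemma computable2_cpt: assumes "computable2 g" shows "cpt (\<lambda>p. g (fst p) (snd p))"
proof (rule cpt_ce_graph)
  obtain p where p: "\<And>x y. evalr no_oracle p [x, y] (g x y)" using assms unfolding computable2_def by blast
  have "g x y = z \<longleftrightarrow> evalr no_oracle p [x, y] z" for x y z using p evalr_det by blast
  moreover have "ce (\<lambda>q. evalr no_oracle p [fst (fst q), snd (fst q)] (snd q))"
    by (intro ce_evalr cpt_Cons cpt_fst cpt_snd cpt_id cpt_const)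
  ultimately show "ce (\<lambda>p. g (fst (fst p)) (snd (fst p)) = snd p)" by simp
qed

lemma cpt_computable2: assumes "cpt (\<lambda>p. g (fst p) (snd p))" shows "computable2 g"
proof -
  obtain p where p: "\<And>orc x y. evalr orc p [prod_encode (x, y)] (g x y)"
    using assms unfolding cpt_def enc_prod_def enc_nat_def by (metis fst_conv snd_conv)
  obtain c where c: "\<And>orc a b. evalr orc c [a, b] (prod_encode (a, b))" using rc_enc_pair by blast
  have "evalr no_oracle (Cn p [c]) [x, y] (g x y)" for x y
    using p c by (intro ev_Cn[where ys="[prod_encode (x, y)]"]) auto
  then show ?thesis unfolding computable2_def by blast
qed

text \<open>The program searches for a coded pair of output and witness. Single-valuedness makes the
  output independent of which pair comes first, and without a pair the search diverges as it
  should.\<close>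

lemma ce_fun:
  assumes "ce (\<lambda>p. G (fst p) (snd p))" "\<And>n k k'. G n k \<Longrightarrow> G n k' \<Longrightarrow> k = k'"
  obtains p where "\<And>orc n k. evalr orc p [n] k \<longleftrightarrow> G n (k::nat)"
proof -
  obtain Q where Q: "cpt Q" "\<And>x y. G x y \<longleftrightarrow> (\<exists>n::nat. Q ((x::nat, y), n))"
    using assms(1) unfolding ce_def by (metis fst_conv snd_conv)
  let ?T = "\<lambda>m n. Q ((n, fst (dec m :: nat \<times> nat)), snd (dec m :: nat \<times> nat))"
  have "cpt (\<lambda>p. if ?T (fst p) (snd p) then 0 else 1 :: nat)"
    by (intro cpt_If cpt_const cpt_comp[OF Q(1)] cpt_Pair cpt_fst cpt_snd cpt_dec cpt_id)
  then obtain T where T: "\<And>orc m n. evalr orc T [prod_encode (m, n)] (if ?T m n then 0 else 1)"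
    unfolding cpt_def enc_prod_def enc_nat_def by (metis fst_conv snd_conv)
  have "cpt (\<lambda>m. fst (dec m :: nat \<times> nat))" by (intro cpt_fst cpt_dec cpt_id)
  then obtain F where F: "\<And>orc m. evalr orc F [m] (fst (dec m :: nat \<times> nat))"
    unfolding cpt_def enc_nat_def by metis
  obtain c where c: "\<And>orc a b. evalr orc c [a, b] (prod_encode (a, b))" using rc_enc_pair by blast
  have T': "evalr orc (Cn T [c]) [m, n] (if ?T m n then 0 else 1)" for orc m n
    using T c by (intro ev_Cn[where ys="[prod_encode (m, n)]"]) auto
  let ?p = "Cn F [Mn (Cn T [c])]"
  have "evalr orc ?p [n] k \<longleftrightarrow> G n k" for orc n k
  proof
    assume "evalr orc ?p [n] k"
    then obtain ys where ys: "list_all2 (\<lambda>g y. evalr orc g [n] y) [Mn (Cn T [c])] ys" "evalr orc F ys k" by (rule evCn)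
    then obtain m where m: "ys = [m]" "evalr orc (Mn (Cn T [c])) [n] m" by (auto simp: list_all2_Cons1)
    have "evalr orc (Cn T [c]) [m, n] 0" using m(2) by (auto elim: evMn)
    with T'[of orc m n] have "?T m n" by (metis evalr_det zero_neq_one)
    moreover have "k = fst (dec m :: nat \<times> nat)" using ys(2) F m(1) evalr_det by blast
    ultimately show "G n k" unfolding Q(2) by blast
  next
    assume "G n k"
    then obtain j where "Q ((n, k), j)" using Q(2) by blast
    then have ex: "\<exists>m. ?T m n" by (intro exI[of _ "enc (k, j)"]) (simp only: dec_enc fst_conv snd_conv)
    define m where "m = (LEAST m. ?T m n)"
    have Tm: "?T m n" unfolding m_def using ex by (rule LeastI_ex)
    have "evalr orc (Mn (Cn T [c])) [n] m"
    proof (rule ev_Mn)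
      show "evalr orc (Cn T [c]) [m, n] 0" using T'[of orc m n] Tm by simp
      show "\<forall>z<m. \<exists>v. v \<noteq> 0 \<and> evalr orc (Cn T [c]) [z, n] v"
      proof (intro allI impI)
        fix z assume "z < m"
        then have "\<not> ?T z n" unfolding m_def by (rule not_less_Least)
        then show "\<exists>v. v \<noteq> 0 \<and> evalr orc (Cn T [c]) [z, n] v" using T'[of orc z n] by (intro exI[of _ 1]) simp
      qed
    qed
    moreover have "fst (dec m :: nat \<times> nat) = k" using assms(2) \<open>G n k\<close> Tm Q(2) by blast
    ultimately show "evalr orc ?p [n] k" using F[of orc m] by (intro ev_Cn[where ys="[m]"]) auto
  qed
  then show ?thesis using that by blast
qed

text \<open>Brings a c.e. relation into the format of \<open>unif_ce_open\<close>, the halting of a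
  program with two arguments.\<close>

lemma ce_halt:
  assumes "ce (\<lambda>p. P (fst p) (snd p))"
  obtains p where "\<And>n k. P n k \<longleftrightarrow> (\<exists>v. evalr no_oracle p [n, k] v)"
proof -
  let ?G = "\<lambda>m v. P (fst (dec m :: nat \<times> nat)) (snd (dec m :: nat \<times> nat)) \<and> v = (0::nat)"
  have "ce (\<lambda>p. ?G (fst p) (snd p))"
    by (intro ce_conj[OF _ ce_cpt[OF cpt_eq[OF cpt_snd[OF cpt_id] cpt_const]]]
        ce_comp[OF assms, of "\<lambda>q. dec (fst q :: nat) :: nat \<times> nat"] cpt_dec cpt_fst cpt_id)
  then obtain q where q: "\<And>orc m v. evalr orc q [m] v \<longleftrightarrow> ?G m v" by (rule ce_fun) auto
  obtain c where c: "\<And>orc a b. evalr orc c [a, b] (prod_encode (a, b))" using rc_enc_pair by blast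
  have "P n k \<longleftrightarrow> (\<exists>v. evalr no_oracle (Cn q [c]) [n, k] v)" for n k
  proof
    assume "P n k"
    then have "evalr no_oracle q [prod_encode (n, k)] 0" unfolding q by (simp add: dec_prod_def dec_nat_def)
    then show "\<exists>v. evalr no_oracle (Cn q [c]) [n, k] v"
      using c by (intro exI ev_Cn[where ys="[prod_encode (n, k)]"]) auto
  next
    assume "\<exists>v. evalr no_oracle (Cn q [c]) [n, k] v"
    then obtain v ys where "list_all2 (\<lambda>g y. evalr no_oracle g [n, k] y) [c] ys" "evalr no_oracle q ys v"
      by (auto elim: evCn)
    moreover then have "ys = [prod_encode (n, k)]" using c evalr_det by (fastforce simp: list_all2_Cons1)
    ultimately show "P n k" unfolding q by (simp add: q dec_prod_def dec_nat_def)
  qed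
  then show ?thesis using that by blast
qed

text \<open>A criterion that spares writing oracle programs: the machine searches for a prefix of
  \<open>Y\<close> and a number \<open>n\<close> that the decidable \<open>Q\<close> accepts, and
  then answers by \<open>B\<close>. Soundness is asked for true prefixes of \<open>Y\<close>
  only.\<close>

lemma turing_leI:
  assumes Q: "cpt (\<lambda>p. Q (fst p) (snd p))"
    and ex: "\<And>x. \<exists>l n. Q (x, map Y [0..<l]) n"
    and sound: "\<And>x l n. Q (x, map Y [0..<l]) n \<Longrightarrow> (x \<in> A) = B x n"
    and B: "cpt (\<lambda>p. B (fst p) (snd p :: nat))"
  shows "turing_le A Y"
proof -
  let ?T = "\<lambda>m x Z. Q (x, rev Z) (snd (dec m :: nat \<times> nat))"
  have "cpt (\<lambda>p. if ?T (fst p) (fst (snd p)) (snd (snd p)) then 0 else 1 :: nat)"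
    by (intro cpt_If cpt_const cpt_comp2[OF Q] cpt_Pair cpt_rev cpt_fst cpt_snd cpt_dec cpt_id)
  then obtain T where T0: "\<And>orc q. evalr orc T [enc q] (if ?T (fst q) (fst (snd q)) (snd (snd q)) then 0 else (1::nat))"
    unfolding cpt_def enc_nat_def by blast
  have T: "evalr orc T [prod_encode (m, prod_encode (x, enc Z))] (if ?T m x Z then 0 else 1)" for orc m x Z
    using T0[of orc "(m, x, Z)"] by (simp add: enc_prod_def enc_nat_def)
  have "cpt (\<lambda>m. fst (dec m :: nat \<times> nat))" by (intro cpt_fst cpt_dec cpt_id)
  then obtain L where L: "\<And>orc m. evalr orc L [m] (fst (dec m :: nat \<times> nat))"
    unfolding cpt_def enc_nat_def by metis
  have "cpt (\<lambda>p. if B (fst p) (snd (dec (snd p) :: nat \<times> nat)) then 1 else 0 :: nat)"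
    by (intro cpt_If cpt_const cpt_comp2[OF B] cpt_fst cpt_snd cpt_dec cpt_id)
  then obtain F where F: "\<And>orc m x. evalr orc F [prod_encode (x, m)] (if B x (snd (dec m :: nat \<times> nat)) then 1 else 0)"
    unfolding cpt_def enc_prod_def enc_nat_def by (metis fst_conv snd_conv)
  obtain c where c: "\<And>orc a b. evalr orc c [a, b] (prod_encode (a, b))" using rc_enc_pair by blast
  let ?o = "seq_oracle Y"
  \<comment> \<open>\<open>Suc\<close> of a pair is the code of a cons, so this step puts the oracle
    bit \<open>Y n\<close> in front of the coded list. The prefix is built backwards, hence the
    \<open>rev\<close> in \<open>?T\<close>.\<close>
  define S where "S = Cn Sc [Cn c [Cn Orc [Pj 1], Pj 0]]"
  have S: "evalr ?o S [enc Z, n] (enc (Y n # Z))" for Z n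
  proof -
    have "evalr ?o (Cn Orc [Pj 1]) [enc Z, n] (enc (Y n))"
      using ev_Orc[of ?o n "[]"] ev_Pj[of 1 "[enc Z, n]"]
      by (intro ev_Cn[where ys="[n]"]) (auto simp: seq_oracle_def enc_bool_def)
    then have "evalr ?o (Cn c [Cn Orc [Pj 1], Pj 0]) [enc Z, n] (prod_encode (enc (Y n), enc Z))"
      using c ev_Pj[of 0 "[enc Z, n]"] by (intro ev_Cn[where ys="[enc (Y n), enc Z]"]) auto
    then show ?thesis unfolding S_def
      by (intro ev_Cn[where ys="[prod_encode (enc (Y n), enc Z)]"]) (auto simp: enc_list_def intro: ev_Sc)
  qed
  have P: "evalr ?o (Pr Zr S) [l] (enc (rev (map Y [0..<l])))" for l
  proof (induction l)
    case 0 then show ?case by (auto intro!: ev_Pr0 simp: enc_list_def intro: ev_Zr)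
  next
    case (Suc l) then show ?case using ev_PrS[OF Suc S] by simp
  qed
  define M where "M = Cn T [Cn c [Pj 0, Cn c [Pj 1, Cn (Pr Zr S) [Cn L [Pj 0]]]]]"
  let ?R = "\<lambda>m x. Q (x, map Y [0..<fst (dec m :: nat \<times> nat)]) (snd (dec m :: nat \<times> nat))"
  have M: "evalr ?o M [m, x] (if ?R m x then 0 else 1)" for m x
  proof -
    let ?l = "fst (dec m :: nat \<times> nat)" let ?Z = "rev (map Y [0..<?l])"
    have "evalr ?o (Cn L [Pj 0]) [m, x] ?l"
      using L ev_Pj[of 0 "[m, x]"] by (intro ev_Cn[where ys="[m]"]) auto
    then have "evalr ?o (Cn (Pr Zr S) [Cn L [Pj 0]]) [m, x] (enc ?Z)"
      using P by (intro ev_Cn[where ys="[?l]"]) auto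
    then have "evalr ?o (Cn c [Pj 1, Cn (Pr Zr S) [Cn L [Pj 0]]]) [m, x] (prod_encode (x, enc ?Z))"
      using c ev_Pj[of 1 "[m, x]"] by (intro ev_Cn[where ys="[x, enc ?Z]"]) auto
    then have "evalr ?o (Cn c [Pj 0, Cn c [Pj 1, Cn (Pr Zr S) [Cn L [Pj 0]]]]) [m, x] (prod_encode (m, prod_encode (x, enc ?Z)))"
      using c ev_Pj[of 0 "[m, x]"] by (intro ev_Cn[where ys="[m, prod_encode (x, enc ?Z)]"]) auto
    then show ?thesis unfolding M_def
      using T[of ?o m x ?Z] by (intro ev_Cn[where ys="[prod_encode (m, prod_encode (x, enc ?Z))]"]) auto
  qed
  have "evalr ?o (Cn F [Cn c [Pj 0, Mn M]]) [x] (chi A x)" for x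
  proof -
    obtain l n where "Q (x, map Y [0..<l]) n" using ex by blast
    then have ex': "\<exists>m. ?R m x" by (intro exI[of _ "enc (l, n)"]) (simp only: dec_enc fst_conv snd_conv)
    define m where "m = (LEAST m. ?R m x)"
    have Rm: "?R m x" unfolding m_def using ex' by (rule LeastI_ex)
    have "evalr ?o (Mn M) [x] m"
    proof (rule ev_Mn)
      show "evalr ?o M [m, x] 0" using M[of m x] Rm by simp
      show "\<forall>z<m. \<exists>v. v \<noteq> 0 \<and> evalr ?o M [z, x] v"
      proof (intro allI impI)
        fix z assume "z < m"
        then have "\<not> ?R z x" unfolding m_def by (rule not_less_Least)
        then show "\<exists>v. v \<noteq> 0 \<and> evalr ?o M [z, x] v" using M[of z x] by (intro exI[of _ 1]) simp
      qed
    qed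
    then have 1: "evalr ?o (Cn c [Pj 0, Mn M]) [x] (prod_encode (x, m))"
      using c ev_Pj[of 0 "[x]"] by (intro ev_Cn[where ys="[x, m]"]) auto
    have "chi A x = (if B x (snd (dec m :: nat \<times> nat)) then 1 else 0)"
      unfolding chi_def using sound[OF Rm] by simp
    then show ?thesis using 1 F[of ?o x m] by (intro ev_Cn[where ys="[prod_encode (x, m)]"]) auto
  qed
  then show ?thesis unfolding turing_le_def by blast
qed

lemma ce_comp2:
  assumes "ce (\<lambda>p. Q (fst p) (snd p))" "cpt f" "cpt g" shows "ce (\<lambda>x. Q (f x) (g x))"
  using ce_comp[OF assms(1) cpt_Pair[OF assms(2,3)]] by simp

section \<open>Measure on Cantor space\<close>

interpretation cantor: product_prob_space "\<lambda>_::nat. measure_pmf (bernoulli_pmf (1/2))" UNIV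
  by unfold_locales

lemma prob_space_cantor: "prob_space cantor"
  unfolding cantor_def by (rule cantor.P.prob_space_axioms)

interpretation CP: prob_space cantor by (rule prob_space_cantor)

lemma space_cantor [simp]: "space cantor = UNIV"
  unfolding cantor_def by (auto simp: space_PiM)

text \<open>Bits may be fixed on any set of positions: pulling back along \<open>enumerate R\<close>
  and fixing bits off \<open>R\<close> both lead outside the sets \<open>cyl\<close>.\<close>

definition gcyl :: "nat set \<Rightarrow> (nat \<Rightarrow> bool) \<Rightarrow> (nat \<Rightarrow> bool) set" where
  "gcyl I a = {Z. \<forall>i\<in>I. Z i = a i}"

lemma gcyl_measure:
  assumes "finite I" shows "gcyl I a \<in> sets cantor" "mu (gcyl I a) = 1 / 2 ^ card I"
proof -
  let ?M = "\<lambda>_::nat. measure_pmf (bernoulli_pmf (1/2))"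
  have e: "gcyl I a = prod_emb UNIV ?M I (Pi\<^sub>E I (\<lambda>i. {a i}))"
    by (rule set_eqI) (simp add: gcyl_def prod_emb_iff PiE_iff)
  show "gcyl I a \<in> sets cantor"
    unfolding e cantor_def by (rule sets_PiM_I) (use assms in auto)
  have "measure (bernoulli_pmf (1/2)) {b} = 1 / 2" for b
    by (cases b) (simp_all add: measure_pmf_single)
  then have "(\<Prod>i\<in>I. measure (bernoulli_pmf (1/2)) {a i}) = (\<Prod>i\<in>I. 1 / 2)" by (intro prod.cong refl)
  also have "\<dots> = 1 / 2 ^ card I" by (simp add: power_divide)
  finally have "measure (PiM UNIV ?M) (prod_emb UNIV ?M I (Pi\<^sub>E I (\<lambda>i. {a i}))) = 1 / 2 ^ card I"
    by (subst cantor.measure_PiM_emb) (use assms in auto)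
  then show "mu (gcyl I a) = 1 / 2 ^ card I" unfolding e mu_def cantor_def .
qed

lemma cyl_gcyl: "cyl s = gcyl {..<length s} (\<lambda>i. s ! i)"
  unfolding cyl_def gcyl_def by (simp add: Ball_def)

lemma sets_cyl [measurable, simp]: "cyl s \<in> sets cantor" unfolding cyl_gcyl by (rule gcyl_measure) simp
lemma mu_cyl: "mu (cyl s) = 1 / 2 ^ length s" unfolding cyl_gcyl by (subst gcyl_measure) auto

definition ucyl :: "bool list set \<Rightarrow> (nat \<Rightarrow> bool) set" where
  "ucyl S = (\<Union>s\<in>S. cyl s)"

lemma sets_ucyl [simp]: "ucyl S \<in> sets cantor"
  unfolding ucyl_def by (rule sets.countable_UN') (auto intro: countableI_type)

lemma ucyl_mono: "S \<subseteq> T \<Longrightarrow> ucyl S \<subseteq> ucyl T" unfolding ucyl_def by blast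

lemma mu_mono: "A \<subseteq> B \<Longrightarrow> B \<in> sets cantor \<Longrightarrow> mu A \<le> mu B"
  unfolding mu_def by (rule CP.finite_measure_mono)

lemma mu_le_1: "mu A \<le> 1" unfolding mu_def by (rule CP.prob_le_1)
lemma mu_nonneg [simp]: "0 \<le> mu A" unfolding mu_def by (rule measure_nonneg)

lemma mu_Un_le: "A \<in> sets cantor \<Longrightarrow> B \<in> sets cantor \<Longrightarrow> mu (A \<union> B) \<le> mu A + mu B"
  unfolding mu_def by (rule measure_Un_le)

lemma mu_UN_le: "finite I \<Longrightarrow> (\<And>i. i \<in> I \<Longrightarrow> A i \<in> sets cantor) \<Longrightarrow> mu (\<Union>i\<in>I. A i) \<le> (\<Sum>i\<in>I. mu (A i))"
  unfolding mu_def by (rule CP.finite_measure_subadditive_finite) auto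

lemma mu_UN_disj: "finite I \<Longrightarrow> (\<And>i. i \<in> I \<Longrightarrow> A i \<in> sets cantor) \<Longrightarrow> disjoint_family_on A I \<Longrightarrow>
    mu (\<Union>i\<in>I. A i) = (\<Sum>i\<in>I. mu (A i))"
  unfolding mu_def by (rule CP.finite_measure_finite_Union) auto

lemma finite_level: "finite {s :: bool list. length s = n}"
  using finite_lists_length_eq[of "UNIV :: bool set" n] by simp

lemma in_cyl_nth: "Z \<in> cyl t \<longleftrightarrow> (\<forall>i<length t. Z i = t ! i)"
  by (simp add: cyl_def)

lemma map_upt_eq_iff: "map Z [0..<n] = t \<longleftrightarrow> length t = n \<and> (\<forall>i<n. Z i = t ! i)"
  unfolding list_eq_iff_nth_eq by auto

lemma in_cyl_map: "Z \<in> cyl t \<longleftrightarrow> map Z [0..<length t] = t"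
  unfolding in_cyl_nth map_upt_eq_iff by simp

lemma cyl_disj: "length s = length t \<Longrightarrow> s \<noteq> t \<Longrightarrow> cyl s \<inter> cyl t = {}"
  by (rule equals0I) (metis IntD1 IntD2 in_cyl_map)

lemma mu_level:
  assumes "S \<subseteq> {s. length s = n}" shows "mu (ucyl S) = card S / 2 ^ n"
proof -
  have fin: "finite S" using assms finite_level finite_subset by blast
  have "disjoint_family_on cyl S" unfolding disjoint_family_on_def using assms cyl_disj by blast
  then have "mu (ucyl S) = (\<Sum>s\<in>S. mu (cyl s))" unfolding ucyl_def by (intro mu_UN_disj fin) auto
  also have "\<dots> = (\<Sum>s\<in>S. 1 / 2 ^ n)" by (rule sum.cong) (use assms in \<open>auto simp: mu_cyl\<close>)
  finally show ?thesis by simp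
qed

lemma mu_incseq:
  assumes "\<And>i. A i \<in> sets cantor" "incseq A" shows "(\<lambda>i. mu (A i)) \<longlonglongrightarrow> mu (\<Union>i. A i)"
  unfolding mu_def by (rule CP.finite_Lim_measure_incseq) (use assms in auto)

text \<open>Continuity from below along the enumeration of all strings; afterwards every measure
  bound is a count over finitely many strings.\<close>

lemma mu_ucyl_le:
  assumes "\<And>F. finite F \<Longrightarrow> F \<subseteq> S \<Longrightarrow> mu (ucyl F) \<le> b" shows "mu (ucyl S) \<le> b"
proof -
  let ?F = "\<lambda>n. S \<inter> str_of ` {..<n}"
  have "(\<Union>n. ucyl (?F n)) = ucyl S"
  proof -
    have "s \<in> ?F (Suc (code s))" if "s \<in> S" for s using that by (auto intro!: image_eqI[of _ _ "code s"])
    then have "(\<Union>n. ?F n) = S" by blast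
    then show ?thesis unfolding ucyl_def by blast
  qed
  moreover have "incseq (\<lambda>n. ucyl (?F n))" by (rule incseq_SucI) (auto simp: ucyl_def)
  ultimately have "(\<lambda>n. mu (ucyl (?F n))) \<longlonglongrightarrow> mu (ucyl S)" using mu_incseq[of "\<lambda>n. ucyl (?F n)"] by simp
  then show ?thesis by (rule LIMSEQ_le_const2) (auto intro!: assms)
qed

lemma cyl_take: assumes "n \<le> length s" "Z \<in> cyl s" shows "Z \<in> cyl (take n s)"
  using assms unfolding in_cyl_nth by (metis length_take less_le_trans min.absorb2 nth_take)

lemma cyl_ext:
  assumes "length s \<le> n" shows "cyl s = ucyl {t. length t = n \<and> take (length s) t = s}"
proof (intro set_eqI iffI)
  fix Z assume "Z \<in> cyl s"
  then have "take (length s) (map Z [0..<n]) = s" using assms by (simp add: in_cyl_map take_map)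
  then have "map Z [0..<n] \<in> {t. length t = n \<and> take (length s) t = s}" by simp
  moreover have "Z \<in> cyl (map Z [0..<n])" by (simp add: in_cyl_nth)
  ultimately show "Z \<in> ucyl {t. length t = n \<and> take (length s) t = s}" unfolding ucyl_def by (rule UN_I)
next
  fix Z assume "Z \<in> ucyl {t. length t = n \<and> take (length s) t = s}"
  then obtain t where t: "length t = n" "take (length s) t = s" "Z \<in> cyl t" unfolding ucyl_def by blast
  show "Z \<in> cyl s" using cyl_take[of "length s" t Z] assms t(1,3) unfolding t(2) by simp
qed

lemma ucyl_finite_level:
  assumes "finite F" obtains n S where "S \<subseteq> {s. length s = n}" "ucyl F = ucyl S"
proof -
  define n where "n = Max (insert 0 (length ` F))"
  have le: "length s \<le> n" if "s \<in> F" for s unfolding n_def using that assms by (intro Max_ge) auto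
  have "ucyl F = (\<Union>s\<in>F. ucyl {t. length t = n \<and> take (length s) t = s})"
    unfolding ucyl_def[of F] using cyl_ext[OF le] by blast
  also have "\<dots> = ucyl (\<Union>s\<in>F. {t. length t = n \<and> take (length s) t = s})" unfolding ucyl_def by blast
  finally show ?thesis by (intro that[of _ n]) auto
qed

text \<open>Positions in \<open>J\<close> and in the range of \<open>e\<close> are disjoint, hence
  independent, and an injective renaming of positions preserves measure.\<close>

lemma gcyl_ucyl_level:
  fixes e :: "nat \<Rightarrow> nat"
  assumes "inj e" "finite J" "J \<inter> range e = {}" "S \<subseteq> {s. length s = n}"
  shows "mu {Z \<in> gcyl J a. (\<lambda>i. Z (e i)) \<in> ucyl S} = mu (ucyl S) / 2 ^ card J"
proof -
  let ?I = "J \<union> e ` {..<n}"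
  let ?b = "\<lambda>s i. if i \<in> J then a i else s ! (inv e i)"
  have fin: "finite S" using assms(4) finite_level finite_subset by blast
  have eq: "{Z \<in> gcyl J a. (\<lambda>i. Z (e i)) \<in> ucyl S} = (\<Union>s\<in>S. gcyl ?I (?b s))"
  proof -
    have "Z \<in> gcyl J a \<and> (\<lambda>i. Z (e i)) \<in> cyl s \<longleftrightarrow> Z \<in> gcyl ?I (?b s)" if "s \<in> S" for Z s
    proof -
      have "length s = n" using that assms(4) by auto
      moreover have "e i \<notin> J" for i using assms(3) by blast
      ultimately show ?thesis unfolding gcyl_def cyl_def using assms(1) by (auto simp: ball_Un)
    qed
    then show ?thesis unfolding ucyl_def by blast
  qed
  have "disjoint_family_on (\<lambda>s. gcyl ?I (?b s)) S"
    unfolding disjoint_family_on_def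
  proof (intro ballI impI)
    fix s t assume "s \<in> S" "t \<in> S" "s \<noteq> t"
    then obtain i where i: "i < n" "s ! i \<noteq> t ! i" using assms(4) by (auto simp: list_eq_iff_nth_eq)
    have "e i \<in> ?I" "e i \<notin> J" "inv e (e i) = i" using i(1) assms(1,3) by auto
    then show "gcyl ?I (?b s) \<inter> gcyl ?I (?b t) = {}" unfolding gcyl_def using i(2) by force
  qed
  then have "mu (\<Union>s\<in>S. gcyl ?I (?b s)) = (\<Sum>s\<in>S. mu (gcyl ?I (?b s)))"
    using fin assms(2) by (intro mu_UN_disj gcyl_measure) auto
  also have "\<dots> = (\<Sum>s\<in>S. 1 / 2 ^ (card J + n))"
  proof (rule sum.cong[OF refl])
    have "card ?I = card J + card (e ` {..<n})" using assms(2,3) by (intro card_Un_disjoint) auto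
    also have "card (e ` {..<n}) = n" using assms(1) by (simp add: card_image inj_on_subset)
    finally show "mu (gcyl ?I (?b s)) = 1 / 2 ^ (card J + n)" for s
      using gcyl_measure(2)[of ?I "?b s"] assms(2) by simp
  qed
  finally show ?thesis unfolding eq mu_level[OF assms(4)] by (simp add: power_add)
qed

lemma sets_pullback [simp]: "{Z. (\<lambda>i. Z (e i)) \<in> ucyl S} \<in> sets cantor"
proof -
  have "{Z. (\<lambda>i. Z (e i)) \<in> cyl s} \<in> sets cantor" for s
  proof -
    have "{Z. (\<lambda>i. Z (e i)) \<in> cyl s} = (\<Inter>i\<in>{..<length s}. {Z. Z (e i) = s ! i}) \<inter> UNIV"
      unfolding cyl_def by auto
    moreover have "{Z. Z (e i) = s ! i} \<in> sets cantor" for i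
      using gcyl_measure(1)[of "{e i}" "\<lambda>_. s ! i"] by (simp add: gcyl_def)
    ultimately show ?thesis
      by (cases "s = []") (use sets.top[of cantor] in \<open>auto intro!: sets.finite_INT\<close>)
  qed
  moreover have "{Z. (\<lambda>i. Z (e i)) \<in> ucyl S} = (\<Union>s\<in>S. {Z. (\<lambda>i. Z (e i)) \<in> cyl s})" unfolding ucyl_def by blast
  ultimately show ?thesis by (auto intro!: sets.countable_UN' countableI_type)
qed

lemma mu_pullback_finite:
  assumes "inj e" "finite F" shows "mu {Z. (\<lambda>i. Z (e i)) \<in> ucyl F} = mu (ucyl F)"
proof -
  obtain n S where S: "S \<subseteq> {s. length s = n}" "ucyl F = ucyl S" by (rule ucyl_finite_level[OF assms(2)])
  have "mu {Z \<in> gcyl {} (\<lambda>_. True). (\<lambda>i. Z (e i)) \<in> ucyl S} = mu (ucyl S) / 2 ^ card ({} :: nat set)"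
    by (rule gcyl_ucyl_level[OF assms(1) finite.emptyI _ S(1)]) (rule Int_empty_left)
  moreover have "gcyl {} (\<lambda>_. True) = UNIV" by (simp add: gcyl_def)
  ultimately show ?thesis by (simp only: S(2) card.empty power_0 div_by_1 UNIV_I simp_thms)
qed

text \<open>The cylinders of a prefix-free set are pairwise disjoint in a space of measure
  1.\<close>

lemma kraft:
  fixes F :: "bool list set"
  assumes "finite F" "\<And>s t. s \<in> F \<Longrightarrow> t \<in> F \<Longrightarrow> take (length s) t = s \<Longrightarrow> s = t"
  shows "(\<Sum>s\<in>F. 1 / 2 ^ length s :: real) \<le> 1"
proof -
  have "disjoint_family_on cyl F" unfolding disjoint_family_on_def
  proof (intro ballI impI)
    have *: "take (length s) t = s" if "Z \<in> cyl s" "Z \<in> cyl t" "length s \<le> length t" for Z s t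
    proof -
      have "take (length s) (map Z [0..<length t]) = map Z [0..<length s]" using that(3) by (simp add: take_map)
      then show ?thesis using that(1,2) unfolding in_cyl_map by simp
    qed
    fix s t assume st: "s \<in> F" "t \<in> F" "s \<noteq> t"
    show "cyl s \<inter> cyl t = {}"
    proof (rule ccontr)
      assume "cyl s \<inter> cyl t \<noteq> {}"
      then obtain Z where Z: "Z \<in> cyl s" "Z \<in> cyl t" by blast
      show False
      proof (cases "length s \<le> length t")
        case True
        with st show False using assms(2)[OF st(1,2) *[OF Z True]] by simp
      next
        case False
        then have "length t \<le> length s" by simp
        with st show False using assms(2)[OF st(2,1) *[OF Z(2,1)]] by simp
      qed
    qed
  qed
  then have "mu (\<Union>s\<in>F. cyl s) = (\<Sum>s\<in>F. mu (cyl s))" by (intro mu_UN_disj assms) auto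
  then show ?thesis using mu_le_1[of "\<Union>s\<in>F. cyl s"] by (simp add: mu_cyl)
qed

lemma unif_ce_open_ucyl:
  assumes Q: "ce (\<lambda>p. Q (fst p) (snd p))" shows "unif_ce_open (\<lambda>n. ucyl {s. Q n s})"
proof -
  have "ce (\<lambda>p. Q (fst p) (str_of (snd p)))"
    by (intro ce_comp2[OF Q] cpt_fst cpt_snd cpt_str_of cpt_id)
  then obtain p where p: "\<And>n k. Q n (str_of k) \<longleftrightarrow> (\<exists>v. evalr no_oracle p [n, k] v)"
    using ce_halt[where P="\<lambda>n k. Q n (str_of k)"] by metis
  have "ucyl {s. Q n s} = (\<Union>k\<in>{k. \<exists>v. evalr no_oracle p [n, k] v}. cyl (str_of k))" for n
  proof -
    have "{s. Q n s} = str_of ` {k. Q n (str_of k)}"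
    proof (intro set_eqI iffI)
      fix s assume "s \<in> {s. Q n s}"
      then show "s \<in> str_of ` {k. Q n (str_of k)}" by (intro image_eqI[of _ _ "code s"]) simp_all
    qed auto
    then show ?thesis unfolding ucyl_def p[symmetric] by simp
  qed
  then show ?thesis unfolding unif_ce_open_def by blast
qed

text \<open>A constant factor \<open>C \<le> 2 ^ c\<close> is absorbed by dropping the first
  \<open>c\<close> components of the test.\<close>

lemma MLrandom_test:
  assumes Y: "MLrandom Y" and Q: "ce (\<lambda>p. Q (fst p) (snd p))"
    and b: "\<And>d::nat. mu (ucyl {s. Q d s}) \<le> C / 2 ^ d"
  obtains d where "Y \<notin> ucyl {s. Q d s}"
proof -
  obtain c :: nat where c: "C \<le> 2 ^ c" using real_arch_pow[of 2 C] by (auto intro: less_imp_le)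
  let ?V = "\<lambda>n. ucyl {s. Q (n + c) s}"
  have "unif_ce_open ?V"
    by (intro unif_ce_open_ucyl ce_comp2[OF Q] cpt_add cpt_fst cpt_snd cpt_id cpt_const)
  moreover have "mu (?V n) \<le> (1/2) ^ n" for n
  proof -
    have "mu (?V n) \<le> C / 2 ^ (n + c)" by (rule b)
    also have "\<dots> \<le> 2 ^ c / 2 ^ (n + c)" using c by (simp add: divide_right_mono)
    finally show ?thesis by (simp add: power_add power_divide)
  qed
  ultimately show ?thesis using Y that unfolding MLrandom_def by blast
qed

text \<open>Markov's inequality for the number of sets \<open>B i\<close> that contain a point; it
  turns a Solovay test into a Martin-Loef test.\<close>

lemma mu_markov:
  assumes "A \<in> sets cantor" "finite I" "\<And>i. i \<in> I \<Longrightarrow> B i \<in> sets cantor"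
    and "\<And>Z. Z \<in> A \<Longrightarrow> c \<le> real (card {i \<in> I. Z \<in> B i})"
  shows "c * mu A \<le> (\<Sum>i\<in>I. mu (B i))"
proof -
  have int: "integrable cantor (indicat_real X)" if "X \<in> sets cantor" for X
    using that by (simp add: integrable_indicator_iff CP.emeasure_eq_measure)
  have "c * mu A = (\<integral>Z. c * indicat_real A Z \<partial>cantor)"
    unfolding mu_def using assms(1) by simp
  also have "\<dots> \<le> (\<integral>Z. (\<Sum>i\<in>I. indicat_real (B i) Z) \<partial>cantor)"
  proof (rule integral_mono)
    show "integrable cantor (\<lambda>Z. c * indicat_real A Z)" by (intro integrable_mult_right int assms)
    show "integrable cantor (\<lambda>Z. \<Sum>i\<in>I. indicat_real (B i) Z)" by (intro Bochner_Integration.integrable_sum int assms)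
    fix Z
    have "(\<Sum>i\<in>I. indicat_real (B i) Z) = real (card {i \<in> I. Z \<in> B i})"
      using assms(2) by (simp add: indicator_def sum.If_cases Int_def)
    then show "c * indicat_real A Z \<le> (\<Sum>i\<in>I. indicat_real (B i) Z)"
      using assms(4)[of Z] by (cases "Z \<in> A") simp_all
  qed
  also have "\<dots> = (\<Sum>i\<in>I. mu (B i))"
    unfolding mu_def using assms(3) by (subst Bochner_Integration.integral_sum) (auto intro: int)
  finally show ?thesis .
qed

section \<open>Binary expansions\<close>

definition nval :: "bool list \<Rightarrow> nat" where
  "nval s = foldl (\<lambda>n b. 2 * n + (if b then 1 else 0)) 0 s"

lemma nval_snoc: "nval (s @ [b]) = 2 * nval s + (if b then 1 else 0)" by (simp add: nval_def)
lemma nval_Nil [simp]: "nval [] = 0" by (simp add: nval_def)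

lemma nval_less: "nval s < 2 ^ length s"
  by (induction s rule: rev_induct) (auto simp: nval_snoc)

lemma nval_inj: "length s = length t \<Longrightarrow> nval s = nval t \<Longrightarrow> s = t"
proof (induction s arbitrary: t rule: rev_induct)
  case (snoc b s)
  then obtain c u where t: "t = u @ [c]" by (cases t rule: rev_cases) auto
  with snoc.prems have e: "2 * nval s + (if b then 1 else 0) = 2 * nval u + (if c then 1 else 0)" by (simp add: nval_snoc)
  then have "nval s = nval u \<and> b = c" by (auto split: if_splits) presburger+
  then show ?case using snoc t by simp
qed simp

lemma nval_append: "nval (s @ t) = nval s * 2 ^ length t + nval t"
  by (induction t rule: rev_induct) (auto simp: nval_snoc simp flip: append_assoc)

text \<open>The strings stand for distinct dyadic units inside \<open>[a, b]\<close>, so there are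
  at most as many as between the least and the largest of them.\<close>

lemma card_nval_le:
  fixes a b :: real
  assumes "S \<subseteq> {s. length s = n}" "\<And>s. s \<in> S \<Longrightarrow> a \<le> nval s / 2 ^ n \<and> (real (nval s) + 1) / 2 ^ n \<le> b" "a \<le> b"
  shows "card S / 2 ^ n \<le> b - a"
proof (cases "S = {}")
  case False
  have fin: "finite S" using assms(1) finite_level finite_subset by blast
  have inj: "inj_on nval S" using assms(1) nval_inj by (intro inj_onI) auto
  define m M where "m = Min (nval ` S)" and "M = Max (nval ` S)"
  have "nval ` S \<subseteq> {m..M}" unfolding m_def M_def using fin by auto
  then have "card S \<le> card {m..M}" using card_mono[of "{m..M}" "nval ` S"] card_image[OF inj] by simp
  moreover have "m \<le> M" unfolding m_def M_def using fin False by auto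
  ultimately have "real (card S) \<le> real M + 1 - real m" by simp
  moreover have "m \<in> nval ` S" "M \<in> nval ` S" unfolding m_def M_def using fin False by auto
  then have "a \<le> m / 2 ^ n" "(real M + 1) / 2 ^ n \<le> b" using assms(2) by auto
  then have "a * 2 ^ n \<le> m" "real M + 1 \<le> b * 2 ^ n" by (simp_all add: field_simps)
  ultimately have "real (card S) \<le> (b - a) * 2 ^ n" by (simp add: algebra_simps)
  then show ?thesis by (simp add: field_simps)
qed (use assms in simp)

definition pre :: "real \<Rightarrow> nat \<Rightarrow> bool list" where
  "pre x l = map (real_bit x) [0..<l]"

lemma length_pre [simp]: "length (pre x l) = l" by (simp add: pre_def)

lemma take_pre: "k \<le> l \<Longrightarrow> take k (pre x l) = pre x k"
  by (simp add: pre_def take_map)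

lemma in_cyl_pre: "real_bit x \<in> cyl s \<longleftrightarrow> s = pre x (length s)"
  unfolding in_cyl_map pre_def by (rule eq_commute)

lemma nval_pre:
  assumes "0 \<le> x" "x < 1" shows "nval (pre x l) = nat \<lfloor>x * 2 ^ l\<rfloor>"
proof (induction l)
  case 0
  have "\<lfloor>x\<rfloor> = 0" using assms by linarith
  then show ?case by (simp add: pre_def)
next
  case (Suc l)
  have "\<lfloor>x * 2 ^ l\<rfloor> = \<lfloor>(x * 2 ^ Suc l) / of_int 2\<rfloor>" by simp
  also have "\<dots> = \<lfloor>x * 2 ^ Suc l\<rfloor> div 2" by (rule floor_divide_real_eq_div) simp
  finally have "nat \<lfloor>x * 2 ^ l\<rfloor> = nat \<lfloor>x * 2 ^ Suc l\<rfloor> div 2" by (simp add: nat_div_distrib)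
  moreover have "pre x (Suc l) = pre x l @ [real_bit x l]" by (simp add: pre_def)
  ultimately show ?case using Suc by (simp add: nval_snoc real_bit_def)
qed

lemma pre_bounds:
  assumes "0 \<le> x" "x < 1"
  shows "nval (pre x l) / 2 ^ l \<le> x" "x < (real (nval (pre x l)) + 1) / 2 ^ l"
proof -
  have "real (nat \<lfloor>x * 2 ^ l\<rfloor>) = of_int \<lfloor>x * 2 ^ l\<rfloor>" using assms by simp
  then have "real (nval (pre x l)) \<le> x * 2 ^ l" "x * 2 ^ l < real (nval (pre x l)) + 1"
    unfolding nval_pre[OF assms] by linarith+
  then show "nval (pre x l) / 2 ^ l \<le> x" "x < (real (nval (pre x l)) + 1) / 2 ^ l"
    by (simp_all add: field_simps)
qed

lemma cpt_nval: "cpt f \<Longrightarrow> cpt (\<lambda>x. nval (f x))"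
  unfolding nval_def by (intro cpt_foldl cpt_basic)

section \<open>An optimal prefix-free machine\<close>

lemma machine_of_graph:
  fixes G :: "bool list \<Rightarrow> bool list \<Rightarrow> bool"
  assumes G: "ce (\<lambda>p. G (fst p) (snd p))" and sv: "\<forall>s t t'. G s t \<longrightarrow> G s t' \<longrightarrow> t = t'"
    and pf: "\<forall>s s' t t'. G s t \<longrightarrow> G s' t' \<longrightarrow> take (length s) s' = s \<longrightarrow> s = s'"
  shows "\<exists>M. prefix_free_machine M \<and> (\<forall>s t. mach_out M s t \<longleftrightarrow> G s t)"
proof -
  let ?G = "\<lambda>n k. G (str_of n) (str_of k)"
  have 1: "ce (\<lambda>p. ?G (fst p) (snd p))"
    by (intro ce_comp2[OF G] cpt_str_of cpt_fst cpt_snd cpt_id)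
  have 2: "k = k'" if "?G n k" "?G n k'" for n k k'
  proof -
    have "str_of k = str_of k'" using sv that by blast
    then show ?thesis by (metis code_str_of)
  qed
  obtain p where p: "\<And>orc n k. evalr orc p [n] k \<longleftrightarrow> ?G n k"
    using ce_fun[where G="?G", OF 1] 2 by metis
  have m: "mach_out p s t \<longleftrightarrow> G s t" for s t unfolding mach_out_def p by simp
  have "prefix_free_machine p" unfolding prefix_free_machine_def
  proof (intro allI impI, elim conjE exE)
    fix s s' v v' assume h: "evalr no_oracle p [code s] v" "evalr no_oracle p [code s'] v'" "take (length s) s' = s"
    then have "G s (str_of v)" "G s' (str_of v')" unfolding p by simp_all
    then show "s = s'" using pf h(3) by blast
  qed
  then show ?thesis using m by blast
qed

section \<open>Enumerating computations and enforcing prefix-freeness\<close>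

definition compat :: "bool list \<Rightarrow> bool list \<Rightarrow> bool" where
  "compat s t \<longleftrightarrow> take (length s) t = s \<or> take (length t) s = t"

lemma compat_sym: "compat s t \<longleftrightarrow> compat t s" unfolding compat_def by blast
text \<open>Every number is read as a prefix length with a derivation; an invalid derivation is
  replaced by the empty list, so that only facts are enumerated.\<close>

definition dproof :: "nat \<Rightarrow> judg list" where
  "dproof n = (let q = dec n :: nat \<times> judg list in
     if valid (map (\<lambda>i. False) [0..<fst q]) (snd q) then snd q else [])"

definition hs :: "nat \<Rightarrow> nat \<Rightarrow> (bool list \<times> nat) list" where
  "hs e n = map (\<lambda>j. (str_of (hd (fst (snd j))), snd (snd j)))
     (filter (\<lambda>j. fst j = e \<and> length (fst (snd j)) = 1) (dproof n))"

lemma hs_iff: "(s, v) \<in> set (hs e n) \<longleftrightarrow> (e, [code s], v) \<in> set (dproof n)"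
proof
  assume "(s, v) \<in> set (hs e n)"
  then obtain j where j: "j \<in> set (dproof n)" "fst j = e" "length (fst (snd j)) = 1"
    "s = str_of (hd (fst (snd j)))" "v = snd (snd j)" unfolding hs_def by auto
  obtain x where "fst (snd j) = [x]" using j(3) by (auto simp: length_Suc_conv)
  then have "j = (e, [code s], v)" using j by (simp add: prod_eq_iff)
  then show "(e, [code s], v) \<in> set (dproof n)" using j(1) by simp
next
  assume "(e, [code s], v) \<in> set (dproof n)"
  then show "(s, v) \<in> set (hs e n)" unfolding hs_def set_map set_filter
    by (intro image_eqI[of _ _ "(e, [code s], v)"]) simp_all
qed

lemma dproof_valid: "\<exists>l. valid (map (\<lambda>i. False) [0..<l]) (dproof n)"
  unfolding dproof_def Let_def by (auto intro: exI[of _ 0])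

lemma hs_sound: "(s, v) \<in> set (hs (rcode M) n) \<Longrightarrow> evalr no_oracle M [code s] v"
  unfolding hs_iff using dproof_valid[of n] unfolding univ_rcode[symmetric] univ_def der_def by blast

lemma hs_complete: assumes "evalr no_oracle M [code s] v" shows "\<exists>n. (s, v) \<in> set (hs (rcode M) n)"
proof -
  obtain l D where D: "valid (map (\<lambda>i. False) [0..<l]) D" "(rcode M, [code s], v) \<in> set D"
    using assms unfolding univ_rcode[symmetric] univ_def der_def by blast
  have "dproof (enc (l, D)) = D" unfolding dproof_def Let_def dec_enc fst_conv snd_conv using D(1) by simp
  then have "(s, v) \<in> set (hs (rcode M) (enc (l, D)))" unfolding hs_iff using D(2) by simp
  then show ?thesis by blast
qed

lemma cpt_hs: "cpt e \<Longrightarrow> cpt n \<Longrightarrow> cpt (\<lambda>x. hs (e x) (n x))"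
proof -
  have d: "cpt dproof" unfolding dproof_def Let_def
    by (intro cpt_If cpt_valid cpt_map cpt_upt cpt_basic cpt_dec)
  have "cpt (\<lambda>p. hs (fst p) (snd p))" unfolding hs_def
    by (intro cpt_map cpt_filter cpt_basic cpt_comp[OF d] cpt_str_of cpt_hd cpt_length)
  from cpt_comp2[OF this] show "cpt e \<Longrightarrow> cpt n \<Longrightarrow> cpt (\<lambda>x. hs (e x) (n x))" .
qed

text \<open>Makes an arbitrary program \<open>e\<close> prefix-free: \<open>s\<close> is accepted at
  the stage where it first shows up, provided that its value there is unambiguous and no other
  compatible string has shown up by then.\<close>

definition acc :: "nat \<Rightarrow> bool list \<Rightarrow> nat \<Rightarrow> nat \<Rightarrow> bool" where
  "acc e s v n \<longleftrightarrow> (s, v) \<in> set (hs e n) \<and> list_all (\<lambda>p. fst p = s \<longrightarrow> snd p = v) (hs e n) \<and>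
     (\<forall>n'<Suc n. list_all (\<lambda>p. compat s (fst p) \<longrightarrow> fst p = s \<and> n' = n) (hs e n'))"

lemma cpt_compat: "cpt s \<Longrightarrow> cpt t \<Longrightarrow> cpt (\<lambda>x. compat (s x) (t x))"
  unfolding compat_def by (intro cpt_disj cpt_eq cpt_take cpt_length)

text \<open>Of two compatible accepted strings, the one that came later was checked against the
  other.\<close>

lemma acc_unique:
  assumes "acc e s v n" "acc e s' v' n'" "compat s s'" shows "s = s' \<and> v = v'"
proof -
  have *: "s = s' \<and> n = n'" if "acc e s v n" "acc e s' v' n'" "compat s s'" "n \<le> n'" for s s' v v' n n'
  proof -
    have "(s, v) \<in> set (hs e n)" using that(1) unfolding acc_def by blast
    moreover have "list_all (\<lambda>p. compat s' (fst p) \<longrightarrow> fst p = s' \<and> n = n') (hs e n)"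
      using that(2,4) unfolding acc_def by simp
    ultimately show ?thesis using that(3) compat_sym[of s s'] unfolding list_all_iff by fastforce
  qed
  have e: "s = s' \<and> n = n'"
  proof (cases "n \<le> n'")
    case True then show ?thesis using *[OF assms] by simp
  next
    case False
    then have "n' \<le> n" by simp
    then show ?thesis using *[OF assms(2,1)] assms(3) compat_sym[of s s'] by simp
  qed
  then have "(s, v) \<in> set (hs e n)" "list_all (\<lambda>p. fst p = s \<longrightarrow> snd p = v') (hs e n)"
    using assms unfolding acc_def by simp_all
  then show ?thesis using e unfolding list_all_iff by fastforce
qed

text \<open>A machine that is prefix-free already never triggers a refusal, so it loses
  nothing.\<close>

lemma acc_complete:
  assumes M: "prefix_free_machine M" "evalr no_oracle M [code s] v"
  shows "\<exists>n. acc (rcode M) s v n"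
proof -
  let ?e = "rcode M"
  define n where "n = (LEAST n. (s, v) \<in> set (hs ?e n))"
  have n: "(s, v) \<in> set (hs ?e n)" unfolding n_def by (rule LeastI_ex[OF hs_complete[OF M(2)]])
  have u: "v' = v" if "(s, v') \<in> set (hs ?e n')" for v' n'
    using evalr_det[OF hs_sound[OF that] M(2)] .
  have "fst p = s \<and> n' = n" if "n' < Suc n" "p \<in> set (hs ?e n')" "compat s (fst p)" for n' p
  proof -
    have p: "(fst p, snd p) \<in> set (hs ?e n')" using that(2) by simp
    have "\<exists>v. evalr no_oracle M [code s] v" "\<exists>v. evalr no_oracle M [code (fst p)] v"
      using M(2) hs_sound[OF p] by blast+
    then have f: "fst p = s" using M(1) that(3) unfolding prefix_free_machine_def compat_def by metis
    then have "(s, v) \<in> set (hs ?e n')" using u[of "snd p" n'] p by simp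
    then have "n \<le> n'" unfolding n_def by (rule Least_le)
    then show ?thesis using f that(1) by simp
  qed
  moreover have "snd p = v" if "p \<in> set (hs ?e n)" "fst p = s" for p
    using u[of "snd p" n] that by (metis prod.collapse)
  ultimately have "acc ?e s v n" unfolding acc_def list_all_iff using n by simp
  then show ?thesis by blast
qed

text \<open>The self-delimiting prefix of \<open>e\<close> ones and a zero names a machine, and
  later a slot, at the price of \<open>e + 1\<close> bits.\<close>

definition ucode :: "nat \<Rightarrow> bool list \<Rightarrow> bool list" where
  "ucode e s = map (\<lambda>i. True) [0..<e] @ False # s"

lemma ucode_prefix:
  assumes "take (length (ucode e s)) (ucode e' s') = ucode e s" shows "e = e' \<and> take (length s) s' = s"
proof -
  define r where "r = drop (length (ucode e s)) (ucode e' s')"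
  have "ucode e s @ r = ucode e' s'" unfolding r_def using assms by (metis append_take_drop_id)
  then have *: "replicate e True @ False # (s @ r) = replicate e' True @ False # s'"
    unfolding ucode_def by (simp add: map_replicate_trivial map_replicate_const)
  have "replicate e True @ False # a = replicate e' True @ False # b \<Longrightarrow> e = e' \<and> a = b" for a b
  proof (induction e arbitrary: e')
    case 0 then show ?case by (cases e') auto
  next
    case (Suc e) then show ?case by (cases e') auto
  qed
  from this[OF *] show ?thesis by auto
qed

lemma cpt_ucode: "cpt e \<Longrightarrow> cpt s \<Longrightarrow> cpt (\<lambda>x. ucode (e x) (s x))"
  unfolding ucode_def by (intro cpt_append cpt_Cons cpt_map cpt_upt cpt_const)

lemma length_ucode [simp]: "length (ucode e s) = e + 1 + length s" by (simp add: ucode_def)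

text \<open>\<open>K_trivial\<close> quantifies over all optimal machines, so one must exist before
  that hypothesis yields anything.\<close>

lemma optimal_exists: "\<exists>U. optimal_pf_machine U"
proof -
  let ?G = "\<lambda>s t. \<exists>e n s'. s = ucode e s' \<and> acc e s' (code t) n"
  have acc: "cpt (\<lambda>p. acc (fst p) (fst (snd p)) (fst (snd (snd p))) (snd (snd (snd p))))"
    unfolding acc_def by (intro cpt_basic cpt_list_all cpt_member cpt_hs cpt_compat)
  have acc': "cpt e \<Longrightarrow> cpt s \<Longrightarrow> cpt v \<Longrightarrow> cpt n \<Longrightarrow> cpt (\<lambda>x. acc (e x) (s x) (v x) (n x))" for e s v n
    using cpt_comp[OF acc cpt_Pair[OF _ cpt_Pair[OF _ cpt_Pair]]] by simp
  have g1: "ce (\<lambda>p. ?G (fst p) (snd p))"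
    by (intro ce_ex ce_ex_str ce_cpt cpt_conj cpt_eq cpt_ucode acc' cpt_code cpt_fst cpt_snd cpt_id)
  have g2: "t = t'" if h: "?G s t" "?G s t'" for s t t'
  proof -
    obtain e n s' e2 n2 s2 where *: "s = ucode e s'" "acc e s' (code t) n" "s = ucode e2 s2" "acc e2 s2 (code t') n2"
      using h by blast
    have "e = e2 \<and> take (length s') s2 = s'" by (rule ucode_prefix) (use * in simp)
    then show ?thesis using acc_unique[of e s' "code t" n s2 "code t'" n2] * unfolding compat_def by simp
  qed
  have g3: "s = s'" if h: "?G s t" "?G s' t'" "take (length s) s' = s" for s s' t t'
  proof -
    obtain e n s1 e2 n2 s2 where *: "s = ucode e s1" "acc e s1 (code t) n" "s' = ucode e2 s2" "acc e2 s2 (code t') n2"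
      using h(1,2) by blast
    have "e = e2 \<and> take (length s1) s2 = s1" by (rule ucode_prefix) (use * h(3) in simp)
    then show ?thesis using acc_unique[of e s1 "code t" n s2 "code t'" n2] * unfolding compat_def by simp
  qed
  have "\<exists>U. prefix_free_machine U \<and> (\<forall>s t. mach_out U s t \<longleftrightarrow> ?G s t)"
  proof (rule machine_of_graph[where G="?G", OF g1])
    show "\<forall>s t t'. ?G s t \<longrightarrow> ?G s t' \<longrightarrow> t = t'" by (intro allI impI, rule g2)
    show "\<forall>s s' t t'. ?G s t \<longrightarrow> ?G s' t' \<longrightarrow> take (length s) s' = s \<longrightarrow> s = s'" by (intro allI impI, rule g3)
  qed
  then obtain U where U: "prefix_free_machine U" "\<And>s t. mach_out U s t \<longleftrightarrow> ?G s t" by blast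
  have "\<exists>c. \<forall>s t. mach_out M s t \<longrightarrow> (\<exists>s'. mach_out U s' t \<and> length s' \<le> length s + c)"
    if M: "prefix_free_machine M" for M
  proof (rule exI[of _ "rcode M + 1"], intro allI impI)
    fix s t assume "mach_out M s t"
    then obtain n where "acc (rcode M) s (code t) n" using acc_complete[OF M] unfolding mach_out_def by blast
    then have "mach_out U (ucode (rcode M) s) t" unfolding U(2) by blast
    then show "\<exists>s'. mach_out U s' t \<and> length s' \<le> length s + (rcode M + 1)"
      by (intro exI[of _ "ucode (rcode M) s"]) simp
  qed
  then have "optimal_pf_machine U" unfolding optimal_pf_machine_def using U(1) by blast
  then show ?thesis by (rule exI)
qed

lemma Kc_machine:
  fixes G :: "bool list \<Rightarrow> bool list \<Rightarrow> bool"
  assumes U: "optimal_pf_machine U" and G: "ce (\<lambda>p. G (fst p) (snd p))" and sv: "\<forall>s t t'. G s t \<longrightarrow> G s t' \<longrightarrow> t = t'"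
    and pf: "\<forall>s s' t t'. G s t \<longrightarrow> G s' t' \<longrightarrow> take (length s) s' = s \<longrightarrow> s = s'"
  obtains c where "\<And>s t. G s t \<Longrightarrow> Kc U t \<le> length s + c"
proof -
  obtain M where M: "prefix_free_machine M" "\<And>s t. mach_out M s t \<longleftrightarrow> G s t"
    using machine_of_graph[of G, OF G sv pf] by blast
  then obtain c where c: "\<And>s t. mach_out M s t \<Longrightarrow> \<exists>s'. mach_out U s' t \<and> length s' \<le> length s + c"
    using U M(1) unfolding optimal_pf_machine_def by blast
  have "Kc U t \<le> length s + c" if st: "G s t" for s t
  proof -
    have "mach_out M s t" using M(2) st by simp
    from c[OF this] obtain s' where s': "mach_out U s' t" "length s' \<le> length s + c" by blast
    then have "Kc U t \<le> length s'" unfolding Kc_def by (intro Least_le) blast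
    then show ?thesis using s'(2) by simp
  qed
  then show ?thesis by (rule that)
qed

text \<open>The machine that maps the empty string to \<open>t\<close> shows that \<open>t\<close>
  has some description, so the minimum in \<open>Kc\<close> is attained.\<close>

lemma Kc_program:
  assumes U: "optimal_pf_machine U" obtains s where "length s = Kc U t" "mach_out U s t"
proof -
  let ?G = "\<lambda>s t'. s = ([] :: bool list) \<and> t' = t"
  have 1: "ce (\<lambda>p. ?G (fst p) (snd p))" by (intro ce_cpt cpt_conj cpt_eq cpt_fst cpt_snd cpt_id cpt_const)
  obtain M where M: "prefix_free_machine M" "\<And>s t. mach_out M s t \<longleftrightarrow> ?G s t"
    using machine_of_graph[of ?G, OF 1] by blast
  have "mach_out M [] t" unfolding M(2) by simp
  then obtain s' where "mach_out U s' t" using U M(1) unfolding optimal_pf_machine_def by blast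
  then have "\<exists>l s. length s = l \<and> mach_out U s t" by blast
  then have "\<exists>s. length s = Kc U t \<and> mach_out U s t" unfolding Kc_def by (rule LeastI_ex)
  then show ?thesis using that by blast
qed

lemma Kc_kraft:
  assumes U: "optimal_pf_machine U" and F: "finite F" shows "(\<Sum>t\<in>F. 1 / 2 ^ Kc U t :: real) \<le> 1"
proof -
  have "\<forall>t. \<exists>s. length s = Kc U t \<and> mach_out U s t" using Kc_program[OF U] by metis
  then obtain g where g: "\<forall>t. length (g t) = Kc U t \<and> mach_out U (g t) t" by (rule choice[THEN exE])
  have inj: "inj_on g F"
  proof (rule inj_onI)
    fix t t' assume "g t = g t'"
    then have "evalr no_oracle U [code (g t)] (code t)" "evalr no_oracle U [code (g t)] (code t')"
      using g unfolding mach_out_def by metis+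
    from evalr_det[OF this] show "t = t'" by simp
  qed
  have pf: "prefix_free_machine U" using U unfolding optimal_pf_machine_def by blast
  have "(\<Sum>t\<in>F. 1 / 2 ^ Kc U t :: real) = (\<Sum>s\<in>g ` F. 1 / 2 ^ length s)"
    unfolding sum.reindex[OF inj] using g by simp
  also have "\<dots> \<le> 1"
  proof (rule kraft)
    show "finite (g ` F)" using F by simp
    fix s t assume "s \<in> g ` F" "t \<in> g ` F" and p: "take (length s) t = s"
    then have "\<exists>v. evalr no_oracle U [code s] v" "\<exists>v. evalr no_oracle U [code t] v"
      using g unfolding mach_out_def by blast+
    then show "s = t" using pf p unfolding prefix_free_machine_def by blast
  qed
  finally show ?thesis .
qed

text \<open>A decidable view of \<open>Kc U t \<le> m\<close> at stage \<open>n\<close>, with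
  \<open>e\<close> the code of \<open>U\<close>.\<close>

definition KS :: "nat \<Rightarrow> nat \<Rightarrow> bool list \<Rightarrow> nat \<Rightarrow> bool" where
  "KS e n t m \<longleftrightarrow> (\<exists>n'<n. list_ex (\<lambda>p. snd p = code t \<and> length (fst p) \<le> m) (hs e n'))"

lemma KS_mono: "KS e n t m \<Longrightarrow> n \<le> n' \<Longrightarrow> KS e n' t m"
  unfolding KS_def using less_le_trans by blast

lemma Kc_iff_KS:
  assumes U: "optimal_pf_machine U" shows "Kc U t \<le> m \<longleftrightarrow> (\<exists>n. KS (rcode U) n t m)"
proof
  assume m: "Kc U t \<le> m"
  obtain s where s: "length s = Kc U t" "mach_out U s t" by (rule Kc_program[OF U])
  then obtain n where "(s, code t) \<in> set (hs (rcode U) n)" using hs_complete unfolding mach_out_def by blast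
  then have "list_ex (\<lambda>p. snd p = code t \<and> length (fst p) \<le> m) (hs (rcode U) n)"
    unfolding list_ex_iff using s(1) m by (intro bexI[of _ "(s, code t)"]) simp_all
  then show "\<exists>n. KS (rcode U) n t m" unfolding KS_def by blast
next
  assume "\<exists>n. KS (rcode U) n t m"
  then obtain n p where p: "p \<in> set (hs (rcode U) n)" "snd p = code t" "length (fst p) \<le> m"
    unfolding KS_def list_ex_iff by blast
  have "(fst p, code t) \<in> set (hs (rcode U) n)" using p(1) unfolding p(2)[symmetric] by simp
  from hs_sound[OF this] have "mach_out U (fst p) t" unfolding mach_out_def .
  then have "Kc U t \<le> length (fst p)" unfolding Kc_def by (intro Least_le) blast
  then show "Kc U t \<le> m" using p(3) by simp
qed

lemma cpt_KS: "cpt e \<Longrightarrow> cpt n \<Longrightarrow> cpt t \<Longrightarrow> cpt m \<Longrightarrow> cpt (\<lambda>x. KS (e x) (n x) (t x) (m x))"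
proof -
  have "cpt (\<lambda>q. KS (fst q) (fst (snd q)) (fst (snd (snd q))) (snd (snd (snd q))))" unfolding KS_def
    by (intro cpt_basic cpt_list_ex cpt_hs cpt_code cpt_length)
  from cpt_comp[OF this cpt_Pair[OF _ cpt_Pair[OF _ cpt_Pair]]]
  show "cpt e \<Longrightarrow> cpt n \<Longrightarrow> cpt t \<Longrightarrow> cpt m \<Longrightarrow> cpt (\<lambda>x. KS (e x) (n x) (t x) (m x))" by simp
qed

section \<open>The left-c.e. real and its bits on a computable set\<close>

locale omega =
  fixes Omega :: real and Om :: "nat \<Rightarrow> real" and R :: "nat set"
  assumes rat: "comp_rat_seq Om" and inc: "incseq Om" and lim: "Om \<longlonglongrightarrow> Omega" and le1: "Omega \<le> 1"
    and ran: "MLrandom (real_bit Omega)" and infR: "infinite R" and cR: "computable_set R"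
begin

lemma Om_rat: obtains a b where "cpt a" "cpt b" "\<And>s. Om s = real (a s) / real (Suc (b s))"
  using rat computable1_cpt unfolding comp_rat_seq_def by (metis Suc_eq_plus1)

lemma crat_Om0: "crat Om"
proof -
  obtain a b where "cpt a" "cpt b" "\<And>s. Om s = real (a s) / real (Suc (b s))" by (rule Om_rat) blast
  then show ?thesis by (intro cratI[OF _ cpt_const[of 0]]) simp_all
qed

lemma crat_Om: "cpt n \<Longrightarrow> crat (\<lambda>x. Om (n x))" by (rule crat_comp[OF crat_Om0])

lemma Om_nonneg: "0 \<le> Om n"
  using Om_rat by (metis of_nat_0_le_iff divide_nonneg_nonneg)

lemma Om_le: "Om n \<le> Omega" using inc lim by (rule incseq_le)
lemma Om_mono: "m \<le> n \<Longrightarrow> Om m \<le> Om n" using inc by (simp add: incseq_def)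

lemma cpt_R: assumes "cpt f" shows "cpt (\<lambda>x. f x \<in> R)"
proof -
  have "cpt (chi R)" using cR unfolding computable_set_def by (rule computable1_cpt)
  from cpt_eq[OF cpt_comp[OF this assms] cpt_const[of "1::nat"]]
  have "cpt (\<lambda>x. chi R (f x) = 1)" .
  moreover have "chi R y = 1 \<longleftrightarrow> y \<in> R" for y by (simp add: chi_def)
  ultimately show ?thesis by (simp only:)
qed

lemma real_bit_rat: "real_bit (real a / real (Suc b)) i = odd (a * 2 ^ Suc i div Suc b)"
proof -
  have "real a / real (Suc b) * 2 ^ Suc i = real (a * 2 ^ Suc i) / real (Suc b)" by simp
  then have "\<lfloor>real a / real (Suc b) * 2 ^ Suc i\<rfloor> = int (a * 2 ^ Suc i div Suc b)"
    by (simp only: floor_divide_of_nat_eq)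
  then show ?thesis unfolding real_bit_def by (simp only: nat_int)
qed

lemma cpt_pre_Om: "cpt s \<Longrightarrow> cpt k \<Longrightarrow> cpt (\<lambda>x. pre (Om (s x)) (k x))"
proof -
  obtain a b where ab: "cpt a" "cpt b" "\<And>s. Om s = real (a s) / real (Suc (b s))" by (rule Om_rat) blast
  have "cpt (\<lambda>p. pre (Om (fst p)) (snd p))"
    unfolding pre_def ab(3) real_bit_rat
    by (intro cpt_map cpt_upt cpt_basic cpt_comp[OF ab(1)] cpt_comp[OF ab(2)])
  from cpt_comp2[OF this] show "cpt s \<Longrightarrow> cpt k \<Longrightarrow> cpt (\<lambda>x. pre (Om (s x)) (k x))" .
qed

text \<open>A rational has a computable expansion, whose initial segments form a test that captures
  it.\<close>

lemma Omega_irrational: "Omega \<noteq> real a / real (Suc b)"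
proof
  assume e: "Omega = real a / real (Suc b)"
  have "ce (\<lambda>p. snd p = pre Omega (fst p))" unfolding e pre_def real_bit_rat
    by (intro ce_cpt cpt_eq cpt_map cpt_upt cpt_basic)
  moreover have "mu (ucyl {s. s = pre Omega d}) \<le> 1 / 2 ^ d" for d
    by (simp add: ucyl_def mu_cyl)
  ultimately obtain d where "real_bit Omega \<notin> ucyl {s. s = pre Omega d}"
    using MLrandom_test[OF ran, of "\<lambda>d s. s = pre Omega d" 1] by blast
  then show False by (simp add: ucyl_def in_cyl_pre)
qed

lemma Omega_less_1: "Omega < 1" using Omega_irrational[of 1 0] le1 by simp
lemma Om_less: "Om n < Omega"
proof -
  have "Om n \<noteq> Omega" using Omega_irrational Om_rat by metis
  then show ?thesis using Om_le[of n] by simp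
qed
lemma Om_less_1: "Om n < 1" using Om_less Omega_less_1 by (rule less_trans)
lemma Omega_nonneg: "0 \<le> Omega" using Om_nonneg[of 0] Om_le[of 0] by simp

text \<open>\<open>Omega\<close> is no dyadic rational, so it lies strictly above the left end of
  its dyadic interval of length \<open>2 ^ (-k)\<close>; once \<open>Om s\<close> has passed that
  end, the first \<open>k\<close> bits are final.\<close>

lemma pre_limit: "\<exists>s0. \<forall>s\<ge>s0. pre (Om s) k = pre Omega k"
proof -
  have "real (nat \<lfloor>Omega * 2 ^ k\<rfloor>) \<noteq> Omega * 2 ^ k"
  proof
    assume "real (nat \<lfloor>Omega * 2 ^ k\<rfloor>) = Omega * 2 ^ k"
    then have "Omega = real (nat \<lfloor>Omega * 2 ^ k\<rfloor>) / real (Suc (2 ^ k - 1))" by (simp add: field_simps)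
    then show False using Omega_irrational by blast
  qed
  then have "real (nval (pre Omega k)) \<noteq> Omega * 2 ^ k" unfolding nval_pre[OF Omega_nonneg Omega_less_1] .
  moreover have "real (nval (pre Omega k)) \<le> Omega * 2 ^ k"
    using pre_bounds(1)[OF Omega_nonneg Omega_less_1, of k] by (simp add: pos_divide_le_eq)
  ultimately have "real (nval (pre Omega k)) / 2 ^ k < Omega" by (simp add: pos_divide_less_eq)
  then obtain s0 where s0: "\<And>s. s \<ge> s0 \<Longrightarrow> real (nval (pre Omega k)) / 2 ^ k < Om s"
    using order_tendstoD(1)[OF lim] unfolding eventually_sequentially by blast
  have "pre (Om s) k = pre Omega k" if s: "s \<ge> s0" for s
  proof (rule nval_inj)
    have "real (nval (pre Omega k)) < Om s * 2 ^ k" using s0[OF s] by (simp add: field_simps)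
    moreover have "Om s * 2 ^ k < real (nval (pre (Om s) k)) + 1"
      using pre_bounds(2)[OF Om_nonneg Om_less_1, of s k] by (simp add: field_simps)
    moreover have "real (nval (pre (Om s) k)) \<le> Om s * 2 ^ k"
      using pre_bounds(1)[OF Om_nonneg Om_less_1, of s k] by (simp add: field_simps)
    moreover have "Om s * 2 ^ k \<le> Omega * 2 ^ k" using Om_le[of s] by simp
    moreover have "Omega * 2 ^ k < real (nval (pre Omega k)) + 1"
      using pre_bounds(2)[OF Omega_nonneg Omega_less_1, of k] by (simp add: field_simps)
    ultimately show "nval (pre (Om s) k) = nval (pre Omega k)" by linarith
  qed simp
  then show ?thesis by blast
qed

section \<open>Selecting the bits on \<open>R\<close>\<close>

definition cnt :: "nat \<Rightarrow> nat" where "cnt l = card (R \<inter> {..<l})"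

definition rz :: "bool list \<Rightarrow> bool list" where
  "rz z = map (\<lambda>i. nthd False z i) (filter (\<lambda>i. i \<in> R) [0..<length z])"

lemma cnt_filter: "cnt l = length (filter (\<lambda>i. i \<in> R) [0..<l])"
proof -
  have "set (filter (\<lambda>i. i \<in> R) [0..<l]) = R \<inter> {..<l}" by auto
  then show ?thesis unfolding cnt_def by (metis distinct_card distinct_filter distinct_upt)
qed

lemma length_rz [simp]: "length (rz z) = cnt (length z)" by (simp add: rz_def cnt_filter)

lemma cpt_rz: assumes "cpt f" shows "cpt (\<lambda>x. rz (f x))"
  unfolding rz_def by (intro cpt_map cpt_filter cpt_upt cpt_length cpt_nthd cpt_const cpt_snd cpt_id cpt_R cpt_comp[OF assms] cpt_fst)

lemma cpt_cnt: "cpt f \<Longrightarrow> cpt (\<lambda>x. cnt (f x))"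
  unfolding cnt_filter by (intro cpt_length cpt_filter cpt_upt cpt_R cpt_snd cpt_id)

lemma cnt_mono: "k \<le> l \<Longrightarrow> cnt k \<le> cnt l" unfolding cnt_def by (rule card_mono) auto
lemma cnt_le: "cnt l \<le> l" unfolding cnt_filter using length_filter_le[of _ "[0..<l]"] by simp

abbreviation "eR \<equiv> enumerate R"

lemma inj_eR: "inj eR" using strict_mono_enumerate[OF infR] by (rule strict_mono_imp_inj_on)
lemma range_eR: "range eR = R" by (rule range_enumerate[OF infR])

lemma eR_cnt: assumes "l \<in> R" shows "eR (cnt l) = l"
proof -
  obtain n where n: "eR n = l" using assms range_eR by (metis imageE)
  have "R \<inter> {..<l} = eR ` {..<n}"
  proof (intro set_eqI iffI)
    fix x assume x: "x \<in> R \<inter> {..<l}"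
    then obtain m where m: "x = eR m" using range_eR by blast
    then have "m < n" using x n strict_mono_less[OF strict_mono_enumerate[OF infR], of m n] by simp
    then show "x \<in> eR ` {..<n}" using m by blast
  next
    fix x assume "x \<in> eR ` {..<n}"
    then show "x \<in> R \<inter> {..<l}"
      using n range_eR strict_mono_less[OF strict_mono_enumerate[OF infR], of _ n] by auto
  qed
  then have "cnt l = n" unfolding cnt_def by (simp add: card_image inj_on_subset[OF inj_eR])
  then show ?thesis using n by simp
qed

lemma rz_map: "rz (map Z [0..<l]) = map (\<lambda>i. Z (eR i)) [0..<cnt l]"
proof (induction l)
  case 0 then show ?case by (simp add: rz_def cnt_def)
next
  case (Suc l)
  have "rz (map Z [0..<Suc l]) = map Z (filter (\<lambda>i. i \<in> R) [0..<Suc l])"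
    unfolding rz_def by (auto simp: nthd_simp nth_append intro!: map_cong)
  also have "\<dots> = map Z (filter (\<lambda>i. i \<in> R) [0..<l]) @ (if l \<in> R then [Z l] else [])" by simp
  also have "map Z (filter (\<lambda>i. i \<in> R) [0..<l]) = rz (map Z [0..<l])"
    unfolding rz_def by (auto simp: nthd_simp intro!: map_cong)
  finally have e: "rz (map Z [0..<Suc l]) = map (\<lambda>i. Z (eR i)) [0..<cnt l] @ (if l \<in> R then [Z l] else [])"
    unfolding Suc .
  show ?case
  proof (cases "l \<in> R")
    case True
    then have "cnt (Suc l) = Suc (cnt l)" by (simp add: cnt_filter)
    then show ?thesis unfolding e using True eR_cnt[OF True] by simp
  next
    case False
    then have "cnt (Suc l) = cnt l" by (simp add: cnt_filter)
    then show ?thesis unfolding e using False by simp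
  qed
qed

lemma rz_cyl: assumes "Z \<in> cyl z" shows "(\<lambda>i. Z (eR i)) \<in> cyl (rz z)"
proof -
  have e: "map Z [0..<length z] = z" using assms unfolding in_cyl_map .
  have "rz z = map (\<lambda>i. Z (eR i)) [0..<cnt (length z)]" using rz_map[of Z "length z"] unfolding e .
  then show ?thesis by (simp add: in_cyl_nth)
qed

lemma rz_take: assumes "k \<le> length z" shows "rz (take k z) = take (cnt k) (rz z)"
proof -
  have e: "map (\<lambda>i. z ! i) [0..<length z] = z" by (rule map_nth)
  have t: "take k z = map (\<lambda>i. z ! i) [0..<k]"
    using take_map[of k "\<lambda>i. z ! i" "[0..<length z]"] assms unfolding e by simp
  have "rz (take k z) = map (\<lambda>i. z ! eR i) [0..<cnt k]" unfolding t by (rule rz_map)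
  moreover have "rz z = map (\<lambda>i. z ! eR i) [0..<cnt (length z)]"
    using rz_map[of "\<lambda>i. z ! i" "length z"] unfolding e .
  ultimately show ?thesis using cnt_mono[OF assms] by (simp only: take_map take_upt add_0 min.absorb1)
qed

section \<open>Randomness of the bits of \<open>Omega\<close> on \<open>R\<close>\<close>

definition YR :: "nat \<Rightarrow> bool" where "YR = bits_on Omega R"

lemma YR_eq: "YR = (\<lambda>i. real_bit Omega (eR i))" unfolding YR_def bits_on_def by (rule ext) simp

lemma YR_pre: "YR \<in> cyl (rz (pre Omega k))"
  unfolding YR_eq by (rule rz_cyl) (simp add: in_cyl_pre)

lemma cnt_unbounded: "\<exists>k. n \<le> cnt k"
proof -
  have "cnt (eR n) = n"
    using eR_cnt[of "eR n"] range_eR inj_eR by (metis injD rangeI)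
  then show ?thesis by (metis order_refl)
qed

lemma MLrandom_YR: "MLrandom YR"
  unfolding MLrandom_def
proof (intro allI impI notI, elim conjE)
  fix V assume u: "unif_ce_open V" and m: "\<forall>n. mu (V n) \<le> (1/2) ^ n" and Y: "YR \<in> (\<Inter>n. V n)"
  obtain p where p: "\<And>n. V n = (\<Union>k\<in>{k. \<exists>v. evalr no_oracle p [n, k] v}. cyl (str_of k))"
    using u unfolding unif_ce_open_def by blast
  let ?P = "\<lambda>n w. \<exists>v. evalr no_oracle p [n, code w] v"
  have V: "V n = ucyl {w. ?P n w}" for n
  proof -
    have "{w. ?P n w} = str_of ` {k. \<exists>v. evalr no_oracle p [n, k] v}"
    proof (intro set_eqI iffI)
      fix s assume "s \<in> {w. ?P n w}"
      then show "s \<in> str_of ` {k. \<exists>v. evalr no_oracle p [n, k] v}" by (intro image_eqI[of _ _ "code s"]) simp_all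
    qed auto
    then show ?thesis unfolding p ucyl_def by simp
  qed
  \<comment> \<open>The pulled-back test, in terms of strings whose bits on \<open>R\<close> already
    extend a string of the given test.\<close>
  define Q where "Q n z \<longleftrightarrow> (\<exists>w. ?P n w \<and> take (length w) (rz z) = w)" for n z
  have "ce (\<lambda>q. Q (fst q) (snd q))" unfolding Q_def
    by (intro ce_ex_str ce_conj ce_ex ce_evalr ce_cpt cpt_eq cpt_take cpt_length cpt_rz cpt_Cons cpt_code cpt_fst cpt_snd cpt_id cpt_const)
  moreover have "mu (ucyl {z. Q n z}) \<le> 1 / 2 ^ n" for n
  proof (rule mu_ucyl_le)
    fix F assume F: "finite F" "F \<subseteq> {z. Q n z}"
    have "\<forall>z. \<exists>w. z \<in> F \<longrightarrow> ?P n w \<and> take (length w) (rz z) = w" using F(2) unfolding Q_def by blast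
    then obtain w where w: "\<forall>z. z \<in> F \<longrightarrow> ?P n (w z) \<and> take (length (w z)) (rz z) = w z" by (rule choice[THEN exE])
    have "ucyl F \<subseteq> {Z. (\<lambda>i. Z (eR i)) \<in> ucyl (w ` F)}"
    proof
      fix Z assume "Z \<in> ucyl F"
      then obtain z where z: "z \<in> F" "Z \<in> cyl z" unfolding ucyl_def by blast
      have t: "take (length (w z)) (rz z) = w z" using w z(1) by blast
      have "length (take (length (w z)) (rz z)) = length (w z)" unfolding t ..
      then have "length (w z) \<le> length (rz z)" by simp
      then have "(\<lambda>i. Z (eR i)) \<in> cyl (take (length (w z)) (rz z))" using cyl_take[OF _ rz_cyl[OF z(2)]] by blast
      then have "(\<lambda>i. Z (eR i)) \<in> cyl (w z)" unfolding t .
      then show "Z \<in> {Z. (\<lambda>i. Z (eR i)) \<in> ucyl (w ` F)}" unfolding ucyl_def using z(1) by blast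
    qed
    then have "mu (ucyl F) \<le> mu {Z. (\<lambda>i. Z (eR i)) \<in> ucyl (w ` F)}" by (rule mu_mono) simp
    also have "\<dots> = mu (ucyl (w ` F))" by (rule mu_pullback_finite[OF inj_eR]) (use F in simp)
    also have "\<dots> \<le> mu (V n)" unfolding V using w by (intro mu_mono ucyl_mono) auto
    also have "\<dots> \<le> 1 / 2 ^ n" using m by (simp add: power_divide)
    finally show "mu (ucyl F) \<le> 1 / 2 ^ n" .
  qed
  ultimately obtain n where n: "real_bit Omega \<notin> ucyl {z. Q n z}"
    using MLrandom_test[OF ran, of Q 1] by blast
  have "YR \<in> V n" using Y by blast
  then obtain w where w: "?P n w" "YR \<in> cyl w" unfolding V ucyl_def by blast
  obtain k where k: "length w \<le> cnt k" using cnt_unbounded by blast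
  have "rz (pre Omega k) = map YR [0..<cnt k]" unfolding YR_eq pre_def by (rule rz_map)
  then have "take (length w) (rz (pre Omega k)) = w" using w(2) k by (simp add: take_map in_cyl_map)
  then have "Q n (pre Omega k)" unfolding Q_def using w(1) by blast
  moreover have "real_bit Omega \<in> cyl (pre Omega k)" by (simp add: in_cyl_pre)
  ultimately show False using n unfolding ucyl_def by blast
qed

section \<open>The exponent of the cost function and its limit\<close>

definition kk :: "real \<Rightarrow> nat" where "kk x = nat \<lfloor>- log 2 x\<rfloor>"

lemma kk_bounds: assumes "0 < x" "x \<le> 1" shows "1 / 2 ^ Suc (kk x) < x" "x \<le> 1 / 2 ^ kk x"
proof -
  have "0 \<le> - log 2 x" using assms by simp
  then have k: "real (kk x) \<le> - log 2 x" "- log 2 x < real (kk x) + 1" unfolding kk_def by linarith+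
  have "2 powr (- real (Suc (kk x))) < 2 powr (log 2 x)" using k(2) by (intro powr_less_mono) auto
  moreover have "2 powr (log 2 x) \<le> 2 powr (- real (kk x))" using k(1) by (intro powr_mono) auto
  moreover have "2 powr (log 2 x) = x" using assms by simp
  moreover have "2 powr (- real n) = 1 / 2 ^ n" for n by (simp add: powr_minus_divide powr_realpow)
  ultimately show "1 / 2 ^ Suc (kk x) < x" "x \<le> 1 / 2 ^ kk x" by metis+
qed

lemma kk_le: assumes "0 < x" "x \<le> 1" "1 / 2 ^ Suc k < x" shows "kk x \<le> k"
proof (rule ccontr)
  assume "\<not> kk x \<le> k"
  then have "(2::real) ^ Suc k \<le> 2 ^ kk x" by (intro power_increasing) auto
  then have "1 / 2 ^ kk x \<le> (1::real) / 2 ^ Suc k" by (intro divide_left_mono) auto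
  then show False using kk_bounds(2)[OF assms(1,2)] assms(3) by linarith
qed

lemma kk_Least: assumes "0 < x" "x \<le> 1" shows "kk x = (LEAST k. 1 / 2 ^ Suc k < x)"
  by (rule Least_equality[symmetric]) (use kk_bounds[OF assms] kk_le[OF assms] in auto)

lemma kk_mono: assumes "0 < x" "x \<le> y" "y \<le> 1" shows "kk y \<le> kk x"
  using kk_le[of y "kk x"] kk_bounds(1)[of x] assms by simp

lemma cpt_kk:
  assumes "cpt s" "cpt n" shows "cpt (\<lambda>x. if Om (n x) < Om (s x) then kk (Om (s x) - Om (n x)) else 0)"
proof -
  let ?P = "\<lambda>p k. \<not> Om (snd p) < Om (fst p) \<or> 1 / 2 ^ Suc k < Om (fst p) - Om (snd p)"
  have "cpt (\<lambda>p. LEAST k. ?P p k)"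
  proof (rule cpt_Least0)
    show "cpt (\<lambda>q. ?P (fst q) (snd q))"
      by (intro cpt_basic cpt_crat crat_Om crat_intros)
    show "\<exists>k. ?P x k" for x
      using kk_bounds(1)[of "Om (fst x) - Om (snd x)"] Om_less_1[of "fst x"] Om_nonneg[of "snd x"]
      by (cases "Om (snd x) < Om (fst x)") (auto intro!: exI[of _ "kk (Om (fst x) - Om (snd x))"])
  qed
  then have "cpt (\<lambda>p. if Om (snd p) < Om (fst p) then kk (Om (fst p) - Om (snd p)) else 0)"
  proof (rule back_subst[of cpt], intro ext)
    fix p :: "nat \<times> nat"
    show "(LEAST k. ?P p k) = (if Om (snd p) < Om (fst p) then kk (Om (fst p) - Om (snd p)) else 0)"
      using Om_less_1[of "fst p"] Om_nonneg[of "snd p"]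
      by (cases "Om (snd p) < Om (fst p)") (auto simp: kk_Least)
  qed
  from cpt_comp2[OF this[unfolded] assms(1,2)] show ?thesis by simp
qed

lemma cOR_eq: "cOR Om R n s = (if Om n < Om s then 1 / 2 ^ cnt (kk (Om s - Om n)) else 0)"
  unfolding cOR_def cnt_def kk_def by simp

lemma crat_cOR: assumes "cpt n" "cpt s" shows "crat (\<lambda>x. cOR Om R (n x) (s x))"
proof -
  have "crat (\<lambda>x. if Om (n x) < Om (s x) then 1 / 2 ^ cnt (if Om (n x) < Om (s x) then kk (Om (s x) - Om (n x)) else 0) else 0)"
    by (intro crat_intros cpt_crat crat_Om cpt_cnt cpt_kk assms)
  then show ?thesis unfolding cOR_eq by (rule back_subst[of crat]) auto
qed

lemma kk_diff: "Om n < Om s \<Longrightarrow> kk (Omega - Om n) \<le> kk (Om s - Om n)"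
  using Om_le[of s] Om_nonneg[of n] le1 by (intro kk_mono) auto

text \<open>The lower bound in \<open>kk_bounds\<close> is strict, so it still holds for
  \<open>Om s\<close> close to \<open>Omega\<close>; hence the exponents become constant and the
  cost attains its limit.\<close>

lemma kk_eventually: "\<exists>s0. \<forall>s\<ge>s0. Om n < Om s \<and> kk (Om s - Om n) = kk (Omega - Om n)"
proof -
  have d: "0 < Omega - Om n" "Omega - Om n \<le> 1" using Om_less[of n] Om_nonneg[of n] le1 by auto
  have "Om n + 1 / 2 ^ Suc (kk (Omega - Om n)) < Omega" using kk_bounds(1)[OF d] by simp
  then obtain s0 where s0: "\<And>s. s \<ge> s0 \<Longrightarrow> Om n + 1 / 2 ^ Suc (kk (Omega - Om n)) < Om s"
    using order_tendstoD(1)[OF lim] unfolding eventually_sequentially by blast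
  have "Om n < Om s \<and> kk (Om s - Om n) = kk (Omega - Om n)" if s: "s \<ge> s0" for s
  proof -
    have "0 < (1::real) / 2 ^ Suc (kk (Omega - Om n))" by simp
    then have l: "Om n < Om s" using s0[OF s] by linarith
    have "kk (Om s - Om n) \<le> kk (Omega - Om n)"
      using s0[OF s] l Om_less_1[of s] Om_nonneg[of n] by (intro kk_le) auto
    then show ?thesis using kk_diff[OF l] l by simp
  qed
  then show ?thesis by blast
qed

definition climit :: "nat \<Rightarrow> real" where "climit n = 1 / 2 ^ cnt (kk (Omega - Om n))"

lemma cOR_lim: "Topological_Spaces.lim (\<lambda>s. cOR Om R n s) = climit n"
proof (rule limI)
  obtain s0 where s0: "\<forall>s\<ge>s0. Om n < Om s \<and> kk (Om s - Om n) = kk (Omega - Om n)" using kk_eventually by blast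
  have "\<forall>\<^sub>F s in sequentially. cOR Om R n s = climit n"
    unfolding eventually_sequentially using s0 by (intro exI[of _ s0]) (simp add: cOR_eq climit_def)
  then show "(\<lambda>s. cOR Om R n s) \<longlonglongrightarrow> climit n" by (rule tendsto_eventually)
qed

lemma cOR_le_climit: "cOR Om R n s \<le> climit n"
proof (cases "Om n < Om s")
  case True
  then have "cnt (kk (Omega - Om n)) \<le> cnt (kk (Om s - Om n))" by (intro cnt_mono kk_diff)
  then have "(2::real) ^ cnt (kk (Omega - Om n)) \<le> 2 ^ cnt (kk (Om s - Om n))" by (intro power_increasing) auto
  then show ?thesis unfolding cOR_eq climit_def using True by (simp add: divide_simps)
qed (simp add: cOR_eq climit_def)

text \<open>The initial segment of \<open>YR\<close> that stage \<open>s\<close> proposes for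
  position \<open>n\<close>, of the length \<open>|R \<inter> k|\<close> that the cost refers to.
  Without progress beyond \<open>Om n\<close> it is empty; all users require
  \<open>Om n < Om s\<close>.\<close>

definition vstr :: "nat \<Rightarrow> nat \<Rightarrow> bool list" where
  "vstr n s = rz (pre (Om s) (if Om n < Om s then kk (Om s - Om n) else 0))"

lemma cpt_vstr: "cpt n \<Longrightarrow> cpt s \<Longrightarrow> cpt (\<lambda>x. vstr (n x) (s x))"
  unfolding vstr_def by (intro cpt_rz cpt_pre_Om cpt_kk)

text \<open>A real in an interval of length at most \<open>2\<^sup>-\<^sup>k\<close> has one of two truncations to \<open>k\<close> bits.\<close>

definition twos :: "real \<Rightarrow> nat \<Rightarrow> bool list set" where
  "twos a k = {s. length s = k \<and> (nval s = nat \<lfloor>a * 2 ^ k\<rfloor> \<or> nval s = Suc (nat \<lfloor>a * 2 ^ k\<rfloor>))}"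

lemma twos_card: "finite (twos a k)" "card (twos a k) \<le> 2"
proof -
  show f: "finite (twos a k)" unfolding twos_def by (rule finite_subset[OF _ finite_level[of k]]) blast
  have "card (twos a k) = card (nval ` twos a k)"
    by (rule card_image[symmetric], rule inj_onI, rule nval_inj) (auto simp: twos_def)
  also have "\<dots> \<le> card {nat \<lfloor>a * 2 ^ k\<rfloor>, Suc (nat \<lfloor>a * 2 ^ k\<rfloor>)}"
    by (rule card_mono) (auto simp: twos_def)
  also have "\<dots> \<le> 2" by (simp add: card_insert_if)
  finally show "card (twos a k) \<le> 2" .
qed

lemma twosI:
  assumes "0 \<le> a" "length s = k" "real (nval s) < (a + 1 / 2 ^ k) * 2 ^ k + 1" "a * 2 ^ k < real (nval s) + 1"
    "real (nval s) \<le> (a + 1 / 2 ^ k) * 2 ^ k"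
  shows "s \<in> twos a k"
proof -
  have "(a + 1 / 2 ^ k) * 2 ^ k = a * 2 ^ k + 1" by (simp add: algebra_simps)
  moreover have "real (nat \<lfloor>a * 2 ^ k\<rfloor>) \<le> a * 2 ^ k" "a * 2 ^ k < real (nat \<lfloor>a * 2 ^ k\<rfloor>) + 1"
    using assms(1) by (auto simp: of_nat_nat)
  ultimately have "nval s = nat \<lfloor>a * 2 ^ k\<rfloor> \<or> nval s = Suc (nat \<lfloor>a * 2 ^ k\<rfloor>)"
    using assms(3-5) by linarith
  then show ?thesis unfolding twos_def using assms(2) by simp
qed

lemma pre_twos:
  assumes "0 \<le> a" "a \<le> y" "y \<le> a + 1 / 2 ^ k" "y < 1" shows "pre y k \<in> twos a k"
proof (rule twosI[OF assms(1)])
  have y: "0 \<le> y" using assms by simp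
  have "real (nval (pre y k)) \<le> y * 2 ^ k" "y * 2 ^ k < real (nval (pre y k)) + 1"
    using pre_bounds[OF y assms(4), of k] by (simp_all add: field_simps)
  moreover have "a * 2 ^ k \<le> y * 2 ^ k" "y * 2 ^ k \<le> (a + 1 / 2 ^ k) * 2 ^ k"
    using assms(2,3) by (simp_all add: mult_right_mono)
  ultimately show "real (nval (pre y k)) < (a + 1 / 2 ^ k) * 2 ^ k + 1" "a * 2 ^ k < real (nval (pre y k)) + 1"
    "real (nval (pre y k)) \<le> (a + 1 / 2 ^ k) * 2 ^ k" by linarith+
qed simp

text \<open>The values \<open>Om s\<close> lie in an interval of length at most
  \<open>2 ^ (-k)\<close> that starts at \<open>Om n\<close>, so all these strings extend one of two
  strings of length \<open>|R \<inter> k|\<close>.\<close>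

lemma mu_vstr:
  assumes b: "Om n < b" "b \<le> Omega" and I: "\<And>s. s \<in> I \<Longrightarrow> Om n < Om s \<and> Om s \<le> b"
  shows "mu (ucyl (vstr n ` I)) \<le> 2 / 2 ^ cnt (kk (b - Om n))"
proof -
  let ?k = "kk (b - Om n)" let ?T = "rz ` twos (Om n) ?k"
  have d: "0 < b - Om n" "b - Om n \<le> 1" using b le1 Om_nonneg[of n] by auto
  have "ucyl (vstr n ` I) \<subseteq> ucyl ?T"
  proof
    fix Z assume "Z \<in> ucyl (vstr n ` I)"
    then obtain s where s: "s \<in> I" "Z \<in> cyl (vstr n s)" unfolding ucyl_def by blast
    have "?k \<le> kk (Om s - Om n)" using I[OF s(1)] d(2) by (intro kk_mono) auto
    then have "take (cnt ?k) (vstr n s) = rz (pre (Om s) ?k)" "cnt ?k \<le> length (vstr n s)"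
      unfolding vstr_def using I[OF s(1)] by (simp_all add: rz_take[symmetric] take_pre cnt_mono)
    then have "Z \<in> cyl (rz (pre (Om s) ?k))" using cyl_take[OF _ s(2), of "cnt ?k"] by simp
    moreover have "pre (Om s) ?k \<in> twos (Om n) ?k"
      using I[OF s(1)] kk_bounds(2)[OF d] Om_nonneg[of n] Om_less_1[of s] by (intro pre_twos) auto
    ultimately show "Z \<in> ucyl ?T" unfolding ucyl_def by blast
  qed
  then have "mu (ucyl (vstr n ` I)) \<le> mu (ucyl ?T)" by (rule mu_mono) simp
  also have "\<dots> = card ?T / 2 ^ cnt ?k" by (rule mu_level) (auto simp: twos_def)
  also have "\<dots> \<le> 2 / 2 ^ cnt ?k"
  proof (rule divide_right_mono)
    have "card ?T \<le> card (twos (Om n) ?k)" by (rule card_image_le[OF twos_card(1)])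
    then show "real (card ?T) \<le> 2" using twos_card(2)[of "Om n" ?k] by linarith
  qed simp
  finally show ?thesis .
qed

lemma YR_vstr: "\<exists>s0. \<forall>s\<ge>s0. Om n < Om s \<and> YR \<in> cyl (vstr n s)"
proof -
  let ?k = "kk (Omega - Om n)"
  obtain s0 where s0: "\<forall>s\<ge>s0. Om n < Om s \<and> kk (Om s - Om n) = ?k" using kk_eventually by blast
  obtain s1 where s1: "\<forall>s\<ge>s1. pre (Om s) ?k = pre Omega ?k" using pre_limit by blast
  have "Om n < Om s \<and> YR \<in> cyl (vstr n s)" if "s \<ge> max s0 s1" for s
    using s0 s1 that YR_pre[of ?k] unfolding vstr_def by simp
  then show ?thesis by blast
qed

text \<open>For a smaller position the difference \<open>Om s - Om m\<close> is larger, its exponent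
  smaller, and fewer bits are proposed.\<close>

lemma vstr_prefix:
  assumes "m \<le> n" "Om n < Om s" "Z \<in> cyl (vstr n s)" shows "Om m < Om s" "Z \<in> cyl (vstr m s)"
proof -
  show l: "Om m < Om s" using Om_mono[OF assms(1)] assms(2) by simp
  have "kk (Om s - Om m) \<le> kk (Om s - Om n)"
    using Om_mono[OF assms(1)] assms(2) Om_less_1[of s] Om_nonneg[of m] by (intro kk_mono) auto
  then have "take (cnt (kk (Om s - Om m))) (vstr n s) = vstr m s" "cnt (kk (Om s - Om m)) \<le> length (vstr n s)"
    unfolding vstr_def using l assms(2) by (simp_all add: rz_take[symmetric] take_pre cnt_mono)
  then show "Z \<in> cyl (vstr m s)" using cyl_take[OF _ assms(3)] by metis
qed

lemma captured: "\<exists>V. c_test (cOR Om R) V \<and> fails_test YR V"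
proof -
  define V where "V n = ucyl {w. \<exists>s. Om n < Om s \<and> w = vstr n s}" for n
  have "unif_ce_open V" unfolding V_def
    by (intro unif_ce_open_ucyl ce_ex ce_cpt cpt_conj cpt_crat crat_Om cpt_eq cpt_vstr cpt_fst cpt_snd cpt_id)
  moreover have "V (Suc n) \<subseteq> V n" for n
    unfolding V_def ucyl_def using vstr_prefix[of n "Suc n"] by fastforce
  moreover have "mu (V n) \<le> 2 * Topological_Spaces.lim (\<lambda>s. cOR Om R n s)" for n
  proof -
    have "{w. \<exists>s. Om n < Om s \<and> w = vstr n s} = vstr n ` {s. Om n < Om s}" by blast
    then show ?thesis unfolding V_def cOR_lim climit_def
      using mu_vstr[OF Om_less[of n] order_refl, of "{s. Om n < Om s}"] Om_le by simp
  qed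
  moreover have "YR \<in> V n" for n
  proof -
    obtain s where "Om n < Om s" "YR \<in> cyl (vstr n s)" using YR_vstr[of n] by blast
    then show ?thesis unfolding V_def ucyl_def by blast
  qed
  ultimately show ?thesis unfolding c_test_def fails_test_def by (intro exI[of _ V]) blast
qed

text \<open>If \<open>YR\<close> extends \<open>vstr x s\<close> and the approximation changes at or
  below \<open>x\<close> after stage \<open>s\<close>, then \<open>YR\<close> enters one more
  component of a Solovay test. This happens finitely often, so from some stage on agreement with
  \<open>vstr x s\<close> certifies the value at \<open>x\<close>.\<close>

lemma obeys_turing:
  assumes "obeys A (cOR Om R)" shows "turing_le A YR"
proof -
  obtain g where g: "comp_approx g A" and sm: "summable (stage_cost (cOR Om R) g)"
    using assms unfolding obeys_def by blast
  have cg: "cpt (\<lambda>p. g (fst p) (snd p))" using g computable2_cpt unfolding comp_approx_def by blast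
  have gl: "\<exists>s0. \<forall>s\<ge>s0. (g x s \<noteq> 0) = (x \<in> A)" for x using g unfolding comp_approx_def by blast
  define ch where "ch t x \<longleftrightarrow> (g x t \<noteq> 0) \<noteq> (g x (Suc t) \<noteq> 0)" for t x
  define fc where "fc t x \<longleftrightarrow> ch t x \<and> (\<forall>y<x. \<not> ch t y)" for t x
  have cch: "cpt f \<Longrightarrow> cpt h \<Longrightarrow> cpt (\<lambda>p. ch (f p) (h p))" for f :: "'c::cod \<Rightarrow> nat" and h
    unfolding ch_def by (intro cpt_not cpt_iff cpt_eq cpt_const cpt_comp2[OF cg] cpt_Suc)
  have cfc: "cpt (\<lambda>q. fc (fst q) (snd q))"
    unfolding fc_def by (intro cpt_conj cch cpt_all_less cpt_not cpt_fst cpt_snd cpt_id)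
  have fc_least: "(LEAST x. ch t x) = x" if "fc t x" for t x
    using that unfolding fc_def by (intro Least_equality) (auto simp: not_less[symmetric])
  have fc_unique: "x = y" if "fc t x" "fc t y" for t x y
    using fc_least[OF that(1)] fc_least[OF that(2)] by simp
  have fc_ex: "\<exists>x\<le>y. fc t x" if "ch t y" for t y
  proof (intro exI conjI)
    show "(LEAST x. ch t x) \<le> y" using that by (rule Least_le)
    show "fc t (LEAST x. ch t x)" unfolding fc_def using LeastI[of "ch t", OF that] not_less_Least by blast
  qed
  \<comment> \<open>All strings proposed by stage \<open>t + 1\<close> for the position that changes
    are included, not just the newest: the computation may have relied on any of them. By
    \<open>mu_vstr\<close> this costs only a factor 2.\<close>
  define W where "W t = {w. \<exists>x s. fc t x \<and> s \<le> Suc t \<and> Om x < Om s \<and> w = vstr x s}" for t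
  have W_le: "mu (ucyl (W t)) \<le> 2 * stage_cost (cOR Om R) g t" for t
  proof (cases "\<exists>x. ch t x")
    case False
    then have "W t = {}" unfolding W_def fc_def by blast
    moreover have "stage_cost (cOR Om R) g t = 0" using False unfolding stage_cost_def ch_def by simp
    ultimately show ?thesis by (simp add: ucyl_def mu_def)
  next
    case True
    then obtain x where x: "fc t x" using fc_ex by blast
    have sc: "stage_cost (cOR Om R) g t = cOR Om R x (Suc t)"
      using True fc_least[OF x] unfolding stage_cost_def ch_def by simp
    let ?I = "{s. s \<le> Suc t \<and> Om x < Om s}"
    have W: "W t = vstr x ` ?I" unfolding W_def using x fc_unique by blast
    show ?thesis
    proof (cases "Om x < Om (Suc t)")
      case True
      have "mu (ucyl (vstr x ` ?I)) \<le> 2 / 2 ^ cnt (kk (Om (Suc t) - Om x))"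
        by (rule mu_vstr[OF True Om_le]) (auto intro: Om_mono)
      then show ?thesis unfolding W sc cOR_eq using True by simp
    next
      case False
      have "?I = {}" using Om_mono[of _ "Suc t"] False by fastforce
      then have "ucyl (W t) = {}" unfolding W \<open>?I = {}\<close> by (simp add: ucyl_def)
      then show ?thesis unfolding sc cOR_eq using False by (simp add: mu_def)
    qed
  qed
  have sc0: "0 \<le> stage_cost (cOR Om R) g t" for t unfolding stage_cost_def cOR_eq by simp
  define C where "C = 2 * suminf (stage_cost (cOR Om R) g)"
  have sumW: "(\<Sum>t<T. mu (ucyl (W t))) \<le> C" for T
  proof -
    have "(\<Sum>t<T. mu (ucyl (W t))) \<le> (\<Sum>t<T. 2 * stage_cost (cOR Om R) g t)" by (intro sum_mono W_le)
    also have "\<dots> = 2 * (\<Sum>t<T. stage_cost (cOR Om R) g t)" by (simp add: sum_distrib_left)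
    also have "\<dots> \<le> C" unfolding C_def using sum_le_suminf[OF sm, of "{..<T}"] sc0 by simp
    finally show ?thesis .
  qed
  have WI: "vstr x s \<in> W t" if "fc t x" "s \<le> Suc t" "Om x < Om s" for t x s
    unfolding W_def using that by blast
  \<comment> \<open>The bound \<open>T\<close> on the position makes membership in a component
    decidable.\<close>
  define hit where "hit T t z \<longleftrightarrow> (\<exists>x<T. fc t x \<and> (\<exists>s<Suc (Suc t). Om x < Om s \<and> take (length (vstr x s)) z = vstr x s))" for T t z
  have pre_cyl: "Z \<in> cyl w" if "take (length w) z = w" "Z \<in> cyl z" for Z w z
  proof -
    have "length (take (length w) z) = length w" by (simp only: that(1))
    then have "length w \<le> length z" by simp
    from cyl_take[OF this that(2)] show ?thesis unfolding that(1) .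
  qed
  have hitW: "Z \<in> ucyl (W t)" if h: "hit T t z" "Z \<in> cyl z" for T t z Z
  proof -
    obtain x s where xs: "fc t x" "s < Suc (Suc t)" "Om x < Om s" "take (length (vstr x s)) z = vstr x s"
      using h(1) unfolding hit_def by blast
    have "Z \<in> cyl (vstr x s)" by (rule pre_cyl[OF xs(4) h(2)])
    moreover have "vstr x s \<in> W t" using WI[of t x s] xs(1-3) by simp
    ultimately show ?thesis unfolding ucyl_def by blast
  qed
  have hit_mono: "hit T t z \<Longrightarrow> T \<le> T' \<Longrightarrow> hit T' t z" for T T' t z
    unfolding hit_def using less_le_trans by blast
  define N where "N T z = (\<Sum>t<T. if hit T t z then 1 else 0 :: nat)" for T z
  have N_card: "N T z = card {t \<in> {..<T}. hit T t z}" for T z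
    unfolding N_def by (simp add: sum.If_cases Int_def)
  \<comment> \<open>Strings seen to lie in at least \<open>2 ^ d\<close> components; by Markov's
    inequality they cover measure at most \<open>C / 2 ^ d\<close>.\<close>
  define Q where "Q d z \<longleftrightarrow> (\<exists>T. 2 ^ d \<le> N T z)" for d z
  have "ce (\<lambda>q. Q (fst q) (snd q))"
    unfolding Q_def N_def hit_def
    by (intro ce_ex ce_cpt cpt_le cpt_power cpt_const cpt_sum_less cpt_If cpt_ex_less cpt_conj cpt_comp2[OF cfc]
        cpt_crat crat_Om cpt_eq cpt_take cpt_length cpt_vstr cpt_Suc cpt_fst cpt_snd cpt_id)
  moreover have "mu (ucyl {z. Q d z}) \<le> C / 2 ^ d" for d
  proof (rule mu_ucyl_le)
    fix F assume F: "finite F" "F \<subseteq> {z. Q d z}"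
    have "\<forall>z. \<exists>T. z \<in> F \<longrightarrow> 2 ^ d \<le> N T z" using F(2) unfolding Q_def by blast
    then obtain T where T: "\<forall>z. z \<in> F \<longrightarrow> 2 ^ d \<le> N (T z) z" by (rule choice[THEN exE])
    define M where "M = Max (insert 0 (T ` F))"
    have TM: "T z \<le> M" if "z \<in> F" for z unfolding M_def using that F(1) by (intro Max_ge) auto
    have "2 ^ d * mu (ucyl F) \<le> (\<Sum>t\<in>{..<M}. mu (ucyl (W t)))"
    proof (rule mu_markov)
      fix Z assume "Z \<in> ucyl F"
      then obtain z where z: "z \<in> F" "Z \<in> cyl z" unfolding ucyl_def by blast
      have "{t \<in> {..<T z}. hit (T z) t z} \<subseteq> {t \<in> {..<M}. Z \<in> ucyl (W t)}"
        using TM[OF z(1)] hitW[OF _ z(2)] by auto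
      then have "N (T z) z \<le> card {t \<in> {..<M}. Z \<in> ucyl (W t)}" unfolding N_card by (intro card_mono) auto
      then have "2 ^ d \<le> card {t \<in> {..<M}. Z \<in> ucyl (W t)}" using T z(1) le_trans by blast
      then show "2 ^ d \<le> real (card {t \<in> {..<M}. Z \<in> ucyl (W t)})" by (simp flip: of_nat_power)
    qed simp_all
    also have "\<dots> \<le> C" by (rule sumW)
    finally show "mu (ucyl F) \<le> C / 2 ^ d" by (simp add: pos_le_divide_eq mult.commute)
  qed
  ultimately obtain d where d: "YR \<notin> ucyl {z. Q d z}"
    using MLrandom_test[OF MLrandom_YR, of Q C] by blast
  have "finite {t. YR \<in> ucyl (W t)}"
  proof (rule ccontr)
    assume "infinite {t. YR \<in> ucyl (W t)}"
    then obtain B where B: "B \<subseteq> {t. YR \<in> ucyl (W t)}" "finite B" "card B = 2 ^ d"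
      using infinite_arbitrarily_large by blast
    have "\<forall>t. \<exists>q. t \<in> B \<longrightarrow> fc t (fst q) \<and> snd q \<le> Suc t \<and> Om (fst q) < Om (snd q) \<and> YR \<in> cyl (vstr (fst q) (snd q))"
      using B(1) unfolding ucyl_def W_def by fastforce
    then obtain q where q: "\<forall>t. t \<in> B \<longrightarrow> fc t (fst (q t)) \<and> snd (q t) \<le> Suc t \<and> Om (fst (q t)) < Om (snd (q t)) \<and> YR \<in> cyl (vstr (fst (q t)) (snd (q t)))"
      by (rule choice[THEN exE])
    define T where "T = Max (insert 0 ((\<lambda>t. Suc t) ` B \<union> (\<lambda>t. Suc (fst (q t))) ` B))"
    define L where "L = Max (insert 0 ((\<lambda>t. length (vstr (fst (q t)) (snd (q t)))) ` B))"
    have T: "Suc t \<le> T" "Suc (fst (q t)) \<le> T" if "t \<in> B" for t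
      unfolding T_def using that B(2) by (auto intro!: Max_ge)
    have L: "length (vstr (fst (q t)) (snd (q t))) \<le> L" if "t \<in> B" for t
      unfolding L_def using that B(2) by (auto intro!: Max_ge)
    let ?z = "map YR [0..<L]"
    have "hit T t ?z" if t: "t \<in> B" for t
      unfolding hit_def
    proof (rule exI[of _ "fst (q t)"], intro conjI exI[of _ "snd (q t)"])
      show "take (length (vstr (fst (q t)) (snd (q t)))) ?z = vstr (fst (q t)) (snd (q t))"
        using q t L[OF t] by (simp add: take_map in_cyl_map)
    qed (use q t T[OF t] in auto)
    then have "B \<subseteq> {t \<in> {..<T}. hit T t ?z}" using T(1) by fastforce
    then have "2 ^ d \<le> N T ?z" unfolding N_card B(3)[symmetric] by (intro card_mono) auto
    then have "Q d ?z" unfolding Q_def by blast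
    moreover have "YR \<in> cyl ?z" by (simp add: in_cyl_nth)
    ultimately show False using d unfolding ucyl_def by blast
  qed
  then obtain t0 where t0: "\<And>t. YR \<in> ucyl (W t) \<Longrightarrow> t < t0"
    unfolding finite_nat_set_iff_bounded by blast
  have stable: "(g x s \<noteq> 0) = (x \<in> A)" if s: "t0 \<le> s" "Om x < Om s" "YR \<in> cyl (vstr x s)" for x s
  proof -
    have "\<not> ch t x" if t: "s \<le> t" for t
    proof
      assume "ch t x"
      then obtain y where y: "y \<le> x" "fc t y" using fc_ex by blast
      have "vstr y s \<in> W t" using WI[of t y s] y(2) vstr_prefix[OF y(1) s(2,3)] t by simp
      then have "YR \<in> ucyl (W t)" unfolding ucyl_def using vstr_prefix(2)[OF y(1) s(2,3)] by blast
      from t0[OF this] show False using s(1) t by simp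
    qed
    then have c: "(g x t \<noteq> 0) = (g x (Suc t) \<noteq> 0)" if "s \<le> t" for t using that unfolding ch_def by blast
    have e: "(g x (s + n) \<noteq> 0) = (g x s \<noteq> 0)" for n
    proof (induction n)
      case (Suc n) then show ?case using c[of "s + n"] by simp
    qed simp
    obtain s0 where "\<forall>s\<ge>s0. (g x s \<noteq> 0) = (x \<in> A)" using gl by blast
    then have "(g x (s + s0) \<noteq> 0) = (x \<in> A)" by simp
    then show ?thesis using e[of s0] by simp
  qed
  show ?thesis
  proof (rule turing_leI[where Q="\<lambda>q s. t0 \<le> s \<and> Om (fst q) < Om s \<and> take (length (vstr (fst q) s)) (snd q) = vstr (fst q) s" and B="\<lambda>x s. g x s \<noteq> 0"])
    show "cpt (\<lambda>p. t0 \<le> snd p \<and> Om (fst (fst p)) < Om (snd p) \<and> take (length (vstr (fst (fst p)) (snd p))) (snd (fst p)) = vstr (fst (fst p)) (snd p))"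
      by (intro cpt_conj cpt_le cpt_crat crat_Om cpt_eq cpt_take cpt_length cpt_vstr cpt_fst cpt_snd cpt_id cpt_const)
    show "cpt (\<lambda>p. g (fst p) (snd p) \<noteq> 0)" by (intro cpt_not cpt_eq cg cpt_const)
    fix x
    obtain s0 where s0: "\<forall>s\<ge>s0. Om x < Om s \<and> YR \<in> cyl (vstr x s)" using YR_vstr by blast
    let ?s = "max s0 t0"
    have "Om x < Om ?s" "YR \<in> cyl (vstr x ?s)" using s0 by simp_all
    then show "\<exists>l n. t0 \<le> n \<and> Om (fst (x, map YR [0..<l])) < Om n \<and>
        take (length (vstr (fst (x, map YR [0..<l])) n)) (snd (x, map YR [0..<l])) = vstr (fst (x, map YR [0..<l])) n"
      by (intro exI[of _ "length (vstr x ?s)"] exI[of _ ?s]) (simp add: in_cyl_map)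
  next
    fix x l n
    assume h: "t0 \<le> n \<and> Om (fst (x, map YR [0..<l])) < Om n \<and>
        take (length (vstr (fst (x, map YR [0..<l])) n)) (snd (x, map YR [0..<l])) = vstr (fst (x, map YR [0..<l])) n"
    let ?w = "vstr x n"
    have e: "take (length ?w) (map YR [0..<l]) = ?w" using h by simp
    have "YR \<in> cyl ?w" by (rule pre_cyl[OF e]) (simp add: in_cyl_nth)
    then show "(x \<in> A) = (g x n \<noteq> 0)" using stable[of n x] h by simp
  qed
qed

end

section \<open>Dyadic intervals as programs\<close>

lemma code_bound: "code s + 2 \<le> 2 ^ Suc (length s)"
proof (induction s rule: rev_induct)
  case Nil then show ?case by (simp add: code_def)
next
  case (snoc b s) then show ?case by (simp add: code_snoc)
qed

text \<open>Strings of length \<open>t\<close> have codes below \<open>2 ^ (t + 1)\<close>, so the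
  cardinality becomes a bounded and visibly computable sum.\<close>

lemma card_level_count:
  fixes P :: "bool list \<Rightarrow> bool"
  shows "card {s. length s = t \<and> P s} = (\<Sum>n<2 ^ Suc t. if length (str_of n) = t \<and> P (str_of n) then 1 else 0)"
proof -
  have "bij_betw code {s. length s = t \<and> P s} {n \<in> {..<2 ^ Suc t}. length (str_of n) = t \<and> P (str_of n)}"
  proof (rule bij_betw_byWitness[where f' = str_of])
    show "\<forall>a\<in>{s. length s = t \<and> P s}. str_of (code a) = a" by (intro ballI) (rule str_of_code)
    show "\<forall>a\<in>{n \<in> {..<2 ^ Suc t}. length (str_of n) = t \<and> P (str_of n)}. code (str_of a) = a" by (intro ballI) (rule code_str_of)
    show "code ` {s. length s = t \<and> P s} \<subseteq> {n \<in> {..<2 ^ Suc t}. length (str_of n) = t \<and> P (str_of n)}"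
    proof (rule image_subsetI)
      fix s assume s: "s \<in> {s. length s = t \<and> P s}"
      then have "code s + 2 \<le> 2 ^ Suc t" using code_bound[of s] by (simp only: mem_Collect_eq)
      then have "code s < 2 ^ Suc t" by linarith
      then show "code s \<in> {n \<in> {..<2 ^ Suc t}. length (str_of n) = t \<and> P (str_of n)}" using s
        by (simp only: mem_Collect_eq str_of_code lessThan_iff simp_thms)
    qed
    show "str_of ` {n \<in> {..<2 ^ Suc t}. length (str_of n) = t \<and> P (str_of n)} \<subseteq> {s. length s = t \<and> P s}" by (rule image_subsetI) (simp only: mem_Collect_eq)
  qed
  then have "card {s. length s = t \<and> P s} = card {n \<in> {..<2 ^ Suc t}. length (str_of n) = t \<and> P (str_of n)}"
    by (rule bij_betw_same_card)
  also have "\<dots> = (\<Sum>n<2 ^ Suc t. if length (str_of n) = t \<and> P (str_of n) then 1 else 0)"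
    unfolding card_eq_sum by (rule sum.inter_filter) (rule finite_lessThan)
  finally show ?thesis .
qed

lemma cpt_card_level:
  fixes P :: "'a::cod \<Rightarrow> bool list \<Rightarrow> bool"
  assumes P: "cpt (\<lambda>q. P (fst q) (snd q))" and t: "cpt t" shows "cpt (\<lambda>x. card {s. length s = t x \<and> P x s})"
  unfolding card_level_count
  by (intro cpt_sum_less cpt_If cpt_conj cpt_eq cpt_length cpt_str_of cpt_comp2[OF P] cpt_comp[OF t] cpt_power cpt_const
      cpt_Suc cpt_fst cpt_snd cpt_id t)

lemma nval_surj: "i < 2 ^ l \<Longrightarrow> \<exists>s. length s = l \<and> nval s = i"
proof (induction l arbitrary: i)
  case (Suc l)
  then have "i div 2 < 2 ^ l" by simp
  from Suc.IH[OF this] obtain s where "length s = l" "nval s = i div 2" by blast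
  then show ?case by (intro exI[of _ "s @ [odd i]"]) (auto simp: nval_snoc)
qed simp

definition lo :: "bool list \<Rightarrow> real" where "lo z = nval z / 2 ^ length z"
definition hi :: "bool list \<Rightarrow> real" where "hi z = (real (nval z) + 1) / 2 ^ length z"

lemma lo_hi: "lo z < hi z" unfolding lo_def hi_def by (simp add: divide_strict_right_mono)
lemma hi_lo: "hi z = lo z + 1 / 2 ^ length z" unfolding lo_def hi_def by (simp add: add_divide_distrib)
lemma crat_lo: "cpt f \<Longrightarrow> crat (\<lambda>x. lo (f x))"
  unfolding lo_def by (intro crat_div_pow crat_nat cpt_nval cpt_length)
lemma crat_hi: "cpt f \<Longrightarrow> crat (\<lambda>x. hi (f x))"
  unfolding hi_def by (intro crat_div_pow crat_add crat_1 crat_nat cpt_nval cpt_length)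

lemma lo_hi_append: "lo z \<le> lo (z @ w)" "hi (z @ w) \<le> hi z"
proof -
  have n: "nval z * 2 ^ length w \<le> nval (z @ w)" "nval (z @ w) + 1 \<le> (nval z + 1) * 2 ^ length w"
    using nval_less[of w] by (simp_all add: nval_append algebra_simps)
  have "real (nval z) * 2 ^ length w \<le> real (nval (z @ w))" using of_nat_mono[OF n(1), where 'a = real] by simp
  then show "lo z \<le> lo (z @ w)" unfolding lo_def by (simp add: power_add field_simps)
  have "real (nval (z @ w) + 1) \<le> real ((nval z + 1) * 2 ^ length w)" using n(2) by (simp only: of_nat_le_iff)
  then have "real (nval (z @ w)) + 1 \<le> (real (nval z) + 1) * 2 ^ length w" by (simp add: algebra_simps)
  then have "(real (nval (z @ w)) + 1) / (2 ^ length z * 2 ^ length w) \<le> (real (nval z) + 1) * 2 ^ length w / (2 ^ length z * 2 ^ length w)"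
    by (intro divide_right_mono) simp_all
  then show "hi (z @ w) \<le> hi z" unfolding hi_def by (simp add: power_add)
qed

lemma lo_hi_take: "lo (take k z) \<le> lo z" "hi z \<le> hi (take k z)"
  using lo_hi_append[of "take k z" "drop k z"] by simp_all

lemma lo_hi_pre: assumes "0 \<le> x" "x < 1" shows "lo (pre x l) \<le> x" "x < hi (pre x l)"
  using pre_bounds[OF assms, of l] unfolding lo_def hi_def by simp_all

lemma mu_interval:
  assumes "finite F" "\<And>z. z \<in> F \<Longrightarrow> a \<le> lo z \<and> hi z \<le> c" "a \<le> c" shows "mu (ucyl F) \<le> c - a"
proof -
  define n where "n = Max (insert 0 (length ` F))"
  have le: "length z \<le> n" if "z \<in> F" for z unfolding n_def using that assms(1) by (intro Max_ge) auto
  let ?S = "\<Union>z\<in>F. {t. length t = n \<and> take (length z) t = z}"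
  have "ucyl F = (\<Union>z\<in>F. ucyl {t. length t = n \<and> take (length z) t = z})"
    unfolding ucyl_def[of F] using cyl_ext[OF le] by simp
  also have "\<dots> = ucyl ?S" unfolding ucyl_def by blast
  finally have e: "ucyl F = ucyl ?S" .
  have "mu (ucyl ?S) = card ?S / 2 ^ n" by (rule mu_level) blast
  also have "\<dots> \<le> c - a"
  proof (rule card_nval_le[OF _ _ assms(3)])
    fix s assume "s \<in> ?S"
    then obtain z where z: "z \<in> F" "length s = n" "take (length z) s = z" by blast
    have "lo z \<le> lo s" "hi s \<le> hi z" using lo_hi_take[where k = "length z" and z = s] unfolding z(3) by simp_all
    then show "a \<le> nval s / 2 ^ n \<and> (real (nval s) + 1) / 2 ^ n \<le> c"
      using assms(2)[OF z(1)] unfolding lo_def hi_def z(2) by linarith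
  qed blast
  finally show ?thesis unfolding e .
qed

text \<open>Disjoint intervals serve as prefix-free codes: a string whose interval lies in the \<open>n\<close>-th
  interval of slot \<open>c\<close> describes \<open>n\<close>.\<close>

lemma Kc_intervals:
  fixes P :: "nat \<Rightarrow> nat \<Rightarrow> bool list \<Rightarrow> bool" and f :: "nat \<Rightarrow> nat \<Rightarrow> real"
  assumes U: "optimal_pf_machine U"
    and P: "ce (\<lambda>q. P (fst q) (fst (snd q)) (snd (snd q)))"
    and iv: "\<And>c n z. P c n z \<Longrightarrow> f c n \<le> lo z \<and> hi z \<le> f c (Suc n)"
    and mono: "\<And>c m n z. m \<le> n \<Longrightarrow> P c n z \<Longrightarrow> f c m \<le> f c n"
    and len: "\<And>c n z z'. P c n z \<Longrightarrow> P c n z' \<Longrightarrow> length z = length z'"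
  obtains k where "\<And>c n z. P c n z \<Longrightarrow> Kc U (str_of (Suc n)) \<le> length z + c + k"
proof -
  \<comment> \<open>The output is \<open>Suc n\<close> because round \<open>n\<close> concerns the
    initial segment of \<open>A\<close> of length \<open>Suc n\<close>.\<close>
  let ?G = "\<lambda>s t. \<exists>c n z. s = ucode c z \<and> t = str_of (Suc n) \<and> P c n z"
  have P': "cpt c \<Longrightarrow> cpt n \<Longrightarrow> cpt z \<Longrightarrow> ce (\<lambda>x. P (c x) (n x) (z x))" for c n z
    using ce_comp[OF P cpt_Pair[OF _ cpt_Pair]] by simp
  have g1: "ce (\<lambda>q. ?G (fst q) (snd q))"
    by (intro ce_ex ce_ex_str ce_conj P' ce_cpt cpt_eq cpt_ucode cpt_str_of cpt_Suc cpt_fst cpt_snd cpt_id)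
  have same: "n = n'" if h: "P c n z" "P c n' z'" "take (length z) z' = z" for c n n' z z'
  proof -
    have i: "lo z \<le> lo z'" "hi z' \<le> hi z" using lo_hi_take[where k = "length z" and z = z'] unfolding h(3) by simp_all
    have "\<not> n < n'"
    proof
      assume "n < n'"
      then have "f c (Suc n) \<le> f c n'" using mono[of "Suc n" n' c z'] h(2) by simp
      then show False using iv[OF h(1)] iv[OF h(2)] i lo_hi[of z'] by linarith
    qed
    moreover have "\<not> n' < n"
    proof
      assume "n' < n"
      then have "f c (Suc n') \<le> f c n" using mono[of "Suc n'" n c z] h(1) by simp
      then show False using iv[OF h(1)] iv[OF h(2)] i lo_hi[of z'] by linarith
    qed
    ultimately show ?thesis by simp
  qed
  have g2: "t = t'" if h: "?G s t" "?G s t'" for s t t'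
  proof -
    obtain c n z c' n' z' where *: "s = ucode c z" "t = str_of (Suc n)" "P c n z" "s = ucode c' z'" "t' = str_of (Suc n')" "P c' n' z'"
      using h by blast
    have e: "c = c' \<and> take (length z) z' = z" by (rule ucode_prefix) (use * in simp)
    then have "n = n'" using same[of c n z n' z'] *(3,6) by simp
    then show ?thesis using * by simp
  qed
  have g3: "s = s'" if h: "?G s t" "?G s' t'" "take (length s) s' = s" for s s' t t'
  proof -
    obtain c n z c' n' z' where *: "s = ucode c z" "P c n z" "s' = ucode c' z'" "P c' n' z'"
      using h(1,2) by blast
    have e: "c = c' \<and> take (length z) z' = z" by (rule ucode_prefix) (use * h(3) in simp)
    then have "n = n'" using same[of c n z n' z'] *(2,4) by simp
    then have "length z = length z'" using len[of c n z z'] * e by simp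
    then show ?thesis using e * by simp
  qed
  have ex: "\<exists>k. \<forall>s t. ?G s t \<longrightarrow> Kc U t \<le> length s + k"
  proof (rule Kc_machine[OF U, where G = "?G", OF g1])
    show "\<forall>s t t'. ?G s t \<longrightarrow> ?G s t' \<longrightarrow> t = t'" by (intro allI impI, rule g2)
    show "\<forall>s s' t t'. ?G s t \<longrightarrow> ?G s' t' \<longrightarrow> take (length s) s' = s \<longrightarrow> s = s'" by (intro allI impI, rule g3)
    fix k assume "\<And>s t. ?G s t \<Longrightarrow> Kc U t \<le> length s + k"
    then show "\<exists>k. \<forall>s t. ?G s t \<longrightarrow> Kc U t \<le> length s + k" by (intro exI[of _ k] allI impI)
  qed
  have "\<exists>k. \<forall>c n z. P c n z \<longrightarrow> Kc U (str_of (Suc n)) \<le> length z + c + k"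
  proof -
    obtain k where k: "\<forall>s t. ?G s t \<longrightarrow> Kc U t \<le> length s + k" using ex by (elim exE)
    have "Kc U (str_of (Suc n)) \<le> length z + c + (k + 1)" if h: "P c n z" for c n z
    proof -
      have "?G (ucode c z) (str_of (Suc n))" using h by (intro exI[of _ c] exI[of _ n] exI[of _ z] conjI refl h)
      with k have "Kc U (str_of (Suc n)) \<le> length (ucode c z) + k" by (elim allE impE)
      then show ?thesis by (simp add: length_ucode)
    qed
    then show ?thesis by blast
  qed
  then show ?thesis using that by blast
qed

section \<open>Density of the computing oracles\<close>

locale omega_A = omega +
  fixes A :: "nat set" and p :: recf and U :: recf and b :: nat
  assumes pA: "\<And>x. evalr (seq_oracle YR) p [x] (chi A x)"
    and U: "optimal_pf_machine U"
    and KA: "\<And>n. Kc U (init_seg A n) \<le> Kc U (str_of n) + b"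
begin

abbreviation "As n \<equiv> init_seg A n"

lemma length_As [simp]: "length (As n) = n" by (simp add: init_seg_def)
lemma take_As: "k \<le> n \<Longrightarrow> take k (As n) = As k" by (simp add: init_seg_def take_map)
lemma nth_As: "i < n \<Longrightarrow> As n ! i = (i \<in> A)" by (simp add: init_seg_def)

text \<open>\<open>t\<close> bounds the codes of the derivations and plays the role of a running
  time; it makes the predicate decidable.\<close>

definition cmps :: "nat \<Rightarrow> bool list \<Rightarrow> bool list \<Rightarrow> bool" where
  "cmps t W u \<longleftrightarrow> (\<forall>x<length u. \<exists>c<t. valid W (dec c) \<and> (rcode p, [x], if nthd False u x then 1 else 0) \<in> set (dec c :: judg list))"

lemma cpt_cmps: "cpt t \<Longrightarrow> cpt W \<Longrightarrow> cpt u \<Longrightarrow> cpt (\<lambda>x. cmps (t x) (W x) (u x))"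
proof -
  have "cpt (\<lambda>q. cmps (fst q) (fst (snd q)) (snd (snd q)))"
    unfolding cmps_def
    by (intro cpt_all_less cpt_ex_less cpt_conj cpt_valid cpt_member cpt_Pair cpt_Cons cpt_If cpt_nthd cpt_dec cpt_length cpt_const cpt_fst cpt_snd cpt_id)
  from cpt_comp[OF this cpt_Pair[OF _ cpt_Pair]] show "cpt t \<Longrightarrow> cpt W \<Longrightarrow> cpt u \<Longrightarrow> cpt (\<lambda>x. cmps (t x) (W x) (u x))" by simp
qed

lemma cmps_mono:
  assumes "cmps t W u" "t \<le> t'" "length W \<le> length W'" "take (length W) W' = W" shows "cmps t' W' u"
  unfolding cmps_def
proof (intro allI impI)
  fix x assume "x < length u"
  then obtain c where c: "c < t" "valid W (dec c)" "(rcode p, [x], if nthd False u x then 1 else 0) \<in> set (dec c :: judg list)"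
    using assms(1) unfolding cmps_def by blast
  have "\<forall>i<length W. W' ! i = W ! i" using assms(4) by (metis nth_take)
  then have "valid W' (dec c)" using valid_mono[OF c(2) assms(3)] by blast
  then show "\<exists>c<t'. valid W' (dec c) \<and> (rcode p, [x], if nthd False u x then 1 else 0) \<in> set (dec c :: judg list)"
    using c(1,3) assms(2) by (intro exI[of _ c] conjI) simp_all
qed

lemma cmps_take: "cmps t W u \<Longrightarrow> cmps t W (take k u)"
  unfolding cmps_def by (simp add: nthd_simp)

text \<open>Both computations also run with the oracle that continues \<open>W\<close> by zeros, and
  there evaluation is single-valued.\<close>

lemma cmps_agree:
  assumes "cmps t W u" "cmps t' W u'" "x < length u" "x < length u'" shows "u ! x = u' ! x"
proof -
  let ?orc = "\<lambda>i. if i < length W \<and> W ! i then 1 else 0 :: nat"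
  have a: "agr ?orc W" unfolding agr_def by simp
  have ev: "evalr ?orc p [x] (if v ! x then 1 else 0)" if h: "cmps s W v" "x < length v" for s v
  proof -
    obtain c where c: "valid W (dec c)" "(rcode p, [x], if nthd False v x then 1 else 0) \<in> set (dec c :: judg list)"
      using h unfolding cmps_def by blast
    from valid_sound[OF a c] show ?thesis using h(2) by (simp add: nthd_simp)
  qed
  from evalr_det[OF ev[OF assms(1,3)] ev[OF assms(2,4)]] show ?thesis by (simp split: if_splits)
qed

lemma cmps_A: "\<exists>m. \<forall>t\<ge>m. \<forall>l\<ge>m. cmps t (map YR [0..<l]) (As n)"
proof -
  have ex: "\<exists>m. \<forall>t\<ge>m. \<forall>l\<ge>m. \<exists>c<t. valid (map YR [0..<l]) (dec c) \<and> (rcode p, [x], chi A x) \<in> set (dec c :: judg list)" for x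
  proof -
    have "\<exists>l. der (opre (seq_oracle YR) l) (rcode p) [x] (chi A x)"
      by (rule der_complete[OF seq_oracle_01 pA])
    then obtain l D where D: "valid (map YR [0..<l]) D" "(rcode p, [x], chi A x) \<in> set D"
      unfolding opre_seq_oracle der_def by blast
    have "\<exists>c<t. valid (map YR [0..<l']) (dec c) \<and> (rcode p, [x], chi A x) \<in> set (dec c :: judg list)"
      if h: "t \<ge> max l (Suc (enc D))" "l' \<ge> max l (Suc (enc D))" for t l'
    proof (intro exI[of _ "enc D"] conjI)
      show "enc D < t" using h(1) by simp
      show "valid (map YR [0..<l']) (dec (enc D))" unfolding dec_enc
        using valid_mono[OF D(1), of "map YR [0..<l']"] h(2) by simp
      show "(rcode p, [x], chi A x) \<in> set (dec (enc D) :: judg list)" unfolding dec_enc by (rule D(2))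
    qed
    then show ?thesis by blast
  qed
  from ex have "\<forall>x. \<exists>m. \<forall>t\<ge>m. \<forall>l\<ge>m. \<exists>c<t. valid (map YR [0..<l]) (dec c) \<and> (rcode p, [x], chi A x) \<in> set (dec c :: judg list)" by (rule allI)
  from choice[OF this] obtain m where m: "\<forall>x. \<forall>t\<ge>m x. \<forall>l\<ge>m x. \<exists>c<t. valid (map YR [0..<l]) (dec c) \<and> (rcode p, [x], chi A x) \<in> set (dec c :: judg list)" by (elim exE)
  define M where "M = Max (insert 0 (m ` {..<n}))"
  have M: "m x \<le> M" if "x < n" for x unfolding M_def using that by (intro Max_ge) auto
  have "cmps t (map YR [0..<l]) (As n)" if h: "t \<ge> M" "l \<ge> M" for t l
    unfolding cmps_def length_As
  proof (intro allI impI)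
    fix x assume x: "x < n"
    have "(if nthd False (As n) x then 1 else 0) = chi A x" using x by (simp add: nthd_simp nth_As chi_def)
    moreover have "\<exists>c<t. valid (map YR [0..<l]) (dec c) \<and> (rcode p, [x], chi A x) \<in> set (dec c :: judg list)"
    proof -
      have "m x \<le> t" "m x \<le> l" using M[OF x] h by simp_all
      then show ?thesis using m by (elim allE[of _ x] allE[of _ t] allE[of _ l] impE)
    qed
    ultimately show "\<exists>c<t. valid (map YR [0..<l]) (dec c) \<and> (rcode p, [x], if nthd False (As n) x then 1 else 0) \<in> set (dec c :: judg list)"
      by (simp only:)
  qed
  then show ?thesis by blast
qed

lemma cmps_A_rz: "\<exists>m. \<forall>t\<ge>m. cmps t (rz (pre Omega t)) (As n)"
proof -
  obtain m where m: "\<forall>t\<ge>m. \<forall>l\<ge>m. cmps t (map YR [0..<l]) (As n)" using cmps_A by blast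
  obtain k where k: "m \<le> cnt k" using cnt_unbounded by blast
  have "rz (pre Omega t) = map YR [0..<cnt t]" for t unfolding pre_def YR_eq by (rule rz_map)
  moreover have "cmps t (map YR [0..<cnt t]) (As n)" if "t \<ge> max m k" for t
  proof -
    have "m \<le> t" "m \<le> cnt t" using that k cnt_mono[of k t] by simp_all
    then show ?thesis using m by simp
  qed
  ultimately have "\<forall>t\<ge>max m k. cmps t (rz (pre Omega t)) (As n)" by simp
  then show ?thesis by blast
qed

text \<open>Here the string itself is the oracle; in \<open>IZ\<close> below it is a real near
  \<open>Omega\<close>, and its bits on \<open>R\<close> are the oracle.\<close>

definition SW :: "nat \<Rightarrow> bool list \<Rightarrow> bool list set" where "SW t u = {W. length W = t \<and> cmps t W u}"
definition mW :: "nat \<Rightarrow> bool list \<Rightarrow> real" where "mW t u = card (SW t u) / 2 ^ t"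

lemma mW_mu: "mW t u = mu (ucyl (SW t u))"
  unfolding mW_def by (rule mu_level[symmetric]) (auto simp: SW_def)

lemma crat_mW: "cpt t \<Longrightarrow> cpt u \<Longrightarrow> crat (\<lambda>x. mW (t x) (u x))"
proof -
  have "crat (\<lambda>q. mW (fst q) (snd q))" unfolding mW_def SW_def
    by (intro crat_div_pow crat_nat cpt_card_level cpt_cmps cpt_fst cpt_snd cpt_id)
  from crat_comp[OF this cpt_Pair] show "cpt t \<Longrightarrow> cpt u \<Longrightarrow> crat (\<lambda>x. mW (t x) (u x))" by simp
qed

lemma in_SW: "Z \<in> ucyl (SW t u) \<longleftrightarrow> cmps t (map Z [0..<t]) u"
proof
  assume "Z \<in> ucyl (SW t u)"
  then obtain W where W: "length W = t" "cmps t W u" "Z \<in> cyl W" unfolding ucyl_def SW_def by blast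
  then have "map Z [0..<t] = W" by (simp add: in_cyl_map)
  then show "cmps t (map Z [0..<t]) u" using W(2) by simp
next
  assume "cmps t (map Z [0..<t]) u"
  then have "map Z [0..<t] \<in> SW t u" unfolding SW_def by simp
  moreover have "Z \<in> cyl (map Z [0..<t])" by (simp add: in_cyl_nth)
  ultimately show "Z \<in> ucyl (SW t u)" unfolding ucyl_def by blast
qed

lemma SW_mono: "t \<le> t' \<Longrightarrow> ucyl (SW t u) \<subseteq> ucyl (SW t' u)"
  unfolding subset_iff in_SW by (intro allI impI, erule cmps_mono) (simp_all add: take_map)

lemma mW_mono: "t \<le> t' \<Longrightarrow> mW t u \<le> mW t' u" unfolding mW_mu by (intro mu_mono SW_mono sets_ucyl)

definition IZ :: "nat \<Rightarrow> nat \<Rightarrow> bool list \<Rightarrow> bool list set" where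
  "IZ t x u = {z. length z = t \<and> (Om x \<le> lo z \<and> hi z \<le> Om t \<and> cmps t (rz z) u)}"

definition mZ :: "nat \<Rightarrow> nat \<Rightarrow> bool list \<Rightarrow> real" where "mZ t x u = card (IZ t x u) / 2 ^ t"

lemma mZ_mu: "mZ t x u = mu (ucyl (IZ t x u))"
  unfolding mZ_def by (rule mu_level[symmetric]) (auto simp: IZ_def)

lemma crat_mZ: "cpt t \<Longrightarrow> cpt n \<Longrightarrow> cpt u \<Longrightarrow> crat (\<lambda>x. mZ (t x) (n x) (u x))"
proof -
  have "crat (\<lambda>q. mZ (fst q) (fst (snd q)) (snd (snd q)))" unfolding mZ_def IZ_def
    by (intro crat_div_pow crat_nat cpt_card_level cpt_conj cpt_crat crat_Om crat_lo crat_hi cpt_cmps cpt_rz cpt_fst cpt_snd cpt_id)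
  from crat_comp[OF this cpt_Pair[OF _ cpt_Pair]] show "cpt t \<Longrightarrow> cpt n \<Longrightarrow> cpt u \<Longrightarrow> crat (\<lambda>x. mZ (t x) (n x) (u x))" by simp
qed

lemma cmps_rz_ext:
  assumes "cmps t (rz z) u" "t \<le> t'" "take (length z) z' = z" shows "cmps t' (rz z') u"
proof -
  have "length (take (length z) z') = length z" unfolding assms(3) ..
  then have l: "length z \<le> length z'" by simp
  have "take (length (rz z)) (rz z') = rz z" using rz_take[OF l] unfolding assms(3) length_rz by simp
  with assms(1,2) show ?thesis using cnt_mono[OF l] by - (rule cmps_mono[of t "rz z"], simp_all)
qed

text \<open>The fraction \<open>2 ^ (-d)\<close> of the stretch from marker \<open>x\<close> to
  stage \<open>s\<close>. It is both the density that is asked for and the room beyond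
  \<open>Om s\<close> that the test may claim.\<close>

definition ext :: "nat \<Rightarrow> nat \<Rightarrow> nat \<Rightarrow> real" where "ext d s x = (Om s - Om x) / 2 ^ d"

lemma crat_ext: "cpt d \<Longrightarrow> cpt s \<Longrightarrow> cpt n \<Longrightarrow> crat (\<lambda>x. ext (d x) (s x) (n x))"
  unfolding ext_def by (intro crat_div_pow crat_diff crat_Om)

definition sat :: "nat \<Rightarrow> bool list \<Rightarrow> nat \<Rightarrow> nat \<Rightarrow> bool" where
  "sat d u x s \<longleftrightarrow> ext d s x \<le> mZ s x (take (Suc x) u)"

text \<open>\<open>mk d u s\<close> is the last marker up to stage \<open>s\<close> along the path \<open>u\<close>: a marker \<open>x\<close> is
  replaced by \<open>s\<close> once the oracles computing \<open>u|(x+1)\<close> have density \<open>2\<^sup>-\<^sup>d\<close> in \<open>[Om x, Om s)\<close>.\<close>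

definition mk :: "nat \<Rightarrow> bool list \<Rightarrow> nat \<Rightarrow> nat" where
  "mk d u s = rec_nat 0 (\<lambda>s x. if sat d u x (Suc s) then Suc s else x) s"

lemma mk_0 [simp]: "mk d u 0 = 0" by (simp add: mk_def)
lemma mk_Suc: "mk d u (Suc s) = (if sat d u (mk d u s) (Suc s) then Suc s else mk d u s)" by (simp add: mk_def)

lemma mk_le: "mk d u s \<le> s" by (induction s) (auto simp: mk_Suc)

text \<open>The marker at stage \<open>s\<close> has consulted only the first \<open>s\<close> bits
  of the path, which lets it be computed along finite strings.\<close>

lemma mk_cong: "take s u = take s u' \<Longrightarrow> mk d u s = mk d u' s"
proof (induction s)
  case (Suc s)
  have t: "take k u = take k u'" if "k \<le> Suc s" for k
    using Suc.prems that by (metis min.absorb2 take_take min.commute)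
  have "mk d u s = mk d u' s" using Suc.IH t[of s] by simp
  moreover have "take (Suc (mk d u s)) u = take (Suc (mk d u s)) u'" using mk_le[of d u s] by (intro t) simp
  ultimately show ?case unfolding mk_Suc sat_def by simp
qed simp

lemma mk_stay: assumes "mk d u s = x" "x \<le> m" "m \<le> s" shows "mk d u m = x"
proof -
  have mono: "mk d u m \<le> mk d u n" if "m \<le> n" for m n
    by (rule lift_Suc_mono_le[OF _ that]) (use mk_le[of d u] in \<open>simp add: mk_Suc le_SucI\<close>)
  have idem: "mk d u (mk d u s) = mk d u s" for s
  proof (induction s)
    case (Suc s) then show ?case by (cases "sat d u (mk d u s) (Suc s)") (simp_all add: mk_Suc)
  qed simp
  have "mk d u x = x" using idem[of s] assms(1) by simp
  then show ?thesis using mono[OF assms(2)] mono[OF assms(3)] assms(1) by simp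
qed

lemma cpt_sat: "cpt d \<Longrightarrow> cpt u \<Longrightarrow> cpt n \<Longrightarrow> cpt s \<Longrightarrow> cpt (\<lambda>x. sat (d x) (u x) (n x) (s x))"
  unfolding sat_def by (intro cpt_crat crat_ext crat_mZ cpt_take cpt_Suc)

lemma cpt_mk: assumes "cpt d" "cpt u" "cpt s" shows "cpt (\<lambda>x. mk (d x) (u x) (s x))"
  unfolding mk_def
  by (intro cpt_rec_nat cpt_If cpt_sat cpt_Suc cpt_const cpt_comp[OF assms(1)] cpt_comp[OF assms(2)] cpt_fst cpt_snd cpt_id assms)

end

text \<open>Rounding \<open>a\<close> up to a multiple of the unit may lose almost one unit, hence
  the room for two. Users therefore spend one bit more than the exponent of their interval.\<close>

lemma string_in_interval:
  assumes "0 \<le> a" "c \<le> 1" "2 / 2 ^ l \<le> c - a" shows "\<exists>z. length z = l \<and> a \<le> lo z \<and> hi z \<le> c"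
proof -
  define i where "i = nat \<lceil>a * 2 ^ l\<rceil>"
  have "0 \<le> a * 2 ^ l" using assms(1) by simp
  then have i: "a * 2 ^ l \<le> real i" "real i < a * 2 ^ l + 1" unfolding i_def by linarith+
  have ac: "a * 2 ^ l + 2 \<le> c * 2 ^ l" using assms(3) by (simp add: field_simps)
  moreover have "c * 2 ^ l \<le> 1 * 2 ^ l" using assms(2) by (intro mult_right_mono) simp_all
  ultimately have "real i < 2 ^ l" using i by linarith
  then have "i < 2 ^ l" by (simp only: of_nat_less_numeral_power_cancel_iff)
  from nval_surj[OF this] obtain z where z: "length z = l" "nval z = i" by blast
  have "a \<le> lo z" unfolding lo_def z using i(1) by (simp add: pos_le_divide_eq)
  moreover have "hi z \<le> c" unfolding hi_def z using i(2) ac by (simp add: pos_divide_le_eq)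
  ultimately show ?thesis using z(1) by blast
qed

lemma cyl_nested: assumes "Z \<in> cyl z" "Z \<in> cyl z'" shows "lo z < hi z'"
proof -
  have t: "take (length z) z' = z" if h: "Z \<in> cyl z" "Z \<in> cyl z'" "length z \<le> length z'" for z z'
  proof -
    have "take (length z) (map Z [0..<length z']) = map Z [0..<length z]" using h(3) by (simp add: take_map)
    with h(1,2) show ?thesis by (simp only: in_cyl_map)
  qed
  show ?thesis
  proof (cases "length z \<le> length z'")
    case True
    from t[OF assms True] have "lo z \<le> lo z'" using lo_hi_take(1)[where k = "length z" and z = z'] by simp
    then show ?thesis using lo_hi[of z'] by simp
  next
    case False
    then have "length z' \<le> length z" by simp
    from t[OF assms(2,1) this] have "hi z \<le> hi z'" using lo_hi_take(2)[where k = "length z'" and z = z] by simp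
    then show ?thesis using lo_hi[of z] by simp
  qed
qed

lemma ucyl_Un: "ucyl (S \<union> T) = ucyl S \<union> ucyl T" unfolding ucyl_def by blast

context omega_A
begin

section \<open>Descriptions paid for by the increments of \<open>Omega\<close>\<close>

definition de :: "nat \<Rightarrow> nat" where
  "de n = (LEAST e. Om n < Om (Suc n) \<longrightarrow> 1 / 2 ^ e \<le> Om (Suc n) - Om n)"

lemma de_ex: "\<exists>e. Om n < Om (Suc n) \<longrightarrow> 1 / 2 ^ e \<le> Om (Suc n) - Om n"
proof (cases "Om n < Om (Suc n)")
  case True
  then obtain e where "(1 / 2 :: real) ^ e < Om (Suc n) - Om n" using real_arch_pow_inv[of "Om (Suc n) - Om n" "1/2"] by auto
  then show ?thesis by (intro exI[of _ e]) (simp add: power_one_over)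
qed simp

lemma cpt_de: "cpt f \<Longrightarrow> cpt (\<lambda>x. de (f x))"
proof -
  have "cpt (\<lambda>n. LEAST e. Om n < Om (Suc n) \<longrightarrow> 1 / 2 ^ e \<le> Om (Suc n) - Om n)"
    by (intro cpt_Least0[OF _ de_ex] cpt_imp cpt_crat crat_Om crat_diff crat_inv_pow cpt_Suc cpt_fst cpt_snd cpt_id)
  then have "cpt de" unfolding de_def .
  then show "cpt f \<Longrightarrow> cpt (\<lambda>x. de (f x))" by (rule cpt_comp)
qed

lemma de: assumes "Om n < Om (Suc n)" shows "1 / 2 ^ de n \<le> Om (Suc n) - Om n" "Om (Suc n) - Om n \<le> 2 / 2 ^ de n"
proof -
  have "Om n < Om (Suc n) \<longrightarrow> 1 / 2 ^ de n \<le> Om (Suc n) - Om n" unfolding de_def by (rule LeastI_ex[OF de_ex])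
  then show "1 / 2 ^ de n \<le> Om (Suc n) - Om n" using assms by blast
  show "Om (Suc n) - Om n \<le> 2 / 2 ^ de n"
  proof (cases "de n")
    case 0 then show ?thesis using Om_nonneg[of n] Om_less_1[of "Suc n"] by simp
  next
    case (Suc e)
    then have "e < de n" by simp
    then have "\<not> (Om n < Om (Suc n) \<longrightarrow> 1 / 2 ^ e \<le> Om (Suc n) - Om n)" unfolding de_def by (rule not_less_Least)
    then show ?thesis unfolding Suc by simp
  qed
qed

text \<open>The intervals from \<open>Om n\<close> to \<open>Om (Suc n)\<close> do not overlap, so
  they can serve as codes for \<open>Suc n\<close>; triviality carries the bound over to the initial
  segments of \<open>A\<close>.\<close>

lemma payments: "\<exists>B. \<forall>n. Om n < Om (Suc n) \<longrightarrow> Kc U (As (Suc n)) \<le> de n + B"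
proof -
  let ?P = "\<lambda>c n z. c = (0::nat) \<and> Om n < Om (Suc n) \<and> length z = Suc (de n) \<and> Om n \<le> lo z \<and> hi z \<le> Om (Suc n)"
  have ce: "ce (\<lambda>q. ?P (fst q) (fst (snd q)) (snd (snd q)))"
    by (intro ce_cpt cpt_conj cpt_eq cpt_crat crat_Om crat_lo crat_hi cpt_length cpt_Suc cpt_de cpt_const cpt_fst cpt_snd cpt_id)
  have "\<exists>k. \<forall>c n z. ?P c n z \<longrightarrow> Kc U (str_of (Suc n)) \<le> length z + c + k"
  proof (rule Kc_intervals[OF U, where P = ?P and f = "\<lambda>c n. Om n", OF ce])
    fix k assume "\<And>c n z. ?P c n z \<Longrightarrow> Kc U (str_of (Suc n)) \<le> length z + c + k"
    then show "\<exists>k. \<forall>c n z. ?P c n z \<longrightarrow> Kc U (str_of (Suc n)) \<le> length z + c + k" by (intro exI[of _ k] allI impI)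
  qed (auto intro: Om_mono)
  then obtain k where k: "\<forall>c n z. ?P c n z \<longrightarrow> Kc U (str_of (Suc n)) \<le> length z + c + k" by (elim exE)
  have "Kc U (As (Suc n)) \<le> de n + (1 + k + b)" if h: "Om n < Om (Suc n)" for n
  proof -
    have "2 / 2 ^ Suc (de n) \<le> Om (Suc n) - Om n" using de(1)[OF h] by simp
    from string_in_interval[OF Om_nonneg less_imp_le[OF Om_less_1] this]
    obtain z where z: "length z = Suc (de n)" "Om n \<le> lo z" "hi z \<le> Om (Suc n)" by blast
    have "Kc U (str_of (Suc n)) \<le> length z + 0 + k" using k[rule_format, of 0 n z] h z by simp
    then show ?thesis using KA[of "Suc n"] z(1) by simp
  qed
  then show ?thesis by blast
qed

text \<open>A c.e. condition that all initial segments of \<open>A\<close> meet for the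
  \<open>B\<close> of \<open>payments\<close>. It restricts the test to strings on which
  \<open>U\<close> spends weight, so that the weight of \<open>U\<close> can bound the
  measure.\<close>

definition paid :: "nat \<Rightarrow> bool list \<Rightarrow> bool" where
  "paid B u \<longleftrightarrow> (\<forall>n<length u. Om n < Om (Suc n) \<longrightarrow> Kc U (take (Suc n) u) \<le> de n + B)"

lemma paid_iff: "paid B u \<longleftrightarrow> (\<exists>t. \<forall>n<length u. Om n < Om (Suc n) \<longrightarrow> KS (rcode U) t (take (Suc n) u) (de n + B))"
proof
  assume *: "paid B u"
  have "\<forall>n. \<exists>t. n < length u \<longrightarrow> Om n < Om (Suc n) \<longrightarrow> KS (rcode U) t (take (Suc n) u) (de n + B)"
  proof
    fix n
    show "\<exists>t. n < length u \<longrightarrow> Om n < Om (Suc n) \<longrightarrow> KS (rcode U) t (take (Suc n) u) (de n + B)"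
    proof (cases "n < length u \<and> Om n < Om (Suc n)")
      case True
      then have "Kc U (take (Suc n) u) \<le> de n + B" using * unfolding paid_def by simp
      then obtain t where "KS (rcode U) t (take (Suc n) u) (de n + B)" unfolding Kc_iff_KS[OF U] by (elim exE)
      then show ?thesis by (intro exI[of _ t] impI)
    next
      case False then show ?thesis by (intro exI[of _ 0]) simp
    qed
  qed
  from choice[OF this] obtain t where t: "\<forall>n. n < length u \<longrightarrow> Om n < Om (Suc n) \<longrightarrow> KS (rcode U) (t n) (take (Suc n) u) (de n + B)"
    by (elim exE)
  define T where "T = Max (insert 0 (t ` {..<length u}))"
  have "KS (rcode U) T (take (Suc n) u) (de n + B)" if h: "n < length u" "Om n < Om (Suc n)" for n
  proof -
    have "t n \<le> T" unfolding T_def using h(1) by (intro Max_ge) auto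
    moreover have "KS (rcode U) (t n) (take (Suc n) u) (de n + B)" by (rule t[rule_format, OF h])
    ultimately show ?thesis using KS_mono by blast
  qed
  then show "\<exists>t. \<forall>n<length u. Om n < Om (Suc n) \<longrightarrow> KS (rcode U) t (take (Suc n) u) (de n + B)"
    by (intro exI[of _ T] allI impI)
next
  assume "\<exists>t. \<forall>n<length u. Om n < Om (Suc n) \<longrightarrow> KS (rcode U) t (take (Suc n) u) (de n + B)"
  then obtain t where t: "\<forall>n<length u. Om n < Om (Suc n) \<longrightarrow> KS (rcode U) t (take (Suc n) u) (de n + B)" by (elim exE)
  show "paid B u" unfolding paid_def Kc_iff_KS[OF U]
  proof (intro allI impI exI[of _ t])
    fix n assume "n < length u" "Om n < Om (Suc n)"
    then show "KS (rcode U) t (take (Suc n) u) (de n + B)" using t by simp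
  qed
qed

lemma ce_paid: assumes "cpt f" shows "ce (\<lambda>x. paid B (f x))"
  unfolding paid_iff
  by (intro ce_ex ce_cpt cpt_all_less cpt_imp cpt_crat crat_Om cpt_KS cpt_take cpt_add cpt_de cpt_Suc cpt_length cpt_comp[OF assms]
      cpt_const cpt_fst cpt_snd cpt_id)

text \<open>What a path contributes to a test against \<open>Omega\<close>. If its marker is
  saturated, the stretch of length \<open>ext\<close> above \<open>Om s\<close>, which
  \<open>Omega\<close> must then skip; otherwise the reals up to there whose bits on
  \<open>R\<close> compute the path beyond its marker, among them \<open>Omega\<close> if the marker
  stays forever. The lower bound on \<open>ext\<close> keeps the strings short against it.\<close>

definition reg :: "nat \<Rightarrow> bool list \<Rightarrow> nat \<Rightarrow> nat \<Rightarrow> bool list \<Rightarrow> bool" where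
  "reg d u x s z \<longleftrightarrow> (if sat d u x s then Om s \<le> lo z \<and> hi z \<le> Om s + ext d s x
     else length z = s \<and> 1 / 2 ^ s \<le> ext d s x \<and> cmps s (rz z) (take (Suc x) u) \<and> Om x \<le> lo z \<and> hi z \<le> Om s + ext d s x)"

definition lm :: "nat \<Rightarrow> bool list \<Rightarrow> nat" where "lm d u = mk d u (length u - 1)"

definition dtest :: "nat \<Rightarrow> nat \<Rightarrow> bool list \<Rightarrow> bool" where
  "dtest B d z \<longleftrightarrow> (\<exists>u. 0 < length u \<and> paid B u \<and> reg d u (lm d u) (length u) z)"

lemma cpt_reg: "cpt d \<Longrightarrow> cpt u \<Longrightarrow> cpt n \<Longrightarrow> cpt s \<Longrightarrow> cpt z \<Longrightarrow> cpt (\<lambda>x. reg (d x) (u x) (n x) (s x) (z x))"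
  unfolding reg_def
  by (intro cpt_If cpt_sat cpt_conj cpt_crat crat_Om crat_lo crat_hi crat_add crat_ext crat_inv_pow cpt_eq cpt_length cpt_cmps cpt_rz cpt_take cpt_Suc)

lemma cpt_lm: "cpt d \<Longrightarrow> cpt u \<Longrightarrow> cpt (\<lambda>x. lm (d x) (u x))"
  unfolding lm_def by (intro cpt_mk cpt_diff cpt_length cpt_const)

lemma ce_dtest: "ce (\<lambda>q. dtest B (fst q) (snd q))"
  unfolding dtest_def
  by (intro ce_ex_str ce_conj ce_paid ce_cpt cpt_less cpt_reg cpt_lm cpt_length cpt_const cpt_fst cpt_snd cpt_id)

text \<open>Paths with the same key contribute to the same region and are bounded together;
  different keys will be charged to disjoint sets of strings.\<close>

definition key :: "nat \<Rightarrow> bool list \<Rightarrow> nat \<times> bool list" where "key d u = (lm d u, take (Suc (lm d u)) u)"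

lemma lm_less: "0 < length u \<Longrightarrow> lm d u < length u"
  unfolding lm_def using mk_le[of d u "length u - 1"] by linarith

lemma key_take: assumes "0 < length u" "lm d u < n" "n \<le> length u" shows "key d (take n u) = key d u"
proof -
  have "lm d (take n u) = mk d u (n - 1)" 
  proof -
    have "length (take n u) - 1 = n - 1" using assms(3) by simp
    moreover have "mk d (take n u) (n - 1) = mk d u (n - 1)" by (rule mk_cong) (simp add: min_def)
    ultimately show ?thesis unfolding lm_def by (simp only:)
  qed
  also have "\<dots> = lm d u" by (rule mk_stay[of d u "length u - 1"]) (use assms in \<open>auto simp: lm_def\<close>)
  finally show ?thesis unfolding key_def using assms(2) by (simp add: min_def)
qed

text \<open>Saturation at stage \<open>s\<close> would have moved the marker to
  \<open>s\<close>.\<close>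

lemma not_sat_before: assumes "lm d u < s" "s < length u" shows "\<not> sat d u (lm d u) s"
proof -
  obtain s' where s': "s = Suc s'" using assms(1) by (cases s) auto
  have m: "mk d u m = lm d u" if "lm d u \<le> m" "m < length u" for m
    by (rule mk_stay[of d u "length u - 1"]) (use that in \<open>auto simp: lm_def\<close>)
  have "mk d u s = lm d u" "mk d u s' = lm d u" using m[of s] m[of s'] assms s' by simp_all
  then show ?thesis using assms(1) unfolding s' mk_Suc by (metis less_irrefl)
qed

lemma ext_mono: "s \<le> s' \<Longrightarrow> ext d s x \<le> ext d s' x"
  unfolding ext_def using Om_mono by (intro divide_right_mono diff_right_mono) simp_all

text \<open>Strings up to \<open>Om L\<close> belong to a set of measure below \<open>ext\<close>,
  since saturation has not been reached. The others stick out over \<open>Om L\<close> and, being no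
  longer than \<open>ext\<close>, stay within distance \<open>ext\<close> of it on both
  sides.\<close>

lemma unsat_measure:
  assumes F: "finite F" "\<And>z. z \<in> F \<Longrightarrow> \<exists>s\<le>L. length z = s \<and> 1 / 2 ^ s \<le> ext d s x \<and> cmps s (rz z) w \<and> Om x \<le> lo z \<and> hi z \<le> Om s + ext d s x"
    and L: "mZ L x w < ext d L x"
  shows "mu (ucyl F) \<le> 3 * ext d L x"
proof -
  let ?G = "{z \<in> F. Om L < hi z}"
  have e0: "0 \<le> ext d L x" using L unfolding mZ_def by (smt (verit) divide_nonneg_nonneg of_nat_0_le_iff zero_le_power)
  have sub: "ucyl F \<subseteq> ucyl (IZ L x w) \<union> ucyl ?G"
  proof
    fix Z assume "Z \<in> ucyl F"
    then obtain z where z: "z \<in> F" "Z \<in> cyl z" unfolding ucyl_def by blast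
    from F(2)[OF z(1)] obtain s where s: "s \<le> L" "length z = s" "cmps s (rz z) w" "Om x \<le> lo z" by blast
    show "Z \<in> ucyl (IZ L x w) \<union> ucyl ?G"
    proof (cases "Om L < hi z")
      case True then show ?thesis using z unfolding ucyl_def by blast
    next
      case False
      let ?z = "map Z [0..<L]"
      have t: "take (length z) ?z = z" using z(2) s(1,2) unfolding in_cyl_map by (simp add: take_map)
      have "lo z \<le> lo ?z" "hi ?z \<le> hi z" using lo_hi_take[where k = "length z" and z = ?z] unfolding t by simp_all
      then have "?z \<in> IZ L x w" unfolding IZ_def using cmps_rz_ext[OF s(3,1) t] False s(4) by simp
      moreover have "Z \<in> cyl ?z" by (simp add: in_cyl_nth)
      ultimately show ?thesis unfolding ucyl_def by blast
    qed
  qed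
  have g: "mu (ucyl ?G) \<le> (Om L + ext d L x) - (Om L - ext d L x)"
  proof (rule mu_interval)
    fix z assume "z \<in> ?G"
    then have z: "z \<in> F" "Om L < hi z" by simp_all
    from F(2)[OF z(1)] obtain s where s: "s \<le> L" "length z = s" "1 / 2 ^ s \<le> ext d s x" "hi z \<le> Om s + ext d s x" by blast
    have "ext d s x \<le> ext d L x" "Om s \<le> Om L" by (rule ext_mono[OF s(1)], rule Om_mono[OF s(1)])
    then show "Om L - ext d L x \<le> lo z \<and> hi z \<le> Om L + ext d L x" using z(2) s(3,4) hi_lo[of z] unfolding s(2) by linarith
  qed (use F(1) e0 in simp_all)
  have "mu (ucyl F) \<le> mu (ucyl (IZ L x w) \<union> ucyl ?G)" by (rule mu_mono[OF sub]) (intro sets.Un sets_ucyl)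
  also have "\<dots> \<le> mu (ucyl (IZ L x w)) + mu (ucyl ?G)" by (rule mu_Un_le) simp_all
  finally show ?thesis using g L unfolding mZ_mu by linarith
qed

lemma sat_measure:
  assumes F: "finite F" "\<And>z. z \<in> F \<Longrightarrow> Om L \<le> lo z \<and> hi z \<le> Om L + ext d L x" and "x \<le> L"
  shows "mu (ucyl F) \<le> ext d L x"
proof -
  have "0 \<le> ext d L x" unfolding ext_def using Om_mono[OF assms(3)] by simp
  then show ?thesis using mu_interval[of F "Om L" "Om L + ext d L x"] F by simp
qed

text \<open>Only the longest path can be saturated at its own length, otherwise the marker would
  have moved. So there is one \<open>ext\<close> for a saturated last stage and three from
  \<open>unsat_measure\<close> for the unsaturated ones.\<close>

lemma key_measure:
  assumes S: "finite S" "S \<noteq> {}" "\<And>u. u \<in> S \<Longrightarrow> 0 < length u \<and> key d u = (x, w)"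
    and L: "L = Max (length ` S)"
    and F: "finite F" "\<And>z. z \<in> F \<Longrightarrow> \<exists>u\<in>S. reg d u (lm d u) (length u) z"
  shows "mu (ucyl F) \<le> 4 * ext d L x"
proof -
  have "L \<in> length ` S" unfolding L using S by (intro Max_in) simp_all
  then obtain v where v: "v \<in> S" "length v = L" by blast
  have le: "length u \<le> L" if "u \<in> S" for u unfolding L using S(1) that by (intro Max_ge) simp_all
  have k: "lm d u = x" "take (Suc x) u = w" "0 < length u" if "u \<in> S" for u
    using S(3)[OF that] unfolding key_def by auto
  have x: "x < L" using lm_less[OF k(3)[OF v(1)], of d] unfolding k(1)[OF v(1)] v(2) .
  have e0: "0 \<le> ext d L x" unfolding ext_def using Om_mono[of x L] x by simp
  have st: "sat d u x s \<longleftrightarrow> ext d s x \<le> mZ s x w" if "u \<in> S" for u s unfolding sat_def k(2)[OF that] ..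
  have rg: "reg d u (lm d u) s z \<longleftrightarrow> (if ext d s x \<le> mZ s x w then Om s \<le> lo z \<and> hi z \<le> Om s + ext d s x
     else length z = s \<and> 1 / 2 ^ s \<le> ext d s x \<and> cmps s (rz z) w \<and> Om x \<le> lo z \<and> hi z \<le> Om s + ext d s x)" if "u \<in> S" for u s z
    unfolding reg_def k(1)[OF that] k(2)[OF that] st[OF that] ..
  have early: "\<not> ext d s x \<le> mZ s x w" if "x < s" "s < L" for s
    using not_sat_before[of d v s] that unfolding k(1)[OF v(1)] v(2) st[OF v(1)] by simp
  have lx: "x < length u" if "u \<in> S" for u using lm_less[OF k(3)[OF that], of d] unfolding k(1)[OF that] .
  have unsat: "\<exists>s\<le>N. length z = s \<and> 1 / 2 ^ s \<le> ext d s x \<and> cmps s (rz z) w \<and> Om x \<le> lo z \<and> hi z \<le> Om s + ext d s x"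
    if h: "u \<in> S" "reg d u (lm d u) (length u) z" "length u \<le> N" "\<not> ext d (length u) x \<le> mZ (length u) x w" for u z N
    using h(2,3,4) unfolding rg[OF h(1)] by auto
  show ?thesis
  proof (cases "ext d L x \<le> mZ L x w")
    case False
    have "mu (ucyl F) \<le> 3 * ext d L x"
    proof (rule unsat_measure[OF F(1)])
      fix z assume "z \<in> F"
      then obtain u where u: "u \<in> S" "reg d u (lm d u) (length u) z" using F(2) by blast
      have "\<not> ext d (length u) x \<le> mZ (length u) x w"
        using early[of "length u"] le[OF u(1)] lx[OF u(1)] False by (cases "length u = L") simp_all
      from unsat[OF u le[OF u(1)] this]
      show "\<exists>s\<le>L. length z = s \<and> 1 / 2 ^ s \<le> ext d s x \<and> cmps s (rz z) w \<and> Om x \<le> lo z \<and> hi z \<le> Om s + ext d s x" .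
    qed (use False in simp)
    then show ?thesis using e0 by simp
  next
    case True
    let ?F1 = "{z \<in> F. \<exists>u\<in>S. length u = L \<and> reg d u (lm d u) L z}" and ?F2 = "{z \<in> F. \<exists>u\<in>S. length u < L \<and> reg d u (lm d u) (length u) z}"
    have "F \<subseteq> ?F1 \<union> ?F2"
    proof
      fix z assume z: "z \<in> F"
      then obtain u where u: "u \<in> S" "reg d u (lm d u) (length u) z" using F(2) by blast
      show "z \<in> ?F1 \<union> ?F2"
      proof (cases "length u = L")
        case True
        then have "z \<in> ?F1" using u z by (intro CollectI conjI bexI[of _ u]) simp_all
        then show ?thesis by (rule UnI1)
      next
        case False
        then have "z \<in> ?F2" using u z le[OF u(1)] by (intro CollectI conjI bexI[of _ u]) simp_all
        then show ?thesis by (rule UnI2)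
      qed
    qed
    then have "ucyl F \<subseteq> ucyl ?F1 \<union> ucyl ?F2" unfolding ucyl_Un[symmetric] by (rule ucyl_mono)
    then have "mu (ucyl F) \<le> mu (ucyl ?F1 \<union> ucyl ?F2)" by (rule mu_mono) (intro sets.Un sets_ucyl)
    also have "\<dots> \<le> mu (ucyl ?F1) + mu (ucyl ?F2)" by (rule mu_Un_le) simp_all
    finally have 0: "mu (ucyl F) \<le> mu (ucyl ?F1) + mu (ucyl ?F2)" .
    have 1: "mu (ucyl ?F1) \<le> ext d L x"
    proof (rule sat_measure)
      fix z assume "z \<in> ?F1"
      then obtain u where u: "u \<in> S" "reg d u (lm d u) L z" by blast
      then show "Om L \<le> lo z \<and> hi z \<le> Om L + ext d L x" using True unfolding rg[OF u(1)] by simp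
    qed (use F(1) x in simp_all)
    have 2: "mu (ucyl ?F2) \<le> 3 * ext d L x"
    proof (cases "x < L - 1")
      case True
      have "mu (ucyl ?F2) \<le> 3 * ext d (L - 1) x"
      proof (rule unsat_measure)
        fix z assume "z \<in> ?F2"
        then obtain u where u: "u \<in> S" "reg d u (lm d u) (length u) z" "length u < L" by blast
        show "\<exists>s\<le>L - 1. length z = s \<and> 1 / 2 ^ s \<le> ext d s x \<and> cmps s (rz z) w \<and> Om x \<le> lo z \<and> hi z \<le> Om s + ext d s x"
          by (rule unsat[OF u(1,2)]) (use u(3) early[of "length u"] lx[OF u(1)] in simp_all)
      qed (use F(1) early[of "L - 1"] True in simp_all)
      then show ?thesis using ext_mono[of "L - 1" L d x] by simp
    next
      case False
      have "length u < L \<longrightarrow> u \<notin> S" for u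
      proof (intro impI notI)
        assume "length u < L" "u \<in> S"
        then show False using lx[of u] False by linarith
      qed
      then have e: "?F2 = {}" by blast
      show ?thesis unfolding e using e0 by (simp add: ucyl_def mu_def)
    qed
    show ?thesis using 0 1 2 by simp
  qed
qed

text \<open>Telescoping: each increment is at most twice \<open>2 ^ (-de n)\<close>, and
  \<open>paid\<close> bounds that by \<open>2 ^ Suc B\<close> times the weight of an initial segment
  of \<open>u\<close>.\<close>

lemma charge:
  assumes "paid B u" "0 < length u"
  shows "Om (length u) - Om (lm d u) \<le> 2 ^ Suc B * (\<Sum>y\<in>(\<lambda>n. take n u) ` {lm d u<..length u}. 1 / 2 ^ Kc U y)"
proof -
  have inj: "inj_on (\<lambda>n. take n u) {lm d u<..length u}"
    by (intro inj_onI) (metis greaterThanAtMost_iff length_take min.absorb2)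
  have "Om (length u) - Om (lm d u) = (\<Sum>n\<in>{lm d u..<length u}. Om (Suc n) - Om n)"
    using lm_less[OF assms(2), of d] by (subst sum_Suc_diff') simp_all
  also have "\<dots> \<le> (\<Sum>n\<in>{lm d u..<length u}. 2 ^ Suc B * (1 / 2 ^ Kc U (take (Suc n) u)))"
  proof (rule sum_mono)
    fix n assume n: "n \<in> {lm d u..<length u}"
    show "Om (Suc n) - Om n \<le> 2 ^ Suc B * (1 / 2 ^ Kc U (take (Suc n) u))"
    proof (cases "Om n < Om (Suc n)")
      case True
      then have "Kc U (take (Suc n) u) \<le> de n + B" using assms(1) n unfolding paid_def by simp
      then have "(2::real) ^ Kc U (take (Suc n) u) \<le> 2 ^ (de n + B)" by (rule power_increasing) simp
      then have "(1::real) / 2 ^ (de n + B) \<le> 1 / 2 ^ Kc U (take (Suc n) u)" by (intro divide_left_mono) simp_all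
      then have "2 ^ Suc B * ((1::real) / 2 ^ (de n + B)) \<le> 2 ^ Suc B * (1 / 2 ^ Kc U (take (Suc n) u))"
        by (rule mult_left_mono) simp
      moreover have "2 ^ Suc B * ((1::real) / 2 ^ (de n + B)) = 2 / 2 ^ de n" by (simp add: power_add)
      ultimately show ?thesis using de(2)[OF True] by linarith
    next
      case False
      moreover have "0 \<le> 2 ^ Suc B * ((1::real) / 2 ^ Kc U (take (Suc n) u))" by simp
      ultimately show ?thesis by linarith
    qed
  qed
  also have "\<dots> = 2 ^ Suc B * (\<Sum>n\<in>{lm d u..<length u}. 1 / 2 ^ Kc U (take (Suc n) u))" by (rule sum_distrib_left[symmetric])
  also have "(\<Sum>n\<in>{lm d u..<length u}. 1 / 2 ^ Kc U (take (Suc n) u)) = (\<Sum>n\<in>{lm d u<..length u}. (1::real) / 2 ^ Kc U (take n u))"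
    by (rule sum.reindex_bij_witness[of _ "\<lambda>n. n - 1" Suc]) auto
  also have "\<dots> = (\<Sum>y\<in>(\<lambda>n. take n u) ` {lm d u<..length u}. 1 / 2 ^ Kc U y)"
    by (subst sum.reindex[OF inj]) simp
  finally show ?thesis .
qed

text \<open>One longest path per key is charged. Its initial segments beyond the marker have the
  same key, so the charges of different keys are disjoint and Kraft's inequality bounds their sum.
  The factor is \<open>4\<close> from \<open>key_measure\<close> times \<open>2 ^ Suc B\<close> from
  \<open>charge\<close>.\<close>

lemma dtest_measure: "mu (ucyl {z. dtest B d z}) \<le> 2 ^ (B + 3) / 2 ^ d"
proof (rule mu_ucyl_le)
  fix F assume F: "finite F" "F \<subseteq> {z. dtest B d z}"
  have "\<forall>z. \<exists>u. z \<in> F \<longrightarrow> 0 < length u \<and> paid B u \<and> reg d u (lm d u) (length u) z" using F(2) unfolding dtest_def by blast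
  from choice[OF this] obtain g where g: "\<forall>z. z \<in> F \<longrightarrow> 0 < length (g z) \<and> paid B (g z) \<and> reg d (g z) (lm d (g z)) (length (g z)) z"
    by (elim exE)
  define S where "S k = {u \<in> g ` F. key d u = k}" for k
  define K where "K = key d ` g ` F"
  have finS: "finite (S k)" for k unfolding S_def using F(1) by simp
  have finK: "finite K" unfolding K_def using F(1) by simp
  have inS: "0 < length u" "paid B u" "key d u = k" if "u \<in> S k" for u k using that g unfolding S_def by auto
  have neS: "S k \<noteq> {}" if "k \<in> K" for k using that unfolding S_def K_def by blast
  have "\<forall>k. \<exists>u. k \<in> K \<longrightarrow> u \<in> S k \<and> length u = Max (length ` S k)"
  proof
    fix k show "\<exists>u. k \<in> K \<longrightarrow> u \<in> S k \<and> length u = Max (length ` S k)"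
    proof (cases "k \<in> K")
      case True
      then have "Max (length ` S k) \<in> length ` S k" using finS neS by (intro Max_in) simp_all
      then show ?thesis by (metis imageE)
    qed simp
  qed
  from choice[OF this] obtain m where m: "\<forall>k. k \<in> K \<longrightarrow> m k \<in> S k \<and> length (m k) = Max (length ` S k)" by (elim exE)
  define Y where "Y k = (\<lambda>n. take n (m k)) ` {lm d (m k)<..length (m k)}" for k
  have keyY: "key d y = k" if h: "k \<in> K" "y \<in> Y k" for k y
  proof -
    obtain n where n: "y = take n (m k)" "lm d (m k) < n" "n \<le> length (m k)" using h(2) unfolding Y_def by auto
    have mk: "m k \<in> S k" using m[rule_format, OF h(1)] by blast
    show ?thesis unfolding n(1) using key_take[OF inS(1)[OF mk] n(2,3)] inS(3)[OF mk] by (rule trans)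
  qed
  have bound: "mu (ucyl {z \<in> F. key d (g z) = k}) \<le> 2 ^ (B + 3) / 2 ^ d * (\<Sum>y\<in>Y k. 1 / 2 ^ Kc U y)" if k: "k \<in> K" for k
  proof -
    obtain x w where xw: "k = (x, w)" by (cases k)
    have mk: "m k \<in> S k" "length (m k) = Max (length ` S k)" using m[rule_format, OF k] by blast+
    have "lm d (m k) = x" using inS(3)[OF mk(1)] unfolding xw key_def by simp
    have "mu (ucyl {z \<in> F. key d (g z) = k}) \<le> 4 * ext d (length (m k)) x"
    proof (rule key_measure[OF finS neS[OF k]])
      show "0 < length u \<and> key d u = (x, w)" if "u \<in> S k" for u using inS[OF that] xw by simp
      show "\<exists>u\<in>S k. reg d u (lm d u) (length u) z" if "z \<in> {z \<in> F. key d (g z) = k}" for z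
        using that g unfolding S_def by blast
    qed (use mk F(1) in simp_all)
    also have "\<dots> = 4 / 2 ^ d * (Om (length (m k)) - Om (lm d (m k)))" unfolding ext_def \<open>lm d (m k) = x\<close> by simp
    also have "\<dots> \<le> 4 / 2 ^ d * (2 ^ Suc B * (\<Sum>y\<in>Y k. 1 / 2 ^ Kc U y))" unfolding Y_def
      by (intro mult_left_mono charge inS(2)[OF mk(1)] inS(1)[OF mk(1)]) simp
    also have "\<dots> = 2 ^ (B + 3) / 2 ^ d * (\<Sum>y\<in>Y k. 1 / 2 ^ Kc U y)" by (simp add: power_add)
    finally show ?thesis .
  qed
  have "ucyl F = (\<Union>k\<in>K. ucyl {z \<in> F. key d (g z) = k})"
  proof (intro set_eqI iffI)
    fix Z assume "Z \<in> ucyl F"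
    then obtain z where z: "z \<in> F" "Z \<in> cyl z" unfolding ucyl_def by blast
    then have "Z \<in> ucyl {z' \<in> F. key d (g z') = key d (g z)}" unfolding ucyl_def by blast
    moreover have "key d (g z) \<in> K" unfolding K_def using z(1) by blast
    ultimately show "Z \<in> (\<Union>k\<in>K. ucyl {z \<in> F. key d (g z) = k})" by blast
  next
    fix Z assume "Z \<in> (\<Union>k\<in>K. ucyl {z \<in> F. key d (g z) = k})"
    then obtain k where "Z \<in> ucyl {z \<in> F. key d (g z) = k}" by blast
    then show "Z \<in> ucyl F" unfolding ucyl_def by blast
  qed
  then have "mu (ucyl F) = mu (\<Union>k\<in>K. ucyl {z \<in> F. key d (g z) = k})" by (rule arg_cong)
  also have "\<dots> \<le> (\<Sum>k\<in>K. mu (ucyl {z \<in> F. key d (g z) = k}))" by (rule mu_UN_le[OF finK]) (rule sets_ucyl)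
  also have "\<dots> \<le> (\<Sum>k\<in>K. 2 ^ (B + 3) / 2 ^ d * (\<Sum>y\<in>Y k. 1 / 2 ^ Kc U y))" by (rule sum_mono) (rule bound)
  also have "\<dots> = 2 ^ (B + 3) / 2 ^ d * (\<Sum>k\<in>K. \<Sum>y\<in>Y k. 1 / 2 ^ Kc U y)" by (rule sum_distrib_left[symmetric])
  also have "(\<Sum>k\<in>K. \<Sum>y\<in>Y k. 1 / 2 ^ Kc U y) = (\<Sum>y\<in>(\<Union>k\<in>K. Y k). (1::real) / 2 ^ Kc U y)"
  proof (rule sum.UNION_disjoint[symmetric, OF finK])
    show "\<forall>k\<in>K. finite (Y k)" unfolding Y_def by simp
    show "\<forall>k\<in>K. \<forall>k'\<in>K. k \<noteq> k' \<longrightarrow> Y k \<inter> Y k' = {}"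
    proof (intro ballI impI equals0I)
      fix k k' y assume "k \<in> K" "k' \<in> K" "k \<noteq> k'" "y \<in> Y k \<inter> Y k'"
      then show False using keyY[of k y] keyY[of k' y] by simp
    qed
  qed
  also have "2 ^ (B + 3) / 2 ^ d * \<dots> \<le> 2 ^ (B + 3) / 2 ^ d * 1"
  proof (rule mult_left_mono)
    show "(\<Sum>y\<in>(\<Union>k\<in>K. Y k). (1::real) / 2 ^ Kc U y) \<le> 1" using finK by (intro Kc_kraft[OF U]) (simp add: Y_def)
  qed simp
  finally show "mu (ucyl F) \<le> 2 ^ (B + 3) / 2 ^ d" by simp
qed

section \<open>The markers along \<open>A\<close> once \<open>Omega\<close> passes the test\<close>

definition Mk :: "nat \<Rightarrow> nat \<Rightarrow> nat" where "Mk d s = mk d (As s) s"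

lemma mk_As: "s \<le> n \<Longrightarrow> mk d (As n) s = Mk d s"
  unfolding Mk_def by (rule mk_cong) (simp add: take_As)

lemma Mk_Suc: "Mk d (Suc s) = (if sat d (As (Suc s)) (Mk d s) (Suc s) then Suc s else Mk d s)"
  using mk_Suc[of d "As (Suc s)" s] mk_As[of s "Suc s" d] by (simp add: Mk_def)

lemma Mk_le: "Mk d s \<le> s" unfolding Mk_def by (rule mk_le)

lemma Mk_mono: "s \<le> s' \<Longrightarrow> Mk d s \<le> Mk d s'"
  by (rule lift_Suc_mono_le) (use Mk_le[of d] in \<open>simp_all add: Mk_Suc le_SucI\<close>)

lemma lm_As: "lm d (As (Suc s)) = Mk d s" unfolding lm_def by (simp add: mk_As)

lemma dtest_passed: "\<exists>d. \<forall>s l. \<not> reg d (As (Suc s)) (Mk d s) (Suc s) (pre Omega l)"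
proof -
  obtain B where B: "\<forall>n. Om n < Om (Suc n) \<longrightarrow> Kc U (As (Suc n)) \<le> de n + B" using payments by (elim exE)
  have paid: "paid B (As s)" for s unfolding paid_def
  proof (intro allI impI)
    fix n assume "n < length (As s)" "Om n < Om (Suc n)"
    then show "Kc U (take (Suc n) (As s)) \<le> de n + B" using B by (simp add: take_As)
  qed
  obtain d where d: "real_bit Omega \<notin> ucyl {z. dtest B d z}"
    by (rule MLrandom_test[OF ran ce_dtest dtest_measure])
  have "\<not> reg d (As (Suc s)) (Mk d s) (Suc s) (pre Omega l)" for s l
  proof
    assume "reg d (As (Suc s)) (Mk d s) (Suc s) (pre Omega l)"
    then have "dtest B d (pre Omega l)" unfolding dtest_def
      by (intro exI[of _ "As (Suc s)"]) (simp add: paid lm_As)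
    moreover have "real_bit Omega \<in> cyl (pre Omega l)" by (simp add: in_cyl_pre)
    ultimately have "real_bit Omega \<in> ucyl {z. dtest B d z}" unfolding ucyl_def by blast
    then show False using d by contradiction
  qed
  then show ?thesis by blast
qed

lemma pre_Omega_lo_hi: "Omega < lo (pre Omega l) + 1 / 2 ^ l" "lo (pre Omega l) \<le> Omega"
    "hi (pre Omega l) \<le> Omega + 1 / 2 ^ l" "Omega < hi (pre Omega l)"
  using lo_hi_pre[OF Omega_nonneg Omega_less_1, of l] hi_lo[of "pre Omega l"] by simp_all

lemma small: assumes "0 < (e::real)" shows "\<exists>l0. \<forall>l\<ge>l0. 1 / 2 ^ l < e"
proof -
  have "(\<lambda>l. (1/2::real) ^ l) \<longlonglongrightarrow> 0" by (rule LIMSEQ_realpow_zero) simp_all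
  from order_tendstoD(2)[OF this assms] show ?thesis unfolding eventually_sequentially by (simp add: power_one_over)
qed

lemma Om_close: assumes "0 < (e::real)" shows "\<exists>l0. \<forall>l\<ge>l0. Omega - Om l < e"
proof -
  have "Omega - e < Omega" using assms by simp
  from order_tendstoD(1)[OF lim this] obtain l0 where "\<forall>l\<ge>l0. Omega - e < Om l" unfolding eventually_sequentially by (elim exE)
  then show ?thesis by (intro exI[of _ l0] allI impI) (simp add: algebra_simps)
qed

text \<open>If the marker stayed at \<open>x\<close>, a late enough initial segment of
  \<open>Omega\<close>, whose bits on \<open>R\<close> compute \<open>A\<close> beyond
  \<open>x\<close>, would enter the test through the unsaturated branch.\<close>

lemma markers_unbounded:
  assumes d: "\<forall>s l. \<not> reg d (As (Suc s)) (Mk d s) (Suc s) (pre Omega l)"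
  shows "\<exists>s\<ge>s0. sat d (As (Suc s)) (Mk d s) (Suc s)"
proof (rule ccontr)
  assume "\<not> ?thesis"
  then have ns: "\<not> sat d (As (Suc s)) (Mk d s) (Suc s)" if "s0 \<le> s" for s using that by blast
  define x where "x = Mk d s0"
  have Mx: "Mk d s = x" if "s0 \<le> s" for s
    using that
  proof (induction s rule: dec_induct)
    case (step n)
    have "Mk d (Suc n) = Mk d n" using ns[OF step.hyps(1)] by (simp add: Mk_Suc)
    then show ?case using step.IH by simp
  qed (simp add: x_def)
  \<comment> \<open>A quarter of the limit of \<open>ext\<close>: it leaves room for the error of
    \<open>Om s\<close> and for the length of the initial segment of \<open>Omega\<close>.\<close>
  define h where "h = (Omega - Om x) / 2 ^ (d + 2)"
  have h0: "0 < h" unfolding h_def using Om_less[of x] by simp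
  obtain l1 where l1: "\<forall>l\<ge>l1. 1 / 2 ^ l < h" using small[OF h0] by (elim exE)
  obtain l2 where l2: "\<forall>l\<ge>l2. Omega - Om l < h" using Om_close[OF h0] by (elim exE)
  obtain l3 where l3: "\<forall>t\<ge>l3. cmps t (rz (pre Omega t)) (As (Suc x))" using cmps_A_rz[of "Suc x"] by (elim exE)
  define s where "s = s0 + l1 + l2 + l3"
  let ?s = "Suc s"
  have a: "1 / 2 ^ ?s < h" "Omega - Om ?s < h" "cmps ?s (rz (pre Omega ?s)) (As (Suc x))"
    by (rule l1[rule_format], simp add: s_def, rule l2[rule_format], simp add: s_def, rule l3[rule_format], simp add: s_def)
  have m: "Mk d s = x" by (rule Mx) (simp add: s_def)
  have pd: "(1::real) \<le> 2 ^ d" by simp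
  have hd: "h * 2 ^ d * 4 = Omega - Om x" unfolding h_def by (simp add: power_add)
  have "h \<le> h * 2 ^ d" using mult_left_mono[OF pd, of h] h0 by simp
  then have h4: "h * 4 \<le> Omega - Om x" using hd by simp
  have "3 * h * 2 ^ d \<le> Om ?s - Om x" using a(2) hd \<open>h \<le> h * 2 ^ d\<close> by simp
  then have e: "3 * h \<le> ext d ?s x" unfolding ext_def by (simp add: pos_le_divide_eq)
  have "reg d (As ?s) x ?s (pre Omega ?s)"
  proof -
    have "\<not> sat d (As ?s) x ?s" using ns[of s] unfolding m by (simp add: s_def)
    moreover have "take (Suc x) (As ?s) = As (Suc x)" using Mk_le[of d s] unfolding m by (intro take_As) simp
    moreover have "Om x \<le> lo (pre Omega ?s)" using pre_Omega_lo_hi(1)[of ?s] a h4 h0 by linarith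
    moreover have "hi (pre Omega ?s) \<le> Om ?s + ext d ?s x" using pre_Omega_lo_hi(3)[of ?s] a e h0 by linarith
    moreover have "1 / 2 ^ ?s \<le> ext d ?s x" using a e h0 by linarith
    ultimately show ?thesis unfolding reg_def using a(3) by simp
  qed
  then show False using d m by blast
qed

text \<open>Otherwise \<open>Omega\<close> would lie inside the stretch claimed by the saturated
  branch, and so would one of its initial segments.\<close>

lemma marker_gap:
  assumes d: "\<forall>s l. \<not> reg d (As (Suc s)) (Mk d s) (Suc s) (pre Omega l)"
    and s: "sat d (As (Suc s)) (Mk d s) (Suc s)"
  shows "Om (Suc s) + ext d (Suc s) (Mk d s) \<le> Omega"
proof (rule ccontr)
  assume "\<not> ?thesis"
  then have g: "0 < Om (Suc s) + ext d (Suc s) (Mk d s) - Omega" by simp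
  have g': "0 < Omega - Om (Suc s)" using Om_less by simp
  obtain l1 where l1: "\<forall>l\<ge>l1. 1 / 2 ^ l < Om (Suc s) + ext d (Suc s) (Mk d s) - Omega" using small[OF g] by (elim exE)
  obtain l2 where l2: "\<forall>l\<ge>l2. 1 / 2 ^ l < Omega - Om (Suc s)" using small[OF g'] by (elim exE)
  have a: "1 / 2 ^ (l1 + l2) < Om (Suc s) + ext d (Suc s) (Mk d s) - Omega" "1 / 2 ^ (l1 + l2) < Omega - Om (Suc s)"
    by (rule l1[rule_format], simp, rule l2[rule_format], simp)
  have "reg d (As (Suc s)) (Mk d s) (Suc s) (pre Omega (l1 + l2))"
    unfolding reg_def using s a pre_Omega_lo_hi[of "l1 + l2"] by simp
  then show False using d by blast
qed

text \<open>\<open>IZ\<close> with independent end points, so that the contributions of successive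
  markers can be added.\<close>

definition GZ :: "nat \<Rightarrow> real \<Rightarrow> real \<Rightarrow> bool list \<Rightarrow> bool list set" where
  "GZ t a c u = {z. length z = t \<and> (a \<le> lo z \<and> hi z \<le> c \<and> cmps t (rz z) u)}"

lemma GZ_add:
  assumes "a \<le> c" "c \<le> c'"
  shows "mu (ucyl (GZ t a c u)) + mu (ucyl (GZ (Suc t) c c' u)) \<le> mu (ucyl (GZ (Suc t) a c' u))"
proof -
  have dj: "ucyl (GZ t a c u) \<inter> ucyl (GZ (Suc t) c c' u) = {}"
  proof (rule equals0I)
    fix Z assume "Z \<in> ucyl (GZ t a c u) \<inter> ucyl (GZ (Suc t) c c' u)"
    then obtain z z' where z: "z \<in> GZ t a c u" "Z \<in> cyl z" "z' \<in> GZ (Suc t) c c' u" "Z \<in> cyl z'" unfolding ucyl_def by blast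
    have "lo z' < hi z" by (rule cyl_nested[OF z(4,2)])
    then show False using z(1,3) unfolding GZ_def by simp
  qed
  have "mu (ucyl (GZ t a c u)) + mu (ucyl (GZ (Suc t) c c' u)) = mu (ucyl (GZ t a c u) \<union> ucyl (GZ (Suc t) c c' u))"
    unfolding mu_def by (rule CP.finite_measure_Union[symmetric, OF sets_ucyl sets_ucyl dj])
  also have "\<dots> \<le> mu (ucyl (GZ (Suc t) a c' u))"
  proof (rule mu_mono[OF Un_least sets_ucyl])
    show "ucyl (GZ t a c u) \<subseteq> ucyl (GZ (Suc t) a c' u)"
    proof
      fix Z assume "Z \<in> ucyl (GZ t a c u)"
      then obtain z where z: "Z \<in> cyl z" "length z = t" "a \<le> lo z" "hi z \<le> c" "cmps t (rz z) u" unfolding ucyl_def GZ_def by blast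
      let ?z = "map Z [0..<Suc t]"
      have t: "take (length z) ?z = z" using z(1,2) unfolding in_cyl_map by (simp add: take_map)
      have "lo z \<le> lo ?z" "hi ?z \<le> hi z" using lo_hi_take[where k = "length z" and z = ?z] unfolding t by simp_all
      moreover have "cmps (Suc t) (rz ?z) u" by (rule cmps_rz_ext[OF z(5) _ t]) simp
      moreover have "length ?z = Suc t" by simp
      ultimately have "?z \<in> GZ (Suc t) a c' u" unfolding GZ_def using z(3,4) assms(2) by (intro CollectI conjI) linarith+
      moreover have "Z \<in> cyl ?z" by (simp add: in_cyl_nth del: upt_Suc)
      ultimately show "Z \<in> ucyl (GZ (Suc t) a c' u)" unfolding ucyl_def by blast
    qed
    show "ucyl (GZ (Suc t) c c' u) \<subseteq> ucyl (GZ (Suc t) a c' u)"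
      by (rule ucyl_mono) (use assms(1) in \<open>auto simp: GZ_def\<close>)
  qed
  finally show ?thesis .
qed

text \<open>Every marker that is replaced leaves density \<open>2 ^ (-d)\<close> on its own
  interval, and an oracle that computes a longer segment of \<open>A\<close> computes the shorter
  one.\<close>

lemma density_growth:
  assumes m: "Mk d m = m" and x: "x \<le> m" and y: "m \<le> y"
  shows "(Om (Mk d y) - Om m) / 2 ^ d \<le> mu (ucyl (GZ y (Om m) (Om (Mk d y)) (As (Suc x))))"
  using y
proof (induction y rule: dec_induct)
  case base then show ?case unfolding m by (simp add: mu_nonneg)
next
  case (step y)
  have my: "m \<le> Mk d y" using Mk_mono[OF step.hyps(1), of d] unfolding m .
  have mm: "Om m \<le> Om (Mk d y)" "Om (Mk d y) \<le> Om (Suc y)" using my Mk_le[of d y] by (auto intro: Om_mono)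
  show ?case
  proof (cases "sat d (As (Suc y)) (Mk d y) (Suc y)")
    case False
    then have e: "Mk d (Suc y) = Mk d y" by (simp add: Mk_Suc)
    show ?thesis unfolding e using step.IH GZ_add[OF mm(1) order_refl, of y "As (Suc x)"] mu_nonneg[of "ucyl (GZ (Suc y) (Om (Mk d y)) (Om (Mk d y)) (As (Suc x)))"]
      by linarith
  next
    case True
    then have e: "Mk d (Suc y) = Suc y" by (simp add: Mk_Suc)
    have t: "take (Suc (Mk d y)) (As (Suc y)) = As (Suc (Mk d y))" "take (Suc x) (As (Suc (Mk d y))) = As (Suc x)"
      using Mk_le[of d y] x my by (simp_all add: take_As)
    have "ext d (Suc y) (Mk d y) \<le> mZ (Suc y) (Mk d y) (As (Suc (Mk d y)))" using True unfolding sat_def t(1) .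
    also have "\<dots> \<le> mu (ucyl (GZ (Suc y) (Om (Mk d y)) (Om (Suc y)) (As (Suc x))))" unfolding mZ_mu
    proof (rule mu_mono[OF ucyl_mono sets_ucyl], rule subsetI)
      fix z assume "z \<in> IZ (Suc y) (Mk d y) (As (Suc (Mk d y)))"
      then show "z \<in> GZ (Suc y) (Om (Mk d y)) (Om (Suc y)) (As (Suc x))"
        unfolding IZ_def GZ_def using cmps_take[of "Suc y" "rz z" "As (Suc (Mk d y))" "Suc x"] unfolding t(2) by simp
    qed
    finally have "(Om (Suc y) - Om (Mk d y)) / 2 ^ d \<le> mu (ucyl (GZ (Suc y) (Om (Mk d y)) (Om (Suc y)) (As (Suc x))))" unfolding ext_def .
    moreover have "(Om (Suc y) - Om m) / 2 ^ d = (Om (Mk d y) - Om m) / 2 ^ d + (Om (Suc y) - Om (Mk d y)) / 2 ^ d"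
      unfolding add_divide_distrib[symmetric] by simp
    ultimately show ?thesis unfolding e using step.IH GZ_add[OF mm, of y "As (Suc x)"] by linarith
  qed
qed

text \<open>Three losses make up the constant: \<open>1 + 2 ^ d\<close> for passing from
  \<open>x\<close> to the next marker, by \<open>marker_gap\<close>; \<open>2\<close> for waiting
  until the markers have covered half of the distance left to \<open>Omega\<close>;
  \<open>2 ^ d\<close> for the density.\<close>

lemma density_Z: "\<exists>d. \<forall>x. \<exists>m\<ge>x. \<exists>y0. \<forall>y\<ge>y0. (Omega - Om x) / (2 ^ Suc d * (1 + 2 ^ d)) \<le> mZ y m (As (Suc x))"
proof -
  obtain d where d: "\<forall>s l. \<not> reg d (As (Suc s)) (Mk d s) (Suc s) (pre Omega l)" using dtest_passed by (elim exE)
  have unb: "\<exists>s. N \<le> Mk d s" for N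
  proof -
    obtain s where s: "N \<le> s" "sat d (As (Suc s)) (Mk d s) (Suc s)" using markers_unbounded[OF d, of N] by blast
    have "Mk d (Suc s) = Suc s" unfolding Mk_Suc if_P[OF s(2)] ..
    then have "N \<le> Mk d (Suc s)" using s(1) by simp
    then show ?thesis by (rule exI)
  qed
  have "\<exists>m\<ge>x. \<exists>y0. \<forall>y\<ge>y0. (Omega - Om x) / (2 ^ Suc d * (1 + 2 ^ d)) \<le> mZ y m (As (Suc x))" for x
  proof -
    \<comment> \<open>The first stage whose marker has reached \<open>x\<close>; the marker moved at
      this stage, or the stage is 0, so \<open>m\<close> is itself a marker.\<close>
    define m where "m = (LEAST s. x \<le> Mk d s)"
    have xm: "x \<le> Mk d m" unfolding m_def by (rule LeastI_ex[OF unb])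
    have "Mk d m = m \<and> Om m - Om x \<le> 2 ^ d * (Omega - Om m)"
    proof (cases m)
      case 0
      then have "x = 0" "Mk d m = m" using xm Mk_le[of d m] by simp_all
      then show ?thesis using 0 Om_le[of 0] by simp
    next
      case (Suc m')
      then have "m' < m" by simp
      then have "\<not> x \<le> Mk d m'" unfolding m_def by (rule not_less_Least)
      then have l: "Mk d m' < x" by simp
      have sat: "sat d (As (Suc m')) (Mk d m') (Suc m')" 
      proof (rule contrapos_pp[OF xm])
        assume "\<not> sat d (As (Suc m')) (Mk d m') (Suc m')"
        then have "Mk d m = Mk d m'" unfolding Suc by (simp only: Mk_Suc if_False)
        then show "\<not> x \<le> Mk d m" using l by simp
      qed
      have "Om (Suc m') - Om (Mk d m') \<le> 2 ^ d * (Omega - Om (Suc m'))"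
        using marker_gap[OF d sat] unfolding ext_def by (simp add: field_simps)
      moreover have "Om (Mk d m') \<le> Om x" using l by (intro Om_mono) simp
      ultimately have "Om m - Om x \<le> 2 ^ d * (Omega - Om m)" unfolding Suc by linarith
      then show ?thesis using sat unfolding Suc by (simp add: Mk_Suc)
    qed
    then have m: "Mk d m = m" "Om m - Om x \<le> 2 ^ d * (Omega - Om m)" by blast+
    have xm': "x \<le> m" using xm unfolding m(1) .
    have "0 < (Omega - Om m) / 2" using Om_less[of m] by simp
    from Om_close[OF this] obtain N where N: "\<forall>l\<ge>N. Omega - Om l < (Omega - Om m) / 2" by (elim exE)
    from unb[of N] obtain y1 where y1: "N \<le> Mk d y1" by (elim exE)
    have "(Omega - Om x) / (2 ^ Suc d * (1 + 2 ^ d)) \<le> mZ y m (As (Suc x))" if h: "max m y1 \<le> y" for y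
    proof -
      have "N \<le> Mk d y" using y1 Mk_mono[of y1 y d] h by simp
      then have c: "Omega - Om (Mk d y) < (Omega - Om m) / 2" using N by blast
      have "Omega - Om x \<le> (1 + 2 ^ d) * (Omega - Om m)" using m(2) by (simp add: algebra_simps)
      then have "(Omega - Om x) / (2 ^ Suc d * (1 + 2 ^ d)) \<le> ((1 + 2 ^ d) * (Omega - Om m)) / (2 ^ Suc d * (1 + 2 ^ d))"
        by (rule divide_right_mono) simp
      also have "\<dots> = (Omega - Om m) / 2 / 2 ^ d"
      proof -
        have "(1::real) + 2 ^ d \<noteq> 0" by (smt (verit) zero_le_power)
        then show ?thesis by simp
      qed
      also have "\<dots> \<le> (Om (Mk d y) - Om m) / 2 ^ d" using c by (intro divide_right_mono) simp_all
      also have "\<dots> \<le> mu (ucyl (GZ y (Om m) (Om (Mk d y)) (As (Suc x))))"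
        by (rule density_growth[OF m(1) xm']) (use h in simp)
      also have "\<dots> \<le> mZ y m (As (Suc x))" unfolding mZ_mu
      proof (rule mu_mono[OF ucyl_mono sets_ucyl], rule subsetI)
        fix z assume "z \<in> GZ y (Om m) (Om (Mk d y)) (As (Suc x))"
        moreover have "Om (Mk d y) \<le> Om y" by (intro Om_mono Mk_le)
        ultimately show "z \<in> IZ y m (As (Suc x))" unfolding GZ_def IZ_def by simp
      qed
      finally show ?thesis .
    qed
    then have "\<forall>y\<ge>max m y1. (Omega - Om x) / (2 ^ Suc d * (1 + 2 ^ d)) \<le> mZ y m (As (Suc x))" by (intro allI impI)
    then show ?thesis using xm' by (intro exI[of _ m] conjI exI[of _ "max m y1"])
  qed
  then have "\<forall>x. \<exists>m\<ge>x. \<exists>y0. \<forall>y\<ge>y0. (Omega - Om x) / (2 ^ Suc d * (1 + 2 ^ d)) \<le> mZ y m (As (Suc x))" by (rule allI)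
  then show ?thesis by (rule exI[of _ d])
qed

text \<open>Reals between \<open>Om x\<close> and \<open>Omega\<close> have one of two initial
  segments of length \<open>k\<close>. Each choice fixes \<open>k - cnt k\<close> positions outside
  \<open>R\<close>, independently of the bits on \<open>R\<close>, and so contributes the measure of
  \<open>SW\<close> divided by that power of 2.\<close>

lemma projection:
  assumes x: "x \<le> m" and k: "k = kk (Omega - Om x)" "k \<le> y"
  shows "mZ y m u \<le> 2 * (mW y u / 2 ^ (k - cnt k))"
proof -
  let ?J = "{..<k} - R"
  let ?A = "\<lambda>v. {Z \<in> gcyl ?J (\<lambda>i. v ! i). (\<lambda>i. Z (eR i)) \<in> ucyl (SW y u)}"
  have ob: "Omega - Om x \<le> 1 / 2 ^ k" unfolding k(1) using kk_bounds(2)[of "Omega - Om x"] Om_less[of x] Om_nonneg[of x] le1 by simp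
  have sub: "ucyl (IZ y m u) \<subseteq> (\<Union>v\<in>twos (Om x) k. ?A v)"
  proof
    fix Z assume "Z \<in> ucyl (IZ y m u)"
    then obtain z where z: "Z \<in> cyl z" "length z = y" "Om m \<le> lo z" "hi z \<le> Om y" "cmps y (rz z) u" unfolding ucyl_def IZ_def by blast
    let ?v = "take k z"
    have lv: "length ?v = k" using z(2) k(2) by simp
    have "lo ?v < Om x + 1 / 2 ^ k" using lo_hi_take(1)[where k = k and z = z] lo_hi[of z] z(4) Om_le[of y] ob by linarith
    then have n1: "real (nval ?v) < (Om x + 1 / 2 ^ k) * 2 ^ k" unfolding lo_def lv by (simp only: pos_divide_less_eq[OF zero_less_power[OF zero_less_numeral]])
    have "Om x < hi ?v" using lo_hi_take(2)[where k = k and z = z] lo_hi[of z] z(3) Om_mono[OF x] by linarith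
    then have n2: "Om x * 2 ^ k < real (nval ?v) + 1" unfolding hi_def lv by (simp only: pos_less_divide_eq[OF zero_less_power[OF zero_less_numeral]])
    have v: "?v \<in> twos (Om x) k" by (rule twosI) (use Om_nonneg lv n1 n2 in simp_all)
    have "Z \<in> gcyl ?J (\<lambda>i. ?v ! i)" unfolding gcyl_def using z(1) k(2) unfolding in_cyl_nth z(2) by simp
    moreover have "(\<lambda>i. Z (eR i)) \<in> ucyl (SW y u)" unfolding in_SW
    proof (rule cmps_mono[OF z(5) order_refl])
      show "length (rz z) \<le> length (map (\<lambda>i. Z (eR i)) [0..<y])" using cnt_le[of y] z(2) by simp
      have "map (\<lambda>i. Z (eR i)) [0..<length (rz z)] = rz z" using rz_cyl[OF z(1)] unfolding in_cyl_map .
      then show "take (length (rz z)) (map (\<lambda>i. Z (eR i)) [0..<y]) = rz z" using cnt_le[of y] z(2) by (simp add: take_map)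
    qed
    ultimately show "Z \<in> (\<Union>v\<in>twos (Om x) k. ?A v)" using v by blast
  qed
  have card: "card ?J = k - cnt k" unfolding cnt_def by (subst card_Diff_subset_Int) (simp_all add: Int_commute)
  have mA: "mu (?A v) = mW y u / 2 ^ (k - cnt k)" for v
    unfolding mW_mu card[symmetric] by (rule gcyl_ucyl_level[OF inj_eR, where n = y]) (auto simp: range_eR SW_def)
  have sA: "?A v \<in> sets cantor" for v
  proof -
    have "?A v = gcyl ?J (\<lambda>i. v ! i) \<inter> {Z. (\<lambda>i. Z (eR i)) \<in> ucyl (SW y u)}" by blast
    moreover have "{Z. (\<lambda>i. Z (eR i)) \<in> ucyl (SW y u)} \<in> sets cantor" by (rule sets_pullback)
    moreover have "gcyl ?J (\<lambda>i. v ! i) \<in> sets cantor" by (rule gcyl_measure(1)) simp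
    ultimately show ?thesis by (simp only: sets.Int)
  qed
  have "mZ y m u \<le> mu (\<Union>v\<in>twos (Om x) k. ?A v)" unfolding mZ_mu
    by (rule mu_mono[OF sub]) (intro sets.finite_UN twos_card sA)
  also have "\<dots> \<le> (\<Sum>v\<in>twos (Om x) k. mu (?A v))" by (intro mu_UN_le twos_card sA)
  also have "\<dots> = card (twos (Om x) k) * (mW y u / 2 ^ (k - cnt k))" unfolding mA by simp
  also have "\<dots> \<le> 2 * (mW y u / 2 ^ (k - cnt k))" using twos_card(2)[of "Om x" k]
    by (intro mult_right_mono) (simp_all add: mW_def)
  finally show ?thesis .
qed

text \<open>The factor \<open>4\<close> is \<open>2\<close> for the two initial segments in
  \<open>projection\<close> times \<open>2\<close> from
  \<open>2 ^ (-Suc k) < Omega - Om x\<close>.\<close>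

theorem density: "\<exists>\<epsilon>>0. \<forall>x. \<exists>y0. \<forall>y\<ge>y0. \<epsilon> * climit x \<le> mW y (As (Suc x))"
proof -
  obtain d where d: "\<forall>x. \<exists>m\<ge>x. \<exists>y0. \<forall>y\<ge>y0. (Omega - Om x) / (2 ^ Suc d * (1 + 2 ^ d)) \<le> mZ y m (As (Suc x))"
    using density_Z by (elim exE)
  define C :: real where "C = 2 ^ Suc d * (1 + 2 ^ d)"
  have C: "0 < C" unfolding C_def by (intro mult_pos_pos add_pos_pos) simp_all
  have "\<exists>y0. \<forall>y\<ge>y0. 1 / (4 * C) * climit x \<le> mW y (As (Suc x))" for x
  proof -
    obtain m y0 where m: "x \<le> m" "\<forall>y\<ge>y0. (Omega - Om x) / C \<le> mZ y m (As (Suc x))"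
    proof -
      have "\<exists>m\<ge>x. \<exists>y0. \<forall>y\<ge>y0. (Omega - Om x) / C \<le> mZ y m (As (Suc x))" unfolding C_def by (rule spec[OF d])
      then show ?thesis using that by (elim exE conjE)
    qed
    define k where "k = kk (Omega - Om x)"
    have kb: "1 / 2 ^ Suc k < Omega - Om x" unfolding k_def using kk_bounds(1)[of "Omega - Om x"] Om_less[of x] Om_nonneg[of x] le1 by simp
    have "1 / (4 * C) * climit x \<le> mW y (As (Suc x))" if y: "max y0 k \<le> y" for y
    proof -
      have p: "2 ^ (k - cnt k) * 2 ^ cnt k = (2::real) ^ k" using cnt_le[of k] by (simp flip: power_add)
      have "(Omega - Om x) / C \<le> 2 * (mW y (As (Suc x)) / 2 ^ (k - cnt k))"
        using m(2)[rule_format, of y] projection[OF m(1) k_def, of y "As (Suc x)"] y by simp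
      then have "1 / 2 ^ Suc k / C \<le> 2 * (mW y (As (Suc x)) / 2 ^ (k - cnt k))"
        using divide_right_mono[OF less_imp_le[OF kb] less_imp_le[OF C]] by linarith
      then have "2 ^ (k - cnt k) / 2 * (1 / 2 ^ Suc k / C) \<le> 2 ^ (k - cnt k) / 2 * (2 * (mW y (As (Suc x)) / 2 ^ (k - cnt k)))"
        by (intro mult_left_mono) simp_all
      moreover have "2 ^ (k - cnt k) / 2 * (1 / 2 ^ Suc k / C) = 1 / (4 * C) * (1 / 2 ^ cnt k)"
        using p C by (simp add: field_simps)
      ultimately show ?thesis unfolding climit_def k_def[symmetric] by simp
    qed
    then show ?thesis by (intro exI[of _ "max y0 k"] allI impI)
  qed
  then show ?thesis using C by (intro exI[of _ "1 / (4 * C)"]) simp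
qed

end

section \<open>The game\<close>

text \<open>A piece \<open>(b, b', w, q)\<close> of a run occupies the rounds \<open>b \<le> n < b'\<close>, was granted the amount
  \<open>2\<^sup>-\<^sup>q\<close> and is meant to protect the first \<open>w\<close> bits. A frame \<open>(e, ps, b, w, q)\<close> is a run with goal
  \<open>2\<^sup>-\<^sup>e\<close>, finished pieces \<open>ps\<close> (latest first) and current piece \<open>b, w, q\<close>.\<close>

type_synonym piece = "nat \<times> nat \<times> nat \<times> nat"
type_synonym frame = "nat \<times> piece list \<times> nat \<times> nat \<times> nat"

abbreviation pb :: "piece \<Rightarrow> nat" where "pb p \<equiv> fst p"
abbreviation pe :: "piece \<Rightarrow> nat" where "pe p \<equiv> fst (snd p)"
abbreviation pw :: "piece \<Rightarrow> nat" where "pw p \<equiv> fst (snd (snd p))"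
abbreviation pq :: "piece \<Rightarrow> nat" where "pq p \<equiv> snd (snd (snd p))"
abbreviation fe :: "frame \<Rightarrow> nat" where "fe F \<equiv> fst F"
abbreviation fps :: "frame \<Rightarrow> piece list" where "fps F \<equiv> fst (snd F)"
abbreviation fb :: "frame \<Rightarrow> nat" where "fb F \<equiv> fst (snd (snd F))"
abbreviation fw :: "frame \<Rightarrow> nat" where "fw F \<equiv> fst (snd (snd (snd F)))"
abbreviation fq :: "frame \<Rightarrow> nat" where "fq F \<equiv> snd (snd (snd (snd F)))"

definition psum :: "(piece \<Rightarrow> bool) \<Rightarrow> piece list \<Rightarrow> real" where
  "psum P ps = (\<Sum>p\<leftarrow>ps. if P p then 1 / 2 ^ pq p else 0)"

lemma psum_Nil [simp]: "psum P [] = 0" by (simp add: psum_def)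
lemma psum_Cons: "psum P (p # ps) = (if P p then 1 / 2 ^ pq p else 0) + psum P ps" by (simp add: psum_def)
lemma psum_nonneg: "0 \<le> psum P ps" by (induction ps) (simp_all add: psum_Cons)
lemma psum_mono: "(\<And>p. p \<in> set ps \<Longrightarrow> P p \<Longrightarrow> Q p) \<Longrightarrow> psum P ps \<le> psum Q ps"
  unfolding psum_def by (rule sum_list_mono) simp
lemma psum_split3: "(\<And>p. P p \<Longrightarrow> Q1 p \<or> Q2 p \<or> Q3 p) \<Longrightarrow> psum P ps \<le> psum Q1 ps + psum Q2 ps + psum Q3 ps"
proof (induction ps)
  case (Cons p ps)
  define x where "x = (1::real) / 2 ^ pq p"
  have "0 \<le> x" unfolding x_def by simp
  then have "(if P p then x else 0) \<le> (if Q1 p then x else 0) + (if Q2 p then x else 0) + (if Q3 p then x else 0)"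
    using Cons.prems[of p] by (cases "P p"; cases "Q1 p"; cases "Q2 p"; cases "Q3 p") simp_all
  then show ?case using Cons.IH[OF Cons.prems] unfolding psum_Cons x_def by linarith
qed simp
lemma psum_targets:
  assumes "\<And>p. p \<in> set ps \<Longrightarrow> pw p < M" shows "psum P ps = (\<Sum>w<M. psum (\<lambda>p. pw p = w \<and> P p) ps)"
  using assms
proof (induction ps)
  case (Cons p ps)
  have "psum P ps = (\<Sum>w<M. psum (\<lambda>p. pw p = w \<and> P p) ps)" using Cons by simp
  moreover have "(\<Sum>w<M. if pw p = w \<and> P p then 1 / 2 ^ pq p else 0) = (if P p then 1 / 2 ^ pq p else (0::real))"
    using Cons.prems[of p] by (cases "P p") simp_all
  ultimately show ?case by (simp only: psum_Cons sum.distrib)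
qed simp
lemma psum_set: "distinct ps \<Longrightarrow> psum P ps = (\<Sum>p\<in>{p \<in> set ps. P p}. 1 / 2 ^ pq p)"
  unfolding psum_def by (simp add: sum_list_distinct_conv_sum_set sum.inter_filter)

text \<open>\<open>ch b t w\<close> says that the answers of the rounds \<open>b, ..., t - 1\<close> do not all agree with that of round
  \<open>b - 1\<close> on the first \<open>w\<close> bits. A piece is wasted if this happens while it runs, and promoted if it
  happens afterwards; then its rounds have been answered by one more string.\<close>

definition held :: "(nat \<Rightarrow> nat \<Rightarrow> nat \<Rightarrow> bool) \<Rightarrow> nat \<Rightarrow> nat \<Rightarrow> piece \<Rightarrow> bool" where
  "held ch t w p \<longleftrightarrow> pw p = w \<and> \<not> ch (pb p) t w"
definition wast :: "(nat \<Rightarrow> nat \<Rightarrow> nat \<Rightarrow> bool) \<Rightarrow> piece \<Rightarrow> bool" where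
  "wast ch p \<longleftrightarrow> ch (pb p) (pe p) (pw p)"
definition prom :: "(nat \<Rightarrow> nat \<Rightarrow> nat \<Rightarrow> bool) \<Rightarrow> nat \<Rightarrow> piece \<Rightarrow> bool" where
  "prom ch t p \<longleftrightarrow> \<not> ch (pb p) (pe p) (pw p) \<and> ch (pb p) t (pw p)"

text \<open>The least target whose held pieces fall short of its demand. The summand
  \<open>1 / 2 ^ w\<close> keeps every demand positive, and division by \<open>2 ^ (e + K)\<close>
  keeps all demands together small against the goal.\<close>

definition pickw :: "nat \<Rightarrow> (nat \<Rightarrow> nat \<Rightarrow> nat \<Rightarrow> bool) \<Rightarrow> (nat \<Rightarrow> real) \<Rightarrow> nat \<Rightarrow> nat \<Rightarrow> piece list \<Rightarrow> nat" where
  "pickw K ch N t e ps = (LEAST w. psum (held ch t w) ps < (N w + 1 / 2 ^ w) / 2 ^ (e + K))"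
definition wcount :: "(nat \<Rightarrow> nat \<Rightarrow> nat \<Rightarrow> bool) \<Rightarrow> nat \<Rightarrow> piece list \<Rightarrow> nat" where
  "wcount ch w ps = length (filter (\<lambda>p. pw p = w \<and> wast ch p) ps)"
text \<open>Each wasted piece halves the next grant for the same target, so the waste per target is
  a geometric series.\<close>

definition pick :: "nat \<Rightarrow> (nat \<Rightarrow> nat \<Rightarrow> nat \<Rightarrow> bool) \<Rightarrow> (nat \<Rightarrow> real) \<Rightarrow> nat \<Rightarrow> nat \<Rightarrow> piece list \<Rightarrow> frame" where
  "pick K ch N t e ps = (e, ps, t, pickw K ch N t e ps, e + K + pickw K ch N t e ps + wcount ch (pickw K ch N t e ps) ps)"
definition full :: "(nat \<Rightarrow> nat \<Rightarrow> nat \<Rightarrow> bool) \<Rightarrow> nat \<Rightarrow> nat \<Rightarrow> piece list \<Rightarrow> bool" where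
  "full ch t e ps \<longleftrightarrow> 1 / 2 ^ e \<le> psum (prom ch t) ps"
definition rcd :: "nat \<Rightarrow> frame \<Rightarrow> piece list" where
  "rcd t F = (fb F, t, fw F, fq F) # fps F"
definition goal :: "frame list \<Rightarrow> nat" where "goal Gs = (if Gs = [] then 1 else fq (hd Gs))"

text \<open>The head of the list is the innermost run. When it has promoted enough, it is finished and counts as
  one piece of the run around it; the run around the last one has goal \<open>2\<^sup>-\<^sup>1\<close>.\<close>

fun adv :: "nat \<Rightarrow> (nat \<Rightarrow> nat \<Rightarrow> nat \<Rightarrow> bool) \<Rightarrow> (nat \<Rightarrow> real) \<Rightarrow> nat \<Rightarrow> frame list \<Rightarrow> frame list" where
  "adv K ch N t [] = []"
| "adv K ch N t (F # Fs) = (if full ch t (fe F) (rcd t F)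
     then pick K ch N t (goal (adv K ch N t Fs)) [] # adv K ch N t Fs
     else pick K ch N t (fe F) (rcd t F) # Fs)"

fun start :: "nat \<Rightarrow> (nat \<Rightarrow> nat \<Rightarrow> nat \<Rightarrow> bool) \<Rightarrow> (nat \<Rightarrow> real) \<Rightarrow> nat \<Rightarrow> frame list" where
  "start K ch N 0 = []"
| "start K ch N (Suc m) = pick K ch N 0 (goal (start K ch N m)) [] # start K ch N m"

lemma pick_sel [simp]: "fe (pick K ch N t e ps) = e" "fps (pick K ch N t e ps) = ps" "fb (pick K ch N t e ps) = t"
  "fw (pick K ch N t e ps) = pickw K ch N t e ps"
  "fq (pick K ch N t e ps) = e + K + pickw K ch N t e ps + wcount ch (pickw K ch N t e ps) ps"
  by (simp_all add: pick_def)

lemma length_adv [simp]: "length (adv K ch N t Fs) = length Fs" by (induction Fs) simp_all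
lemma length_start [simp]: "length (start K ch N m) = m" by (induction m) simp_all

lemma start_nth: "i < m \<Longrightarrow> start K ch N m ! i = pick K ch N 0 (goal (drop (Suc i) (start K ch N m))) []"
  by (induction m arbitrary: i) (auto simp: less_Suc_eq_0_disj)

text \<open>Resolves the recursion into the one level at which the block of finished runs stops;
  \<open>L\<close> will name it.\<close>

lemma adv_step:
  "\<exists>l\<le>length Fs. (\<forall>i<l. full ch t (fe (Fs ! i)) (rcd t (Fs ! i)) \<and> adv K ch N t Fs ! i = pick K ch N t (goal (drop (Suc i) (adv K ch N t Fs))) [])
    \<and> (l < length Fs \<longrightarrow> \<not> full ch t (fe (Fs ! l)) (rcd t (Fs ! l)) \<and> adv K ch N t Fs ! l = pick K ch N t (fe (Fs ! l)) (rcd t (Fs ! l)))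
    \<and> (\<forall>i. l < i \<longrightarrow> i < length Fs \<longrightarrow> adv K ch N t Fs ! i = Fs ! i)"
proof (induction Fs)
  case Nil then show ?case by simp
next
  case (Cons F Fs)
  show ?case
  proof (cases "full ch t (fe F) (rcd t F)")
    case False
    then show ?thesis by (intro exI[of _ 0]) (auto simp: nth_Cons')
  next
    case True
    from Cons.IH obtain l where l: "l \<le> length Fs"
      "\<forall>i<l. full ch t (fe (Fs ! i)) (rcd t (Fs ! i)) \<and> adv K ch N t Fs ! i = pick K ch N t (goal (drop (Suc i) (adv K ch N t Fs))) []"
      "l < length Fs \<longrightarrow> \<not> full ch t (fe (Fs ! l)) (rcd t (Fs ! l)) \<and> adv K ch N t Fs ! l = pick K ch N t (fe (Fs ! l)) (rcd t (Fs ! l))"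
      "\<forall>i. l < i \<longrightarrow> i < length Fs \<longrightarrow> adv K ch N t Fs ! i = Fs ! i"
      by (elim exE conjE)
    have a: "adv K ch N t (F # Fs) = pick K ch N t (goal (adv K ch N t Fs)) [] # adv K ch N t Fs" using True by simp
    show ?thesis unfolding a
    proof (intro exI[of _ "Suc l"] conjI allI impI)
      fix i assume i: "i < Suc l"
      show "full ch t (fe ((F # Fs) ! i)) (rcd t ((F # Fs) ! i))" using i l(2) True by (cases i) simp_all
      show "(pick K ch N t (goal (adv K ch N t Fs)) [] # adv K ch N t Fs) ! i
        = pick K ch N t (goal (drop (Suc i) (pick K ch N t (goal (adv K ch N t Fs)) [] # adv K ch N t Fs))) []"
        using i l(2) by (cases i) simp_all
    next
      fix i assume i: "Suc l < i" "i < length (F # Fs)"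
      then obtain i' where "i = Suc i'" by (cases i) auto
      then show "(pick K ch N t (goal (adv K ch N t Fs)) [] # adv K ch N t Fs) ! i = (F # Fs) ! i" using i l(4) by simp
    qed (use l(1,3) in simp_all)
  qed
qed

text \<open>Pigeonhole: the pieces have at most \<open>length ps\<close> targets, so some
  \<open>w\<close> up to this number is untried, holds nothing and is short of its positive
  demand.\<close>

lemma demand_ex:
  assumes N0: "\<And>w. 0 \<le> N w" shows "\<exists>w\<le>length ps. psum (held ch t w) ps < (N w + 1 / 2 ^ w) / 2 ^ (e + K)"
proof -
  have "card (pw ` set ps) \<le> length ps" using card_image_le[of "set ps" pw] card_length[of ps] by simp
  then have "card (pw ` set ps) < card {..length ps}" by simp
  then have "\<not> {..length ps} \<subseteq> pw ` set ps" using card_mono[of "pw ` set ps" "{..length ps}"] by fastforce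
  then have "\<exists>w. w \<in> {..length ps} \<and> w \<notin> pw ` set ps" unfolding subset_iff not_all not_imp .
  then obtain w where w: "w \<in> {..length ps}" "w \<notin> pw ` set ps" by (elim exE conjE)
  have "psum (held ch t w) ps \<le> psum (\<lambda>_. False) ps"
  proof (rule psum_mono)
    fix p assume p: "p \<in> set ps" "held ch t w p"
    then have "pw p = w" unfolding held_def by (elim conjE)
    then have "w \<in> pw ` set ps" using p(1) by (rule image_eqI[OF sym])
    then show False using w(2) by contradiction
  qed
  also have "\<dots> = 0" by (simp add: psum_def)
  also have "0 < (N w + 1 / 2 ^ w) / 2 ^ (e + K)" using N0[of w] by (intro divide_pos_pos add_nonneg_pos) simp_all
  finally have "psum (held ch t w) ps < (N w + 1 / 2 ^ w) / 2 ^ (e + K)" .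
  then show ?thesis using w(1) by (intro exI[of _ w] conjI) simp_all
qed

text \<open>\<open>sg r\<close> is the opponent's answer to round \<open>r\<close> and
  \<open>N t w\<close> the demand for target \<open>w\<close> at round \<open>t\<close>. By
  \<open>Nm\<close> a demand can drop only if the answers change below \<open>w\<close>.\<close>

locale game =
  fixes sg :: "nat \<Rightarrow> bool list" and N :: "nat \<Rightarrow> nat \<Rightarrow> real" and K m :: nat
  assumes m0: "0 < m"
    and N0: "\<And>t w. 0 \<le> N t w" and N1: "\<And>t M. (\<Sum>w<M. N t w) \<le> 1"
    and Nm: "\<And>b t w. b \<le> t \<Longrightarrow> \<not> (\<exists>r. b \<le> r \<and> r < t \<and> take w (sg r) \<noteq> take w (if b = 0 then [] else sg (b - 1))) \<Longrightarrow> N b w \<le> N t w"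
begin

text \<open>The guess in force when round \<open>b\<close> begins; before round 0 there is
  none.\<close>

definition sgp :: "nat \<Rightarrow> bool list" where "sgp b = (if b = 0 then [] else sg (b - 1))"

definition ch :: "nat \<Rightarrow> nat \<Rightarrow> nat \<Rightarrow> bool" where
  "ch b t w \<longleftrightarrow> (\<exists>r. b \<le> r \<and> r < t \<and> take w (sg r) \<noteq> take w (sgp b))"

lemma N_mono: "b \<le> t \<Longrightarrow> \<not> ch b t w \<Longrightarrow> N b w \<le> N t w" using Nm[of b t w] unfolding ch_def sgp_def by blast
lemma ch_mono: "ch b t w \<Longrightarrow> t \<le> t' \<Longrightarrow> ch b t' w" unfolding ch_def using less_le_trans by blast
lemma ch_sgp: assumes "\<not> ch b t w" "b < t" shows "take w (sgp t) = take w (sgp b)"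
proof -
  have "b \<le> t - 1" "t - 1 < t" using assms(2) by simp_all
  then have "take w (sg (t - 1)) = take w (sgp b)" using assms(1) unfolding ch_def by blast
  then show ?thesis unfolding sgp_def[of t] using assms(2) by simp
qed

abbreviation "pk t e ps \<equiv> pick K ch (N t) t e ps"

primrec S :: "nat \<Rightarrow> frame list" where
  "S 0 = start K ch (N 0) m"
| "S (Suc t) = adv K ch (N (Suc t)) (Suc t) (S t)"

lemma length_S [simp]: "length (S t) = m" by (induction t) simp_all

definition out :: "nat \<Rightarrow> nat" where "out t = goal (S t)"
text \<open>Level \<open>m\<close> stands for the imaginary run around the outermost one, whose
  single piece begins at round 0 with grant \<open>2 ^ (-1)\<close>.\<close>

definition Q :: "nat \<Rightarrow> nat \<Rightarrow> nat" where "Q t i = (if i < m then fq (S t ! i) else 1)"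
definition Bg :: "nat \<Rightarrow> nat \<Rightarrow> nat" where "Bg t i = (if i < m then fb (S t ! i) else 0)"

lemma goal_drop: "goal (drop i (S t)) = Q t i"
  unfolding goal_def Q_def by (simp add: hd_drop_conv_nth)

lemma out_Q: "out t = Q t 0" using goal_drop[of 0 t] by (simp add: out_def)

lemma S_start: "i < m \<Longrightarrow> S 0 ! i = pk 0 (Q 0 (Suc i)) []"
  using start_nth[of i m K ch "N 0"] goal_drop[of "Suc i" 0] by simp

lemma L_ex: "\<exists>l. l \<le> m \<and> (\<forall>i<l. full ch (Suc t) (fe (S t ! i)) (rcd (Suc t) (S t ! i)) \<and> S (Suc t) ! i = pk (Suc t) (Q (Suc t) (Suc i)) [])
    \<and> (l < m \<longrightarrow> \<not> full ch (Suc t) (fe (S t ! l)) (rcd (Suc t) (S t ! l)) \<and> S (Suc t) ! l = pk (Suc t) (fe (S t ! l)) (rcd (Suc t) (S t ! l)))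
    \<and> (\<forall>i. l < i \<longrightarrow> i < m \<longrightarrow> S (Suc t) ! i = S t ! i)"
  using adv_step[of "S t" ch "Suc t" K "N (Suc t)"] unfolding S.simps(2)[symmetric] goal_drop length_S .

text \<open>The level that moves on after round \<open>t\<close>, all runs inside it having reached
  their goals; \<open>m\<close> means that the outermost run has done so too.\<close>

definition L :: "nat \<Rightarrow> nat" where
  "L t = (SOME l. l \<le> m \<and> (\<forall>i<l. full ch (Suc t) (fe (S t ! i)) (rcd (Suc t) (S t ! i)) \<and> S (Suc t) ! i = pk (Suc t) (Q (Suc t) (Suc i)) [])
    \<and> (l < m \<longrightarrow> \<not> full ch (Suc t) (fe (S t ! l)) (rcd (Suc t) (S t ! l)) \<and> S (Suc t) ! l = pk (Suc t) (fe (S t ! l)) (rcd (Suc t) (S t ! l)))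
    \<and> (\<forall>i. l < i \<longrightarrow> i < m \<longrightarrow> S (Suc t) ! i = S t ! i))"

lemma L_le: "L t \<le> m"
  and L_done: "i < L t \<Longrightarrow> full ch (Suc t) (fe (S t ! i)) (rcd (Suc t) (S t ! i))"
  and L_fresh: "i < L t \<Longrightarrow> S (Suc t) ! i = pk (Suc t) (Q (Suc t) (Suc i)) []"
  and L_not: "L t < m \<Longrightarrow> \<not> full ch (Suc t) (fe (S t ! L t)) (rcd (Suc t) (S t ! L t))"
  and L_pick: "L t < m \<Longrightarrow> S (Suc t) ! L t = pk (Suc t) (fe (S t ! L t)) (rcd (Suc t) (S t ! L t))"
  and L_same: "L t < i \<Longrightarrow> i < m \<Longrightarrow> S (Suc t) ! i = S t ! i"
  using someI_ex[OF L_ex[of t]] unfolding L_def[symmetric] by blast+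

text \<open>The possible histories of one run begun at round \<open>s\<close> with goal
  \<open>2 ^ (-e)\<close>, regardless of the nesting. The bounds on waste are inductions over this
  relation.\<close>

inductive gf :: "nat \<Rightarrow> nat \<Rightarrow> nat \<Rightarrow> piece list \<Rightarrow> bool" for e s where
  gf_Nil: "gf e s s []"
| gf_Cons: "gf e s b ps \<Longrightarrow> \<not> full ch b e ps \<Longrightarrow> b < b' \<Longrightarrow> gf e s b' ((b, b', fw (pk b e ps), fq (pk b e ps)) # ps)"

lemma gf_le: "gf e s t ps \<Longrightarrow> s + length ps \<le> t" by (induction rule: gf.induct) simp_all

lemmas pickw_ex = demand_ex[where N = "N t" and ch = ch and t = t and K = K for t, OF N0]

lemma pickw_le: "pickw K ch (N t) t e ps \<le> length ps"
proof -
  obtain w where w: "w \<le> length ps" "psum (held ch t w) ps < (N t w + 1 / 2 ^ w) / 2 ^ (e + K)"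
    using pickw_ex[of ps t e] by (elim exE conjE)
  have "pickw K ch (N t) t e ps \<le> w" unfolding pickw_def by (rule Least_le) (rule w(2))
  then show ?thesis using w(1) by (rule le_trans)
qed

lemma pickw_held: "psum (held ch t (pickw K ch (N t) t e ps)) ps < (N t (pickw K ch (N t) t e ps) + 1 / 2 ^ pickw K ch (N t) t e ps) / 2 ^ (e + K)"
proof -
  have "\<exists>w. psum (held ch t w) ps < (N t w + 1 / 2 ^ w) / 2 ^ (e + K)" using pickw_ex[of ps t e] by (elim exE conjE, intro exI)
  from LeastI_ex[OF this] show ?thesis unfolding pickw_def[of K ch "N t" t e ps, symmetric] .
qed

lemma pickw_less: assumes "w < pickw K ch (N t) t e ps" shows "(N t w + 1 / 2 ^ w) / 2 ^ (e + K) \<le> psum (held ch t w) ps"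
  using not_less_Least[OF assms[unfolded pickw_def]] by simp

text \<open>A target is at most the number of earlier pieces and hence at most the round at which
  its piece begins. So every answer to a round of the piece is long enough to show a change below
  the target.\<close>

lemma gf_piece: "gf e s t ps \<Longrightarrow> p \<in> set ps \<Longrightarrow> s \<le> pb p \<and> pb p < pe p \<and> pe p \<le> t \<and> pw p \<le> pb p"
proof (induction rule: gf.induct)
  case (gf_Cons b ps b')
  show ?case
  proof (cases "p \<in> set ps")
    case True then show ?thesis using gf_Cons by simp
  next
    case False
    then have p: "p = (b, b', fw (pk b e ps), fq (pk b e ps))" using gf_Cons.prems by simp
    have "pickw K ch (N b) b e ps \<le> b" using pickw_le[of b e ps] gf_le[OF gf_Cons.hyps(1)] by simp
    then show ?thesis unfolding p using gf_le[OF gf_Cons.hyps(1)] gf_Cons.hyps(3) by simp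
  qed
qed simp

lemma gf_distinct: "gf e s t ps \<Longrightarrow> distinct (map pb ps)"
proof (induction rule: gf.induct)
  case (gf_Cons b ps b')
  have "b \<notin> pb ` set ps"
  proof
    assume "b \<in> pb ` set ps"
    then obtain p where "p \<in> set ps" "b = pb p" by blast
    then show False using gf_piece[OF gf_Cons.hyps(1)] by fastforce
  qed
  then show ?case using gf_Cons by simp
qed simp

text \<open>The grants of the pieces wasted on \<open>w\<close> are
  \<open>2 ^ (-(e + K + w))\<close> and its successive halves.\<close>

lemma gf_wasted: "gf e s t ps \<Longrightarrow> psum (\<lambda>p. pw p = w \<and> wast ch p) ps = (2 - 2 / 2 ^ wcount ch w ps) / 2 ^ (e + K + w)"
proof (induction rule: gf.induct)
  case gf_Nil then show ?case by (simp add: wcount_def)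
next
  case (gf_Cons b ps b')
  let ?p = "(b, b', fw (pk b e ps), fq (pk b e ps))"
  show ?case
  proof (cases "pw ?p = w \<and> wast ch ?p")
    case False
    then have "wcount ch w (?p # ps) = wcount ch w ps" unfolding wcount_def by (simp only: filter.simps if_False)
    then show ?thesis using gf_Cons.IH False by (simp only: psum_Cons if_False add_0)
  next
    case True
    then have w: "wcount ch w (?p # ps) = Suc (wcount ch w ps)" unfolding wcount_def by (simp only: filter.simps if_True simp_thms list.size add_Suc_right add_0_right)
    have "pq ?p = e + K + w + wcount ch w ps" using True by simp
    with gf_Cons.IH True have "psum (\<lambda>p. pw p = w \<and> wast ch p) (?p # ps) = 1 / 2 ^ (e + K + w + wcount ch w ps) + (2 - 2 / 2 ^ wcount ch w ps) / 2 ^ (e + K + w)"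
      by (simp only: psum_Cons if_True simp_thms)
    also have "\<dots> = (1 / 2 ^ wcount ch w ps + (2 - 2 / 2 ^ wcount ch w ps)) / 2 ^ (e + K + w)"
      by (simp only: power_add[of 2 "e + K + w"] add_divide_distrib divide_divide_eq_left mult.commute)
    also have "\<dots> = (2 - 2 / 2 ^ Suc (wcount ch w ps)) / 2 ^ (e + K + w)" by simp
    finally show ?thesis unfolding w .
  qed
qed

text \<open>A piece is granted only while the demand is unmet, and that demand has not dropped if
  the piece is still held; so held pieces exceed the demand by at most one grant.\<close>

lemma gf_held: "gf e s t ps \<Longrightarrow> t \<le> T \<Longrightarrow> psum (held ch T w) ps \<le> (N T w + 2 / 2 ^ w) / 2 ^ (e + K)"
proof (induction rule: gf.induct)
  case gf_Nil then show ?case using N0[of T w] by simp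
next
  case (gf_Cons b ps b')
  let ?p = "(b, b', fw (pk b e ps), fq (pk b e ps))"
  show ?case
  proof (cases "held ch T w ?p")
    case False
    then show ?thesis using gf_Cons by (simp add: psum_Cons)
  next
    case True
    then have w: "w = pickw K ch (N b) b e ps" and nc: "\<not> ch b T w" unfolding held_def by simp_all
    have bT: "b \<le> T" using gf_Cons.hyps(3) gf_Cons.prems by simp
    have "psum (held ch T w) ps \<le> psum (held ch b w) ps"
      by (rule psum_mono) (use ch_mono[OF _ bT] in \<open>auto simp: held_def\<close>)
    moreover have "psum (held ch b w) ps < (N b w + 1 / 2 ^ w) / 2 ^ (e + K)" unfolding w by (rule pickw_held)
    moreover have "1 / 2 ^ pq ?p \<le> (1 / 2 ^ w) / (2::real) ^ (e + K)"
    proof -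
      have "e + K + w \<le> pq ?p" unfolding w by simp
      then have "(2::real) ^ (e + K + w) \<le> 2 ^ pq ?p" by (rule power_increasing) simp
      then have "1 / 2 ^ pq ?p \<le> 1 / (2::real) ^ (e + K + w)" by (intro divide_left_mono) simp_all
      then show ?thesis by (simp only: power_add[of 2 "e + K"] divide_divide_eq_left mult.commute)
    qed
    moreover have "(N b w + 1 / 2 ^ w) / 2 ^ (e + K) + (1 / 2 ^ w) / 2 ^ (e + K) \<le> (N T w + 2 / 2 ^ w) / 2 ^ (e + K)"
      unfolding add_divide_distrib[symmetric] by (rule divide_right_mono) (use N_mono[OF bT nc] in simp_all)
    ultimately have "psum (held ch T w) ps + 1 / 2 ^ pq ?p \<le> (N T w + 2 / 2 ^ w) / 2 ^ (e + K)" by linarith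
    then show ?thesis using True by (simp only: psum_Cons if_True add.commute)
  qed
qed

lemma geo2: "(\<Sum>w<M. 2 / 2 ^ w :: real) \<le> 4"
proof -
  have "(\<Sum>w<M. 2 / 2 ^ w :: real) = 4 - 4 / 2 ^ M" by (induction M) simp_all
  then show ?thesis by simp
qed

text \<open>Of the \<open>9\<close>, the wasted pieces account for \<open>4\<close>; the held ones
  for \<open>5\<close>, which is \<open>1\<close> for the sum of \<open>N\<close> and
  \<open>4\<close> for the geometric part. The promoted pieces stay below the goal.\<close>

lemma gf_total:
  assumes g: "gf e s t ps" and n: "\<not> full ch t e ps" shows "psum (\<lambda>_. True) ps \<le> (1 + 9 / 2 ^ K) / 2 ^ e"
proof -
  have M: "pw p < Suc t" if "p \<in> set ps" for p using gf_piece[OF g that] by simp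
  have "psum (wast ch) ps = (\<Sum>w<Suc t. psum (\<lambda>p. pw p = w \<and> wast ch p) ps)" by (rule psum_targets[OF M])
  also have "\<dots> \<le> (\<Sum>w<Suc t. (2 / 2 ^ w) / 2 ^ (e + K))"
  proof (rule sum_mono)
    fix w
    have "psum (\<lambda>p. pw p = w \<and> wast ch p) ps \<le> 2 / 2 ^ (e + K + w)" unfolding gf_wasted[OF g] by (intro divide_right_mono) simp_all
    then show "psum (\<lambda>p. pw p = w \<and> wast ch p) ps \<le> (2 / 2 ^ w) / 2 ^ (e + K)"
      by (simp only: power_add[of 2 "e + K"] divide_divide_eq_left mult.commute)
  qed
  also have "\<dots> = (\<Sum>w<Suc t. 2 / 2 ^ w) / 2 ^ (e + K)" by (rule sum_divide_distrib[symmetric])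
  also have "\<dots> \<le> 4 / 2 ^ (e + K)" by (intro divide_right_mono geo2) simp
  finally have 1: "psum (wast ch) ps \<le> 4 / 2 ^ (e + K)" .
  have "psum (\<lambda>p. \<not> ch (pb p) t (pw p)) ps = (\<Sum>w<Suc t. psum (\<lambda>p. pw p = w \<and> \<not> ch (pb p) t (pw p)) ps)" by (rule psum_targets[OF M])
  also have "\<dots> \<le> (\<Sum>w<Suc t. (N t w + 2 / 2 ^ w) / 2 ^ (e + K))"
  proof (rule sum_mono)
    fix w
    have "psum (\<lambda>p. pw p = w \<and> \<not> ch (pb p) t (pw p)) ps \<le> psum (held ch t w) ps" by (rule psum_mono) (auto simp: held_def)
    then show "psum (\<lambda>p. pw p = w \<and> \<not> ch (pb p) t (pw p)) ps \<le> (N t w + 2 / 2 ^ w) / 2 ^ (e + K)" using gf_held[OF g order_refl, of w] by linarith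
  qed
  also have "\<dots> = ((\<Sum>w<Suc t. N t w) + (\<Sum>w<Suc t. 2 / 2 ^ w)) / 2 ^ (e + K)"
    by (simp only: sum_divide_distrib[symmetric] sum.distrib)
  also have "\<dots> \<le> 5 / 2 ^ (e + K)" using N1[where t = t and M = "Suc t"] geo2[of "Suc t"] by (intro divide_right_mono) simp_all
  finally have 2: "psum (\<lambda>p. \<not> ch (pb p) t (pw p)) ps \<le> 5 / 2 ^ (e + K)" .
  have 3: "psum (prom ch t) ps < 1 / 2 ^ e" using n unfolding full_def by simp
  have "psum (\<lambda>_. True) ps \<le> psum (wast ch) ps + psum (\<lambda>p. \<not> ch (pb p) t (pw p)) ps + psum (prom ch t) ps"
    by (rule psum_split3) (auto simp: prom_def wast_def)
  also have "\<dots> \<le> 4 / 2 ^ (e + K) + 5 / 2 ^ (e + K) + 1 / 2 ^ e" using 1 2 3 by linarith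
  also have "\<dots> = (1 + 9 / 2 ^ K) / 2 ^ e" by (simp add: power_add field_simps)
  finally show ?thesis .
qed

definition mass :: "nat set \<Rightarrow> real" where "mass D = (\<Sum>n\<in>D. 1 / 2 ^ out n)"

lemma mass_Un: "finite D \<Longrightarrow> finite D' \<Longrightarrow> D \<inter> D' = {} \<Longrightarrow> mass (D \<union> D') = mass D + mass D'"
  unfolding mass_def by (rule sum.union_disjoint)
lemma mass_split: "a \<le> c \<Longrightarrow> c \<le> d \<Longrightarrow> mass {a..<d} = mass {a..<c} + mass {c..<d}"
  by (subst mass_Un[symmetric]) (auto simp: ivl_disj_un)

lemma gf_mass: "gf e s t ps \<Longrightarrow> (\<And>p. p \<in> set ps \<Longrightarrow> mass {pb p..<pe p} \<le> B / 2 ^ pq p) \<Longrightarrow> mass {s..<t} \<le> B * psum (\<lambda>_. True) ps"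
proof (induction rule: gf.induct)
  case gf_Nil then show ?case by (simp add: mass_def)
next
  case (gf_Cons b ps b')
  let ?p = "(b, b', fw (pk b e ps), fq (pk b e ps))"
  have "mass {s..<b'} = mass {s..<b} + mass {b..<b'}" using gf_le[OF gf_Cons.hyps(1)] gf_Cons.hyps(3) by (intro mass_split) simp_all
  moreover have "mass {b..<b'} \<le> B / 2 ^ pq ?p" using gf_Cons.prems[of ?p] by simp
  moreover have "mass {s..<b} \<le> B * psum (\<lambda>_. True) ps" by (rule gf_Cons.IH) (rule gf_Cons.prems, simp)
  moreover have "B * psum (\<lambda>_. True) (?p # ps) = B / 2 ^ pq ?p + B * psum (\<lambda>_. True) ps"
    unfolding psum_Cons by (simp only: if_True distrib_left mult_1_right times_divide_eq_right)
  ultimately show ?case by linarith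
qed

lemma gf_rounds: "gf e s t ps \<Longrightarrow> (\<And>p. p \<in> set ps \<Longrightarrow> P p \<Longrightarrow> \<exists>D\<subseteq>{pb p..<pe p}. 1 / 2 ^ pq p \<le> mass D \<and> (\<forall>n\<in>D. X n))
  \<Longrightarrow> \<exists>D\<subseteq>{s..<t}. psum P ps \<le> mass D \<and> (\<forall>n\<in>D. X n)"
proof (induction rule: gf.induct)
  case gf_Nil then show ?case by (intro exI[of _ "{}"]) (simp add: mass_def)
next
  case (gf_Cons b ps b')
  let ?p = "(b, b', fw (pk b e ps), fq (pk b e ps))"
  have "\<exists>D\<subseteq>{s..<b}. psum P ps \<le> mass D \<and> (\<forall>n\<in>D. X n)" by (rule gf_Cons.IH) (rule gf_Cons.prems, simp_all)
  then obtain D where D: "D \<subseteq> {s..<b}" "psum P ps \<le> mass D" "\<forall>n\<in>D. X n" by (elim exE conjE)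
  have "\<exists>D'\<subseteq>{b..<b'}. (if P ?p then 1 / 2 ^ pq ?p else 0) \<le> mass D' \<and> (\<forall>n\<in>D'. X n)"
  proof (cases "P ?p")
    case True then show ?thesis using gf_Cons.prems[of ?p] by simp
  next
    case False then show ?thesis by (intro exI[of _ "{}"]) (simp add: mass_def)
  qed
  then obtain D' where D': "D' \<subseteq> {b..<b'}" "(if P ?p then 1 / 2 ^ pq ?p else 0) \<le> mass D'" "\<forall>n\<in>D'. X n" by (elim exE conjE)
  have "s \<le> b" using gf_le[OF gf_Cons.hyps(1)] by simp
  then have sub: "{s..<b} \<subseteq> {s..<b'}" "{b..<b'} \<subseteq> {s..<b'}" using gf_Cons.hyps(3) by auto
  have fin: "finite D" "finite D'" using D(1) D'(1) by (auto intro: finite_subset)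
  have "D \<inter> D' = {}" using D(1) D'(1) by fastforce
  then have "mass (D \<union> D') = mass D + mass D'" by (rule mass_Un[OF fin])
  then have "psum P (?p # ps) \<le> mass (D \<union> D')" using D(2) D'(2) unfolding psum_Cons by linarith
  moreover have "D \<union> D' \<subseteq> {s..<b'}" using D(1) D'(1) sub by blast
  moreover have "\<forall>n\<in>D \<union> D'. X n" using D(3) D'(3) by blast
  ultimately show ?case by blast
qed

text \<open>The different answers that round \<open>n\<close> has received before \<open>T\<close>;
  for each of them \<open>U\<close> needs a description of its own.\<close>

definition rs :: "nat \<Rightarrow> nat \<Rightarrow> bool list set" where "rs n T = (\<lambda>r. take (Suc n) (sg r)) ` {n..<T}"

definition good :: "nat \<Rightarrow> nat \<Rightarrow> nat \<Rightarrow> nat \<Rightarrow> bool" where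
  "good i b b' q \<longleftrightarrow> (\<exists>D\<subseteq>{b..<b'}. 1 / 2 ^ q \<le> mass D \<and> (\<forall>n\<in>D. Suc i \<le> card (rs n b')))"

text \<open>While the piece ran, all answers agreed below its target. A later answer differs there,
  so it is new for every round of the piece.\<close>

lemma rs_promoted:
  assumes "prom ch T p" "pb p \<le> n" "n < pe p" "pw p \<le> n" "pe p \<le> T" "Suc i \<le> card (rs n (pe p))"
  shows "Suc (Suc i) \<le> card (rs n T)"
proof -
  have nw: "take (pw p) (sg r) = take (pw p) (sgp (pb p))" if "pb p \<le> r" "r < pe p" for r
    using assms(1) that unfolding prom_def ch_def by blast
  obtain r where r: "pb p \<le> r" "r < T" "take (pw p) (sg r) \<noteq> take (pw p) (sgp (pb p))" using assms(1) unfolding prom_def ch_def by blast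
  have re: "pe p \<le> r" using nw[of r] r by (cases "pe p \<le> r") simp_all
  have "take (Suc n) (sg r) \<notin> rs n (pe p)"
  proof
    assume "take (Suc n) (sg r) \<in> rs n (pe p)"
    then obtain r' where r': "n \<le> r'" "r' < pe p" "take (Suc n) (sg r) = take (Suc n) (sg r')" unfolding rs_def by auto
    from r'(3) have "take (pw p) (take (Suc n) (sg r)) = take (pw p) (take (Suc n) (sg r'))" by (rule arg_cong)
    then have "take (pw p) (sg r) = take (pw p) (sg r')" using assms(4) by (simp add: min_def)
    then show False using nw[of r'] r' r(3) assms(2) by simp
  qed
  moreover have "take (Suc n) (sg r) \<in> rs n T" unfolding rs_def using re assms(3) r(2) by auto
  moreover have "rs n (pe p) \<subseteq> rs n T" unfolding rs_def using assms(5) by auto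
  ultimately have "rs n (pe p) \<subset> rs n T" by blast
  then have "card (rs n (pe p)) < card (rs n T)" by (rule psubset_card_mono[rotated]) (simp add: rs_def)
  then show ?thesis using assms(6) by simp
qed

text \<open>How far one level overspends: \<open>1 + 9 / 2 ^ K\<close> from \<open>gf_total\<close>,
  and \<open>1 / 2 ^ K\<close> for the piece still running.\<close>

definition Bf :: real where "Bf = 1 + 10 / 2 ^ K"

section \<open>The invariant of the nested runs\<close>

definition Inv :: "nat \<Rightarrow> bool" where
  "Inv t \<longleftrightarrow> Bg t 0 = t \<and> (\<forall>i<m. gf (fe (S t ! i)) (Bg t (Suc i)) (fb (S t ! i)) (fps (S t ! i)) \<and> \<not> full ch (fb (S t ! i)) (fe (S t ! i)) (fps (S t ! i))
     \<and> S t ! i = pk (fb (S t ! i)) (fe (S t ! i)) (fps (S t ! i)) \<and> fe (S t ! i) = Q t (Suc i) \<and> fb (S t ! i) \<le> t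
     \<and> (\<forall>p\<in>set (fps (S t ! i)). good i (pb p) (pe p) (pq p) \<and> mass {pb p..<pe p} \<le> Bf ^ i / 2 ^ pq p))"

lemma InvD:
  assumes "Inv t" "i < m"
  shows "gf (fe (S t ! i)) (Bg t (Suc i)) (fb (S t ! i)) (fps (S t ! i))" "\<not> full ch (fb (S t ! i)) (fe (S t ! i)) (fps (S t ! i))"
    "S t ! i = pk (fb (S t ! i)) (fe (S t ! i)) (fps (S t ! i))" "fe (S t ! i) = Q t (Suc i)" "fb (S t ! i) \<le> t"
    "\<And>p. p \<in> set (fps (S t ! i)) \<Longrightarrow> good i (pb p) (pe p) (pq p)" "\<And>p. p \<in> set (fps (S t ! i)) \<Longrightarrow> mass {pb p..<pe p} \<le> Bf ^ i / 2 ^ pq p"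
  using assms unfolding Inv_def by blast+

lemma Inv_gf: assumes "Inv t" "i < m" shows "gf (fe (S t ! i)) (Bg t (Suc i)) (Suc t) (rcd (Suc t) (S t ! i))"
proof -
  let ?F = "S t ! i"
  have "gf (fe ?F) (Bg t (Suc i)) (Suc t) ((fb ?F, Suc t, fw (pk (fb ?F) (fe ?F) (fps ?F)), fq (pk (fb ?F) (fe ?F) (fps ?F))) # fps ?F)"
    by (rule gf_Cons[OF InvD(1,2)[OF assms]]) (use InvD(5)[OF assms] in simp)
  then show ?thesis unfolding rcd_def InvD(3)[OF assms, symmetric] .
qed

lemma Inv_total:
  assumes "Inv t" "i < m" shows "psum (\<lambda>_. True) (fps (S t ! i)) + 1 / 2 ^ Q t i \<le> Bf / 2 ^ Q t (Suc i)"
proof -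
  let ?F = "S t ! i"
  have q: "fe ?F + K \<le> fq ?F" using arg_cong[OF InvD(3)[OF assms], of fq] by simp
  have "Q t i = fq ?F" unfolding Q_def using assms(2) by simp
  moreover have "(2::real) ^ (fe ?F + K) \<le> 2 ^ fq ?F" using q by (rule power_increasing) simp
  then have "(1::real) / 2 ^ fq ?F \<le> 1 / 2 ^ (fe ?F + K)" by (intro divide_left_mono) simp_all
  moreover have "psum (\<lambda>_. True) (fps ?F) \<le> (1 + 9 / 2 ^ K) / 2 ^ fe ?F" by (rule gf_total[OF InvD(1,2)[OF assms]])
  moreover have "(1 + 9 / 2 ^ K) / 2 ^ fe ?F + 1 / 2 ^ (fe ?F + K) = Bf / 2 ^ fe ?F" unfolding Bf_def by (simp add: power_add field_simps)
  ultimately show ?thesis unfolding InvD(4)[OF assms, symmetric] by (simp only:)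
qed

text \<open>Each level spends at most \<open>Bf\<close> times its grant, so the factors multiply
  from level to level.\<close>

lemma Inv_mass: assumes "Inv t" "i \<le> m" shows "mass {Bg t i..<Suc t} \<le> Bf ^ i / 2 ^ Q t i"
  using assms(2)
proof (induction i)
  case 0
  have "Bg t 0 = t" using assms(1) unfolding Inv_def by blast
  then show ?case by (simp add: mass_def out_Q)
next
  case (Suc i)
  then have i: "i < m" by simp
  let ?F = "S t ! i"
  have Bfi: "0 \<le> Bf ^ i" unfolding Bf_def by (intro zero_le_power add_nonneg_nonneg) simp_all
  have b: "Bg t i = fb ?F" unfolding Bg_def using i by simp
  have "mass {Bg t (Suc i)..<Suc t} = mass {Bg t (Suc i)..<fb ?F} + mass {fb ?F..<Suc t}"
    using gf_le[OF InvD(1)[OF assms(1) i]] InvD(5)[OF assms(1) i] by (intro mass_split) simp_all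
  also have "\<dots> \<le> Bf ^ i * psum (\<lambda>_. True) (fps ?F) + Bf ^ i / 2 ^ Q t i"
    using gf_mass[OF InvD(1)[OF assms(1) i] InvD(7)[OF assms(1) i]] Suc.IH i unfolding b by simp
  also have "\<dots> = Bf ^ i * (psum (\<lambda>_. True) (fps ?F) + 1 / 2 ^ Q t i)" by (simp add: distrib_left)
  also have "\<dots> \<le> Bf ^ i * (Bf / 2 ^ Q t (Suc i))" by (rule mult_left_mono[OF Inv_total[OF assms(1) i] Bfi])
  finally show ?case by (simp add: mult.commute)
qed

text \<open>Upwards through the runs that end at this round: the promoted pieces of a finished run
  supply the rounds, with one answer more, for the piece of the level above.\<close>

lemma Inv_good: assumes "Inv t" "i \<le> L t" shows "good i (Bg t i) (Suc t) (Q t i)"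
  using assms(2)
proof (induction i)
  case 0
  have "Bg t 0 = t" using assms(1) unfolding Inv_def by blast
  then show ?case unfolding good_def by (intro exI[of _ "{t}"]) (simp add: mass_def out_Q rs_def)
next
  case (Suc i)
  then have i: "i < L t" "i < m" using L_le[of t] by simp_all
  let ?F = "S t ! i"
  note g = Inv_gf[OF assms(1) i(2)]
  have gd: "good i (pb p) (pe p) (pq p)" if p: "p \<in> set (rcd (Suc t) ?F)" for p
  proof (cases "p \<in> set (fps ?F)")
    case True then show ?thesis by (rule InvD(6)[OF assms(1) i(2)])
  next
    case False
    then have "p = (fb ?F, Suc t, fw ?F, fq ?F)" using p unfolding rcd_def by simp
    then show ?thesis using Suc.IH i unfolding Bg_def Q_def by simp
  qed
  have "\<exists>D\<subseteq>{Bg t (Suc i)..<Suc t}. psum (prom ch (Suc t)) (rcd (Suc t) ?F) \<le> mass D \<and> (\<forall>n\<in>D. Suc (Suc i) \<le> card (rs n (Suc t)))"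
  proof (rule gf_rounds[OF g])
    fix p assume p: "p \<in> set (rcd (Suc t) ?F)" "prom ch (Suc t) p"
    obtain D where D: "D \<subseteq> {pb p..<pe p}" "1 / 2 ^ pq p \<le> mass D" "\<forall>n\<in>D. Suc i \<le> card (rs n (pe p))"
      using gd[OF p(1)] unfolding good_def by (elim exE conjE)
    have "Suc (Suc i) \<le> card (rs n (Suc t))" if "n \<in> D" for n
    proof (rule rs_promoted[OF p(2)])
      have "n \<in> {pb p..<pe p}" using D(1) that by blast
      then show "pb p \<le> n" "n < pe p" "pw p \<le> n" "pe p \<le> Suc t" using gf_piece[OF g p(1)] by simp_all
      show "Suc i \<le> card (rs n (pe p))" using D(3) that by blast
    qed
    then show "\<exists>D\<subseteq>{pb p..<pe p}. 1 / 2 ^ pq p \<le> mass D \<and> (\<forall>n\<in>D. Suc (Suc i) \<le> card (rs n (Suc t)))"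
      using D(1,2) by (intro exI[of _ D] conjI ballI)
  qed
  then obtain D where D: "D \<subseteq> {Bg t (Suc i)..<Suc t}" "psum (prom ch (Suc t)) (rcd (Suc t) ?F) \<le> mass D" "\<forall>n\<in>D. Suc (Suc i) \<le> card (rs n (Suc t))"
    by (elim exE conjE)
  have "1 / 2 ^ Q t (Suc i) \<le> mass D" using D(2) L_done[OF i(1)] unfolding full_def InvD(4)[OF assms(1) i(2)] by linarith
  then show ?case unfolding good_def using D(1,3) by (intro exI[of _ D] conjI)
qed

lemma not_full_Nil: "\<not> full c t e []"
  unfolding full_def psum_Nil not_le by simp

lemma Inv_0: "Inv 0"
  unfolding Inv_def
proof (intro conjI allI impI)
  show "Bg 0 0 = 0" unfolding Bg_def using m0 by (simp add: S_start del: S.simps)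
  fix i assume i: "i < m"
  have b: "Bg 0 j = 0" for j unfolding Bg_def by (simp add: S_start del: S.simps)
  show "gf (fe (S 0 ! i)) (Bg 0 (Suc i)) (fb (S 0 ! i)) (fps (S 0 ! i))" unfolding S_start[OF i] pick_sel b by (rule gf_Nil)
  show "\<not> full ch (fb (S 0 ! i)) (fe (S 0 ! i)) (fps (S 0 ! i))" unfolding S_start[OF i] pick_sel by (rule not_full_Nil)
  show "S 0 ! i = pk (fb (S 0 ! i)) (fe (S 0 ! i)) (fps (S 0 ! i))" unfolding S_start[OF i] pick_sel ..
  show "fe (S 0 ! i) = Q 0 (Suc i)" unfolding S_start[OF i] pick_sel ..
  show "fb (S 0 ! i) \<le> 0" unfolding S_start[OF i] pick_sel ..
  show "\<forall>p\<in>set (fps (S 0 ! i)). good i (pb p) (pe p) (pq p) \<and> mass {pb p..<pe p} \<le> Bf ^ i / 2 ^ pq p" unfolding S_start[OF i] pick_sel by simp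
qed

lemma Inv_Suc: assumes "Inv t" "L t < m" shows "Inv (Suc t)"
proof -
  have fbl: "fb (S (Suc t) ! j) = Suc t" if "j \<le> L t" for j
    using that L_fresh[of j t] L_pick[OF assms(2)] by (cases "j = L t") simp_all
  have Bl: "Bg (Suc t) j = Suc t" if "j \<le> L t" for j unfolding Bg_def using fbl[OF that] that assms(2) by simp
  have same: "Bg (Suc t) j = Bg t j" "Q (Suc t) j = Q t j" if "L t < j" for j
    unfolding Bg_def Q_def using L_same[OF that] by simp_all
  have "Bg (Suc t) 0 = Suc t" by (rule Bl) simp
  moreover have "gf (fe (S (Suc t) ! i)) (Bg (Suc t) (Suc i)) (fb (S (Suc t) ! i)) (fps (S (Suc t) ! i))
     \<and> \<not> full ch (fb (S (Suc t) ! i)) (fe (S (Suc t) ! i)) (fps (S (Suc t) ! i))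
     \<and> S (Suc t) ! i = pk (fb (S (Suc t) ! i)) (fe (S (Suc t) ! i)) (fps (S (Suc t) ! i)) \<and> fe (S (Suc t) ! i) = Q (Suc t) (Suc i) \<and> fb (S (Suc t) ! i) \<le> Suc t
     \<and> (\<forall>p\<in>set (fps (S (Suc t) ! i)). good i (pb p) (pe p) (pq p) \<and> mass {pb p..<pe p} \<le> Bf ^ i / 2 ^ pq p)" if i: "i < m" for i
  proof -
    consider "i < L t" | "i = L t" | "L t < i" by linarith
    then show ?thesis
    proof cases
      case 1
      have B: "Bg (Suc t) (Suc i) = Suc t" by (rule Bl) (use 1 in simp)
      show ?thesis unfolding L_fresh[OF 1] pick_sel B using not_full_Nil by (simp add: gf_Nil)
    next
      case 2
      let ?F = "S t ! i"
      have P: "S (Suc t) ! i = pk (Suc t) (fe ?F) (rcd (Suc t) ?F)" unfolding 2 by (rule L_pick[OF assms(2)])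
      have B: "Bg (Suc t) (Suc i) = Bg t (Suc i)" "Q (Suc t) (Suc i) = Q t (Suc i)" using same[of "Suc i"] 2 by simp_all
      have "good i (pb p) (pe p) (pq p) \<and> mass {pb p..<pe p} \<le> Bf ^ i / 2 ^ pq p" if p: "p \<in> set (rcd (Suc t) ?F)" for p
      proof (cases "p \<in> set (fps ?F)")
        case True then show ?thesis using InvD(6,7)[OF assms(1) i] by blast
      next
        case False
        then have p: "p = (fb ?F, Suc t, fw ?F, fq ?F)" using p unfolding rcd_def by simp
        have "Bg t i = fb ?F" "Q t i = fq ?F" unfolding Bg_def Q_def using i by simp_all
        then show ?thesis unfolding p using Inv_good[OF assms(1), of i] Inv_mass[OF assms(1), of i] i 2 by simp
      qed
      moreover have "\<not> full ch (Suc t) (fe ?F) (rcd (Suc t) ?F)" unfolding 2 by (rule L_not[OF assms(2)])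
      ultimately show ?thesis unfolding P pick_sel B using Inv_gf[OF assms(1) i] InvD(4)[OF assms(1) i] by simp
    next
      case 3
      have B: "Bg (Suc t) (Suc i) = Bg t (Suc i)" "Q (Suc t) (Suc i) = Q t (Suc i)" using same[of "Suc i"] 3 by simp_all
      show ?thesis unfolding L_same[OF 3 i] B by (intro conjI ballI InvD[OF assms(1) i] le_SucI)
    qed
  qed
  ultimately show ?thesis unfolding Inv_def by blast
qed

end

section \<open>The golden run\<close>

text \<open>After \<open>T\<close> no level outside \<open>i\<close> moves, so the run at level
  \<open>i\<close> is never ended, while it begins new pieces forever.\<close>

locale golden = game +
  fixes i T :: nat
  assumes inv: "\<And>t. Inv t" and im: "i < m" and Li: "\<And>t. T \<le> t \<Longrightarrow> L t \<le> i" and Linf: "\<And>n. \<exists>t\<ge>n. L t = i"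
begin

definition ps :: "nat \<Rightarrow> piece list" where "ps t = fps (S t ! i)"
definition e :: nat where "e = fe (S T ! i)"
definition W :: "nat \<Rightarrow> nat" where "W t = fw (S t ! i)"
text \<open>The rounds at which the golden run begins a piece. Just there its record is complete,
  and all demands below the new target are met.\<close>

definition bd :: "nat \<Rightarrow> bool" where "bd s \<longleftrightarrow> (\<exists>t. s = Suc t \<and> T \<le> t \<and> L t = i)"

lemma S_same: "T \<le> t \<Longrightarrow> L t \<noteq> i \<Longrightarrow> S (Suc t) ! i = S t ! i"
  using Li[of t] im by (intro L_same) simp_all
lemma S_pick: "L t = i \<Longrightarrow> S (Suc t) ! i = pk (Suc t) (fe (S t ! i)) (rcd (Suc t) (S t ! i))"
  using L_pick[of t] im by simp

lemma e_const: "T \<le> t \<Longrightarrow> fe (S t ! i) = e"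
proof (induction t rule: dec_induct)
  case base then show ?case by (simp add: e_def)
next
  case (step t) then show ?case using S_same[of t] S_pick[of t] by (cases "L t = i") (simp_all del: S.simps)
qed

lemma ps_step: assumes "T \<le> t" shows "set (ps t) \<subseteq> set (ps (Suc t))"
proof (cases "L t = i")
  case True
  show ?thesis unfolding ps_def S_pick[OF True] pick_sel rcd_def by auto
next
  case False then show ?thesis unfolding ps_def S_same[OF assms False] by simp
qed

lemma ps_mono: assumes "T \<le> t" "t \<le> t'" shows "set (ps t) \<subseteq> set (ps t')"
  using assms(2)
proof (induction t' rule: dec_induct)
  case (step n)
  have "T \<le> n" using assms(1) step.hyps by simp
  from step.IH ps_step[OF this] show ?case by (rule subset_trans)
qed simp

lemma bd_T: "bd s \<Longrightarrow> T < s" unfolding bd_def by auto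
lemma bd_inf: "\<exists>s\<ge>n. bd s"
proof -
  obtain t where "t \<ge> max T n" "L t = i" using Linf[of "max T n"] by (elim exE conjE)
  then show ?thesis by (intro exI[of _ "Suc t"]) (simp add: bd_def)
qed

lemma bd_fb: "bd s \<Longrightarrow> fb (S s ! i) = s"
  unfolding bd_def by (elim exE conjE) (simp add: S_pick del: S.simps)
lemma bd_gf: assumes "bd s" shows "gf e (Bg s (Suc i)) s (ps s)"
  using InvD(1)[OF inv im, of s] e_const[of s] bd_T[OF assms] unfolding bd_fb[OF assms] ps_def by simp
lemma bd_full: assumes "bd s" shows "\<not> full ch s e (ps s)"
  using InvD(2)[OF inv im, of s] e_const[of s] bd_T[OF assms] unfolding bd_fb[OF assms] ps_def by simp
lemma bd_W: assumes "bd s" shows "W s = pickw K ch (N s) s e (ps s)"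
proof -
  have "S s ! i = pk s e (ps s)"
    using InvD(3)[OF inv im, of s] e_const[of s] bd_T[OF assms] unfolding bd_fb[OF assms] ps_def by simp
  from arg_cong[OF this, of fw] show ?thesis unfolding W_def pick_sel .
qed

lemma bd_demand: assumes "bd s" "w < W s" shows "N s w / 2 ^ (e + K) \<le> psum (held ch s w) (ps s)"
proof -
  have "(N s w + 1 / 2 ^ w) / 2 ^ (e + K) \<le> psum (held ch s w) (ps s)" using assms(2) unfolding bd_W[OF assms(1)] by (rule pickw_less)
  moreover have "N s w / 2 ^ (e + K) \<le> (N s w + 1 / 2 ^ w) / 2 ^ (e + K)" by (intro divide_right_mono) simp_all
  ultimately show ?thesis by linarith
qed

lemma W_le: "bd s \<Longrightarrow> W s \<le> s"
  using pickw_le[of s e "ps s"] gf_le[OF bd_gf, of s] bd_W[of s] by simp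

lemma piece_recorded: assumes "bd s" "bd s'" "s < s'" shows "\<exists>p\<in>set (ps s'). pb p = s \<and> pw p = W s"
proof -
  have T: "T \<le> s" using bd_T[OF assms(1)] by simp
  have "(fb (S t ! i) = s \<and> fw (S t ! i) = W s) \<or> (\<exists>p\<in>set (ps t). pb p = s \<and> pw p = W s)" if "s \<le> t" for t
    using that
  proof (induction t rule: dec_induct)
    case base then show ?case using bd_fb[OF assms(1)] by (simp add: W_def)
  next
    case (step n)
    have Tn: "T \<le> n" using T step.hyps by simp
    show ?case
    proof (cases "L n = i")
      case False show ?thesis using step.IH unfolding ps_def S_same[OF Tn False] .
    next
      case True
      have "\<exists>p\<in>set (ps (Suc n)). pb p = s \<and> pw p = W s"
      proof (rule disjE[OF step.IH])
        assume *: "fb (S n ! i) = s \<and> fw (S n ! i) = W s"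
        have "(fb (S n ! i), Suc n, fw (S n ! i), fq (S n ! i)) \<in> set (ps (Suc n))"
          unfolding ps_def S_pick[OF True] pick_sel rcd_def by simp
        then show ?thesis by (rule bexI[rotated]) (use * in simp)
      next
        assume "\<exists>p\<in>set (ps n). pb p = s \<and> pw p = W s"
        then show ?thesis using ps_step[OF Tn] by blast
      qed
      then show ?thesis by (rule disjI2)
    qed
  qed
  from this[of s'] show ?thesis using bd_fb[OF assms(2)] assms(3) by simp
qed

text \<open>For \<open>w\<close> in \<open>X\<close>, the pieces held at \<open>s\<close> were
  answered consistently up to \<open>s\<close>, and by \<open>s'\<close> the guess differs below
  \<open>w\<close>; all of them get promoted, and none was promoted before.\<close>

lemma promote:
  assumes s: "bd s" "bd s'" "s \<le> s'" and X: "finite X" "\<And>w. w \<in> X \<Longrightarrow> w < W s \<and> take w (sgp s) \<noteq> take w (sgp s')"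
  shows "psum (prom ch s) (ps s) + (\<Sum>w\<in>X. N s w) / 2 ^ (e + K) \<le> psum (prom ch s') (ps s')"
proof -
  let ?f = "\<lambda>p::piece. 1 / 2 ^ pq p :: real"
  let ?A = "{p \<in> set (ps s). prom ch s p}" and ?B = "\<lambda>w. {p \<in> set (ps s). held ch s w p}"
  have d: "distinct (ps s)" "distinct (ps s')" using gf_distinct[OF bd_gf[OF s(1)]] gf_distinct[OF bd_gf[OF s(2)]] by (auto dest: distinct_map[THEN iffD1])
  have "(\<Sum>w\<in>X. N s w) / 2 ^ (e + K) = (\<Sum>w\<in>X. N s w / 2 ^ (e + K))" by (rule sum_divide_distrib)
  also have "\<dots> \<le> (\<Sum>w\<in>X. sum ?f (?B w))"
    by (rule sum_mono) (use bd_demand[OF s(1)] X(2) in \<open>simp add: psum_set[OF d(1), symmetric]\<close>)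
  also have "\<dots> = sum ?f (\<Union>w\<in>X. ?B w)"
    by (rule sum.UNION_disjoint[symmetric, OF X(1)]) (auto simp: held_def)
  finally have 1: "(\<Sum>w\<in>X. N s w) / 2 ^ (e + K) \<le> sum ?f (\<Union>w\<in>X. ?B w)" .
  have "psum (prom ch s) (ps s) + sum ?f (\<Union>w\<in>X. ?B w) = sum ?f (?A \<union> (\<Union>w\<in>X. ?B w))"
    unfolding psum_set[OF d(1)] by (rule sum.union_disjoint[symmetric]) (auto simp: prom_def held_def X(1))
  also have "\<dots> \<le> sum ?f {p \<in> set (ps s'). prom ch s' p}"
  proof (rule sum_mono2)
    show "?A \<union> (\<Union>w\<in>X. ?B w) \<subseteq> {p \<in> set (ps s'). prom ch s' p}"
    proof
      fix p assume p: "p \<in> ?A \<union> (\<Union>w\<in>X. ?B w)"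
      then have ps: "p \<in> set (ps s)" by blast
      have "p \<in> set (ps s')" using ps ps_mono[of s s'] bd_T[OF s(1)] s(3) by auto
      moreover have "prom ch s' p"
      proof (cases "p \<in> ?A")
        case True then show ?thesis using ch_mono[OF _ s(3)] unfolding prom_def by blast
      next
        case False
        then obtain w where w: "w \<in> X" "pw p = w" "\<not> ch (pb p) s w" using p unfolding held_def by blast
        have pe: "pb p < pe p" "pe p \<le> s" using gf_piece[OF bd_gf[OF s(1)] ps] by simp_all
        have "\<not> ch (pb p) (pe p) w" using w(3) ch_mono[OF _ pe(2)] by blast
        moreover have "take w (sgp s) = take w (sgp (pb p))" by (rule ch_sgp[OF w(3)]) (use pe in simp)
        then have "ch (pb p) s' w" using ch_sgp[of "pb p" s' w] X(2)[OF w(1)] pe s(3) by fastforce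
        ultimately show ?thesis unfolding prom_def w(2) by blast
      qed
      ultimately show "p \<in> {p \<in> set (ps s'). prom ch s' p}" by blast
    qed
  qed simp_all
  also have "\<dots> = psum (prom ch s') (ps s')" unfolding psum_set[OF d(2)] ..
  finally show ?thesis using 1 by linarith
qed

text \<open>Every destroyed demand adds its share, over \<open>2 ^ (e + K)\<close>, to the promoted
  weight, which stays below \<open>2 ^ (-e)\<close> because the run never reaches its goal.\<close>

lemma destroyed_demand:
  assumes s: "\<And>j. bd (s j)" "\<And>j. s j \<le> s (Suc j)"
    and X: "\<And>j. finite (X j)" "\<And>j w. w \<in> X j \<Longrightarrow> w < W (s j) \<and> take w (sgp (s j)) \<noteq> take w (sgp (s (Suc j)))"
  shows "(\<Sum>j<J. \<Sum>w\<in>X j. N (s j) w) \<le> 2 ^ K"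
proof -
  have "(\<Sum>j<J. \<Sum>w\<in>X j. N (s j) w) / 2 ^ (e + K) \<le> psum (prom ch (s J)) (ps (s J))"
  proof (induction J)
    case 0 then show ?case by (simp add: psum_nonneg)
  next
    case (Suc J)
    show ?case using Suc.IH promote[OF s(1)[of J] s(1)[of "Suc J"] s(2)[of J] X(1)[of J] X(2)[where j = J]] by (simp add: add_divide_distrib)
  qed
  also have "\<dots> < 1 / 2 ^ e" using bd_full[OF s(1)[of J]] unfolding full_def by simp
  finally show ?thesis by (simp add: power_add field_simps)
qed

text \<open>Once the answers agree on \<open>w\<close> bits, pieces for \<open>w\<close> are no
  longer wasted: their grants stop shrinking and they stay held. Infinitely many would exceed the
  bound on held pieces.\<close>

lemma W_finite:
  assumes conv: "\<And>r. T1 \<le> r \<Longrightarrow> take w (sg r) = \<tau>" shows "finite {s. bd s \<and> W s = w}"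
proof (rule ccontr)
  assume inf: "infinite {s. bd s \<and> W s = w}"
  have nch: "\<not> ch b t w" if "T1 < b" for b t
  proof
    assume "ch b t w"
    then obtain r where r: "b \<le> r" "take w (sg r) \<noteq> take w (sgp b)" unfolding ch_def by blast
    have "take w (sg r) = \<tau>" "take w (sg (b - 1)) = \<tau>" using r(1) that by (simp_all add: conv)
    then show False using r(2) that unfolding sgp_def by (simp split: if_splits)
  qed
  have wc: "wcount ch w qs \<le> Suc T1" if g: "gf e0 s0 t qs" for e0 s0 t qs
  proof -
    let ?F = "filter (\<lambda>p. pw p = w \<and> wast ch p) qs"
    have "length ?F = length (map pb ?F)" by simp
    also have "\<dots> = card (set (map pb ?F))"
      by (rule distinct_card[symmetric]) (rule distinct_map_filter, rule gf_distinct[OF g])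
    also have "\<dots> \<le> card {..T1}"
    proof (rule card_mono)
      show "set (map pb ?F) \<subseteq> {..T1}"
      proof
        fix b assume "b \<in> set (map pb ?F)"
        then obtain p where p: "b = pb p" "pw p = w" "wast ch p" by auto
        then show "b \<in> {..T1}" using nch[of b "pe p"] unfolding wast_def by (cases "T1 < b") auto
      qed
    qed simp
    finally show ?thesis by (simp add: wcount_def)
  qed
  have pql: "pq p \<le> e0 + K + w + Suc T1" if g: "gf e0 s0 t qs" "p \<in> set qs" "pw p = w" for e0 s0 t qs p
    using g
  proof (induction rule: gf.induct)
    case (gf_Cons b qs b')
    show ?case
    proof (cases "p \<in> set qs")
      case True then show ?thesis using gf_Cons by simp
    next
      case False
      then have "p = (b, b', fw (pk b e0 qs), fq (pk b e0 qs))" using gf_Cons.prems by simp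
      then show ?thesis using gf_Cons.prems(2) wc[OF gf_Cons.hyps(1)] by auto
    qed
  qed simp
  \<comment> \<open>A lower bound for every grant with target \<open>w\<close>, since at most
    \<open>Suc T1\<close> pieces for it are wasted.\<close>
  define c where "c = (1::real) / 2 ^ (e + K + w + Suc T1)"
  have c0: "0 < c" unfolding c_def by simp
  obtain J :: nat where J: "3 / 2 ^ (e + K) < J * c" using reals_Archimedean3[OF c0] by (metis (no_types))
  define H where "H = {s. bd s \<and> W s = w} - {..T1}"
  have "infinite H" unfolding H_def using inf by (rule Diff_infinite_finite[rotated]) simp
  then obtain G where G: "G \<subseteq> H" "finite G" "card G = J" by (meson infinite_arbitrarily_large)
  obtain s' where s': "s' \<ge> Suc (Max (insert 0 G))" "bd s'" using bd_inf by blast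
  have less: "s < s'" if "s \<in> G" for s
  proof -
    have "s \<le> Max (insert 0 G)" using G(2) that by (intro Max_ge) simp_all
    then show ?thesis using s'(1) by simp
  qed
  have d: "distinct (ps s')" using gf_distinct[OF bd_gf[OF s'(2)]] by (auto dest: distinct_map[THEN iffD1])
  let ?P = "{p \<in> set (ps s'). held ch s' w p}"
  have "G \<subseteq> pb ` ?P"
  proof
    fix s assume s: "s \<in> G"
    then have sH: "bd s" "W s = w" "T1 < s" using G(1) unfolding H_def by auto
    obtain p where p: "p \<in> set (ps s')" "pb p = s" "pw p = W s" using piece_recorded[OF sH(1) s'(2) less[OF s]] by blast
    have "held ch s' w p" unfolding held_def using p nch[of s s'] sH by simp
    then show "s \<in> pb ` ?P" using p(1,2) by blast
  qed
  then have "J \<le> card ?P" using surj_card_le[of ?P G pb] G(3) by simp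
  then have "J * c \<le> card ?P * c" using c0 by simp
  also have "\<dots> = (\<Sum>p\<in>?P. c)" by simp
  also have "\<dots> \<le> (\<Sum>p\<in>?P. 1 / 2 ^ pq p)"
  proof (rule sum_mono)
    fix p assume "p \<in> ?P"
    then have "pq p \<le> e + K + w + Suc T1" using pql[OF bd_gf[OF s'(2)]] unfolding held_def by blast
    then have "(2::real) ^ pq p \<le> 2 ^ (e + K + w + Suc T1)" by (rule power_increasing) simp
    then show "c \<le> 1 / 2 ^ pq p" unfolding c_def by (intro divide_left_mono) simp_all
  qed
  also have "\<dots> = psum (held ch s' w) (ps s')" by (rule psum_set[OF d, symmetric])
  also have "\<dots> \<le> (N s' w + 2 / 2 ^ w) / 2 ^ (e + K)" by (rule gf_held[OF bd_gf[OF s'(2)] order_refl])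
  also have "\<dots> \<le> 3 / 2 ^ (e + K)"
  proof (rule divide_right_mono)
    have "N s' w \<le> (\<Sum>v<Suc w. N s' v)" using N0 by (simp add: sum_nonneg)
    then have "N s' w \<le> 1" using N1[where t = s' and M = "Suc w"] by linarith
    moreover have "2 / (2::real) ^ w \<le> 2" by (simp add: divide_le_eq)
    ultimately show "N s' w + 2 / 2 ^ w \<le> 3" by linarith
  qed simp
  finally show False using J by simp
qed

lemma W_large:
  assumes conv: "\<And>w. \<exists>T1 \<tau>. \<forall>r\<ge>T1. take w (sg r) = \<tau>" shows "\<exists>n. \<forall>s\<ge>n. bd s \<longrightarrow> M < W s"
proof -
  have "finite {s. bd s \<and> W s = w}" for w
  proof -
    obtain T1 \<tau> where "\<forall>r\<ge>T1. take w (sg r) = \<tau>" using conv by blast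
    then show ?thesis by (intro W_finite[of T1 w \<tau>]) simp
  qed
  then have f: "finite (\<Union>w\<le>M. {s. bd s \<and> W s = w})" by (intro finite_UN_I) simp_all
  have "M < W s" if s: "Suc (Max (insert 0 (\<Union>w\<le>M. {s. bd s \<and> W s = w}))) \<le> s" "bd s" for s
  proof (rule ccontr)
    assume "\<not> M < W s"
    then have "s \<in> insert 0 (\<Union>w\<le>M. {s. bd s \<and> W s = w})" using s(2) by simp
    then have "s \<le> Max (insert 0 (\<Union>w\<le>M. {s. bd s \<and> W s = w}))" using f by (intro Max_ge) simp_all
    then show False using s(1) by simp
  qed
  then show ?thesis by blast
qed

end

context game
begin

text \<open>The largest of the finitely many levels that move infinitely often; every larger one has
  stopped from some round on.\<close>

lemma golden_exists:
  assumes "\<And>t. Inv t" "\<And>t. L t < m"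
  shows "\<exists>i T. golden sg N K m i T"
proof -
  define I where "I = {l \<in> {..<m}. infinite {t. L t = l}}"
  have "I \<noteq> {}"
  proof
    assume "I = {}"
    then have "finite (\<Union>l<m. {t. L t = l})" unfolding I_def by (intro finite_UN_I) auto
    moreover have "(\<Union>l<m. {t. L t = l}) = UNIV" using assms(2) by auto
    ultimately show False by simp
  qed
  moreover have fI: "finite I" unfolding I_def by simp
  ultimately have Mx: "Max I \<in> I" by (rule Max_in[rotated])
  have "finite {t. L t = l}" if "l \<in> {Max I<..<m}" for l
  proof (rule ccontr)
    assume "infinite {t. L t = l}"
    then have "l \<in> I" unfolding I_def using that by simp
    then have "l \<le> Max I" by (rule Max_ge[OF fI])
    then show False using that by simp
  qed
  then have f: "finite (\<Union>l\<in>{Max I<..<m}. {t. L t = l})" by (intro finite_UN_I) simp_all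
  define T where "T = Suc (Max (insert 0 (\<Union>l\<in>{Max I<..<m}. {t. L t = l})))"
  have Li: "L t \<le> Max I" if "T \<le> t" for t
  proof (rule ccontr)
    assume "\<not> L t \<le> Max I"
    then have "t \<in> insert 0 (\<Union>l\<in>{Max I<..<m}. {t. L t = l})" using assms(2)[of t] by simp
    then have "t \<le> Max (insert 0 (\<Union>l\<in>{Max I<..<m}. {t. L t = l}))" using f by (intro Max_ge) simp_all
    then show False using that unfolding T_def by simp
  qed
  have "golden sg N K m (Max I) T"
  proof (unfold_locales)
    show "Inv t" for t by (rule assms(1))
    show "Max I < m" using Mx unfolding I_def by simp
    show "L t \<le> Max I" if "T \<le> t" for t by (rule Li[OF that])
    show "\<exists>t\<ge>n. L t = Max I" for n
    proof -
      have "infinite {t. L t = Max I}" using Mx unfolding I_def by simp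
      then have "\<exists>t\<ge>n. t \<in> {t. L t = Max I}" unfolding infinite_nat_iff_unbounded_le by (rule spec)
      then show ?thesis by simp
    qed
  qed
  then show ?thesis by blast
qed

end

section \<open>Playing against the optimal machine\<close>

text \<open>No recorded round lies beyond \<open>t\<close>, so a move at \<open>t\<close> consults
  the answers before \<open>t\<close> only. This is what allows replaying the game from a finite
  history.\<close>

definition bounded :: "nat \<Rightarrow> frame list \<Rightarrow> bool" where
  "bounded t Fs \<longleftrightarrow> (\<forall>F\<in>set Fs. fb F \<le> t \<and> (\<forall>p\<in>set (fps F). pb p \<le> t \<and> pe p \<le> t))"

lemma psum_cong: "(\<And>p. p \<in> set ps \<Longrightarrow> P p = Q p) \<Longrightarrow> psum P ps = psum Q ps"
  unfolding psum_def by (intro arg_cong[where f = sum_list] map_cong) simp_all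

lemma pick_cong:
  assumes c: "\<And>b t' w. b \<le> t \<Longrightarrow> t' \<le> t \<Longrightarrow> c b t' w = c' b t' w" and b: "\<And>p. p \<in> set ps \<Longrightarrow> pb p \<le> t \<and> pe p \<le> t"
  shows "pick K c N t e ps = pick K c' N t e ps" "full c t e ps = full c' t e ps"
proof -
  have h: "psum (held c t w) ps = psum (held c' t w) ps" for w
    by (rule psum_cong) (use c b in \<open>simp add: held_def\<close>)
  have w: "wcount c w ps = wcount c' w ps" for w
    unfolding wcount_def by (intro arg_cong[where f = length] filter_cong) (use c b in \<open>simp_all add: wast_def\<close>)
  show "pick K c N t e ps = pick K c' N t e ps" unfolding pick_def pickw_def h w ..
  have "psum (prom c t) ps = psum (prom c' t) ps" by (rule psum_cong) (use c b in \<open>simp add: prom_def\<close>)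
  then show "full c t e ps = full c' t e ps" unfolding full_def by (simp only:)
qed

lemma adv_cong:
  assumes c: "\<And>b t' w. b \<le> t \<Longrightarrow> t' \<le> t \<Longrightarrow> c b t' w = c' b t' w" and "bounded t Fs"
  shows "adv K c N t Fs = adv K c' N t Fs"
  using assms(2)
proof (induction Fs)
  case (Cons F Fs)
  have b: "pb p \<le> t \<and> pe p \<le> t" if "p \<in> set (rcd t F)" for p
    using Cons.prems that unfolding bounded_def rcd_def by auto
  have IH: "adv K c N t Fs = adv K c' N t Fs" by (rule Cons.IH) (use Cons.prems in \<open>simp add: bounded_def\<close>)
  have n: "pick K c N t g [] = pick K c' N t g []" for g by (rule pick_cong(1)[OF c]) simp_all
  have f: "full c t (fe F) (rcd t F) = full c' t (fe F) (rcd t F)" by (rule pick_cong(2)) (simp_all add: c b)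
  have p: "pick K c N t (fe F) (rcd t F) = pick K c' N t (fe F) (rcd t F)" by (rule pick_cong(1)) (simp_all add: c b)
  show ?case unfolding adv.simps IH n f p ..
qed simp

lemma start_cong: "start K c N m = start K c' N m"
proof (induction m)
  case (Suc m)
  have "pick K c N 0 g [] = pick K c' N 0 g []" for g unfolding pick_def pickw_def wcount_def psum_Nil filter.simps ..
  then show ?case using Suc.IH by simp
qed simp

lemma bounded_adv: assumes "bounded s Fs" "s \<le> t" shows "bounded t (adv K c N t Fs)"
  using assms(1)
proof (induction Fs)
  case Nil then show ?case by (simp add: bounded_def)
next
  case (Cons F Fs)
  have IH: "bounded t (adv K c N t Fs)" by (rule Cons.IH) (use Cons.prems in \<open>simp add: bounded_def\<close>)
  have c: "bounded t (G # Gs) \<longleftrightarrow> (fb G \<le> t \<and> (\<forall>p\<in>set (fps G). pb p \<le> t \<and> pe p \<le> t)) \<and> bounded t Gs" for G Gs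
    by (simp add: bounded_def)
  have F: "fb F \<le> s" "\<And>p. p \<in> set (fps F) \<Longrightarrow> pb p \<le> s \<and> pe p \<le> s" using Cons.prems unfolding bounded_def by simp_all
  have Fs: "bounded t Fs" unfolding bounded_def
  proof (intro ballI conjI)
    fix G p assume G: "G \<in> set Fs"
    then have 1: "fb G \<le> s" "\<And>p. p \<in> set (fps G) \<Longrightarrow> pb p \<le> s \<and> pe p \<le> s" using Cons.prems unfolding bounded_def by simp_all
    show "fb G \<le> t" using 1(1) assms(2) by simp
    assume "p \<in> set (fps G)"
    then show "pb p \<le> t" "pe p \<le> t" using 1(2)[of p] assms(2) by simp_all
  qed
  have b: "pb p \<le> t \<and> pe p \<le> t" if "p \<in> set (rcd t F)" for p
  proof (cases "p \<in> set (fps F)")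
    case True then show ?thesis using F(2)[of p] assms(2) by simp
  next
    case False
    then have "p = (fb F, t, fw F, fq F)" using that unfolding rcd_def by simp
    then show ?thesis using F(1) assms(2) by simp
  qed
  show ?case
  proof (cases "full c t (fe F) (rcd t F)")
    case True then show ?thesis using IH by (simp add: c)
  next
    case False then show ?thesis using Fs b by (simp add: c)
  qed
qed

lemma bounded_start: "bounded t (start K c N m)"
  by (induction m) (simp_all add: bounded_def)

section \<open>First errors against a guess\<close>

definition flip :: "bool list \<Rightarrow> bool list" where
  "flip u = take (length u - 1) u @ [\<not> nthd False u (length u - 1)]"

lemma length_flip: "u \<noteq> [] \<Longrightarrow> length (flip u) = length u" by (simp add: flip_def)
lemma nth_flip_last: "u \<noteq> [] \<Longrightarrow> flip u ! (length u - 1) = (\<not> u ! (length u - 1))"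
  by (simp add: flip_def nth_append nthd_simp)
lemma nth_flip: "i < length u - 1 \<Longrightarrow> flip u ! i = u ! i" by (simp add: flip_def nth_append)

text \<open>With \<open>m + 5\<close> the small term \<open>x\<close> satisfies
  \<open>m * x \<le> 1 / 2\<close>. Bernoulli's inequality gives
  \<open>(1 - x) ^ m \<ge> 1 / 2\<close>, and \<open>(1 + x) * (1 - x) \<le> 1\<close> turns this
  around.\<close>

lemma power_bound: "(1 + 10 / 2 ^ (m + 5) :: real) ^ m \<le> 2"
proof -
  define x :: real where "x = 10 / 2 ^ (m + 5)"
  have "real m < 2 ^ m" by (rule of_nat_less_two_power)
  moreover have p5: "(2::real) ^ (m + 5) = 32 * 2 ^ m" by (simp add: power_add)
  moreover have "(1::real) \<le> 2 ^ m" by simp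
  ultimately have "real m * 20 \<le> 2 ^ (m + 5)" by linarith
  then have mx: "m * x \<le> 1 / 2" unfolding x_def by (simp add: field_simps)
  have x: "0 \<le> x" "x \<le> 1"
    using \<open>(1::real) \<le> 2 ^ m\<close> unfolding x_def p5 by (simp_all add: divide_le_eq del: one_le_power)
  have "1 - m * x \<le> (1 - x) ^ m" using Bernoulli_inequality[of "- x" m] x by simp
  then have h: "1 / 2 \<le> (1 - x) ^ m" using mx by linarith
  have "(1 + x) * (1 - x) \<le> 1" by (simp add: algebra_simps)
  then have "((1 + x) * (1 - x)) ^ m \<le> 1" using x by (intro power_le_one mult_nonneg_nonneg) simp_all
  then have le: "(1 + x) ^ m * (1 - x) ^ m \<le> 1" by (simp only: power_mult_distrib)
  have "(1 + x) ^ m * (1 / 2) \<le> (1 + x) ^ m * (1 - x) ^ m" by (rule mult_left_mono[OF h]) (use x in simp)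
  then show ?thesis using le unfolding x_def by linarith
qed

context omega_A
begin

text \<open>The guess at \<open>A\<close> from the bits of \<open>Om t\<close> on \<open>R\<close>;
  a bit is 0 until a derivation of 1 is seen.\<close>

definition Aat :: "nat \<Rightarrow> bool list" where
  "Aat t = map (\<lambda>x. \<exists>c<t. valid (rz (pre (Om t) t)) (dec c) \<and> (rcode p, [x], 1) \<in> set (dec c :: judg list)) [0..<t]"

lemma length_Aat [simp]: "length (Aat t) = t" by (simp add: Aat_def)

lemma cpt_Aat: "cpt f \<Longrightarrow> cpt (\<lambda>x. Aat (f x))"
proof -
  have "cpt Aat" unfolding Aat_def
    by (intro cpt_map cpt_upt cpt_ex_less cpt_conj cpt_valid cpt_rz cpt_pre_Om cpt_member cpt_Pair cpt_Cons cpt_dec cpt_const cpt_fst cpt_snd cpt_id)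
  then show "cpt f \<Longrightarrow> cpt (\<lambda>x. Aat (f x))" by (rule cpt_comp)
qed

lemma Aat_limit: "\<exists>s. \<forall>t\<ge>s. take n (Aat t) = As n"
proof -
  obtain m where m: "\<forall>t\<ge>m. \<forall>l\<ge>m. cmps t (map YR [0..<l]) (As n)" using cmps_A[of n] by (elim exE)
  obtain k where k: "m \<le> cnt k" using cnt_unbounded[of m] by (elim exE)
  obtain s0 where s0: "\<forall>s\<ge>s0. pre (Om s) k = pre Omega k" using pre_limit[of k] by (elim exE)
  have "take n (Aat t) = As n" if t: "m + k + s0 + n \<le> t" for t
  proof (rule nth_equalityI)
    show "length (take n (Aat t)) = length (As n)" using t by simp
    let ?W = "rz (pre (Om t) t)"
    have W0: "take (cnt k) ?W = map YR [0..<cnt k]"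
    proof -
      have "take (cnt k) ?W = rz (take k (pre (Om t) t))" using rz_take[of k "pre (Om t) t"] t by simp
      also have "take k (pre (Om t) t) = pre Omega k" using s0 t by (simp add: take_pre)
      also have "rz (pre Omega k) = map YR [0..<cnt k]" unfolding pre_def YR_eq by (rule rz_map)
      finally show ?thesis .
    qed
    have c: "cmps t ?W (As n)"
    proof (rule cmps_mono)
      show "cmps t (map YR [0..<cnt k]) (As n)" using m k t by simp
      show "length (map YR [0..<cnt k]) \<le> length ?W" using cnt_mono[of k t] t by simp
      show "take (length (map YR [0..<cnt k])) ?W = map YR [0..<cnt k]" using W0 by simp
    qed simp
    fix x assume "x < length (take n (Aat t))"
    then have x: "x < n" "x < t" using t by simp_all
    let ?orc = "\<lambda>i. if i < length ?W \<and> ?W ! i then 1 else 0 :: nat"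
    have a: "agr ?orc ?W" unfolding agr_def by simp
    obtain d where d: "d < t" "valid ?W (dec d)" "(rcode p, [x], if nthd False (As n) x then 1 else 0) \<in> set (dec d :: judg list)"
      using c x(1) unfolding cmps_def length_As by blast
    have v: "nthd False (As n) x = (x \<in> A)" using x(1) by (simp add: nthd_simp nth_As)
    have "Aat t ! x = (\<exists>c<t. valid ?W (dec c) \<and> (rcode p, [x], 1) \<in> set (dec c :: judg list))"
      unfolding Aat_def using x(2) by simp
    also have "\<dots> = (x \<in> A)"
    proof
      assume "\<exists>c<t. valid ?W (dec c) \<and> (rcode p, [x], 1) \<in> set (dec c :: judg list)"
      then obtain c where c: "valid ?W (dec c)" "(rcode p, [x], 1) \<in> set (dec c :: judg list)" by (elim exE conjE)
      have "1 = (if nthd False (As n) x then 1 else 0 :: nat)"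
        by (rule evalr_det[OF valid_sound[OF a c] valid_sound[OF a d(2,3)]])
      then show "x \<in> A" unfolding v by (simp split: if_splits)
    next
      assume "x \<in> A"
      then have "(rcode p, [x], 1) \<in> set (dec d :: judg list)" using d(3) unfolding v by simp
      then show "\<exists>c<t. valid ?W (dec c) \<and> (rcode p, [x], 1) \<in> set (dec c :: judg list)" using d(1,2) by (intro exI[of _ d] conjI)
    qed
    finally show "take n (Aat t) ! x = As n ! x" using x(1) by (simp add: nth_As)
  qed
  then show ?thesis by blast
qed

text \<open>The oracles whose first error against the guess \<open>u\<close> sits at position
  \<open>w - 1\<close>. They would be right up to there if the guess changed at that bit, which is
  why \<open>w\<close> has to be protected in proportion to them.\<close>

definition NN :: "nat \<Rightarrow> bool list \<Rightarrow> nat \<Rightarrow> real" where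
  "NN t u w = (if 0 < w \<and> w \<le> length u then mW t (flip (take w u)) else 0)"

lemma mW_nonneg: "0 \<le> mW t u" by (simp add: mW_def)

lemma NN_nonneg: "0 \<le> NN t u w" by (simp add: NN_def mW_nonneg)

text \<open>First errors at different positions exclude each other, so the sets are
  disjoint.\<close>

lemma NN_sum: "(\<Sum>w<M. NN t u w) \<le> 1"
proof -
  let ?I = "{w \<in> {..<M}. 0 < w \<and> w \<le> length u}"
  let ?B = "\<lambda>w. ucyl (SW t (flip (take w u)))"
  have dj: "disjoint_family_on ?B ?I"
  proof -
    have lt: "?B w \<inter> ?B w' = {}" if h: "w \<in> ?I" "w' \<in> ?I" "w < w'" for w w'
    proof (rule equals0I)
      fix Z assume "Z \<in> ?B w \<inter> ?B w'"
      then have c: "cmps t (map Z [0..<t]) (flip (take w u))" "cmps t (map Z [0..<t]) (flip (take w' u))" unfolding in_SW[symmetric] by simp_all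
      have l: "length (take w u) = w" "length (take w' u) = w'" "take w u \<noteq> []" "take w' u \<noteq> []" using h by auto
      have "flip (take w u) ! (w - 1) = flip (take w' u) ! (w - 1)"
        by (rule cmps_agree[OF c]) (use h in \<open>simp_all add: length_flip[OF l(3)] length_flip[OF l(4)]\<close>)
      moreover have "flip (take w u) ! (w - 1) = (\<not> u ! (w - 1))" using nth_flip_last[OF l(3)] h unfolding l(1) by simp
      moreover have "flip (take w' u) ! (w - 1) = u ! (w - 1)" using nth_flip[of "w - 1" "take w' u"] h unfolding l(2) by simp
      ultimately show False by simp
    qed
    have "?B w \<inter> ?B w' = {}" if "w \<in> ?I" "w' \<in> ?I" "w \<noteq> w'" for w w'
    proof (cases "w < w'")
      case True show ?thesis by (rule lt[OF that(1,2) True])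
    next
      case False
      then have "w' < w" using that(3) by simp
      from lt[OF that(2,1) this] show ?thesis by (subst Int_commute)
    qed
    then show ?thesis unfolding disjoint_family_on_def by blast
  qed
  have "(\<Sum>w<M. NN t u w) = (\<Sum>w\<in>?I. mW t (flip (take w u)))"
    unfolding NN_def by (rule sum.inter_filter[symmetric]) simp
  also have "\<dots> = mu (\<Union>w\<in>?I. ?B w)" unfolding mW_mu by (rule mu_UN_disj[symmetric]) (use dj in simp_all)
  also have "\<dots> \<le> 1" by (rule mu_le_1)
  finally show ?thesis .
qed

lemma NN_mono: assumes "t \<le> t'" "take w u = take w u'" shows "NN t u w \<le> NN t' u' w"
proof (cases "0 < w \<and> w \<le> length u")
  case True
  have "length (take w u') = w" unfolding assms(2)[symmetric] using True by simp
  then have "w \<le> length u'" by simp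
  then show ?thesis using True mW_mono[OF assms(1)] unfolding NN_def assms(2) by simp
next
  case False
  then have "NN t u w = 0" by (auto simp: NN_def)
  then show ?thesis using NN_nonneg[of t' u' w] by simp
qed

text \<open>The game once more, with the answers read off a finite list \<open>h\<close> of response
  stages. In this form it is total and computable for every \<open>h\<close>, whether or not
  \<open>U\<close> ever responds.\<close>

definition sgl :: "nat list \<Rightarrow> nat \<Rightarrow> bool list" where "sgl h r = take (Suc r) (Aat (nthd 0 h r))"
definition sgq :: "nat list \<Rightarrow> nat \<Rightarrow> bool list" where "sgq h a = (if a = 0 then [] else sgl h (a - 1))"
definition chh :: "nat list \<Rightarrow> nat \<Rightarrow> nat \<Rightarrow> nat \<Rightarrow> bool" where
  "chh h a t w \<longleftrightarrow> (\<exists>r<t. a \<le> r \<and> take w (sgl h r) \<noteq> take w (sgq h a))"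
definition Nh :: "nat list \<Rightarrow> nat \<Rightarrow> nat \<Rightarrow> real" where "Nh h t w = NN t (sgq h t) w"

text \<open>A finished outermost run would have weight \<open>1 / 2\<close> in rounds with
  \<open>mm c + 1\<close> answers each, more than the \<open>4 ^ c\<close> that
  \<open>payment\<close> permits. The \<open>5\<close> in \<open>KK\<close> below is that of
  \<open>power_bound\<close>.\<close>

definition mm :: "nat \<Rightarrow> nat" where "mm c = 2 * 4 ^ c"
definition KK :: "nat \<Rightarrow> nat" where "KK c = mm c + 5"

definition Sh :: "nat \<Rightarrow> nat list \<Rightarrow> frame list" where
  "Sh c h = rec_nat (start (KK c) (chh []) (Nh [] 0) (mm c)) (\<lambda>t Fs. adv (KK c) (chh (take (Suc t) h)) (Nh (take (Suc t) h) (Suc t)) (Suc t) Fs) (length h)"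

definition outh :: "nat \<Rightarrow> nat list \<Rightarrow> nat" where "outh c h = goal (Sh c h)"

lemma cpt_sgl: "cpt h \<Longrightarrow> cpt r \<Longrightarrow> cpt (\<lambda>x. sgl (h x) (r x))"
  unfolding sgl_def by (intro cpt_take cpt_Suc cpt_Aat cpt_nthd cpt_const)
lemma cpt_sgq: "cpt h \<Longrightarrow> cpt r \<Longrightarrow> cpt (\<lambda>x. sgq (h x) (r x))"
  unfolding sgq_def by (intro cpt_If cpt_eq cpt_sgl cpt_diff cpt_const)
lemma cpt_chh: "cpt h \<Longrightarrow> cpt a \<Longrightarrow> cpt t \<Longrightarrow> cpt w \<Longrightarrow> cpt (\<lambda>x. chh (h x) (a x) (t x) (w x))"
proof -
  have "cpt (\<lambda>q. chh (fst q) (fst (snd q)) (fst (snd (snd q))) (snd (snd (snd q))))" unfolding chh_def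
    by (intro cpt_ex_less cpt_conj cpt_le cpt_not cpt_eq cpt_take cpt_sgl cpt_sgq cpt_fst cpt_snd cpt_id)
  from cpt_comp[OF this cpt_Pair[OF _ cpt_Pair[OF _ cpt_Pair]]]
  show "cpt h \<Longrightarrow> cpt a \<Longrightarrow> cpt t \<Longrightarrow> cpt w \<Longrightarrow> cpt (\<lambda>x. chh (h x) (a x) (t x) (w x))" by simp
qed
lemma cpt_flip: assumes "cpt u" shows "cpt (\<lambda>x. flip (u x))"
  unfolding flip_def by (intro cpt_append cpt_take cpt_diff cpt_length cpt_Cons cpt_not cpt_nthd cpt_const assms)
lemma crat_Nh: "cpt h \<Longrightarrow> cpt t \<Longrightarrow> cpt w \<Longrightarrow> crat (\<lambda>x. Nh (h x) (t x) (w x))"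
  unfolding Nh_def NN_def
  by (intro crat_If cpt_conj cpt_less cpt_le cpt_length cpt_sgq crat_mW cpt_flip cpt_take crat_0 cpt_const)

lemma crat_psum: assumes "cpt (\<lambda>q. P (fst q) (snd q))" "cpt ps" shows "crat (\<lambda>x. psum (P x) (ps x))"
  unfolding psum_def
  by (intro crat_sum_list crat_If assms crat_inv_pow crat_0 cpt_snd cpt_id)

lemma cpt_pickw: "cpt K \<Longrightarrow> cpt h \<Longrightarrow> cpt s \<Longrightarrow> cpt t \<Longrightarrow> cpt e \<Longrightarrow> cpt ps \<Longrightarrow> cpt (\<lambda>x. pickw (K x) (chh (h x)) (Nh (h x) (s x)) (t x) (e x) (ps x))"
proof -
  have ex: "\<exists>w. psum (held (chh h) t w) ps < (Nh h s w + 1 / 2 ^ w) / 2 ^ (e + K)" for h t ps s e K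
    using demand_ex[where N = "Nh h s" and ps = ps and ch = "chh h" and t = t and e = e and K = K, OF NN_nonneg[of s "sgq h s", folded Nh_def]]
    by (elim exE conjE, intro exI)
  have "cpt (\<lambda>q. pickw (fst q) (chh (fst (snd q))) (Nh (fst (snd q)) (fst (snd (snd q)))) (fst (snd (snd (snd q)))) (fst (snd (snd (snd (snd q))))) (snd (snd (snd (snd (snd q))))))"
    unfolding pickw_def
    by (rule cpt_Least0[OF _ ex], unfold held_def,
        intro cpt_crat crat_psum crat_div_pow crat_add crat_Nh crat_inv_pow cpt_add cpt_conj cpt_eq cpt_not cpt_chh cpt_fst cpt_snd cpt_id)
  from cpt_comp[OF this cpt_Pair[OF _ cpt_Pair[OF _ cpt_Pair[OF _ cpt_Pair[OF _ cpt_Pair]]]]]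
  show "cpt K \<Longrightarrow> cpt h \<Longrightarrow> cpt s \<Longrightarrow> cpt t \<Longrightarrow> cpt e \<Longrightarrow> cpt ps \<Longrightarrow> cpt (\<lambda>x. pickw (K x) (chh (h x)) (Nh (h x) (s x)) (t x) (e x) (ps x))" by simp
qed

lemma cpt_wcount: "cpt h \<Longrightarrow> cpt w \<Longrightarrow> cpt ps \<Longrightarrow> cpt (\<lambda>x. wcount (chh (h x)) (w x) (ps x))"
proof -
  have "cpt (\<lambda>q. wcount (chh (fst q)) (fst (snd q)) (snd (snd q) :: piece list))"
    unfolding wcount_def wast_def
    by (intro cpt_length cpt_filter cpt_conj cpt_eq cpt_chh cpt_fst cpt_snd cpt_id)
  from cpt_comp[OF this cpt_Pair[OF _ cpt_Pair]]
  show "cpt h \<Longrightarrow> cpt w \<Longrightarrow> cpt ps \<Longrightarrow> cpt (\<lambda>x. wcount (chh (h x)) (w x) (ps x))" by simp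
qed

lemma cpt_pick: "cpt K \<Longrightarrow> cpt h \<Longrightarrow> cpt s \<Longrightarrow> cpt t \<Longrightarrow> cpt e \<Longrightarrow> cpt ps \<Longrightarrow> cpt (\<lambda>x. pick (K x) (chh (h x)) (Nh (h x) (s x)) (t x) (e x) (ps x))"
  unfolding pick_def by (intro cpt_Pair cpt_pickw cpt_add cpt_wcount)

lemma cpt_full: "cpt h \<Longrightarrow> cpt t \<Longrightarrow> cpt e \<Longrightarrow> cpt ps \<Longrightarrow> cpt (\<lambda>x. full (chh (h x)) (t x) (e x) (ps x))"
proof -
  have "cpt (\<lambda>q. full (chh (fst q)) (fst (snd q)) (fst (snd (snd q))) (snd (snd (snd q))))"
    unfolding full_def prom_def psum_def
    by (intro cpt_crat crat_inv_pow crat_sum_list crat_If crat_0 cpt_conj cpt_not cpt_chh cpt_fst cpt_snd cpt_id)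
  from cpt_comp[OF this cpt_Pair[OF _ cpt_Pair[OF _ cpt_Pair]]]
  show "cpt h \<Longrightarrow> cpt t \<Longrightarrow> cpt e \<Longrightarrow> cpt ps \<Longrightarrow> cpt (\<lambda>x. full (chh (h x)) (t x) (e x) (ps x))" by simp
qed

lemma cpt_goal: assumes "cpt Gs" shows "cpt (\<lambda>x. goal (Gs x))"
  unfolding goal_def by (intro cpt_If cpt_eq cpt_const cpt_snd cpt_hd assms)

lemma cpt_rcd: "cpt t \<Longrightarrow> cpt F \<Longrightarrow> cpt (\<lambda>x. rcd (t x) (F x))"
  unfolding rcd_def by (intro cpt_Cons cpt_Pair cpt_fst cpt_snd)

lemma adv_foldr: "foldr (\<lambda>F acc. (F # fst acc, if full c t (fe F) (rcd t F) then pick K c N t (goal (snd acc)) [] # snd acc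
    else pick K c N t (fe F) (rcd t F) # fst acc)) Fs ([], []) = (Fs, adv K c N t Fs)"
  by (induction Fs) simp_all

lemma cpt_adv: "cpt K \<Longrightarrow> cpt h \<Longrightarrow> cpt t \<Longrightarrow> cpt Fs \<Longrightarrow> cpt (\<lambda>x. adv (K x) (chh (h x)) (Nh (h x) (t x)) (t x) (Fs x))"
proof -
  have "cpt (\<lambda>q. snd (foldr (\<lambda>F acc. (F # fst acc, if full (chh (fst (snd q))) (fst (snd (snd q))) (fe F) (rcd (fst (snd (snd q))) F)
      then pick (fst q) (chh (fst (snd q))) (Nh (fst (snd q)) (fst (snd (snd q)))) (fst (snd (snd q))) (goal (snd acc)) [] # snd acc
      else pick (fst q) (chh (fst (snd q))) (Nh (fst (snd q)) (fst (snd (snd q)))) (fst (snd (snd q))) (fe F) (rcd (fst (snd (snd q))) F) # fst acc)) (snd (snd (snd q))) ([], [])))"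
    by (intro cpt_snd cpt_foldr cpt_Pair cpt_Cons cpt_If cpt_full cpt_pick cpt_goal cpt_rcd cpt_fst cpt_id cpt_const)
  then have "cpt (\<lambda>q. adv (fst q) (chh (fst (snd q))) (Nh (fst (snd q)) (fst (snd (snd q)))) (fst (snd (snd q))) (snd (snd (snd q))))"
    unfolding adv_foldr snd_conv .
  from cpt_comp[OF this cpt_Pair[OF _ cpt_Pair[OF _ cpt_Pair]]]
  show "cpt K \<Longrightarrow> cpt h \<Longrightarrow> cpt t \<Longrightarrow> cpt Fs \<Longrightarrow> cpt (\<lambda>x. adv (K x) (chh (h x)) (Nh (h x) (t x)) (t x) (Fs x))" by simp
qed

lemma start_rec: "start K c N m = rec_nat [] (\<lambda>_ Gs. pick K c N 0 (goal Gs) [] # Gs) m"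
  by (induction m) simp_all

lemma cpt_KK: "cpt c \<Longrightarrow> cpt (\<lambda>x. KK (c x))" "cpt c \<Longrightarrow> cpt (\<lambda>x. mm (c x))"
  unfolding KK_def mm_def by (intro cpt_add cpt_mult cpt_power cpt_const, assumption)+

lemma cpt_Sh: "cpt c \<Longrightarrow> cpt h \<Longrightarrow> cpt (\<lambda>x. Sh (c x) (h x))"
proof -
  have "cpt (\<lambda>q. Sh (fst q) (snd q))"
    unfolding Sh_def start_rec
    by (intro cpt_goal cpt_rec_nat cpt_adv cpt_KK cpt_take cpt_Suc cpt_length cpt_Cons cpt_pick cpt_const cpt_fst cpt_snd cpt_id)
  from cpt_comp[OF this cpt_Pair] show "cpt c \<Longrightarrow> cpt h \<Longrightarrow> cpt (\<lambda>x. Sh (c x) (h x))" by simp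
qed

lemma cpt_outh: "cpt c \<Longrightarrow> cpt h \<Longrightarrow> cpt (\<lambda>x. outh (c x) (h x))"
  unfolding outh_def by (intro cpt_goal cpt_Sh)

text \<open>A response honours all requests made so far with the current guess. The allowance
  \<open>2 * c\<close> covers the slot number, the constant of the machine and the triviality
  constant.\<close>

definition rsp :: "nat \<Rightarrow> nat list \<Rightarrow> nat \<Rightarrow> bool" where
  "rsp c h t \<longleftrightarrow> Suc (length h) \<le> t \<and> (\<forall>n<Suc (length h). KS (rcode U) t (take (Suc n) (Aat t)) (outh c (take n h) + 2 * c))"

text \<open>Taking the least response stages makes the history of each length unique, so that
  requests are a function of the round.\<close>

definition vh :: "nat \<Rightarrow> nat list \<Rightarrow> bool" where
  "vh c h \<longleftrightarrow> (\<forall>r<length h. rsp c (take r h) (nthd 0 h r) \<and> (\<forall>t<nthd 0 h r. \<not> rsp c (take r h) t))"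

lemma cpt_rsp: "cpt c \<Longrightarrow> cpt h \<Longrightarrow> cpt t \<Longrightarrow> cpt (\<lambda>x. rsp (c x) (h x) (t x))"
proof -
  have "cpt (\<lambda>q. rsp (fst q) (fst (snd q)) (snd (snd q)))" unfolding rsp_def
    by (intro cpt_conj cpt_le cpt_all_less cpt_KS cpt_Suc cpt_length cpt_take cpt_Aat cpt_add cpt_mult cpt_outh cpt_const cpt_fst cpt_snd cpt_id)
  from cpt_comp[OF this cpt_Pair[OF _ cpt_Pair]]
  show "cpt c \<Longrightarrow> cpt h \<Longrightarrow> cpt t \<Longrightarrow> cpt (\<lambda>x. rsp (c x) (h x) (t x))" by simp
qed

lemma cpt_vh: "cpt c \<Longrightarrow> cpt h \<Longrightarrow> cpt (\<lambda>x. vh (c x) (h x))"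
proof -
  have "cpt (\<lambda>q. vh (fst q) (snd q))" unfolding vh_def
    by (intro cpt_all_less cpt_conj cpt_not cpt_rsp cpt_take cpt_nthd cpt_length cpt_const cpt_fst cpt_snd cpt_id)
  from cpt_comp[OF this cpt_Pair] show "cpt c \<Longrightarrow> cpt h \<Longrightarrow> cpt (\<lambda>x. vh (c x) (h x))" by simp
qed

lemma vh_unique: assumes "vh c h" "vh c h'" "length h = length h'" shows "h = h'"
proof -
  have "take r h = take r h'" if "r \<le> length h" for r
    using that
  proof (induction r)
    case (Suc r)
    then have r: "r < length h" "r < length h'" "take r h = take r h'" using assms(3) by simp_all
    have 1: "rsp c (take r h) (h ! r)" "\<And>t. t < h ! r \<Longrightarrow> \<not> rsp c (take r h) t"
      using assms(1) r(1) unfolding vh_def by (simp_all add: nthd_simp)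
    have 2: "rsp c (take r h) (h' ! r)" "\<And>t. t < h' ! r \<Longrightarrow> \<not> rsp c (take r h) t"
      using assms(2) r(2) unfolding vh_def r(3) by (simp_all add: nthd_simp)
    have "h ! r = h' ! r" using 1 2 by (metis linorder_neqE_nat)
    then show ?case using r by (simp add: take_Suc_conv_app_nth)
  qed simp
  from this[of "length h"] show ?thesis using assms(3) by simp
qed

lemma vh_take: assumes "vh c h" shows "vh c (take n h)"
  unfolding vh_def
proof (intro allI impI conjI)
  fix r assume r: "r < length (take n h)"
  have rr: "r < n" "r < length h" using r by simp_all
  have e: "take r (take n h) = take r h" "nthd 0 (take n h) r = nthd 0 h r" using rr by (simp_all add: nthd_simp min_absorb1)
  from rr(2) show "rsp c (take r (take n h)) (nthd 0 (take n h) r)" "\<And>t. t < nthd 0 (take n h) r \<Longrightarrow> \<not> rsp c (take r (take n h)) t"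
    using assms unfolding vh_def e by blast+
qed

definition osum :: "nat \<Rightarrow> nat list \<Rightarrow> nat \<Rightarrow> real" where "osum c h n = (\<Sum>i<n. 1 / 2 ^ outh c (take i h))"

text \<open>Requests of one slot become consecutive intervals, all slots being served by one
  machine. So \<open>k\<close> does not depend on \<open>c\<close>, which can be chosen after
  it.\<close>

lemma slot_program:
  "\<exists>k. \<forall>c h. vh c h \<longrightarrow> osum c h (Suc (length h)) \<le> 1 \<longrightarrow> Kc U (str_of (Suc (length h))) \<le> outh c h + c + k"
proof -
  let ?P = "\<lambda>c n z. \<exists>h. length h = n \<and> vh c h \<and> length z = Suc (outh c h) \<and> osum c h n \<le> lo z \<and> hi z \<le> osum c h (Suc n)"
  \<comment> \<open>The left end of interval \<open>n\<close> as a function of \<open>c\<close> and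
    \<open>n\<close> alone; rounds that no valid history reaches get width 0.\<close>
  let ?f = "\<lambda>c n. \<Sum>i<n. if \<exists>h. length h = i \<and> vh c h then 1 / 2 ^ outh c (THE h. length h = i \<and> vh c h) else (0::real)"
  have ce: "ce (\<lambda>q. ?P (fst q) (fst (snd q)) (snd (snd q)))" unfolding osum_def
    by (intro ce_ex ce_cpt cpt_conj cpt_eq cpt_vh cpt_crat crat_sum_less crat_inv_pow crat_lo crat_hi cpt_length cpt_Suc cpt_outh cpt_take cpt_const cpt_fst cpt_snd cpt_id)
  have the: "(THE h. length h = i \<and> vh c h) = h" if "length h = i" "vh c h" for c h i
    by (rule the_equality) (use that vh_unique[of c] in auto)
  have fo: "?f c n = osum c h n" if h: "vh c h" "n \<le> Suc (length h)" for c h n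
    unfolding osum_def
  proof (rule sum.cong[OF refl])
    fix i assume "i \<in> {..<n}"
    then have "i \<le> length h" using h(2) by simp
    then have t: "length (take i h) = i" "vh c (take i h)" using vh_take[OF h(1), of i] by (simp_all add: min_absorb2)
    then have "\<exists>h. length h = i \<and> vh c h" by blast
    then show "(if \<exists>h. length h = i \<and> vh c h then 1 / 2 ^ outh c (THE h. length h = i \<and> vh c h) else (0::real)) = 1 / 2 ^ outh c (take i h)"
      unfolding the[OF t] by simp
  qed
  have "\<exists>k. \<forall>c n z. ?P c n z \<longrightarrow> Kc U (str_of (Suc n)) \<le> length z + c + k"
  proof (rule Kc_intervals[OF U, where P = ?P and f = ?f, OF ce])
    fix c n z assume "?P c n z"
    then obtain h where h: "length h = n" "vh c h" "osum c h n \<le> lo z" "hi z \<le> osum c h (Suc n)" by (elim exE conjE)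
    show "?f c n \<le> lo z \<and> hi z \<le> ?f c (Suc n)" using h(3,4) fo[OF h(2), of n] fo[OF h(2), of "Suc n"] h(1) by simp
  next
    fix c m n :: nat and z :: "bool list" assume "m \<le> n"
    then show "?f c m \<le> ?f c n" by (intro sum_mono2) auto
  next
    fix c n z z' assume "?P c n z" "?P c n z'"
    then obtain h h' where h: "length h = n" "vh c h" "length z = Suc (outh c h)" "length h' = n" "vh c h'" "length z' = Suc (outh c h')" by (elim exE conjE)
    have "h = h'" by (rule vh_unique[OF h(2,5)]) (simp add: h(1,4))
    then show "length z = length z'" using h(3,6) by simp
  next
    fix k assume "\<And>c n z. ?P c n z \<Longrightarrow> Kc U (str_of (Suc n)) \<le> length z + c + k"
    then show "\<exists>k. \<forall>c n z. ?P c n z \<longrightarrow> Kc U (str_of (Suc n)) \<le> length z + c + k" by (intro exI[of _ k] allI impI)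
  qed
  then obtain k where k: "\<forall>c n z. ?P c n z \<longrightarrow> Kc U (str_of (Suc n)) \<le> length z + c + k" by (elim exE)
  have "Kc U (str_of (Suc (length h))) \<le> outh c h + c + Suc k" if h: "vh c h" "osum c h (Suc (length h)) \<le> 1" for c h
  proof -
    have o: "osum c h (Suc (length h)) = osum c h (length h) + 1 / 2 ^ outh c h" unfolding osum_def by simp
    have "0 \<le> osum c h (length h)" unfolding osum_def by (intro sum_nonneg) simp
    moreover have "2 / 2 ^ Suc (outh c h) \<le> osum c h (Suc (length h)) - osum c h (length h)" unfolding o by simp
    ultimately obtain z where z: "length z = Suc (outh c h)" "osum c h (length h) \<le> lo z" "hi z \<le> osum c h (Suc (length h))"
      using string_in_interval[OF _ h(2)] by blast
    have "?P c (length h) z" using h(1) z by (intro exI[of _ h] conjI) simp_all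
    with k have "Kc U (str_of (Suc (length h))) \<le> length z + c + k" by (elim allE impE)
    then show ?thesis using z(1) by simp
  qed
  then show ?thesis by blast
qed

end

text \<open>By \<open>large\<close>, the bound \<open>out + c + ks\<close> for the round number,
  increased by \<open>b\<close> for the initial segment of \<open>A\<close>, stays within
  \<open>out + 2 * c\<close>.\<close>

locale slot = omega_A +
  fixes c ks :: nat
  assumes prog: "\<And>h. vh c h \<Longrightarrow> osum c h (Suc (length h)) \<le> 1 \<Longrightarrow> Kc U (str_of (Suc (length h))) \<le> outh c h + c + ks"
    and large: "ks + b \<le> c"
begin

text \<open>Until \<open>all_answered\<close> shows that responses exist, the \<open>LEAST\<close>
  may be arbitrary; \<open>answered\<close> keeps track of this.\<close>

primrec hh :: "nat \<Rightarrow> nat list" where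
  "hh 0 = []"
| "hh (Suc n) = hh n @ [LEAST t. rsp c (hh n) t]"

definition tt :: "nat \<Rightarrow> nat" where "tt n = (LEAST t. rsp c (hh n) t)"
definition sgt :: "nat \<Rightarrow> bool list" where "sgt r = take (Suc r) (Aat (tt r))"
definition Nt :: "nat \<Rightarrow> nat \<Rightarrow> real" where "Nt t w = NN t (if t = 0 then [] else sgt (t - 1)) w"

lemma length_hh [simp]: "length (hh n) = n" by (induction n) simp_all
lemma take_hh: "r \<le> n \<Longrightarrow> take r (hh n) = hh r"
proof (induction n)
  case (Suc n) then show ?case by (cases "r = Suc n") simp_all
qed simp
lemma nth_hh: "r < n \<Longrightarrow> nthd 0 (hh n) r = tt r"
proof (induction n)
  case (Suc n) then show ?case by (cases "r = n") (simp_all add: nthd_simp nth_append tt_def)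
qed simp

lemma sgl_hh: "r < n \<Longrightarrow> sgl (hh n) r = sgt r" unfolding sgl_def sgt_def by (simp only: nth_hh)

sublocale g: game sgt Nt "KK c" "mm c"
proof (unfold_locales)
  show "0 < mm c" by (simp add: mm_def)
  show "0 \<le> Nt t w" for t w unfolding Nt_def by (rule NN_nonneg)
  show "(\<Sum>w<M. Nt t w) \<le> 1" for t M unfolding Nt_def by (rule NN_sum)
  fix a t w
  assume at: "a \<le> t" and n: "\<not> (\<exists>r. a \<le> r \<and> r < t \<and> take w (sgt r) \<noteq> take w (if a = 0 then [] else sgt (a - 1)))"
  show "Nt a w \<le> Nt t w" unfolding Nt_def
  proof (rule NN_mono[OF at])
    show "take w (if a = 0 then [] else sgt (a - 1)) = take w (if t = 0 then [] else sgt (t - 1))"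
    proof (cases "a = t")
      case False
      then have "a \<le> t - 1" "t - 1 < t" using at by simp_all
      then have "take w (sgt (t - 1)) = take w (if a = 0 then [] else sgt (a - 1))" using n by blast
      then show ?thesis using False at by simp
    qed simp
  qed
qed

lemma sgq_hh: "a \<le> n \<Longrightarrow> sgq (hh n) a = g.sgp a"
  unfolding sgq_def g.sgp_def by (simp add: sgl_hh)

lemma chh_hh: assumes "a \<le> n" "t \<le> n" shows "chh (hh n) a t w = g.ch a t w"
proof -
  have "(r < t \<and> a \<le> r \<and> take w (sgl (hh n) r) \<noteq> take w (sgq (hh n) a)) = (a \<le> r \<and> r < t \<and> take w (sgt r) \<noteq> take w (g.sgp a))" for r
    using sgl_hh[of r n] sgq_hh[OF assms(1)] assms(2) by (cases "r < t") simp_all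
  then show ?thesis unfolding chh_def g.ch_def by (simp only:)
qed

lemma Nh_hh: "Nh (hh n) n = Nt n"
proof
  fix w show "Nh (hh n) n w = Nt n w" unfolding Nh_def Nt_def sgq_hh[OF order_refl] g.sgp_def ..
qed

lemma bounded_S: "bounded t (g.S t)"
proof (induction t)
  case 0 then show ?case by (simp add: bounded_start)
next
  case (Suc t) then show ?case using bounded_adv[of t "g.S t" "Suc t"] by simp
qed

lemma Sh_S: "Sh c (hh n) = g.S n"
proof -
  have "rec_nat (start (KK c) (chh []) (Nh [] 0) (mm c)) (\<lambda>t Fs. adv (KK c) (chh (take (Suc t) (hh n))) (Nh (take (Suc t) (hh n)) (Suc t)) (Suc t) Fs) k = g.S k"
    if "k \<le> n" for k
    using that
  proof (induction k)
    case 0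
    have "start (KK c) (chh []) (Nt 0) (mm c) = start (KK c) g.ch (Nt 0) (mm c)" by (rule start_cong)
    moreover have "Nh [] 0 = Nt 0" using Nh_hh[of 0] by simp
    ultimately show ?case by simp
  next
    case (Suc k)
    have t: "take (Suc k) (hh n) = hh (Suc k)" by (rule take_hh[OF Suc.prems])
    have b: "bounded (Suc k) (g.S k)" using bounded_S[of k] unfolding bounded_def by (meson le_SucI)
    have "adv (KK c) (chh (hh (Suc k))) (Nt (Suc k)) (Suc k) (g.S k) = adv (KK c) g.ch (Nt (Suc k)) (Suc k) (g.S k)"
      by (rule adv_cong[OF chh_hh b])
    then show ?case using Suc.IH Suc.prems by (simp add: t Nh_hh del: hh.simps)
  qed
  from this[of n] show ?thesis unfolding Sh_def by simp
qed

lemma outh_hh: "outh c (hh n) = g.out n" unfolding outh_def g.out_def Sh_S ..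

definition answered :: "nat \<Rightarrow> bool" where "answered n \<longleftrightarrow> (\<forall>r<n. rsp c (hh r) (tt r))"

lemma vh_hh: assumes "answered n" shows "vh c (hh n)"
  unfolding vh_def
proof (intro allI impI conjI)
  fix r assume "r < length (hh n)"
  then have r: "r < n" by simp
  have e: "take r (hh n) = hh r" "nthd 0 (hh n) r = tt r" using take_hh[of r n] nth_hh[OF r] r by simp_all
  show "rsp c (take r (hh n)) (nthd 0 (hh n) r)" unfolding e using assms r unfolding answered_def by blast
  show "\<not> rsp c (take r (hh n)) t" if "t < nthd 0 (hh n) r" for t
    using that unfolding e tt_def by (rule not_less_Least)
qed

lemma osum_mass: "osum c (hh n) (Suc n) = g.mass {0..<Suc n}"
  unfolding osum_def g.mass_def atLeast0LessThan
  by (rule sum.cong[OF refl]) (simp add: take_hh outh_hh)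

text \<open>Different answers to a round are different strings, each with a description of at most
  \<open>out n + 2 * c\<close> bits, and answers counted for different rounds differ in length. So
  all descriptions enter Kraft's inequality separately.\<close>

lemma payment:
  assumes T: "answered T" and D: "D \<subseteq> {0..<T}" and j: "\<And>n. n \<in> D \<Longrightarrow> j \<le> card (g.rs n T)"
  shows "real j * g.mass D \<le> 4 ^ c"
proof -
  have fD: "finite D" using D by (rule finite_subset) simp
  have frs: "finite (g.rs n T)" for n unfolding g.rs_def by simp
  have rs: "length s = Suc n \<and> Kc U s \<le> g.out n + 2 * c" if h: "n \<in> D" "s \<in> g.rs n T" for n s
  proof -
    obtain r where r: "n \<le> r" "r < T" "s = take (Suc n) (sgt r)" using h(2) unfolding g.rs_def by auto
    have rsp: "rsp c (hh r) (tt r)" using T r(2) unfolding answered_def by blast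
    have s: "s = take (Suc n) (Aat (tt r))" unfolding r(3) sgt_def using r(1) by (simp add: min_absorb1)
    have "KS (rcode U) (tt r) (take (Suc n) (Aat (tt r))) (outh c (take n (hh r)) + 2 * c)" "Suc r \<le> tt r"
      using rsp r(1) unfolding rsp_def by simp_all
    then have "KS (rcode U) (tt r) s (g.out n + 2 * c)" "length s = Suc n" unfolding s take_hh[OF r(1)] outh_hh using r(1) by simp_all
    then show ?thesis using Kc_iff_KS[OF U] by blast
  qed
  have "real j * g.mass D / 4 ^ c = (\<Sum>n\<in>D. real j * (1 / 2 ^ g.out n) / 4 ^ c)"
    unfolding g.mass_def sum_distrib_left sum_divide_distrib ..
  also have "\<dots> \<le> (\<Sum>n\<in>D. \<Sum>s\<in>g.rs n T. 1 / 2 ^ Kc U s)"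
  proof (rule sum_mono)
    fix n assume n: "n \<in> D"
    have p4: "(4::real) ^ c = 2 ^ (2 * c)" by (simp add: power_mult)
    have "real j * (1 / 2 ^ g.out n) / 4 ^ c = real j * (1 / 2 ^ (g.out n + 2 * c))" unfolding p4 power_add by simp
    also have "\<dots> \<le> real (card (g.rs n T)) * (1 / 2 ^ (g.out n + 2 * c))" using j[OF n] by (intro mult_right_mono) simp_all
    also have "\<dots> = (\<Sum>s\<in>g.rs n T. 1 / 2 ^ (g.out n + 2 * c))" by simp
    also have "\<dots> \<le> (\<Sum>s\<in>g.rs n T. 1 / 2 ^ Kc U s)"
    proof (rule sum_mono)
      fix s assume "s \<in> g.rs n T"
      then have "Kc U s \<le> g.out n + 2 * c" using rs[OF n] by blast
      then have "(2::real) ^ Kc U s \<le> 2 ^ (g.out n + 2 * c)" by (rule power_increasing) simp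
      then show "1 / 2 ^ (g.out n + 2 * c) \<le> (1::real) / 2 ^ Kc U s" by (intro divide_left_mono) simp_all
    qed
    finally show "real j * (1 / 2 ^ g.out n) / 4 ^ c \<le> (\<Sum>s\<in>g.rs n T. 1 / 2 ^ Kc U s)" .
  qed
  also have "\<dots> = (\<Sum>s\<in>(\<Union>n\<in>D. g.rs n T). 1 / 2 ^ Kc U s)"
  proof (rule sum.UNION_disjoint[symmetric, OF fD])
    show "\<forall>n\<in>D. finite (g.rs n T)" using frs by blast
    show "\<forall>n\<in>D. \<forall>n'\<in>D. n \<noteq> n' \<longrightarrow> g.rs n T \<inter> g.rs n' T = {}"
    proof (intro ballI impI equals0I)
      fix n n' s assume "n \<in> D" "n' \<in> D" "n \<noteq> n'" "s \<in> g.rs n T \<inter> g.rs n' T"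
      then show False using rs[of n s] rs[of n' s] by simp
    qed
  qed
  also have "\<dots> \<le> 1" by (rule Kc_kraft[OF U]) (use fD frs in blast)
  finally show ?thesis by (simp add: divide_le_eq)
qed

lemma L_less: assumes "g.Inv t" "answered (Suc t)" shows "g.L t < mm c"
proof (rule ccontr)
  assume "\<not> g.L t < mm c"
  then have "g.good (mm c) (g.Bg t (mm c)) (Suc t) (g.Q t (mm c))" by (intro g.Inv_good[OF assms(1)]) simp
  moreover have "g.Bg t (mm c) = 0" "g.Q t (mm c) = 1" unfolding g.Bg_def g.Q_def by simp_all
  ultimately obtain D where D: "D \<subseteq> {0..<Suc t}" "1 / 2 ^ 1 \<le> g.mass D" "\<forall>n\<in>D. Suc (mm c) \<le> card (g.rs n (Suc t))"
    unfolding g.good_def by (simp only:) (elim exE conjE)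
  have 1: "real (Suc (mm c)) * g.mass D \<le> 4 ^ c" by (rule payment[OF assms(2) D(1)]) (use D(3) in blast)
  have "real (Suc (mm c)) * (1 / 2) \<le> real (Suc (mm c)) * g.mass D" using D(2) by (intro mult_left_mono) simp_all
  from order_trans[OF this 1] have "real (Suc (mm c)) * (1 / 2) \<le> 4 ^ c" .
  moreover have "real (Suc (mm c)) = 2 * 4 ^ c + 1" unfolding mm_def by simp
  ultimately have "(2 * 4 ^ c + 1) * (1 / 2) \<le> (4::real) ^ c" by (simp only:)
  then show False by (simp add: field_simps)
qed

lemma Inv_answered: "answered t \<Longrightarrow> g.Inv t"
proof (induction t)
  case 0 then show ?case by (simp add: g.Inv_0)
next
  case (Suc t)
  have "answered t" using Suc.prems unfolding answered_def by simp
  from g.Inv_Suc[OF Suc.IH[OF this] L_less[OF Suc.IH[OF this] Suc.prems]] show ?case .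
qed

text \<open>The weight requested so far is at most \<open>Bf ^ mm c / 2 \<le> 1\<close>, so the
  intervals of the slot fit into the unit interval and describe the round.\<close>

lemma honoured: assumes "answered n" shows "Kc U (As (Suc n)) \<le> g.out n + 2 * c"
proof -
  have I: "g.Inv n" by (rule Inv_answered[OF assms])
  have "g.mass {g.Bg n (mm c)..<Suc n} \<le> g.Bf ^ mm c / 2 ^ g.Q n (mm c)" by (rule g.Inv_mass[OF I]) simp
  then have "g.mass {0..<Suc n} \<le> g.Bf ^ mm c / 2" unfolding g.Bg_def g.Q_def by simp
  moreover have "g.Bf ^ mm c \<le> 2" unfolding g.Bf_def unfolding KK_def by (rule power_bound)
  ultimately have "osum c (hh n) (Suc (length (hh n))) \<le> 1" unfolding length_hh osum_mass by linarith
  from prog[OF vh_hh[OF assms] this] have "Kc U (str_of (Suc n)) \<le> g.out n + c + ks" unfolding length_hh outh_hh .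
  then show ?thesis using KA[of "Suc n"] large by linarith
qed

text \<open>The finitely many requests are honoured for the true initial segments of
  \<open>A\<close>; late enough the guess agrees with them and the descriptions have
  appeared.\<close>

lemma responds: assumes "answered n" shows "\<exists>t. rsp c (hh n) t"
proof -
  have "\<forall>n'. \<exists>t. n' \<le> n \<longrightarrow> KS (rcode U) t (As (Suc n')) (g.out n' + 2 * c)"
  proof
    fix n'
    show "\<exists>t. n' \<le> n \<longrightarrow> KS (rcode U) t (As (Suc n')) (g.out n' + 2 * c)"
    proof (cases "n' \<le> n")
      case True
      then have "answered n'" using assms unfolding answered_def by simp
      from honoured[OF this] obtain t where "KS (rcode U) t (As (Suc n')) (g.out n' + 2 * c)" unfolding Kc_iff_KS[OF U] by (elim exE)
      then show ?thesis by (intro exI[of _ t] impI)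
    next
      case False then show ?thesis by (intro exI[of _ 0] impI) (rule notE)
    qed
  qed
  from choice[OF this] obtain f where f: "\<forall>n'. n' \<le> n \<longrightarrow> KS (rcode U) (f n') (As (Suc n')) (g.out n' + 2 * c)" by (elim exE)
  obtain s where s: "\<forall>t\<ge>s. take (Suc n) (Aat t) = As (Suc n)" using Aat_limit[of "Suc n"] by (elim exE)
  define t where "t = Suc n + s + Max (f ` {..n})"
  have "KS (rcode U) t (take (Suc n') (Aat t)) (outh c (take n' (hh n)) + 2 * c)" if "n' < Suc n" for n'
  proof -
    have n': "n' \<le> n" using that by simp
    have "f n' \<le> Max (f ` {..n})" using n' by (intro Max_ge) simp_all
    then have "f n' \<le> t" unfolding t_def by simp
    moreover have "KS (rcode U) (f n') (As (Suc n')) (g.out n' + 2 * c)" using f n' by blast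
    ultimately have "KS (rcode U) t (As (Suc n')) (g.out n' + 2 * c)" using KS_mono by blast
    moreover have "take (Suc n') (Aat t) = As (Suc n')"
    proof -
      have "take (Suc n) (Aat t) = As (Suc n)" using s unfolding t_def by simp
      then have "take (Suc n') (take (Suc n) (Aat t)) = take (Suc n') (As (Suc n))" by (rule arg_cong)
      then show ?thesis using n' by (simp add: min_absorb1 take_As)
    qed
    ultimately show ?thesis unfolding take_hh[OF n'] outh_hh by simp
  qed
  then have "rsp c (hh n) t" unfolding rsp_def length_hh by (intro conjI allI impI) (simp_all add: t_def)
  then show ?thesis by (rule exI)
qed

text \<open>Opens the circle round by round: the invariant needs the answers so far, and the next
  answer needs the invariant.\<close>

lemma all_answered: "answered n"
proof (induction n)
  case 0 then show ?case by (simp add: answered_def)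
next
  case (Suc n)
  have "rsp c (hh n) (tt n)" unfolding tt_def by (rule LeastI_ex[OF responds[OF Suc.IH]])
  then show ?case using Suc.IH unfolding answered_def by (simp add: less_Suc_eq)
qed

lemma tt_ge: "Suc r \<le> tt r"
proof -
  have "rsp c (hh r) (tt r)" using all_answered[of "Suc r"] unfolding answered_def by blast
  then show ?thesis unfolding rsp_def by simp
qed

lemma length_sgt: "length (sgt r) = Suc r" unfolding sgt_def using tt_ge[of r] by simp

lemma sgt_limit: "\<exists>T1. \<forall>r\<ge>T1. take w (sgt r) = As w"
proof -
  obtain s where s: "\<forall>t\<ge>s. take w (Aat t) = As w" using Aat_limit[of w] by (elim exE)
  have "take w (sgt r) = As w" if "s + w \<le> r" for r
  proof -
    have "s \<le> tt r" using tt_ge[of r] that by simp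
    then show ?thesis unfolding sgt_def using s that by (simp add: min_absorb1)
  qed
  then show ?thesis by (intro exI[of _ "s + w"] allI impI)
qed

lemma golden_ex: "\<exists>i T. golden sgt Nt (KK c) (mm c) i T"
  by (rule g.golden_exists) (rule Inv_answered[OF all_answered], rule L_less[OF Inv_answered[OF all_answered] all_answered])

text \<open>\<open>hh n\<close> is found by search as the only valid history of length
  \<open>n\<close>.\<close>

lemma cpt_hh: "cpt f \<Longrightarrow> cpt (\<lambda>x. hh (f x))"
proof -
  have ex: "\<exists>k. length (dec k :: nat list) = n \<and> vh c (dec k)" for n
    by (rule exI[of _ "enc (hh n)"]) (simp add: vh_hh[OF all_answered])
  have "cpt (\<lambda>n. dec (LEAST k. length (dec k :: nat list) = n \<and> vh c (dec k)) :: nat list)"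
    by (intro cpt_dec cpt_Least0[OF _ ex] cpt_conj cpt_eq cpt_length cpt_vh cpt_const cpt_fst cpt_snd cpt_id)
  moreover have "dec (LEAST k. length (dec k :: nat list) = n \<and> vh c (dec k)) = hh n" for n
  proof (rule vh_unique[of c])
    have "length (dec (LEAST k. length (dec k :: nat list) = n \<and> vh c (dec k)) :: nat list) = n \<and> vh c (dec (LEAST k. length (dec k :: nat list) = n \<and> vh c (dec k)))"
      by (rule LeastI_ex[OF ex])
    then show "vh c (dec (LEAST k. length (dec k :: nat list) = n \<and> vh c (dec k)))"
      "length (dec (LEAST k. length (dec k :: nat list) = n \<and> vh c (dec k)) :: nat list) = length (hh n)" by simp_all
  qed (rule vh_hh[OF all_answered])
  ultimately have "cpt hh" by simp
  then show "cpt f \<Longrightarrow> cpt (\<lambda>x. hh (f x))" by (rule cpt_comp)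
qed

lemma cpt_S: "cpt f \<Longrightarrow> cpt (\<lambda>x. g.S (f x))"
  unfolding Sh_S[symmetric] by (intro cpt_Sh cpt_hh cpt_const)

lemma cpt_sgp: "cpt f \<Longrightarrow> cpt (\<lambda>x. g.sgp (f x))"
proof -
  assume f: "cpt f"
  have "cpt (\<lambda>x. sgq (hh (f x)) (f x))" by (intro cpt_sgq cpt_hh f)
  then show ?thesis unfolding sgq_hh[OF order_refl] .
qed

lemma length_sgp: "length (g.sgp t) = t" unfolding g.sgp_def using length_sgt[of "t - 1"] by simp

lemma sgp_limit: "\<exists>T1. \<forall>t\<ge>T1. take w (g.sgp t) = As w"
proof -
  obtain T1 where T1: "\<forall>r\<ge>T1. take w (sgt r) = As w" using sgt_limit[of w] by (elim exE)
  have "take w (g.sgp t) = As w" if "Suc T1 \<le> t" for t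
  proof -
    have "T1 \<le> t - 1" "t \<noteq> 0" using that by simp_all
    then show ?thesis using T1 unfolding g.sgp_def by simp
  qed
  then show ?thesis by (intro exI[of _ "Suc T1"] allI impI)
qed

end

section \<open>An approximation of finite cost\<close>

lemma sum_mu_le:
  assumes "finite F" "finite G" "\<And>j. j \<in> F \<Longrightarrow> A j \<in> sets cantor" "\<And>q. q \<in> G \<Longrightarrow> B q \<in> sets cantor"
    and le: "\<And>Z. (\<Sum>j\<in>F. indicat_real (A j) Z) \<le> 1 + (\<Sum>q\<in>G. indicat_real (B q) Z)"
  shows "(\<Sum>j\<in>F. mu (A j)) \<le> 1 + (\<Sum>q\<in>G. mu (B q))"
proof -
  have iA: "integrable cantor (indicat_real (A j))" if "j \<in> F" for j
    using assms(3)[OF that] CP.emeasure_finite by (intro integrable_real_indicator) (simp_all add: less_top[symmetric])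
  have iB: "integrable cantor (indicat_real (B q))" if "q \<in> G" for q
    using assms(4)[OF that] CP.emeasure_finite by (intro integrable_real_indicator) (simp_all add: less_top[symmetric])
  have spA: "A j \<inter> space cantor = A j" if "j \<in> F" for j using sets.sets_into_space[OF assms(3)[OF that]] by blast
  have spB: "B q \<inter> space cantor = B q" if "q \<in> G" for q using sets.sets_into_space[OF assms(4)[OF that]] by blast
  have "(\<Sum>j\<in>F. mu (A j)) = (\<Sum>j\<in>F. integral\<^sup>L cantor (indicat_real (A j)))"
    unfolding mu_def by (intro sum.cong refl) (simp add: spA)
  also have "\<dots> = integral\<^sup>L cantor (\<lambda>Z. \<Sum>j\<in>F. indicat_real (A j) Z)" by (rule Bochner_Integration.integral_sum[symmetric]) (rule iA)
  also have "\<dots> \<le> integral\<^sup>L cantor (\<lambda>Z. 1 + (\<Sum>q\<in>G. indicat_real (B q) Z))"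
    by (intro integral_mono le Bochner_Integration.integrable_add Bochner_Integration.integrable_sum iA iB) simp_all
  also have "\<dots> = 1 + integral\<^sup>L cantor (\<lambda>Z. \<Sum>q\<in>G. indicat_real (B q) Z)"
    using CP.prob_space by (subst Bochner_Integration.integral_add) (simp_all add: iB Bochner_Integration.integrable_sum CP.prob_space)
  also have "integral\<^sup>L cantor (\<lambda>Z. \<Sum>q\<in>G. indicat_real (B q) Z) = (\<Sum>q\<in>G. integral\<^sup>L cantor (indicat_real (B q)))"
    by (rule Bochner_Integration.integral_sum) (rule iB)
  also have "\<dots> = (\<Sum>q\<in>G. mu (B q))"
    unfolding mu_def by (intro sum.cong refl) (simp add: spB)
  finally show ?thesis .
qed

text \<open>\<open>i\<close>, \<open>T\<close> and \<open>d\<close> are finitely much information;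
  the approximation uses them as fixed constants, and they need not be computed.\<close>

locale slot_run = slot +
  fixes i T d :: nat
  assumes gold: "golden sgt Nt (KK c) (mm c) i T"
    and dens: "\<And>x. \<exists>y0. \<forall>y\<ge>y0. climit x / 2 ^ d \<le> mW y (As (Suc x))"
begin

sublocale G: golden sgt Nt "KK c" "mm c" i T by (rule gold)

text \<open>A piece of level \<open>i\<close> with beginning \<open>s\<close> shows that the level
  moved just then, which makes \<open>bd\<close> decidable from the state.\<close>

lemma bd_iff: "G.bd s \<longleftrightarrow> T < s \<and> fb (g.S s ! i) = s"
proof
  assume "G.bd s"
  then show "T < s \<and> fb (g.S s ! i) = s" using G.bd_T G.bd_fb by blast
next
  assume s: "T < s \<and> fb (g.S s ! i) = s"
  then obtain t where t: "s = Suc t" "T \<le> t" by (cases s) simp_all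
  have "g.L t = i"
  proof (rule ccontr)
    assume "g.L t \<noteq> i"
    then have "g.S (Suc t) ! i = g.S t ! i" by (rule G.S_same[OF t(2)])
    then have "fb (g.S (Suc t) ! i) \<le> t" using g.InvD(5)[OF G.inv G.im, of t] by (simp only:)
    then show False using s t(1) by simp
  qed
  then show "G.bd s" unfolding G.bd_def using t by blast
qed

lemma frame_nthd: "g.S s ! i = nthd (0, [], 0, 0, 0) (g.S s) i"
  using G.im by (simp add: nthd_simp del: g.S.simps)

lemma cpt_bd: "cpt f \<Longrightarrow> cpt (\<lambda>x. G.bd (f x))"
  unfolding bd_iff frame_nthd by (intro cpt_conj cpt_less cpt_eq cpt_fst cpt_snd cpt_nthd cpt_S cpt_const)

lemma cpt_W: "cpt f \<Longrightarrow> cpt (\<lambda>x. G.W (f x))"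
  unfolding G.W_def frame_nthd by (intro cpt_fst cpt_snd cpt_nthd cpt_S cpt_const)

text \<open>Stage \<open>s\<close> is fit for step \<open>j\<close> if the demands up to
  \<open>Suc j\<close> are met and the oracles computing the guess are dense enough to pay for
  whatever change the next step may bring.\<close>

definition cond :: "nat \<Rightarrow> nat \<Rightarrow> nat \<Rightarrow> bool" where
  "cond j v s \<longleftrightarrow> v < s \<and> G.bd s \<and> Suc j < G.W s \<and> (\<forall>x<Suc j. cOR Om R x (Suc j) / 2 ^ d \<le> mW s (take (Suc x) (g.sgp s)))"

lemma cond_ex: "\<exists>s. cond j v s"
proof -
  have "\<forall>x. \<exists>y0. \<forall>y\<ge>y0. climit x / 2 ^ d \<le> mW y (As (Suc x))" using dens by (rule allI)
  from choice[OF this] obtain y where y: "\<forall>x. \<forall>t\<ge>y x. climit x / 2 ^ d \<le> mW t (As (Suc x))" by (elim exE)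
  obtain T1 where T1: "\<forall>t\<ge>T1. take (Suc j) (g.sgp t) = As (Suc j)" using sgp_limit[of "Suc j"] by (elim exE)
  have "\<exists>n. \<forall>s\<ge>n. G.bd s \<longrightarrow> Suc j < G.W s"
  proof (rule G.W_large)
    fix w
    obtain T2 where "\<forall>r\<ge>T2. take w (sgt r) = As w" using sgt_limit[of w] by (elim exE)
    then show "\<exists>T1 \<tau>. \<forall>r\<ge>T1. take w (sgt r) = \<tau>" by (intro exI)
  qed
  then obtain n where n: "\<forall>s\<ge>n. G.bd s \<longrightarrow> Suc j < G.W s" by (elim exE)
  obtain s where s: "s \<ge> Suc v + T1 + n + Max (y ` {..j})" "G.bd s" using G.bd_inf by blast
  have "cOR Om R x (Suc j) / 2 ^ d \<le> mW s (take (Suc x) (g.sgp s))" if x: "x < Suc j" for x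
  proof -
    have "y x \<le> Max (y ` {..j})" using x by (intro Max_ge) simp_all
    then have "climit x / 2 ^ d \<le> mW s (As (Suc x))" using y s(1) by simp
    moreover have "take (Suc x) (g.sgp s) = As (Suc x)"
    proof -
      have "take (Suc j) (g.sgp s) = As (Suc j)" using T1 s(1) by simp
      then have "take (Suc x) (take (Suc j) (g.sgp s)) = take (Suc x) (As (Suc j))" by (rule arg_cong)
      then show ?thesis using x by (simp add: min_absorb1 take_As)
    qed
    moreover have "cOR Om R x (Suc j) / 2 ^ d \<le> climit x / 2 ^ d" by (intro divide_right_mono cOR_le_climit) simp
    ultimately show ?thesis by simp
  qed
  then have "cond j v s" unfolding cond_def using s n by simp
  then show ?thesis by (rule exI)
qed

lemma cpt_cond: "cpt (\<lambda>q. cond (fst q) (fst (snd q)) (snd (snd q)))"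
  unfolding cond_def
  by (intro cpt_conj cpt_less cpt_bd cpt_W cpt_all_less cpt_crat crat_div_pow crat_cOR crat_mW cpt_take cpt_sgp cpt_Suc cpt_const cpt_fst cpt_snd cpt_id)

definition sq :: "nat \<Rightarrow> nat" where "sq j = rec_nat (LEAST s. cond 0 0 s) (\<lambda>j v. LEAST s. cond (Suc j) v s) j"

lemma sq_cond: "cond j (if j = 0 then 0 else sq (j - 1)) (sq j)"
proof (cases j)
  case 0
  have "sq 0 = (LEAST s. cond 0 0 s)" by (simp add: sq_def)
  then show ?thesis using LeastI_ex[OF cond_ex[of 0 0]] unfolding 0 by simp
next
  case (Suc k)
  have "sq (Suc k) = (LEAST s. cond (Suc k) (sq k) s)" by (simp add: sq_def)
  then show ?thesis using LeastI_ex[OF cond_ex[of "Suc k" "sq k"]] unfolding Suc by simp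
qed

lemma cpt_sq: "cpt f \<Longrightarrow> cpt (\<lambda>x. sq (f x))"
proof -
  have c: "cpt a \<Longrightarrow> cpt v \<Longrightarrow> cpt s \<Longrightarrow> cpt (\<lambda>x. cond (a x) (v x) (s x))" for a v s
    using cpt_comp[OF cpt_cond cpt_Pair[OF _ cpt_Pair]] by simp
  have "cpt sq" unfolding sq_def
    by (intro cpt_rec_nat cpt_Least0[OF _ cond_ex] c cpt_const cpt_Suc cpt_fst cpt_snd cpt_id)
  then show "cpt f \<Longrightarrow> cpt (\<lambda>x. sq (f x))" by (rule cpt_comp)
qed

lemma sq_facts: "G.bd (sq j)" "Suc j < G.W (sq j)" "Suc j < sq j" "sq j < sq (Suc j)"
    "x \<le> j \<Longrightarrow> cOR Om R x (Suc j) / 2 ^ d \<le> mW (sq j) (take (Suc x) (g.sgp (sq j)))"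
  using sq_cond[of j] sq_cond[of "Suc j"] G.W_le[of "sq j"] unfolding cond_def by (simp_all add: less_Suc_eq_le)

section \<open>Changes of the approximation and the oracles they refute\<close>

abbreviation u :: "nat \<Rightarrow> bool list" where "u j \<equiv> g.sgp (sq j)"
definition gx :: "nat \<Rightarrow> nat \<Rightarrow> nat" where "gx x j = (if nthd False (u j) x then 1 else 0)"
definition chg :: "nat \<Rightarrow> bool" where "chg j \<longleftrightarrow> (\<exists>x. (gx x j \<noteq> 0) \<noteq> (gx x (Suc j) \<noteq> 0))"
definition xc :: "nat \<Rightarrow> nat" where "xc j = (LEAST x. (gx x j \<noteq> 0) \<noteq> (gx x (Suc j) \<noteq> 0))"

lemma gx_nthd: "(gx x j \<noteq> 0) = nthd False (u j) x" by (simp add: gx_def)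
lemma length_u: "length (u j) = sq j" by (rule length_sgp)

lemma xc_change: assumes "chg j" shows "nthd False (u j) (xc j) \<noteq> nthd False (u (Suc j)) (xc j)"
proof -
  have "(gx (xc j) j \<noteq> 0) \<noteq> (gx (xc j) (Suc j) \<noteq> 0)" unfolding xc_def by (rule LeastI_ex) (rule assms[unfolded chg_def])
  then show ?thesis unfolding gx_nthd .
qed

lemma u_same: assumes "\<not> chg j \<or> y \<le> xc j" "y \<le> Suc j" shows "take y (u (Suc j)) = take y (u j)"
proof (rule nth_equalityI)
  have y: "y \<le> length (u j)" "y \<le> length (u (Suc j))" using assms(2) sq_facts(3,4)[of j] unfolding length_u by simp_all
  then show "length (take y (u (Suc j))) = length (take y (u j))" by simp
  fix x assume "x < length (take y (u (Suc j)))"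
  then have x: "x < y" by simp
  have "(gx x j \<noteq> 0) = (gx x (Suc j) \<noteq> 0)"
  proof (cases "chg j")
    case True
    then have "x < xc j" using assms(1) x by simp
    then show ?thesis unfolding xc_def using not_less_Least by blast
  next
    case False then show ?thesis unfolding chg_def by blast
  qed
  then show "take y (u (Suc j)) ! x = take y (u j) ! x" unfolding gx_nthd using x y by (simp add: nthd_simp)
qed

lemma u_differ: assumes "chg j" "xc j < w" "w \<le> Suc j" shows "take w (u j) \<noteq> take w (u (Suc j))"
proof
  assume "take w (u j) = take w (u (Suc j))"
  then have "take w (u j) ! xc j = take w (u (Suc j)) ! xc j" by simp
  then have "u j ! xc j = u (Suc j) ! xc j" using assms(2) by simp
  moreover have "xc j < length (u j)" "xc j < length (u (Suc j))" using assms(2,3) sq_facts(3,4)[of j] unfolding length_u by simp_all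
  ultimately show False using xc_change[OF assms(1)] by (simp add: nthd_simp)
qed

text \<open>The targets whose demands step \<open>j\<close> destroys: those beyond the changed
  position.\<close>

definition Xs :: "nat \<Rightarrow> nat set" where "Xs j = (if chg j then {xc j<..Suc j} else {})"

lemma finite_Xs: "finite (Xs j)" by (simp add: Xs_def)

text \<open>The oracles that had computed the bit refuted at step \<open>j\<close>. A change beyond
  \<open>j\<close> costs nothing, as \<open>Om\<close> has not advanced past it, and is left
  out.\<close>

definition Ev :: "nat \<Rightarrow> (nat \<Rightarrow> bool) set" where
  "Ev j = (if chg j \<and> xc j \<le> j then ucyl (SW (sq j) (take (Suc (xc j)) (u j))) else {})"
definition Ds :: "nat \<Rightarrow> nat \<Rightarrow> (nat \<Rightarrow> bool) set" where "Ds j w = ucyl (SW (sq j) (flip (take w (u j))))"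

definition dis :: "nat \<Rightarrow> (nat \<Rightarrow> bool) \<Rightarrow> bool" where "dis j Z \<longleftrightarrow> (\<exists>y\<le>j. Z \<in> Ds j (Suc y))"

lemma Ds_keep: assumes "Z \<in> Ds j w" "take w (u (Suc j)) = take w (u j)" shows "Z \<in> Ds (Suc j) w"
  using assms(1) SW_mono[of "sq j" "sq (Suc j)" "flip (take w (u j))"] sq_facts(4)[of j] unfolding Ds_def assms(2) by auto

lemma flip_change: assumes "chg j" "xc j \<le> j" shows "flip (take (Suc (xc j)) (u (Suc j))) = take (Suc (xc j)) (u j)"
proof -
  have l: "xc j < length (u j)" "xc j < length (u (Suc j))" using assms(2) sq_facts(3,4)[of j] unfolding length_u by simp_all
  have e: "take (xc j) (u (Suc j)) = take (xc j) (u j)" by (rule u_same) (use assms(2) in simp_all)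
  have "flip (take (Suc (xc j)) (u (Suc j))) = take (xc j) (u (Suc j)) @ [\<not> u (Suc j) ! xc j]"
    using l(2) by (simp add: flip_def nthd_simp min_absorb2)
  also have "(\<not> u (Suc j) ! xc j) = u j ! xc j" using xc_change[OF assms(1)] l by (simp add: nthd_simp)
  also have "take (xc j) (u (Suc j)) @ [u j ! xc j] = take (Suc (xc j)) (u j)" unfolding e by (rule take_Suc_conv_app_nth[OF l(1), symmetric])
  finally show ?thesis .
qed

text \<open>An oracle that computed the old bit at \<open>xc j\<close> has its first error against
  the new guess exactly there.\<close>

lemma Ev_dis: assumes "Z \<in> Ev j" shows "dis (Suc j) Z"
proof -
  have c: "chg j" "xc j \<le> j" and Z: "Z \<in> ucyl (SW (sq j) (take (Suc (xc j)) (u j)))"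
    using assms unfolding Ev_def by (simp_all split: if_splits)
  have "Z \<in> ucyl (SW (sq (Suc j)) (take (Suc (xc j)) (u j)))" using Z SW_mono[of "sq j" "sq (Suc j)"] sq_facts(4)[of j] by auto
  then have "Z \<in> Ds (Suc j) (Suc (xc j))" unfolding Ds_def flip_change[OF c] .
  then show ?thesis unfolding dis_def using c(2) by (intro exI[of _ "xc j"]) simp
qed

text \<open>Such an oracle agrees with the guess through \<open>xc j\<close>, so its first error
  lies later, and its demand is among those destroyed.\<close>

lemma Ev_after: assumes Z: "Z \<in> Ev j" and y: "y \<le> j" "Z \<in> Ds j (Suc y)" shows "Suc y \<in> Xs j"
proof -
  have c: "chg j" "xc j \<le> j" and E: "cmps (sq j) (map Z [0..<sq j]) (take (Suc (xc j)) (u j))"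
    using Z unfolding Ev_def by (simp_all add: in_SW split: if_splits)
  have D: "cmps (sq j) (map Z [0..<sq j]) (flip (take (Suc y) (u j)))" using y(2) unfolding Ds_def in_SW .
  have ly: "length (take (Suc y) (u j)) = Suc y" using y(1) sq_facts(3)[of j] unfolding length_take length_u by simp
  then have ne: "take (Suc y) (u j) \<noteq> []" by auto
  have "\<not> y \<le> xc j"
  proof
    assume yx: "y \<le> xc j"
    have lx: "y < length (take (Suc (xc j)) (u j))" using yx y(1) c(2) sq_facts(3)[of j] unfolding length_take length_u by simp
    have "take (Suc (xc j)) (u j) ! y = flip (take (Suc y) (u j)) ! y"
      by (rule cmps_agree[OF E D lx]) (simp only: length_flip[OF ne] ly lessI)
    moreover have "flip (take (Suc y) (u j)) ! y = (\<not> u j ! y)" using nth_flip_last[OF ne] unfolding ly by simp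
    ultimately show False using yx by simp
  qed
  then show ?thesis unfolding Xs_def using c y(1) by simp
qed

text \<open>If the demand is not destroyed, the guess is unchanged up to the error, and the error
  persists.\<close>

lemma dis_keep: assumes "dis j Z" shows "dis (Suc j) Z \<or> (\<exists>w\<in>Xs j. Z \<in> Ds j w)"
proof -
  obtain y where y: "y \<le> j" "Z \<in> Ds j (Suc y)" using assms unfolding dis_def by blast
  show ?thesis
  proof (cases "Suc y \<in> Xs j")
    case True then show ?thesis using y(2) by blast
  next
    case False
    then have "\<not> chg j \<or> Suc y \<le> xc j" using y(1) unfolding Xs_def by (simp split: if_splits)
    then have "take (Suc y) (u (Suc j)) = take (Suc y) (u j)" by (rule u_same) (use y(1) in simp)
    from Ds_keep[OF y(2) this] show ?thesis unfolding dis_def using y(1) by (intro disjI1 exI[of _ y]) simp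
  qed
qed

definition ecnt :: "nat \<Rightarrow> (nat \<Rightarrow> bool) \<Rightarrow> real" where "ecnt J Z = (\<Sum>j<J. indicat_real (Ev j) Z)"
definition dcnt :: "nat \<Rightarrow> (nat \<Rightarrow> bool) \<Rightarrow> real" where "dcnt J Z = (\<Sum>j<J. \<Sum>w\<in>Xs j. indicat_real (Ds j w) Z)"

lemma dcnt_step: "dcnt J Z \<le> dcnt (Suc J) Z" unfolding dcnt_def by (simp add: sum_nonneg)
lemma dcnt_hit: assumes "w \<in> Xs J" "Z \<in> Ds J w" shows "dcnt J Z + 1 \<le> dcnt (Suc J) Z"
proof -
  have "indicat_real (Ds J w) Z \<le> (\<Sum>w\<in>Xs J. indicat_real (Ds J w) Z)"
    by (rule member_le_sum[OF assms(1) _ finite_Xs]) simp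
  then show ?thesis using assms(2) unfolding dcnt_def by simp
qed

text \<open>An oracle takes part in two events only if in between a demand it belongs to is destroyed.\<close>

lemma count_events: "ecnt J Z \<le> dcnt J Z \<or> (ecnt J Z \<le> dcnt J Z + 1 \<and> dis J Z)"
proof (induction J)
  case 0 then show ?case by (simp add: ecnt_def dcnt_def)
next
  case (Suc J)
  have s: "dcnt J Z \<le> dcnt (Suc J) Z" by (rule dcnt_step)
  show ?case
  proof (cases "Z \<in> Ev J")
    case False
    then have e: "ecnt (Suc J) Z = ecnt J Z" by (simp add: ecnt_def)
    show ?thesis
    proof (cases "ecnt J Z \<le> dcnt J Z")
      case True then show ?thesis using s unfolding e by simp
    next
      case False
      then have *: "ecnt J Z \<le> dcnt J Z + 1" "dis J Z" using Suc.IH by simp_all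
      show ?thesis
      proof (rule disjE[OF dis_keep[OF *(2)]])
        assume "dis (Suc J) Z" then show ?thesis using * s unfolding e by simp
      next
        assume "\<exists>w\<in>Xs J. Z \<in> Ds J w"
        then have "dcnt J Z + 1 \<le> dcnt (Suc J) Z" using dcnt_hit by blast
        then show ?thesis using * unfolding e by simp
      qed
    qed
  next
    case True
    then have e: "ecnt (Suc J) Z = ecnt J Z + 1" by (simp add: ecnt_def)
    have "dis (Suc J) Z" by (rule Ev_dis[OF True])
    moreover have "ecnt J Z \<le> dcnt (Suc J) Z"
    proof (cases "ecnt J Z \<le> dcnt J Z")
      case True then show ?thesis using s by simp
    next
      case False
      then have *: "ecnt J Z \<le> dcnt J Z + 1" "dis J Z" using Suc.IH by simp_all
      obtain y where y: "y \<le> J" "Z \<in> Ds J (Suc y)" using *(2) unfolding dis_def by blast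
      show ?thesis using dcnt_hit[OF Ev_after[OF True y] y(2)] *(1) by simp
    qed
    ultimately show ?thesis unfolding e by simp
  qed
qed

text \<open>Integrating \<open>count_events\<close>: the \<open>1\<close> is the last event of an
  oracle that no destroyed demand matches, and \<open>2 ^ KK c\<close> is the bound of
  \<open>destroyed_demand\<close>.\<close>

lemma events_bounded: "(\<Sum>j<J. mu (Ev j)) \<le> 1 + 2 ^ KK c"
proof -
  let ?G = "SIGMA j:{..<J}. Xs j"
  have "(\<Sum>j<J. mu (Ev j)) \<le> 1 + (\<Sum>q\<in>?G. mu (Ds (fst q) (snd q)))"
  proof (rule sum_mu_le)
    show "Ev j \<in> sets cantor" for j unfolding Ev_def by simp
    show "Ds (fst q) (snd q) \<in> sets cantor" for q unfolding Ds_def by simp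
    show "(\<Sum>j<J. indicat_real (Ev j) Z) \<le> 1 + (\<Sum>q\<in>?G. indicat_real (Ds (fst q) (snd q)) Z)" for Z
    proof -
      have "(\<Sum>q\<in>?G. indicat_real (Ds (fst q) (snd q)) Z) = dcnt J Z"
        unfolding dcnt_def by (subst sum.Sigma) (simp_all add: finite_Xs case_prod_unfold)
      then show ?thesis using count_events[of J Z] unfolding ecnt_def by linarith
    qed
  qed (simp_all add: finite_Xs)
  also have "(\<Sum>q\<in>?G. mu (Ds (fst q) (snd q))) = (\<Sum>j<J. \<Sum>w\<in>Xs j. mu (Ds j w))"
    by (subst sum.Sigma) (simp_all add: finite_Xs case_prod_unfold)
  also have "\<dots> = (\<Sum>j<J. \<Sum>w\<in>Xs j. Nt (sq j) w)"
  proof (intro sum.cong refl)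
    fix j w assume "w \<in> Xs j"
    then have w: "0 < w" "w \<le> Suc j" unfolding Xs_def by (simp_all split: if_splits)
    have "w \<le> length (u j)" using w(2) sq_facts(3)[of j] unfolding length_u by simp
    then show "mu (Ds j w) = Nt (sq j) w" using w(1) unfolding Ds_def mW_mu[symmetric] Nt_def NN_def g.sgp_def[symmetric] by simp
  qed
  also have "\<dots> \<le> 2 ^ KK c"
  proof (rule G.destroyed_demand)
    show "sq j \<le> sq (Suc j)" for j using sq_facts(4)[of j] by simp
    fix j w assume "w \<in> Xs j"
    then have w: "chg j" "xc j < w" "w \<le> Suc j" unfolding Xs_def by (simp_all split: if_splits)
    have "w < G.W (sq j)" using w(3) sq_facts(2)[of j] by simp
    then show "w < G.W (sq j) \<and> take w (u j) \<noteq> take w (u (Suc j))" using u_differ[OF w] by blast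
  qed (simp_all add: sq_facts finite_Xs)
  finally show ?thesis by simp
qed

lemma cOR_nonneg: "0 \<le> cOR Om R x s" by (simp add: cOR_def)

lemma stage_cost_event: "stage_cost (cOR Om R) gx j \<le> 2 ^ d * mu (Ev j)"
proof (cases "chg j")
  case False
  then have "stage_cost (cOR Om R) gx j = 0" unfolding stage_cost_def chg_def by (simp only: if_False)
  then show ?thesis by (simp add: mu_nonneg)
next
  case True
  then have e: "stage_cost (cOR Om R) gx j = cOR Om R (xc j) (Suc j)" unfolding stage_cost_def chg_def xc_def by (simp only: if_True)
  show ?thesis
  proof (cases "xc j \<le> j")
    case True
    have "cOR Om R (xc j) (Suc j) / 2 ^ d \<le> mu (Ev j)" using sq_facts(5)[OF True] \<open>chg j\<close> True unfolding Ev_def mW_mu by simp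
    then show ?thesis unfolding e by (simp add: divide_le_eq mult.commute)
  next
    case False
    then have "Om (Suc j) \<le> Om (xc j)" by (intro Om_mono) simp
    then have "cOR Om R (xc j) (Suc j) = 0" by (simp add: cOR_def)
    then show ?thesis unfolding e by (simp add: mu_nonneg)
  qed
qed

lemma obeys_A: "obeys A (cOR Om R)"
proof -
  have "cpt (\<lambda>q. gx (fst q) (snd q))" unfolding gx_def
    by (intro cpt_If cpt_nthd cpt_sgp cpt_sq cpt_const cpt_fst cpt_snd cpt_id)
  then have "computable2 gx" by (rule cpt_computable2)
  moreover have "\<exists>s0. \<forall>s\<ge>s0. (gx x s \<noteq> 0) = (x \<in> A)" for x
  proof -
    obtain T1 where T1: "\<forall>t\<ge>T1. take (Suc x) (g.sgp t) = As (Suc x)" using sgp_limit[of "Suc x"] by (elim exE)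
    have "(gx x s \<noteq> 0) = (x \<in> A)" if "T1 + x \<le> s" for s
    proof -
      have l: "T1 + x < sq s" using sq_facts(3)[of s] that by simp
      then have "take (Suc x) (u s) = As (Suc x)" using T1 by simp
      then have "take (Suc x) (u s) ! x = As (Suc x) ! x" by simp
      then have "u s ! x = (x \<in> A)" by (simp add: nth_As)
      then show ?thesis unfolding gx_nthd using l by (simp add: nthd_simp length_u)
    qed
    then show ?thesis by blast
  qed
  ultimately have "comp_approx gx A" unfolding comp_approx_def by blast
  moreover have "summable (stage_cost (cOR Om R) gx)"
  proof (rule summableI_nonneg_bounded)
    show "0 \<le> stage_cost (cOR Om R) gx j" for j unfolding stage_cost_def by (simp add: cOR_nonneg)
    fix J
    have "sum (stage_cost (cOR Om R) gx) {..<J} \<le> (\<Sum>j<J. 2 ^ d * mu (Ev j))" by (rule sum_mono) (rule stage_cost_event)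
    also have "\<dots> = 2 ^ d * (\<Sum>j<J. mu (Ev j))" by (rule sum_distrib_left[symmetric])
    also have "\<dots> \<le> 2 ^ d * (1 + 2 ^ KK c)" by (intro mult_left_mono events_bounded) simp
    finally show "sum (stage_cost (cOR Om R) gx) {..<J} \<le> 2 ^ d * (1 + 2 ^ KK c)" .
  qed
  ultimately show ?thesis unfolding obeys_def by blast
qed

end

text \<open>The order of choices matters: \<open>k\<close> comes from the machine for all slots,
  then the slot is \<open>k + b\<close>, and only then is its golden run selected.\<close>

lemma (in omega_A) obeys_of_computed: "obeys A (cOR Om R)"
proof -
  obtain \<epsilon> where \<epsilon>: "0 < \<epsilon>" "\<forall>x. \<exists>y0. \<forall>y\<ge>y0. \<epsilon> * climit x \<le> mW y (As (Suc x))" using density by (elim exE conjE)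
  \<comment> \<open>A power of two below the real \<open>\<epsilon>\<close> is a threshold that
    \<open>cond\<close> can test.\<close>
  obtain d where d: "1 / 2 ^ d < \<epsilon>" using small[OF \<epsilon>(1)] by blast
  have dens: "\<exists>y0. \<forall>y\<ge>y0. climit x / 2 ^ d \<le> mW y (As (Suc x))" for x
  proof -
    obtain y0 where y0: "\<forall>y\<ge>y0. \<epsilon> * climit x \<le> mW y (As (Suc x))" using spec[OF \<epsilon>(2), of x] by (elim exE)
    have "1 / 2 ^ d * climit x \<le> \<epsilon> * climit x" using d by (intro mult_right_mono) (simp_all add: climit_def)
    then have "\<forall>y\<ge>y0. climit x / 2 ^ d \<le> mW y (As (Suc x))" using y0 by fastforce
    then show ?thesis by (rule exI)
  qed
  obtain k where k: "\<forall>c h. vh c h \<longrightarrow> osum c h (Suc (length h)) \<le> 1 \<longrightarrow> Kc U (str_of (Suc (length h))) \<le> outh c h + c + k"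
    using slot_program by (elim exE)
  have sl: "slot Omega Om R A p U b (k + b) k"
    by unfold_locales (use k in simp_all)
  interpret slot Omega Om R A p U b "k + b" k by (rule sl)
  obtain i T where gold: "golden sgt Nt (KK (k + b)) (mm (k + b)) i T" using golden_ex by (elim exE)
  have "slot_run Omega Om R A p U b (k + b) k i T d"
    by (intro slot_run.intro sl slot_run_axioms.intro gold dens)
  then show ?thesis by (rule slot_run.obeys_A)
qed

theorem theorem5p11:
  fixes Omega :: real and Om :: "nat \<Rightarrow> real" and R :: "nat set"
  assumes "comp_rat_seq Om"
    and "incseq Om"
    and "Om \<longlonglongrightarrow> Omega"
    and "Omega \<le> 1"
    and "MLrandom (real_bit Omega)"
    and "infinite R"
    and "computable_set R"
  shows "dumb (bits_on Omega R) (cOR Om R)"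
proof -
  interpret omega Omega Om R by unfold_locales (rule assms)+
  have "obeys A (cOR Om R)" if K: "K_trivial A" and T: "turing_le A YR" for A
  proof -
    obtain U where U: "optimal_pf_machine U" using optimal_exists by (elim exE)
    obtain b where b: "\<forall>n. Kc U (init_seg A n) \<le> Kc U (str_of n) + b" using K U unfolding K_trivial_def by blast
    obtain p where p: "\<forall>x. evalr (seq_oracle YR) p [x] (chi A x)" using T unfolding turing_le_def by (elim exE)
    interpret omega_A Omega Om R A p U b by unfold_locales (rule p[rule_format], rule U, rule b[rule_format])
    show ?thesis by (rule obeys_of_computed)
  qed
  then show ?thesis unfolding dumb_def YR_def[symmetric] using MLrandom_YR captured obeys_turing by blast
qed

end
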